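(* Let $n\ge 2$, let $T\subset\mathbb{R}^n$ be a nondegenerate $n$-simplex with Alfeld split $T^z$, and let $r\ge 0$ and $0\le k\le n-1$ be integers. Then $$\dim M_{d,r}^k(T^z)=\dim M_{r-1}^{k+1}(T^z)+\dim M_r^k(T^z)-\dim V_{d,r-1}^{k+1}(T^z),$$ $$\dim \mathring{M}_{d,r}^k(T^z)=\dim \mathring{M}_{r-1}^{k+1}(T^z)+\dim \mathring{M}_r^k(T^z)-\dim \mathring{V}_{d,r-1}^{k+1}(T^z).$$
   Context: Let $T=[x_0,\dots,x_n]$ be a nondegenerate $n$-simplex in $\mathbb{R}^n$ and let $z=\frac1{n+1}\sum_{i=0}^n x_i$ be its barycenter. The Alfeld split is $T^z=\{T_0,\dots,T_n\}$, where $T_i$ is the $n$-simplex with vertices $z$ and all $x_j$, $j\ne i$. $\Delta_{s}(T)$ denotes the set of $s$-dimensional subsimplices of $T$. For an $n$-simplex $S$, $\mathcal{P}_r\Lambda^k(S)$ is the space of differential $k$-forms on $S$ whose coefficients are polynomials of total degree at most $r$ (it is $\{0\}$ if $r<0$). $L^2\Lambda^k(T)$ and $C^0\Lambda^k(T)$ are the $k$-forms on $T$ with $L^2$ coefficients, respectively with coefficients continuous on the closed simplex. $d$ is the exterior derivative (in the weak sense), and $\operatorname{tr}_F\omega$ is the trace of a form on a face $F$, i.e. its pullback under the inclusion of $F$; by contrast $\omega|_{\partial T}=0$ means that all coefficients of $\omega$ vanish on $\partial T$. Spaces: $V_r^k(T^z)=\{\omega\in L^2\Lambda^k(T):\omega|_{T_i}\in\mathcal{P}_r\Lambda^k(T_i),\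 0\le i\le n\}$; $V_{d,r}^k(T^z)=\{\omega\in V_r^k(T^z): d\omega\in L^2\Lambda^{k+1}(T)\}$; $M_r^k(T^z)=\{\omega\in C^0\Lambda^k(T):\omega|_{T_i}\in\mathcal{P}_r\Lambda^k(T_i),\ 0\le i\le n\}$; $M_{d,r}^k(T^z)=\{\omega\in M_r^k(T^z): d\omega\in C^0\Lambda^{k+1}(T)\}$. For $k\le n-1$: $\mathring{V}_{d,r}^k(T^z)=\{\omega\in V_{d,r}^k(T^z):\operatorname{tr}_F\omega=0\ \forall F\in\Delta_{n-1}(T)\}$; $\mathring{M}_r^k(T^z)=\{\omega\in M_r^k(T^z):\omega|_{\partial T}=0\}$; $\mathring{M}_{d,r}^k(T^z)=\{\omega\in M_{d,r}^k(T^z):\omega|_{\partial T}=0,\ d\omega|_{\partial T}=0\}$. For $k=n$: $\mathring{V}_{d,r}^n(T^z)=\{\omega\in V_{d,r}^n(T^z):\int_T\omega=0\}$; $\mathring{M}_r^n(T^z)=\{\omega\in M_r^n(T^z):\omega|_{\partial T}=0,\ \int_T\omega=0\}$. *)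

theory Defs
  imports "HOL-Analysis.Analysis"
begin

text \<open>
  A field of covectors assigns to each point of $\mathbb{R}^n$ a function of lists of tangent
  vectors; it is a $k$-form when each value is an alternating $k$-linear map.  The value on
  lists of length different from $k$ is fixed to be $0$.
\<close>

type_synonym 'n rform = "real ^ 'n \<Rightarrow> (real ^ 'n) list \<Rightarrow> real"

definition alternating :: "nat \<Rightarrow> ((real ^ 'n) list \<Rightarrow> real) \<Rightarrow> bool" where
  "alternating k f \<longleftrightarrow>
     (\<forall>vs. length vs \<noteq> k \<longrightarrow> f vs = 0) \<and>
     (\<forall>vs i. length vs = k \<and> i < k \<longrightarrow> linear (\<lambda>v. f (vs[i := v]))) \<and>
     (\<forall>vs. length vs = k \<and> \<not> distinct vs \<longrightarrow> f vs = 0)"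

text \<open>
  For $i_1 < \dots < i_k$ (in some enumeration of the indices),
  \<open>form_coeff \<omega> [i\<^sub>1, \<dots>, i\<^sub>k]\<close> is the coefficient of
  $dx_{i_1} \wedge \dots \wedge dx_{i_k}$.  Requirements on the coefficients are imposed below for
  all index lists; the further ones are zero or equal to a coefficient up to sign.
\<close>

definition form_coeff :: "'n::finite rform \<Rightarrow> 'n list \<Rightarrow> real ^ 'n \<Rightarrow> real" where
  "form_coeff \<omega> is x = \<omega> x (map (\<lambda>i. axis i 1) is)"


subsection \<open>Forms up to equality almost everywhere\<close>

quotient_type (overloaded) 'n ae_form =
  "'n::finite rform" / "\<lambda>\<omega> \<eta>. AE x in lebesgue. \<omega> x = \<eta> x"
proof (rule equivpI)
  show "reflp (\<lambda>\<omega> \<eta> :: 'n rform. AE x in lebesgue. \<omega> x = \<eta> x)"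
    by (rule reflpI) simp
  show "symp (\<lambda>\<omega> \<eta> :: 'n rform. AE x in lebesgue. \<omega> x = \<eta> x)"
    by (rule sympI) (auto elim: eventually_mono)
  show "transp (\<lambda>\<omega> \<eta> :: 'n rform. AE x in lebesgue. \<omega> x = \<eta> x)"
  proof (rule transpI)
    fix \<omega> \<eta> \<theta> :: "'n rform"
    assume "AE x in lebesgue. \<omega> x = \<eta> x" "AE x in lebesgue. \<eta> x = \<theta> x"
    then show "AE x in lebesgue. \<omega> x = \<theta> x"
      by eventually_elim simp
  qed
qed

instantiation ae_form :: (finite) real_vector
begin

lift_definition zero_ae_form :: "'a ae_form" is "\<lambda>x vs. 0" .

lift_definition plus_ae_form :: "'a ae_form \<Rightarrow> 'a ae_form \<Rightarrow> 'a ae_form"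
  is "\<lambda>\<omega> \<eta> x vs. \<omega> x vs + \<eta> x vs"
  by (erule (1) eventually_elim2) simp

lift_definition minus_ae_form :: "'a ae_form \<Rightarrow> 'a ae_form \<Rightarrow> 'a ae_form"
  is "\<lambda>\<omega> \<eta> x vs. \<omega> x vs - \<eta> x vs"
  by (erule (1) eventually_elim2) simp

lift_definition uminus_ae_form :: "'a ae_form \<Rightarrow> 'a ae_form"
  is "\<lambda>\<omega> x vs. - \<omega> x vs"
  by (erule eventually_mono) simp

lift_definition scaleR_ae_form :: "real \<Rightarrow> 'a ae_form \<Rightarrow> 'a ae_form"
  is "\<lambda>c \<omega> x vs. c * \<omega> x vs"
  by (erule eventually_mono) simp

instance
  by standard (transfer; simp add: algebra_simps)+

end


subsection \<open>Classes of forms on a set\<close>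

text \<open>Forms on \<open>T\<close> are extended by zero, so that two of them have the same class in
  \<^typ>\<open>'n ae_form\<close> if and only if they agree almost everywhere on \<open>T\<close>.\<close>

definition forms_on :: "(real ^ 'n) set \<Rightarrow> nat \<Rightarrow> 'n::finite rform set" where
  "forms_on T k = {\<omega>. (\<forall>x. alternating k (\<omega> x)) \<and> (\<forall>x. x \<notin> T \<longrightarrow> \<omega> x = (\<lambda>vs. 0))}"

definition L2_forms :: "(real ^ 'n) set \<Rightarrow> nat \<Rightarrow> 'n::finite rform set" where
  "L2_forms T k = {\<omega> \<in> forms_on T k. \<forall>is.
     form_coeff \<omega> is \<in> borel_measurable (lebesgue_on T) \<and>
     integrable (lebesgue_on T) (\<lambda>x. (form_coeff \<omega> is x)\<^sup>2)}"

definition C0_forms :: "(real ^ 'n) set \<Rightarrow> nat \<Rightarrow> 'n::finite rform set" where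
  "C0_forms T k = {\<omega> \<in> forms_on T k. \<forall>is. continuous_on T (form_coeff \<omega> is)}"

text \<open>Polynomial functions of total degree at most \<open>r\<close>; for \<open>r < 0\<close> the sum is empty.\<close>

definition poly_le :: "int \<Rightarrow> (real ^ 'n::finite \<Rightarrow> real) \<Rightarrow> bool" where
  "poly_le r f \<longleftrightarrow> (\<exists>c. \<forall>x.
     f x = (\<Sum>\<alpha> | int (\<Sum>i\<in>UNIV. \<alpha> i) \<le> r. c \<alpha> * (\<Prod>i\<in>UNIV. (x $ i) ^ \<alpha> i)))"

definition poly_forms :: "int \<Rightarrow> nat \<Rightarrow> 'n::finite rform set" where
  "poly_forms r k = {p. (\<forall>x. alternating k (p x)) \<and> (\<forall>is. poly_le r (form_coeff p is))}"


subsection \<open>Weak exterior derivative\<close>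

definition partial :: "'n \<Rightarrow> (real ^ 'n \<Rightarrow> real) \<Rightarrow> real ^ 'n::finite \<Rightarrow> real" where
  "partial i f x = frechet_derivative f (at x) (axis i 1)"

definition smooth :: "(real ^ 'n::finite \<Rightarrow> real) \<Rightarrow> bool" where
  "smooth f \<longleftrightarrow> (\<forall>is x. foldr partial is f differentiable at x)"

definition test_function :: "(real ^ 'n) set \<Rightarrow> (real ^ 'n::finite \<Rightarrow> real) \<Rightarrow> bool" where
  "test_function U \<phi> \<longleftrightarrow>
     smooth \<phi> \<and> (\<exists>K. compact K \<and> K \<subseteq> U \<and> (\<forall>x. x \<notin> K \<longrightarrow> \<phi> x = 0))"

text \<open>
  \<open>\<xi> = d\<omega>\<close> in the sense of distributions on the interior of \<open>T\<close>: the classical formula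
  $(d\omega)_{j_0 \dots j_k} = \sum_l (-1)^l \partial_{j_l} \omega_{j_0 \dots \hat{j_l} \dots j_k}$
  is tested against \<open>\<phi>\<close> and the derivatives are moved onto \<open>\<phi>\<close>.
\<close>

definition weak_d :: "(real ^ 'n) set \<Rightarrow> nat \<Rightarrow> 'n::finite rform \<Rightarrow> 'n rform \<Rightarrow> bool" where
  "weak_d T k \<omega> \<xi> \<longleftrightarrow>
     (\<forall>\<phi> js. test_function (interior T) \<phi> \<and> length js = Suc k \<longrightarrow>
        (LINT x|lebesgue_on T. (\<Sum>l\<le>k. (-1) ^ l *
            form_coeff \<omega> (take l js @ drop (Suc l) js) x * partial (js ! l) \<phi> x))
        = - (LINT x|lebesgue_on T. form_coeff \<xi> js x * \<phi> x))"


subsection \<open>Simplices, traces, integrals\<close>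

text \<open>A simplex is given by the set \<open>C\<close> of its vertices.\<close>

definition subsimplices :: "nat \<Rightarrow> (real ^ 'n) set \<Rightarrow> (real ^ 'n) set set" where
  "subsimplices s C = {convex hull D | D. D \<subseteq> C \<and> card D = s + 1}"

definition barycenter :: "(real ^ 'n) set \<Rightarrow> real ^ 'n" where
  "barycenter C = (1 / real (card C)) *\<^sub>R \<Sum>C"

definition alfeld_split :: "(real ^ 'n) set \<Rightarrow> (real ^ 'n) set set" where
  "alfeld_split C = (\<lambda>v. convex hull (insert (barycenter C) (C - {v}))) ` C"

definition tangent_space :: "(real ^ 'n) set \<Rightarrow> (real ^ 'n) set" where
  "tangent_space F = span {a - b | a b. a \<in> F \<and> b \<in> F}"

definition trace_form :: "(real ^ 'n) set \<Rightarrow> 'n rform \<Rightarrow> 'n rform" where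
  "trace_form F \<omega> = (\<lambda>x vs. if x \<in> F \<and> set vs \<subseteq> tangent_space F then \<omega> x vs else 0)"

text \<open>The integral of an $n$-form depends on the orientation of $\mathbb{R}^n$, here the one of
  an arbitrary but fixed enumeration of the coordinates. The opposite orientation changes its
  sign only.\<close>

definition coords :: "'n::finite list" where
  "coords = (SOME is. distinct is \<and> set is = UNIV)"

definition form_integral :: "(real ^ 'n) set \<Rightarrow> 'n::finite rform \<Rightarrow> real" where
  "form_integral T \<omega> = (LINT x|lebesgue_on T. form_coeff \<omega> coords x)"


subsection \<open>The piecewise polynomial spaces\<close>

text \<open>In all of the following, \<open>C\<close> is the vertex set of the simplex. The names ending in
  \<open>_fun\<close> are the sets of representatives, those ending in \<open>_space\<close> the vector spaces of their
  classes; a \<open>0\<close> in the name stands for the ring accent (vanishing boundary data).\<close>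

definition V_fun :: "(real ^ 'n) set \<Rightarrow> int \<Rightarrow> nat \<Rightarrow> 'n::finite rform set" where
  "V_fun C r k = {\<omega> \<in> L2_forms (convex hull C) k.
     \<forall>S\<in>alfeld_split C. \<exists>p\<in>poly_forms r k. AE x in lebesgue_on S. \<omega> x = p x}"

definition Vd_fun :: "(real ^ 'n) set \<Rightarrow> int \<Rightarrow> nat \<Rightarrow> 'n::finite rform set" where
  "Vd_fun C r k = {\<omega> \<in> V_fun C r k.
     \<exists>\<xi>\<in>L2_forms (convex hull C) (k + 1). weak_d (convex hull C) k \<omega> \<xi>}"

definition M_fun :: "(real ^ 'n) set \<Rightarrow> int \<Rightarrow> nat \<Rightarrow> 'n::finite rform set" where
  "M_fun C r k = {\<omega> \<in> C0_forms (convex hull C) k.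
     \<forall>S\<in>alfeld_split C. \<exists>p\<in>poly_forms r k. \<forall>x\<in>S. \<omega> x = p x}"

definition Md_fun :: "(real ^ 'n) set \<Rightarrow> int \<Rightarrow> nat \<Rightarrow> 'n::finite rform set" where
  "Md_fun C r k = {\<omega> \<in> M_fun C r k.
     \<exists>\<xi>\<in>C0_forms (convex hull C) (k + 1). weak_d (convex hull C) k \<omega> \<xi>}"

text \<open>A facet \<open>F\<close> of the simplex is contained in exactly one cell \<open>S\<close> of the split; the trace
  on \<open>F\<close> is that of the polynomial form on \<open>S\<close>.\<close>

definition zero_traces :: "(real ^ 'n) set \<Rightarrow> int \<Rightarrow> nat \<Rightarrow> 'n::finite rform \<Rightarrow> bool" where
  "zero_traces C r k \<omega> \<longleftrightarrow>
     (\<forall>F\<in>subsimplices (CARD('n) - 1) C. \<forall>S\<in>alfeld_split C. F \<subseteq> S \<longrightarrow>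
        (\<exists>p\<in>poly_forms r k. (AE x in lebesgue_on S. \<omega> x = p x) \<and>
           trace_form F p = (\<lambda>x vs. 0)))"

definition zero_on :: "(real ^ 'n) set \<Rightarrow> 'n::finite rform \<Rightarrow> bool" where
  "zero_on B \<omega> \<longleftrightarrow> (\<forall>is. \<forall>x\<in>B. form_coeff \<omega> is x = 0)"

definition Vd0_fun :: "(real ^ 'n) set \<Rightarrow> int \<Rightarrow> nat \<Rightarrow> 'n::finite rform set" where
  "Vd0_fun C r k = {\<omega> \<in> Vd_fun C r k.
     if k < CARD('n) then zero_traces C r k \<omega>
     else form_integral (convex hull C) \<omega> = 0}"

definition M0_fun :: "(real ^ 'n) set \<Rightarrow> int \<Rightarrow> nat \<Rightarrow> 'n::finite rform set" where
  "M0_fun C r k = {\<omega> \<in> M_fun C r k. zero_on (frontier (convex hull C)) \<omega> \<and>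
     (k = CARD('n) \<longrightarrow> form_integral (convex hull C) \<omega> = 0)}"

text \<open>Used for \<open>k < n\<close> only.\<close>

definition Md0_fun :: "(real ^ 'n) set \<Rightarrow> int \<Rightarrow> nat \<Rightarrow> 'n::finite rform set" where
  "Md0_fun C r k = {\<omega> \<in> M_fun C r k. zero_on (frontier (convex hull C)) \<omega> \<and>
     (\<exists>\<xi>\<in>C0_forms (convex hull C) (k + 1). weak_d (convex hull C) k \<omega> \<xi> \<and>
        zero_on (frontier (convex hull C)) \<xi>)}"

definition Vd_space :: "(real ^ 'n) set \<Rightarrow> int \<Rightarrow> nat \<Rightarrow> 'n::finite ae_form set" where
  "Vd_space C r k = abs_ae_form ` Vd_fun C r k"

definition M_space :: "(real ^ 'n) set \<Rightarrow> int \<Rightarrow> nat \<Rightarrow> 'n::finite ae_form set" where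
  "M_space C r k = abs_ae_form ` M_fun C r k"

definition Md_space :: "(real ^ 'n) set \<Rightarrow> int \<Rightarrow> nat \<Rightarrow> 'n::finite ae_form set" where
  "Md_space C r k = abs_ae_form ` Md_fun C r k"

definition Vd0_space :: "(real ^ 'n) set \<Rightarrow> int \<Rightarrow> nat \<Rightarrow> 'n::finite ae_form set" where
  "Vd0_space C r k = abs_ae_form ` Vd0_fun C r k"

definition M0_space :: "(real ^ 'n) set \<Rightarrow> int \<Rightarrow> nat \<Rightarrow> 'n::finite ae_form set" where
  "M0_space C r k = abs_ae_form ` M0_fun C r k"

definition Md0_space :: "(real ^ 'n) set \<Rightarrow> int \<Rightarrow> nat \<Rightarrow> 'n::finite ae_form set" where
  "Md0_space C r k = abs_ae_form ` Md0_fun C r k"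

end

theory Submission
  imports Defs "HOL-Computational_Algebra.Polynomial"
begin

text \<open>
  Both formulas count the kernel of one surjective linear map.  Send a pair of \<open>\<rho> \<in> M\<^sub>r\<^sup>k\<close> and
  \<open>\<eta> \<in> M\<^sub>r\<^sub>-\<^sub>1\<^sup>k\<^sup>+\<^sup>1\<close> to \<open>d\<rho> + \<eta>\<close>.  The pairs in the kernel are \<open>(\<rho>, - d\<rho>)\<close> with \<open>d\<rho>\<close> continuous, which is to say
  \<open>\<rho> \<in> M\<^sub>d\<^sub>,\<^sub>r\<^sup>k\<close>.  The image is all of \<open>V\<^sub>d\<^sub>,\<^sub>r\<^sub>-\<^sub>1\<^sup>k\<^sup>+\<^sup>1\<close>: a piecewise polynomial form with square integrable
  derivative is the sum of a continuous one and of the derivative of a continuous one.  This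
  decomposition, with and without boundary conditions, is the heart of the matter (lemmas
  \<open>decomposition\<close> and \<open>decomposition_zero_boundary\<close>); the rest of the count is \<open>dim_graph\<close>.

  Let \<open>lam\<close> be the continuous function that is on each cell the barycentric coordinate vanishing on the
  outer facet of the cell.  A tangentially continuous form \<open>\<omega>\<close> without
  tangential trace on the boundary equals \<open>d lam \<and> \<gamma>\<close> there, and the facetwise forms \<open>\<gamma>\<close> have single-valued
  traces on the faces of codimension two.  They extend to a polynomial form \<open>\<gamma>\<close> on the whole
  space (\<open>extend_traces\<close>), so that \<open>\<omega> - d (lam \<gamma>)\<close> vanishes on the boundary and equals \<open>lam \<omega>'\<close>, with \<open>\<omega>'\<close>
  tangentially continuous and of lower degree.  The trace of \<open>\<omega>'\<close> is removed by a global polynomial form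
  \<open>\<Phi>\<close>, where \<open>lam \<Phi>\<close> is continuous, and the step is repeated with higher powers of \<open>lam\<close> until the degree is
  zero (\<open>descent\<close>).  Piecewise constant forms are treated directly: they are \<open>c + d lam \<and> \<beta>\<close> with
  constant forms \<open>c\<close> and \<open>\<beta>\<close> (\<open>piecewise_constant_decomposition\<close>).

  Both extension arguments rest on one fact about constant forms, \<open>extend_from_hyperplanes\<close>: forms
  given on linearly independent hyperplanes and agreeing on the intersections have a common extension.  For
  polynomial traces it is applied to the coefficients in the expansion by barycentric monomials.

  The analytic part identifies the spaces defined by weak derivatives with families of polynomial
  forms subject to matching conditions.  Tangential continuity implies that the piecewise derivative is the weak one
  (\<open>piecewise_stokes\<close>), by regularizing the form with a softmin partition of unity.  Conversely, test
  functions concentrating at an interface exclude a tangential jump (\<open>no_tangential_jump\<close>).  Surface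
  integrals never occur; the only integration by parts is
  that over the whole space, for functions of compact support (\<open>integral_derivative_eq_0\<close>).
\<close>


section \<open>Alternating multilinear functions of lists\<close>

lemma alternating_length: "alternating k w \<Longrightarrow> length vs \<noteq> k \<Longrightarrow> w vs = 0"
  by (auto simp: alternating_def)

lemma alternating_linear: "alternating k w \<Longrightarrow> length vs = k \<Longrightarrow> i < k \<Longrightarrow> linear (\<lambda>v. w (vs[i := v]))"
  by (auto simp: alternating_def)

lemma alternating_repeat: "alternating k w \<Longrightarrow> \<not> distinct vs \<Longrightarrow> w vs = 0"
  by (cases "length vs = k") (auto simp: alternating_def)

lemma alternating_0: "alternating k (\<lambda>vs. 0)"
  by (auto simp: alternating_def intro: linear_zero)

lemma alternating_add: "alternating k f \<Longrightarrow> alternating k g \<Longrightarrow> alternating k (\<lambda>vs. f vs + g vs)"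
  by (auto simp: alternating_def intro: linear_compose_add)

lemma alternating_scale: "alternating k f \<Longrightarrow> alternating k (\<lambda>vs. c * f vs)"
  by (auto simp: alternating_def intro!: linear_compose_scale_right[where 'b = real, unfolded real_scaleR_def])

lemma alternating_diff: "alternating k f \<Longrightarrow> alternating k g \<Longrightarrow> alternating k (\<lambda>vs. f vs - g vs)"
  using alternating_add[of k f "\<lambda>vs. (-1) * g vs"] alternating_scale[of k g "-1"] by simp

lemma alternating_sum: "(\<And>i. i \<in> I \<Longrightarrow> alternating k (f i)) \<Longrightarrow> alternating k (\<lambda>vs. \<Sum>i\<in>I. f i vs)"
  by (induction I rule: infinite_finite_induct) (auto intro: alternating_0 alternating_add)

lemma alternating_pullback:
  assumes "linear P" "alternating k w"
  shows "alternating k (\<lambda>vs. w (map P vs))"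
  unfolding alternating_def
proof (intro conjI allI impI)
  fix vs :: "(real^'a) list" and i assume "length vs = k \<and> i < k"
  then have "linear (\<lambda>v. w ((map P vs)[i := v]))" using assms(2) by (auto simp: alternating_def)
  from linear_compose[OF assms(1) this] show "linear (\<lambda>v. w (map P (vs[i := v])))"
    by (simp add: o_def map_update)
qed (use assms(2) in \<open>auto simp: alternating_def distinct_map\<close>)

lemma alternating_contract:
  assumes "alternating (Suc k) w"
  shows "alternating k (\<lambda>vs. w (N # vs))"
  unfolding alternating_def
proof (intro conjI allI impI)
  fix vs :: "(real^'a) list" and i assume "length vs = k \<and> i < k"
  then have "linear (\<lambda>v. w ((N # vs)[Suc i := v]))" using assms by (intro alternating_linear) auto
  then show "linear (\<lambda>v. w (N # vs[i := v]))" by simp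
qed (use assms in \<open>auto simp: alternating_def\<close>)

lemma alternating_swap:
  assumes "alternating k w"
  shows "w (xs @ a # b # ys) = - w (xs @ b # a # ys)"
proof (cases "length (xs @ a # b # ys) = k")
  case True
  let ?i = "length xs" and ?F = "\<lambda>x y. w (xs @ x # y # ys)"
  have 1: "linear (\<lambda>x. ?F x y)" for y
    using alternating_linear[OF assms, of "xs @ a # y # ys" ?i] True by (simp add: list_update_append)
  have 2: "linear (\<lambda>y. ?F x y)" for x
    using alternating_linear[OF assms, of "xs @ x # b # ys" "Suc ?i"] True by (simp add: list_update_append)
  have 0: "?F x x = 0" for x by (rule alternating_repeat[OF assms]) auto
  have "0 = ?F (a + b) (a + b)" using 0 by simp
  also have "\<dots> = ?F a a + ?F a b + (?F b a + ?F b b)"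
    by (simp only: linear_add[OF 1] linear_add[OF 2])
  finally show ?thesis using 0 by simp
qed (use assms in \<open>auto simp: alternating_length\<close>)

lemma alternating_move:
  assumes "alternating k w"
  shows "w (xs @ a # ys @ zs) = (-1) ^ length ys * w (xs @ ys @ a # zs)"
proof (induction ys arbitrary: xs)
  case (Cons b ys)
  have "w (xs @ a # (b # ys) @ zs) = - w ((xs @ [b]) @ a # ys @ zs)"
    using alternating_swap[OF assms, of xs a b "ys @ zs"] by simp
  also have "\<dots> = - ((-1) ^ length ys * w ((xs @ [b]) @ ys @ a # zs))" by (subst Cons.IH) simp
  finally show ?case by simp
qed simp

text \<open>
  The entries are moved into the spanning set one slot after the other, each time by linearity in that
  slot; \<open>j\<close> counts the leading slots that are still arbitrary.
\<close>

lemma alternating_eqI_spanning: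
  assumes w: "alternating k w" and B: "span B = UNIV"
    and 0: "\<And>vs. length vs = k \<Longrightarrow> set vs \<subseteq> B \<Longrightarrow> w vs = 0"
  shows "w vs = 0"
proof -
  have "w vs = 0" if "length vs = k" "j \<le> k" "set (drop j vs) \<subseteq> B" for j vs
    using that
  proof (induction j arbitrary: vs)
    case 0 then show ?case using assms(3) by simp
  next
    case (Suc j)
    have lin: "linear (\<lambda>v. w (vs[j := v]))" using Suc.prems w by (intro alternating_linear) auto
    have "w (vs[j := v]) = 0" if "v \<in> B" for v
    proof (rule Suc.IH)
      have "drop j (vs[j := v]) = v # drop (Suc j) vs"
        using Suc.prems by (simp add: list_eq_iff_nth_eq nth_Cons split: nat.split)
      then show "set (drop j (vs[j := v])) \<subseteq> B" using Suc.prems that by simp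
    qed (use Suc.prems in auto)
    from linear_eq_on[OF lin linear_zero, of "vs!j" B] this B
    have "w (vs[j := vs!j]) = 0" by auto
    then show ?case by simp
  qed
  from this[of vs k] show ?thesis using w by (cases "length vs = k") (auto simp: alternating_length)
qed

text \<open>
  Antisymmetrization in the first argument only: the exterior product with a covector and the
  exterior derivative both have this shape.
\<close>

definition alt_sum :: "nat \<Rightarrow> (real ^ 'n \<Rightarrow> (real ^ 'n) list \<Rightarrow> real) \<Rightarrow> (real ^ 'n) list \<Rightarrow> real" where
  "alt_sum k B vs = (if length vs = Suc k
     then \<Sum>l\<le>k. (-1) ^ l * B (vs ! l) (take l vs @ drop (Suc l) vs) else 0)"

text \<open>
  If two entries are equal, the terms that keep both vanish.  The other two terms omit one of the
  equal entries each; moving the remaining one past the entries in between makes the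
  arguments the same, with opposite signs.
\<close>

lemma alternating_alt_sum:
  assumes alt: "\<And>v. alternating k (B v)" and lin: "\<And>ws. linear (\<lambda>v. B v ws)"
  shows "alternating (Suc k) (alt_sum k B)"
  unfolding alternating_def
proof (intro conjI allI impI)
  fix vs :: "(real^'a) list" and i assume vs: "length vs = Suc k \<and> i < Suc k"
  have "linear (\<lambda>v. B (vs[i := v] ! l) (take l (vs[i := v]) @ drop (Suc l) (vs[i := v])))" if "l \<le> k" for l
  proof (cases "l = i")
    case True then show ?thesis using vs lin by simp
  next
    case False
    let ?i = "if i < l then i else i - 1"
    have "take l (vs[i := v]) @ drop (Suc l) (vs[i := v]) = (take l vs @ drop (Suc l) vs)[?i := v]" for v
      using False vs that
      by (cases "i < l") (auto simp: list_update_append take_update_swap drop_update_swap Suc_diff_Suc min_def list_update_beyond)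
    moreover have "linear (\<lambda>v. B (vs ! l) ((take l vs @ drop (Suc l) vs)[?i := v]))"
      using False vs that by (intro alternating_linear[OF alt]) auto
    ultimately show ?thesis using False by simp
  qed
  then have "linear (\<lambda>v. \<Sum>l\<le>k. (-1) ^ l *\<^sub>R B (vs[i := v] ! l) (take l (vs[i := v]) @ drop (Suc l) (vs[i := v])))"
    by (intro linear_compose_sum ballI linear_compose_scale_right) auto
  then show "linear (\<lambda>v. alt_sum k B (vs[i := v]))" using vs by (simp add: alt_sum_def)
next
  fix vs :: "(real^'a) list" assume vs: "length vs = Suc k \<and> \<not> distinct vs"
  then obtain xs a ys zs where d: "vs = xs @ [a] @ ys @ [a] @ zs" using not_distinct_decomp by blast
  let ?i = "length xs" and ?j = "length xs + Suc (length ys)"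
  let ?t = "\<lambda>l. (-1) ^ l * B (vs ! l) (take l vs @ drop (Suc l) vs)"
  have z: "?t l = 0" if "l \<in> {..k} - {?i, ?j}" for l
  proof -
    have "\<not> distinct (take l vs @ drop (Suc l) vs)"
    proof -
      have "l < ?i \<or> (?i < l \<and> l < ?j) \<or> ?j < l" using that by auto
      then show ?thesis
      proof (elim disjE conjE)
        assume "l < ?i"
        then show ?thesis by (simp add: d)
      next
        assume "?i < l" "l < ?j"
        then obtain q where "l = ?i + Suc q" "q < length ys" by (metis add_Suc_right less_iff_Suc_add nat_add_left_cancel_less Suc_less_eq)
        then show ?thesis by (simp add: d)
      next
        assume "?j < l"
        then obtain q where "l = ?j + Suc q" by (metis add_Suc_right less_iff_Suc_add)
        then show ?thesis by (simp add: d)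
      qed
    qed
    then show ?thesis using alternating_repeat[OF alt] by simp
  qed
  have ij: "{?i, ?j} \<subseteq> {..k}" using vs d by auto
  have "sum ?t {..k} = sum ?t {?i, ?j}" using z ij by (intro sum.mono_neutral_right) auto
  also have "\<dots> = ?t ?i + ?t ?j" by simp
  also have "?t ?i = (-1) ^ ?i * B a (xs @ ys @ a # zs)" by (simp add: d)
  also have "?t ?j = (-1) ^ ?j * B a (xs @ a # ys @ zs)" by (simp add: d nth_append)
  also have "B a (xs @ a # ys @ zs) = (-1) ^ length ys * B a (xs @ ys @ a # zs)"
    by (rule alternating_move[OF alt])
  finally have "sum ?t {..k} = 0" by (simp add: power_add flip: power_mult_distrib)
  then show "alt_sum k B vs = 0" by (simp add: alt_sum_def)
qed (simp add: alt_sum_def)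

lemma alt_sum_add: "alt_sum k (\<lambda>v ws. B v ws + B' v ws) vs = alt_sum k B vs + alt_sum k B' vs"
  by (simp add: alt_sum_def algebra_simps sum.distrib)

lemma alt_sum_scale: "alt_sum k (\<lambda>v ws. c * B v ws) vs = c * alt_sum k B vs"
  by (simp add: alt_sum_def sum_distrib_left mult_ac)

lemma alt_sum_cong:
  assumes "\<And>v ws. v \<in> set vs \<Longrightarrow> set ws \<subseteq> set vs \<Longrightarrow> length ws = k \<Longrightarrow> B v ws = B' v ws"
  shows "alt_sum k B vs = alt_sum k B' vs"
proof -
  have "B (vs ! l) (take l vs @ drop (Suc l) vs) = B' (vs ! l) (take l vs @ drop (Suc l) vs)"
    if "length vs = Suc k" "l \<le> k" for l
    using that set_take_subset[of l vs] set_drop_subset[of "Suc l" vs] by (intro assms) auto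
  then show ?thesis by (simp add: alt_sum_def)
qed

definition wedge :: "nat \<Rightarrow> (real ^ 'n \<Rightarrow> real) \<Rightarrow> ((real ^ 'n) list \<Rightarrow> real) \<Rightarrow> (real ^ 'n) list \<Rightarrow> real" where
  "wedge k a w = alt_sum k (\<lambda>v ws. a v * w ws)"

lemma alternating_wedge:
  assumes "linear a" "alternating k w" shows "alternating (Suc k) (wedge k a w)"
  unfolding wedge_def
proof (rule alternating_alt_sum)
  show "linear (\<lambda>v. a v * w ws)" for ws
    using linear_compose_scale_right[OF assms(1), of "w ws"] by (simp add: mult.commute)
qed (rule alternating_scale[OF assms(2)])

lemma wedge_vanishes_on_kernel:
  assumes "\<And>y. y \<in> set vs \<Longrightarrow> a y = 0" shows "wedge k a w vs = 0"
  unfolding wedge_def alt_sum_def using assms by (auto intro!: sum.neutral)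

lemma wedge_diff: "wedge k a (\<lambda>vs. w vs - w' vs) vs = wedge k a w vs - wedge k a w' vs"
  by (simp add: wedge_def alt_sum_def sum_subtractf algebra_simps)

lemma wedge_scale: "wedge k a (\<lambda>vs. c * w vs) vs = c * wedge k a w vs"
  by (simp add: wedge_def alt_sum_scale[symmetric] mult_ac)

lemma wedge_diff_left: "wedge k (\<lambda>y. a y - b y) w vs = wedge k a w vs - wedge k b w vs"
  by (simp add: wedge_def alt_sum_def sum_subtractf algebra_simps)

lemma wedge_scale_left: "wedge k (\<lambda>y. c * a y) w vs = c * wedge k a w vs"
  by (simp add: wedge_def alt_sum_scale[symmetric] mult_ac)

text \<open>Contraction with \<open>N\<close> is an antiderivation; hence \<open>a \<and> (\<iota>\<^sub>N w) = w\<close> as soon as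
  \<open>a \<and> w = 0\<close> and \<open>a N = 1\<close>.\<close>

lemma contract_wedge:
  assumes "length vs = Suc k"
  shows "wedge (Suc k) a w (N # vs) = a N * w vs - wedge k a (\<lambda>ws. w (N # ws)) vs"
  using assms by (simp add: wedge_def alt_sum_def sum.atMost_Suc_shift sum_negf del: sum.atMost_Suc)

text \<open>
  Every vector is the sum of one in the kernel of \<open>a\<close> and a multiple of \<open>N\<close>; on a list of vectors
  of these two kinds, at most one term of the product survives.
\<close>

lemma wedge_eq_0_if_vanishes_on_kernel:
  assumes a: "linear a" and N: "a N = 1" and w: "alternating k w"
    and 0: "\<And>vs. (\<And>y. y \<in> set vs \<Longrightarrow> a y = 0) \<Longrightarrow> w vs = 0"
  shows "wedge k a w vs = 0"
proof (rule alternating_eqI_spanning[OF alternating_wedge[OF a w]])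
  let ?B = "insert N {y. a y = 0}"
  have "y \<in> span ?B" for y
  proof -
    have "a (y - a y *\<^sub>R N) = 0" using a N by (simp add: linear_diff linear_scale)
    then have "y - a y *\<^sub>R N \<in> span ?B" by (intro span_base) auto
    then have "(y - a y *\<^sub>R N) + a y *\<^sub>R N \<in> span ?B"
      by (intro span_add span_scale) (auto intro: span_base)
    then show ?thesis by simp
  qed
  then show "span ?B = UNIV" by auto
  fix vs assume vs: "length vs = Suc k" "set vs \<subseteq> ?B"
  show "wedge k a w vs = 0"
  proof (cases "distinct vs")
    case False then show ?thesis by (rule alternating_repeat[OF alternating_wedge[OF a w]])
  next
    case True
    have "a (vs ! l) * w (take l vs @ drop (Suc l) vs) = 0" if "l \<le> k" for l
    proof (cases "a (vs ! l) = 0")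
      case nz: False
      then have "vs ! l = N" using vs(2) nth_mem[of l vs] vs(1) that by (auto dest!: subsetD)
      moreover have "vs = take l vs @ vs ! l # drop (Suc l) vs" using vs that by (intro id_take_nth_drop) auto
      ultimately have "N \<notin> set (take l vs @ drop (Suc l) vs)" using True
        by (metis distinct.simps(2) distinct_append Un_iff disjoint_iff list.set_intros(1) set_append not_distinct_conv_prefix)
      moreover have "set (take l vs @ drop (Suc l) vs) \<subseteq> set vs"
        using set_take_subset[of l vs] set_drop_subset[of "Suc l" vs] by auto
      ultimately have "w (take l vs @ drop (Suc l) vs) = 0" using vs by (intro 0) auto
      then show ?thesis by simp
    qed simp
    then show ?thesis by (auto simp: wedge_def alt_sum_def intro!: sum.neutral)
  qed
qed

lemma eq_wedge_contract_if_vanishes_on_kernel: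
  assumes a: "linear a" and N: "a N = 1" and w: "alternating (Suc k) w"
    and 0: "\<And>vs. (\<And>y. y \<in> set vs \<Longrightarrow> a y = 0) \<Longrightarrow> w vs = 0"
  shows "w vs = wedge k a (\<lambda>ws. w (N # ws)) vs"
proof (cases "length vs = Suc k")
  case True
  have "wedge (Suc k) a w (N # vs) = 0" by (rule wedge_eq_0_if_vanishes_on_kernel[OF a N w 0]) auto
  then show ?thesis using contract_wedge[OF True, of a w N] N by simp
qed (use w in \<open>auto simp: alternating_length wedge_def alt_sum_def\<close>)

lemma span_axes: "span (range (\<lambda>i::'n::finite. axis i (1::real))) = UNIV"
proof -
  have "(Basis :: (real^'n) set) = range (\<lambda>i. axis i 1)" by (auto simp: Basis_vec_def)
  then show ?thesis using span_Basis[where 'a = "real^'n"] by simp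
qed

lemma set_subset_axes_imp_map:
  assumes "set vs \<subseteq> range (\<lambda>i::'n::finite. axis i (1::real))"
  obtains "is" where "vs = map (\<lambda>i. axis i 1) is"
  using assms ex_map_conv[of vs "\<lambda>i. axis i 1"] by (metis image_iff subsetD)

lemma alternating_above_dimension:
  fixes w :: "(real^'n::finite) list \<Rightarrow> real"
  assumes "alternating k w" "CARD('n) < k"
  shows "w vs = 0"
proof (rule alternating_eqI_spanning[OF assms(1) span_axes])
  fix vs :: "(real^'n) list" assume vs: "length vs = k" "set vs \<subseteq> range (\<lambda>i::'n. axis i 1)"
  then obtain "is" where ix: "vs = map (\<lambda>i. axis i 1) is" by (blast elim: set_subset_axes_imp_map)
  have "\<not> distinct is" using distinct_card[of "is"] card_mono[of UNIV "set is"] assms(2) vs ix by auto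
  then show "w vs = 0" by (intro alternating_repeat[OF assms(1)]) (auto simp: ix distinct_map)
qed

text \<open>
  The product \<open>a \<and> w\<close> has degree \<open>n + 1\<close> and is zero; contracted with \<open>N\<close> it gives \<open>w - a \<and> (\<iota>\<^sub>N w)\<close>, and
  the second term vanishes on the hyperplane.
\<close>

lemma vanishes_on_hyperplane_if_top_degree:
  fixes w :: "(real^'n::finite) list \<Rightarrow> real"
  assumes a: "linear a" "a N = (1::real)" and w: "alternating CARD('n) w" and vs: "\<And>y. y \<in> set vs \<Longrightarrow> a y = 0"
  shows "w vs = 0"
proof (cases "length vs = CARD('n)")
  case True
  obtain k where k: "CARD('n) = Suc k" by (metis zero_less_card_finite gr0_conv_Suc)
  have "wedge (Suc k) a w (N # vs) = 0"
    using w k by (intro alternating_above_dimension[OF alternating_wedge[OF a(1)]]) auto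
  then show ?thesis using contract_wedge[of vs k a w N] a(2) True k wedge_vanishes_on_kernel[OF vs] by simp
qed (use w in \<open>auto simp: alternating_length\<close>)

lemma coords: "distinct (coords :: 'n::finite list)" "set (coords :: 'n list) = UNIV"
proof -
  have "\<exists>is :: 'n list. distinct is \<and> set is = UNIV"
    using finite_distinct_list[of "UNIV :: 'n set"] by auto
  then have "distinct (coords :: 'n list) \<and> set (coords :: 'n list) = UNIV"
    unfolding coords_def by (rule someI_ex)
  then show "distinct (coords :: 'n list)" "set (coords :: 'n list) = UNIV" by auto
qed

lemma length_coords: "length (coords :: 'n::finite list) = CARD('n)"
  using distinct_card[OF coords(1)] coords(2) by metis

text \<open>
  A top form is determined by its value on one enumeration of a basis: exchanges of two entries
  turn any other enumeration into this one, position after position.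
\<close>

lemma top_form_eq_0:
  fixes w :: "(real^'n::finite) list \<Rightarrow> real"
  assumes w: "alternating CARD('n) w" and 0: "w (map (\<lambda>i. axis i 1) coords) = 0"
  shows "w vs = 0"
proof (rule alternating_eqI_spanning[OF w span_axes])
  let ?ax = "\<lambda>i::'n. axis i (1::real)"
  have main: "\<exists>is. distinct is \<and> length is = CARD('n) \<and> take j is = take j coords \<and> w (map ?ax is) \<noteq> 0"
    if "distinct is0" "length is0 = CARD('n)" "w (map ?ax is0) \<noteq> 0" "j \<le> CARD('n)" for is0 j
    using that(4)
  proof (induction j)
    case 0 then show ?case using that by auto
  next
    case (Suc j)
    then obtain "is" where ix: "distinct is" "length is = CARD('n)" "take j is = take j coords" "w (map ?ax is) \<noteq> 0"
      by auto
    let ?c = "coords ! j :: 'n"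
    have j: "j < length is" using Suc.prems ix by simp
    have "set is = UNIV" using distinct_card[OF ix(1)] ix(2) by (simp add: card_eq_UNIV_imp_eq_UNIV)
    moreover have "?c \<notin> set (take j is)"
    proof -
      have "coords = take j coords @ ?c # drop (Suc j) coords"
        using Suc.prems by (intro id_take_nth_drop) (simp add: length_coords)
      then have "distinct (take j coords @ ?c # drop (Suc j) coords)" using coords(1) by metis
      then show ?thesis using ix(3) by simp
    qed
    moreover have "set is = set (take j is) \<union> set (drop j is)"
      by (metis append_take_drop_id set_append)
    ultimately have "?c \<in> set (drop j is)" by blast
    then obtain ys zs where d: "drop j is = ys @ ?c # zs" by (metis split_list)
    define is' where "is' = take j is @ ?c # ys @ zs"
    have e: "is = take j is @ ys @ ?c # zs" using d append_take_drop_id[of j "is"] by simp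
    have "mset is' = mset is" by (subst e) (simp add: is'_def)
    then have "distinct is'" "length is' = CARD('n)"
      using ix mset_eq_imp_distinct_iff mset_eq_length by metis+
    moreover have "take (Suc j) is' = take (Suc j) coords"
      using ix(3) j Suc.prems by (simp add: is'_def take_Suc_conv_app_nth length_coords)
    moreover have "w (map ?ax is') = (-1) ^ length ys * w (map ?ax is)"
    proof -
      have "map ?ax is' = map ?ax (take j is) @ ?ax ?c # map ?ax ys @ map ?ax zs" by (simp add: is'_def)
      moreover have "map ?ax is = map ?ax (take j is) @ map ?ax ys @ ?ax ?c # map ?ax zs"
        by (subst e) simp
      ultimately show ?thesis using alternating_move[OF w, of "map ?ax (take j is)" "?ax ?c" "map ?ax ys" "map ?ax zs"]
        by simp
    qed
    ultimately show ?case using ix(4) by (intro exI[of _ is']) auto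
  qed
  fix vs :: "(real^'n) list" assume vs: "length vs = CARD('n)" "set vs \<subseteq> range ?ax"
  then obtain "is" where ix: "vs = map ?ax is" by (blast elim: set_subset_axes_imp_map)
  show "w vs = 0"
  proof (rule ccontr)
    assume nz: "w vs \<noteq> 0"
    then have "distinct is" using alternating_repeat[OF w, of vs] by (auto simp: ix distinct_map)
    from main[OF this _ _ order_refl] obtain js where "take CARD('n) js = take CARD('n) (coords :: 'n list)"
      "length js = CARD('n)" "w (map ?ax js) \<noteq> 0" using nz vs ix by auto
    then show False using 0 by (simp add: length_coords)
  qed
qed

text \<open>
  Independence of the hyperplanes provides projections \<open>P\<^sub>u\<close> onto each of them that preserve
  the other ones.  The hyperplanes are treated one by one: the defect on a further one is pulled back by its projection, and this
  pullback vanishes on those treated before.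
\<close>

lemma extend_from_hyperplanes:
  fixes l :: "'i \<Rightarrow> real^'n \<Rightarrow> real"
  assumes "finite U" and lin: "\<And>u. u \<in> U \<Longrightarrow> linear (l u)"
    and dual: "\<And>u v. u \<in> U \<Longrightarrow> v \<in> U \<Longrightarrow> l u (N v) = (if u = v then 1 else 0)"
    and alt: "\<And>u. u \<in> U \<Longrightarrow> alternating k (w u)"
    and compat: "\<And>u v vs. u \<in> U \<Longrightarrow> v \<in> U \<Longrightarrow> (\<And>y. y \<in> set vs \<Longrightarrow> l u y = 0 \<and> l v y = 0) \<Longrightarrow> w u vs = w v vs"
  shows "\<exists>W. alternating k W \<and> (\<forall>u\<in>U. \<forall>vs. (\<forall>y\<in>set vs. l u y = 0) \<longrightarrow> W vs = w u vs)"
  using assms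
proof (induction U rule: finite_induct)
  case empty
  then show ?case using alternating_0 by blast
next
  case (insert u U)
  have "\<exists>W. alternating k W \<and> (\<forall>u\<in>U. \<forall>vs. (\<forall>y\<in>set vs. l u y = 0) \<longrightarrow> W vs = w u vs)"
    by (rule insert.IH) (use insert.prems in auto)
  then obtain W where W: "alternating k W" "\<And>u vs. u \<in> U \<Longrightarrow> (\<And>y. y \<in> set vs \<Longrightarrow> l u y = 0) \<Longrightarrow> W vs = w u vs"
    by blast
  define P where "P y = y - l u y *\<^sub>R N u" for y
  have linu: "linear (l u)" using insert.prems by simp
  have linP: "linear P" unfolding P_def
    by (rule linearI) (simp_all add: linear_add[OF linu] linear_scale[OF linu] algebra_simps)
  define W' where "W' vs = W vs + (w u (map P vs) - W (map P vs))" for vs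
  have "alternating k W'" unfolding W'_def
    by (intro alternating_add alternating_diff alternating_pullback[OF linP] W(1) insert.prems) simp
  moreover have "W' vs = w v vs" if v: "v \<in> insert u U" and vs: "\<forall>y\<in>set vs. l v y = 0" for v vs
  proof (cases "v = u")
    case True
    then have "map P vs = vs" using vs by (simp add: P_def map_idI)
    then show ?thesis by (simp add: W'_def True)
  next
    case False
    then have vU: "v \<in> U" using v by simp
    have linv: "linear (l v)" using insert.prems(1) v by blast
    have "l v (N u) = 0" "l u (N u) = 1" using insert.prems(2) v False by auto
    then have *: "\<And>y. y \<in> set (map P vs) \<Longrightarrow> l v y = 0 \<and> l u y = 0"
      using vs linu linv by (auto simp: P_def linear_diff linear_scale)
    then have "W (map P vs) = w v (map P vs)" using W(2)[OF vU] by blast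
    also have "\<dots> = w u (map P vs)" using insert.prems(4)[OF v, of u] * by blast
    finally show ?thesis using W(2)[OF vU, of vs] vs by (simp add: W'_def)
  qed
  ultimately show ?case by blast
qed


section \<open>Polynomial functions and polynomial forms\<close>

text \<open>
  Generating polynomials by multiplication with affine functions makes all closure properties
  below inductions, whatever the coordinates in which a hyperplane is simple.
\<close>

inductive pol :: "int \<Rightarrow> (real ^ 'n::finite \<Rightarrow> real) \<Rightarrow> bool" where
  zero: "pol r (\<lambda>x. 0)"
| const: "0 \<le> r \<Longrightarrow> pol r (\<lambda>x. c)"
| add: "pol r f \<Longrightarrow> pol r g \<Longrightarrow> pol r (\<lambda>x. f x + g x)"
| affine: "pol r f \<Longrightarrow> pol (r + 1) (\<lambda>x. (a \<bullet> x + c) * f x)"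

lemma pol_negative: "pol r f \<Longrightarrow> r < 0 \<Longrightarrow> f x = 0"
  by (induction rule: pol.induct) auto

lemma pol_mono: "pol r f \<Longrightarrow> r \<le> s \<Longrightarrow> pol s f"
proof (induction arbitrary: s rule: pol.induct)
  case (affine r f a c)
  then show ?case using pol.affine[OF affine.IH[of "s - 1"], of a c] by simp
qed (auto intro: pol.intros)

lemma pol_scale: "pol r f \<Longrightarrow> pol r (\<lambda>x. c * f x)"
proof (induction rule: pol.induct)
  case (add r f g) then show ?case using pol.add[OF add.IH] by (simp add: algebra_simps)
next
  case (affine r f a d) then show ?case using pol.affine[OF affine.IH, of a d] by (simp add: algebra_simps)
qed (auto intro: pol.intros)

lemma pol_diff: "pol r f \<Longrightarrow> pol r g \<Longrightarrow> pol r (\<lambda>x. f x - g x)"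
  using pol.add[of r f "\<lambda>x. (-1) * g x"] pol_scale[of r g "-1"] by simp

lemma pol_sum: "(\<And>i. i \<in> I \<Longrightarrow> pol r (f i)) \<Longrightarrow> pol r (\<lambda>x. \<Sum>i\<in>I. f i x)"
  by (induction I rule: infinite_finite_induct) (auto intro: pol.intros)

lemma pol_mult: "pol r f \<Longrightarrow> pol s g \<Longrightarrow> pol (r + s) (\<lambda>x. f x * g x)"
proof (induction rule: pol.induct)
  case (const r c) then show ?case using pol_mono[OF pol_scale[OF const(2), of c], of "r + s"] by simp
next
  case (add r f h) then show ?case using pol.add[OF add.IH] by (simp add: algebra_simps)
next
  case (affine r f a d)
  then show ?case using pol.affine[OF affine.IH, of a d] by (simp add: algebra_simps)
qed (auto intro: pol.intros)

lemma pol_affine: "pol 1 (\<lambda>x. a \<bullet> x + c)"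
  using pol.affine[OF pol.const, of 0 a c 1] by simp

lemma pol_component: "pol 1 (\<lambda>x. x $ i)"
  using pol_affine[of "axis i 1" 0] by (simp add: inner_axis' )

lemma pol_power: "pol r f \<Longrightarrow> pol (int m * r) (\<lambda>x. f x ^ m)"
proof (induction m)
  case (Suc m)
  then show ?case using pol_mult[of r f "int m * r" "\<lambda>x. f x ^ m"] by (simp add: algebra_simps)
qed (auto intro: pol.const)

lemma pol_prod: "(\<And>i. i \<in> I \<Longrightarrow> pol (r i) (f i)) \<Longrightarrow> pol (\<Sum>i\<in>I. r i) (\<lambda>x. \<Prod>i\<in>I. f i x)"
  by (induction I rule: infinite_finite_induct) (auto intro: pol.const pol_mult)

lemma pol_projection: "pol r f \<Longrightarrow> pol r (\<lambda>x. f (x - (a \<bullet> x + c) *\<^sub>R N))"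
proof (induction rule: pol.induct)
  case (affine r f b d)
  have "(b - (b \<bullet> N) *\<^sub>R a) \<bullet> x + (d - c * (b \<bullet> N)) = b \<bullet> (x - (a \<bullet> x + c) *\<^sub>R N) + d" for x
    by (simp add: inner_diff_left inner_diff_right algebra_simps)
  then show ?case using pol.affine[OF affine.IH, of "b - (b \<bullet> N) *\<^sub>R a" "d - c * (b \<bullet> N)"] by (simp only:)
qed (auto intro: pol.intros)

text \<open>
  Polynomial division by the affine function \<open>a \<bullet> x + c\<close> in the direction \<open>N\<close>.  If \<open>a \<bullet> N = 1\<close>, the subtracted value is
  the one at the projection of \<open>x\<close> to the zero set, so that a polynomial vanishing there is divisible.
\<close>

lemma pol_divided_difference:
  "pol r f \<Longrightarrow> \<exists>g. pol (r - 1) g \<and> (\<forall>x. f x - f (x - (a \<bullet> x + c) *\<^sub>R N) = (a \<bullet> x + c) * g x)"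
proof (induction rule: pol.induct)
  case (add r f f')
  let ?Q = "\<lambda>x. x - (a \<bullet> x + c) *\<^sub>R N"
  obtain g g' where g: "pol (r - 1) g" "pol (r - 1) g'"
    and e: "\<And>x. f x - f (?Q x) = (a \<bullet> x + c) * g x" "\<And>x. f' x - f' (?Q x) = (a \<bullet> x + c) * g' x"
    using add.IH by blast
  have "(f x + f' x) - (f (?Q x) + f' (?Q x)) = (f x - f (?Q x)) + (f' x - f' (?Q x))" for x by linarith
  then have "(f x + f' x) - (f (?Q x) + f' (?Q x)) = (a \<bullet> x + c) * (g x + g' x)" for x
    unfolding e by (simp add: distrib_left)
  then show ?case using pol.add[OF g] by blast
next
  case (affine r f b d)
  then obtain g where g: "pol (r - 1) g" "\<And>x. f x - f (x - (a \<bullet> x + c) *\<^sub>R N) = (a \<bullet> x + c) * g x" by blast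
  let ?Q = "\<lambda>x. x - (a \<bullet> x + c) *\<^sub>R N" and ?g = "\<lambda>x. (b \<bullet> x + d) * g x + (b \<bullet> N) * f (x - (a \<bullet> x + c) *\<^sub>R N)"
  have "pol r ?g"
    using pol.affine[OF g(1), of b d] pol_scale[OF pol_projection[OF affine.hyps]] by (intro pol.add) auto
  moreover have "(b \<bullet> x + d) * f x - (b \<bullet> ?Q x + d) * f (?Q x) = (a \<bullet> x + c) * ?g x" for x
  proof -
    define h where "h = a \<bullet> x + c"
    define y where "y = f (x - h *\<^sub>R N)"
    have "f x = y + h * g x" using g(2)[of x] by (simp add: y_def h_def)
    moreover have "b \<bullet> ?Q x = b \<bullet> x - h * (b \<bullet> N)" by (simp add: h_def inner_diff_right)
    ultimately show ?thesis
      unfolding h_def[symmetric] y_def[symmetric] by (simp add: algebra_simps)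
  qed
  ultimately show ?case by auto
qed (auto intro!: exI[of _ "\<lambda>x. 0"] pol.zero)

lemma pol_has_derivative:
  "pol r f \<Longrightarrow> \<exists>f'. (\<forall>x. (f has_derivative f' x) (at x)) \<and> (\<forall>v. pol (r - 1) (\<lambda>x. f' x v))"
proof (induction rule: pol.induct)
  case (add r f g)
  then obtain f' g' where "\<forall>x. (f has_derivative f' x) (at x)" "\<forall>v. pol (r - 1) (\<lambda>x. f' x v)"
    "\<forall>x. (g has_derivative g' x) (at x)" "\<forall>v. pol (r - 1) (\<lambda>x. g' x v)" by blast
  then show ?case
    by (intro exI[of _ "\<lambda>x v. f' x v + g' x v"]) (auto intro!: derivative_eq_intros pol.add)
next
  case (affine r f a c)
  then obtain f' where f': "\<forall>x. (f has_derivative f' x) (at x)" "\<And>v. pol (r - 1) (\<lambda>x. f' x v)" by blast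
  have "pol r (\<lambda>x. (a \<bullet> x + c) * f' x v + (a \<bullet> v) * f x)" for v
    using pol.affine[OF f'(2)[of v], of a c] pol_scale[OF affine.hyps, of "a \<bullet> v"] by (intro pol.add) auto
  then show ?case using f'(1)
    by (intro exI[of _ "\<lambda>x v. (a \<bullet> x + c) * f' x v + (a \<bullet> v) * f x"])
       (auto intro!: derivative_eq_intros)
qed (auto intro!: exI[of _ "\<lambda>x v. 0"] pol.zero)

lemma pol_differentiable: "pol r f \<Longrightarrow> f differentiable (at x)"
  using pol_has_derivative[of r f] by (auto simp: differentiable_def)

lemma pol_frechet_derivative: "pol r f \<Longrightarrow> pol (r - 1) (\<lambda>x. frechet_derivative f (at x) v)"
proof -
  assume "pol r f"
  then obtain f' where f': "\<And>x. (f has_derivative f' x) (at x)" "\<And>v. pol (r - 1) (\<lambda>x. f' x v)"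
    using pol_has_derivative by blast
  then show ?thesis using frechet_derivative_at[OF f'(1)] by simp
qed

lemma pol_continuous: "pol r f \<Longrightarrow> continuous_on S f"
  using pol_differentiable[of r f]
  by (meson continuous_at_imp_continuous_on differentiable_imp_continuous_within)

lemma pol_on_line:
  "pol r f \<Longrightarrow> \<exists>q. \<forall>t. f (x + t *\<^sub>R d) = poly q t"
proof (induction rule: pol.induct)
  case (zero r) show ?case by (intro exI[of _ 0]) simp
next
  case (const r c) show ?case by (intro exI[of _ "[:c:]"]) simp
next
  case (add r f g)
  then obtain q q' where "\<forall>t. f (x + t *\<^sub>R d) = poly q t" "\<forall>t. g (x + t *\<^sub>R d) = poly q' t" by blast
  then show ?case by (intro exI[of _ "q + q'"]) simp
next
  case (affine r f a c)
  then obtain q where "\<forall>t. f (x + t *\<^sub>R d) = poly q t" by blast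
  moreover have "a \<bullet> (x + t *\<^sub>R d) + c = poly [:a \<bullet> x + c, a \<bullet> d:] t" for t
    by (simp add: inner_add_right)
  ultimately show ?case by (intro exI[of _ "[:a \<bullet> x + c, a \<bullet> d:] * q"]) (simp only: poly_mult, simp)
qed

text \<open>
  On the line from \<open>x\<close> to \<open>y\<close>, which stays in \<open>H\<close>, the function is a polynomial in one variable with
  infinitely many zeros near \<open>x\<close>.
\<close>

lemma pol_eq_0_on_affine:
  assumes f: "pol r f" and H: "affine H" and U: "open U" "x \<in> H" "x \<in> U"
    and 0: "\<And>x. x \<in> H \<Longrightarrow> x \<in> U \<Longrightarrow> f x = 0" and y: "y \<in> H"
  shows "f y = 0"
proof -
  obtain q where q: "\<And>t. f (x + t *\<^sub>R (y - x)) = poly q t" using pol_on_line[OF f] by blast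
  have on: "x + t *\<^sub>R (y - x) \<in> H" for t
    using mem_affine[OF H U(2) y, of "1 - t" t] by (simp add: algebra_simps)
  have "((\<lambda>t. x + t *\<^sub>R (y - x)) \<longlongrightarrow> x + 0 *\<^sub>R (y - x)) (at_right 0)" by (intro tendsto_intros)
  then have "\<forall>\<^sub>F t in at_right 0. x + t *\<^sub>R (y - x) \<in> U"
    using topological_tendstoD[OF _ U(1)] U(3) by fastforce
  then obtain e where e: "0 < e" "\<And>t. 0 < t \<Longrightarrow> t < e \<Longrightarrow> x + t *\<^sub>R (y - x) \<in> U"
    by (auto simp: eventually_at_right_field)
  have "poly q t = 0" if "t \<in> {0<..<e}" for t using 0[OF on e(2)] that q by auto
  then have "{0<..<e} \<subseteq> {t. poly q t = 0}" by blast
  then have "infinite {t. poly q t = 0}" using e(1) infinite_Ioo[of 0 e] finite_subset by blast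
  then have "q = 0" using poly_roots_finite by blast
  then show ?thesis using q[of 1] by simp
qed

subsection \<open>Comparison with the expansion in monomials\<close>

lemma finite_exponents: "finite {\<alpha> :: 'n::finite \<Rightarrow> nat. int (\<Sum>i\<in>UNIV. \<alpha> i) \<le> r}"
proof (rule finite_subset)
  show "{\<alpha> :: 'n \<Rightarrow> nat. int (\<Sum>i\<in>UNIV. \<alpha> i) \<le> r} \<subseteq>
      {\<alpha>. \<forall>i. (i \<in> UNIV \<longrightarrow> \<alpha> i \<in> {..nat r}) \<and> (i \<notin> UNIV \<longrightarrow> \<alpha> i = 0)}"
  proof clarsimp
    fix \<alpha> :: "'n \<Rightarrow> nat" and i assume "(\<Sum>i\<in>UNIV. int (\<alpha> i)) \<le> r"
    moreover have "int (\<alpha> i) \<le> (\<Sum>i\<in>UNIV. int (\<alpha> i))" by (rule member_le_sum) auto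
    ultimately show "\<alpha> i \<le> nat r" by simp
  qed
  show "finite {\<alpha> :: 'n \<Rightarrow> nat. \<forall>i. (i \<in> UNIV \<longrightarrow> \<alpha> i \<in> {..nat r}) \<and> (i \<notin> UNIV \<longrightarrow> \<alpha> i = 0)}"
    by (rule finite_set_of_finite_funs) auto
qed

lemma poly_le_imp_pol: "poly_le r f \<Longrightarrow> pol r f"
proof -
  assume "poly_le r f"
  then obtain c where c: "\<And>x. f x = (\<Sum>\<alpha> | int (\<Sum>i\<in>UNIV. \<alpha> i) \<le> r. c \<alpha> * (\<Prod>i\<in>UNIV. (x $ i) ^ \<alpha> i))"
    unfolding poly_le_def by blast
  have "pol (\<Sum>i\<in>UNIV. int (\<alpha> i) * 1) (\<lambda>x. \<Prod>i\<in>UNIV. (x $ i) ^ \<alpha> i)" for \<alpha> :: "'a \<Rightarrow> nat"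
    by (intro pol_prod pol_power pol_component)
  then have "pol r (\<lambda>x. \<Prod>i\<in>UNIV. (x $ i) ^ \<alpha> i)" if "int (\<Sum>i\<in>UNIV. \<alpha> i) \<le> r" for \<alpha> :: "'a \<Rightarrow> nat"
    using pol_mono that by fastforce
  then have "pol r (\<lambda>x. \<Sum>\<alpha> | int (\<Sum>i\<in>UNIV. \<alpha> i) \<le> r. c \<alpha> * (\<Prod>i\<in>UNIV. (x $ i) ^ \<alpha> i))"
    by (intro pol_sum pol_scale) auto
  then show "pol r f" using c by presburger
qed

lemma poly_le_add: "poly_le r f \<Longrightarrow> poly_le r g \<Longrightarrow> poly_le r (\<lambda>x. f x + g x)"
proof -
  assume "poly_le r f" "poly_le r g"
  then obtain c d where "\<And>x. f x = (\<Sum>\<alpha> | int (\<Sum>i\<in>UNIV. \<alpha> i) \<le> r. c \<alpha> * (\<Prod>i\<in>UNIV. (x $ i) ^ \<alpha> i))"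
    "\<And>x. g x = (\<Sum>\<alpha> | int (\<Sum>i\<in>UNIV. \<alpha> i) \<le> r. d \<alpha> * (\<Prod>i\<in>UNIV. (x $ i) ^ \<alpha> i))"
    unfolding poly_le_def by blast
  then show ?thesis unfolding poly_le_def
    by (intro exI[of _ "\<lambda>\<alpha>. c \<alpha> + d \<alpha>"]) (simp add: algebra_simps sum.distrib)
qed

lemma poly_le_scale: "poly_le r f \<Longrightarrow> poly_le r (\<lambda>x. b * f x)"
proof -
  assume "poly_le r f"
  then obtain c where "\<And>x. f x = (\<Sum>\<alpha> | int (\<Sum>i\<in>UNIV. \<alpha> i) \<le> r. c \<alpha> * (\<Prod>i\<in>UNIV. (x $ i) ^ \<alpha> i))"
    unfolding poly_le_def by blast
  then show ?thesis unfolding poly_le_def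
    by (intro exI[of _ "\<lambda>\<alpha>. b * c \<alpha>"]) (simp add: sum_distrib_left mult_ac)
qed

lemma poly_le_zero: "poly_le r (\<lambda>x. 0)"
  unfolding poly_le_def by (intro exI[of _ "\<lambda>\<alpha>. 0"]) simp

lemma poly_le_sum: "(\<And>i. i \<in> I \<Longrightarrow> poly_le r (f i)) \<Longrightarrow> poly_le r (\<lambda>x. \<Sum>i\<in>I. f i x)"
  by (induction I rule: infinite_finite_induct) (auto intro: poly_le_zero poly_le_add)

lemma poly_le_monomial:
  assumes "int (\<Sum>i\<in>UNIV. \<beta> i) \<le> r" shows "poly_le r (\<lambda>x. \<Prod>i\<in>UNIV. (x $ i) ^ \<beta> i)"
  unfolding poly_le_def
proof (intro exI allI)
  fix x :: "real^'a"
  have "(\<Sum>\<alpha> | int (\<Sum>i\<in>UNIV. \<alpha> i) \<le> r. (if \<alpha> = \<beta> then 1 else 0) * (\<Prod>i\<in>UNIV. (x $ i) ^ \<alpha> i))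
      = (\<Sum>\<alpha> | int (\<Sum>i\<in>UNIV. \<alpha> i) \<le> r. if \<alpha> = \<beta> then (\<Prod>i\<in>UNIV. (x $ i) ^ \<alpha> i) else 0)"
    by (intro sum.cong) auto
  also have "\<dots> = (\<Prod>i\<in>UNIV. (x $ i) ^ \<beta> i)"
    using assms finite_exponents[of r] by (subst sum.delta) auto
  finally show "(\<Prod>i\<in>UNIV. (x $ i) ^ \<beta> i) =
      (\<Sum>\<alpha> | int (\<Sum>i\<in>UNIV. \<alpha> i) \<le> r. (if \<alpha> = \<beta> then 1 else 0) * (\<Prod>i\<in>UNIV. (x $ i) ^ \<alpha> i))" by simp
qed

lemma poly_le_component_mult: "poly_le r f \<Longrightarrow> poly_le (r + 1) (\<lambda>x. x $ j * f x)"
proof -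
  assume "poly_le r f"
  then obtain c where c: "\<And>x. f x = (\<Sum>\<alpha> | int (\<Sum>i\<in>UNIV. \<alpha> i) \<le> r. c \<alpha> * (\<Prod>i\<in>UNIV. (x $ i) ^ \<alpha> i))"
    unfolding poly_le_def by blast
  have e: "x $ j * (\<Prod>i\<in>UNIV. (x $ i) ^ \<alpha> i) = (\<Prod>i\<in>UNIV. (x $ i) ^ (\<alpha>(j := Suc (\<alpha> j))) i)"
    for x :: "real^'a" and \<alpha>
    by (simp add: prod.remove[of UNIV j] mult_ac)
  have "poly_le (r + 1) (\<lambda>x. \<Sum>\<alpha> | int (\<Sum>i\<in>UNIV. \<alpha> i) \<le> r. c \<alpha> * (x $ j * (\<Prod>i\<in>UNIV. (x $ i) ^ \<alpha> i)))"
    unfolding e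
  proof (intro poly_le_sum poly_le_scale poly_le_monomial)
    fix \<alpha> :: "'a \<Rightarrow> nat" assume "\<alpha> \<in> {\<alpha>. int (\<Sum>i\<in>UNIV. \<alpha> i) \<le> r}"
    moreover have "(\<Sum>i\<in>UNIV. (\<alpha>(j := Suc (\<alpha> j))) i) = (\<Sum>i\<in>UNIV. \<alpha> i) + 1"
      by (simp add: sum.remove[of UNIV j])
    ultimately show "int (\<Sum>i\<in>UNIV. (\<alpha>(j := Suc (\<alpha> j))) i) \<le> r + 1" by simp
  qed
  then show ?thesis by (simp add: c sum_distrib_left mult_ac)
qed

lemma poly_le_mono: "poly_le r f \<Longrightarrow> r \<le> s \<Longrightarrow> poly_le s f"
proof -
  assume "poly_le r f" "r \<le> s"
  then obtain c where c: "\<And>x. f x = (\<Sum>\<alpha> | int (\<Sum>i\<in>UNIV. \<alpha> i) \<le> r. c \<alpha> * (\<Prod>i\<in>UNIV. (x $ i) ^ \<alpha> i))"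
    unfolding poly_le_def by blast
  have "poly_le s (\<lambda>x. \<Sum>\<alpha> | int (\<Sum>i\<in>UNIV. \<alpha> i) \<le> r. c \<alpha> * (\<Prod>i\<in>UNIV. (x $ i) ^ \<alpha> i))"
    using \<open>r \<le> s\<close> by (intro poly_le_sum poly_le_scale poly_le_monomial) auto
  moreover have "f = (\<lambda>x. \<Sum>\<alpha> | int (\<Sum>i\<in>UNIV. \<alpha> i) \<le> r. c \<alpha> * (\<Prod>i\<in>UNIV. (x $ i) ^ \<alpha> i))"
    by (rule ext) (rule c)
  ultimately show ?thesis by simp
qed

lemma pol_imp_poly_le: "pol r f \<Longrightarrow> poly_le r f"
proof (induction rule: pol.induct)
  case (const r c)
  have "poly_le r (\<lambda>x::real^'a. c * (\<Prod>i\<in>UNIV. (x $ i) ^ 0))"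
    using const by (intro poly_le_scale poly_le_monomial) simp
  then show ?case by simp
next
  case (affine r f a c)
  have "poly_le (r + 1) (\<lambda>x. (\<Sum>i\<in>UNIV. a $ i * (x $ i * f x)) + c * f x)"
    using affine.IH
    by (intro poly_le_add poly_le_sum poly_le_scale poly_le_component_mult poly_le_mono[OF affine.IH]) auto
  moreover have "(\<Sum>i\<in>UNIV. a $ i * (x $ i * f x)) + c * f x = (a \<bullet> x + c) * f x" for x
    by (simp add: inner_vec_def sum_distrib_right distrib_right mult.assoc)
  ultimately show ?case by simp
qed (auto intro: poly_le_zero poly_le_add)

lemma pol_iff_poly_le: "pol r f \<longleftrightarrow> poly_le r f"
  using pol_imp_poly_le poly_le_imp_pol by blast

subsection \<open>Polynomial forms\<close>

lemma poly_formsI: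
  assumes "\<And>x. alternating k (p x)" "\<And>vs. pol r (\<lambda>x. p x vs)" shows "p \<in> poly_forms r k"
  using assms by (auto simp: poly_forms_def form_coeff_def[abs_def] pol_iff_poly_le[symmetric])

lemma poly_forms_alternating: "p \<in> poly_forms r k \<Longrightarrow> alternating k (p x)"
  by (simp add: poly_forms_def)

lemma alternating_expand_slot:
  fixes w :: "(real^'n::finite) list \<Rightarrow> real"
  assumes w: "alternating k w" and "length vs = k" "j < k"
  shows "w vs = (\<Sum>i\<in>UNIV. (vs ! j) $ i * w (vs[j := axis i 1]))"
proof -
  have lin: "linear (\<lambda>v. w (vs[j := v]))" using assms by (intro alternating_linear)
  have "w vs = w (vs[j := vs ! j])" by simp
  also have "vs ! j = (\<Sum>i\<in>UNIV. (vs ! j) $ i *\<^sub>R axis i 1)"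
    using basis_expansion[of "vs ! j"] by (simp add: scalar_mult_eq_scaleR)
  finally show ?thesis by (simp add: linear_sum[OF lin] linear_scale[OF lin])
qed

text \<open>
  Membership constrains the values on lists of basis vectors; linearity carries the bound over to arbitrary
  constant vectors, again slot after slot.
\<close>

lemma poly_forms_pol:
  assumes p: "p \<in> poly_forms r k"
  shows "pol r (\<lambda>x. p x vs)"
proof -
  have a: "alternating k (p x)" for x using p by (rule poly_forms_alternating)
  have "pol r (\<lambda>x. p x vs)" if "length vs = k" "j \<le> k" "set (drop j vs) \<subseteq> range (\<lambda>i. axis i 1)" for j vs
    using that
  proof (induction j arbitrary: vs)
    case 0
    then obtain "is" where "vs = map (\<lambda>i. axis i 1) is" using set_subset_axes_imp_map[of vs] by auto
    then show ?case using p by (auto simp: poly_forms_def form_coeff_def[abs_def] pol_iff_poly_le)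
  next
    case (Suc j)
    have "pol r (\<lambda>x. p x (vs[j := axis i 1]))" for i
    proof (rule Suc.IH)
      have "drop j (vs[j := axis i 1]) = axis i 1 # drop (Suc j) vs"
        using Suc.prems by (simp add: list_eq_iff_nth_eq nth_Cons split: nat.split)
      then show "set (drop j (vs[j := axis i 1])) \<subseteq> range (\<lambda>i. axis i 1)" using Suc.prems by simp
    qed (use Suc.prems in auto)
    then have "pol r (\<lambda>x. \<Sum>i\<in>UNIV. (vs ! j) $ i * p x (vs[j := axis i 1]))" by (intro pol_sum pol_scale)
    then show ?case using alternating_expand_slot[OF a, of vs j] Suc.prems by simp
  qed
  from this[of vs k] show ?thesis using alternating_length[OF a, of vs]
    by (cases "length vs = k") (auto simp: pol.zero)
qed

lemma poly_forms_add: "p \<in> poly_forms r k \<Longrightarrow> q \<in> poly_forms r k \<Longrightarrow> (\<lambda>x vs. p x vs + q x vs) \<in> poly_forms r k"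
  by (rule poly_formsI; rule alternating_add pol.add) (erule poly_forms_alternating poly_forms_pol)+

lemma poly_forms_diff: "p \<in> poly_forms r k \<Longrightarrow> q \<in> poly_forms r k \<Longrightarrow> (\<lambda>x vs. p x vs - q x vs) \<in> poly_forms r k"
  by (rule poly_formsI; rule alternating_diff pol_diff) (erule poly_forms_alternating poly_forms_pol)+

lemma poly_forms_scale: "p \<in> poly_forms r k \<Longrightarrow> (\<lambda>x vs. c * p x vs) \<in> poly_forms r k"
  by (rule poly_formsI; rule alternating_scale pol_scale) (erule poly_forms_alternating poly_forms_pol)+

lemma poly_forms_zero: "(\<lambda>x vs. 0) \<in> poly_forms r k"
  by (rule poly_formsI alternating_0 pol.zero)+

lemma poly_forms_mono: "p \<in> poly_forms r k \<Longrightarrow> r \<le> s \<Longrightarrow> p \<in> poly_forms s k"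
  by (meson poly_formsI poly_forms_alternating poly_forms_pol pol_mono)

lemma poly_forms_negative: "p \<in> poly_forms r k \<Longrightarrow> r < 0 \<Longrightarrow> p x vs = 0"
  using pol_negative[OF poly_forms_pol, of p r k x vs] by simp

lemma poly_forms_mult: "pol s f \<Longrightarrow> p \<in> poly_forms r k \<Longrightarrow> (\<lambda>x vs. f x * p x vs) \<in> poly_forms (s + r) k"
  by (rule poly_formsI; rule alternating_scale pol_mult) (assumption | erule poly_forms_alternating poly_forms_pol)+

lemma poly_forms_const: "alternating k w \<Longrightarrow> 0 \<le> r \<Longrightarrow> (\<lambda>x. w) \<in> poly_forms r k"
  by (rule poly_formsI) (auto intro: pol.const)

lemma poly_forms_wedge:
  assumes "linear a" "p \<in> poly_forms r k" shows "(\<lambda>x. wedge k a (p x)) \<in> poly_forms r (Suc k)"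
proof (rule poly_formsI)
  show "pol r (\<lambda>x. wedge k a (p x) vs)" for vs
    unfolding wedge_def alt_sum_def
    by (cases "length vs = Suc k") (auto intro!: pol_sum pol_scale poly_forms_pol[OF assms(2)] pol.zero simp: mult.assoc)
qed (rule alternating_wedge[OF assms(1) poly_forms_alternating[OF assms(2)]])

lemma poly_forms_contract: "p \<in> poly_forms r (Suc k) \<Longrightarrow> (\<lambda>x vs. p x (N # vs)) \<in> poly_forms r k"
  by (rule poly_formsI) (auto intro: alternating_contract poly_forms_alternating elim: poly_forms_pol)

text \<open>
  The quotients for the different argument lists are chosen independently.  Off the hyperplane they are
  determined by \<open>p\<close> and hence alternating, and the hyperplane is in the closure of its complement.
\<close>

lemma poly_forms_divide:
  assumes p: "p \<in> poly_forms r k" and N: "a \<bullet> N = 1"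
    and 0: "\<And>x vs. a \<bullet> x + c = 0 \<Longrightarrow> p x vs = 0"
  obtains q where "q \<in> poly_forms (r - 1) k" "\<And>x vs. p x vs = (a \<bullet> x + c) * q x vs"
proof -
  have "\<exists>g. pol (r - 1) g \<and> (\<forall>x. p x vs = (a \<bullet> x + c) * g x)" for vs
  proof -
    have "a \<bullet> (x - (a \<bullet> x + c) *\<^sub>R N) + c = 0" for x using N by (simp add: inner_diff_right)
    then have "p (x - (a \<bullet> x + c) *\<^sub>R N) vs = 0" for x by (rule 0)
    then show ?thesis using pol_divided_difference[OF poly_forms_pol[OF p, of vs], of a c N] by simp
  qed
  then obtain g where g: "\<And>vs. pol (r - 1) (g vs)" "\<And>x vs. p x vs = (a \<bullet> x + c) * g vs x" by metis
  have uniq: "f x = 0" if f: "pol s f" and z: "\<And>x. (a \<bullet> x + c) * f x = 0" for s f x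
  proof (rule pol_eq_0_on_affine[OF f affine_UNIV, of "- {x. a \<bullet> x = - c}" "(1 - c) *\<^sub>R N"])
    show "open (- {x. a \<bullet> x = - c})" using closed_hyperplane[of a "-c"] by blast
    show "f x = 0" if "x \<in> - {x. a \<bullet> x = - c}" for x using z[of x] that by auto
  qed (use N in auto)
  have "alternating k (\<lambda>vs. g vs x)" for x
    unfolding alternating_def
  proof (intro conjI allI impI)
    fix vs :: "(real^'a) list" assume "length vs \<noteq> k"
    then have "(a \<bullet> x + c) * g vs x = 0" for x
      using alternating_length[OF poly_forms_alternating[OF p]] g(2) by metis
    from uniq[OF g(1) this] show "g vs x = 0" .
  next
    fix vs :: "(real^'a) list" assume "length vs = k \<and> \<not> distinct vs"
    then have "(a \<bullet> x + c) * g vs x = 0" for x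
      using alternating_repeat[OF poly_forms_alternating[OF p]] g(2) by metis
    from uniq[OF g(1) this] show "g vs x = 0" .
  next
    fix vs :: "(real^'a) list" and i assume i: "length vs = k \<and> i < k"
    have lin: "linear (\<lambda>v. p x (vs[i := v]))" for x
      using alternating_linear[OF poly_forms_alternating[OF p]] i by blast
    show "linear (\<lambda>v. g (vs[i := v]) x)"
    proof (rule linearI)
      fix v w
      have "(a \<bullet> x + c) * (g (vs[i := v + w]) x - (g (vs[i := v]) x + g (vs[i := w]) x)) = 0" for x
        using linear_add[OF lin, of x v w] by (simp add: g(2) algebra_simps)
      from uniq[OF _ this] show "g (vs[i := v + w]) x = g (vs[i := v]) x + g (vs[i := w]) x"
        using pol_diff[OF g(1) pol.add[OF g(1) g(1)]] by fastforce
    next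
      fix b v
      have "(a \<bullet> x + c) * (g (vs[i := b *\<^sub>R v]) x - b * g (vs[i := v]) x) = 0" for x
        using linear_scale[OF lin, of x b v] by (simp add: g(2) algebra_simps)
      from uniq[OF _ this] show "g (vs[i := b *\<^sub>R v]) x = b *\<^sub>R g (vs[i := v]) x"
        using pol_diff[OF g(1) pol_scale[OF g(1)]] by fastforce
    qed
  qed
  then have "(\<lambda>x vs. g vs x) \<in> poly_forms (r - 1) k" using g(1) by (intro poly_formsI)
  then show ?thesis using that g(2) by blast
qed

lemma has_frechet_derivative: "f differentiable (at x) \<Longrightarrow> (f has_derivative frechet_derivative f (at x)) (at x)"
  using frechet_derivative_works by blast

definition ext_d :: "nat \<Rightarrow> 'n::finite rform \<Rightarrow> 'n rform" where
  "ext_d k p x = alt_sum k (\<lambda>v ws. frechet_derivative (\<lambda>y. p y ws) (at x) v)"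

lemma poly_forms_differentiable: "p \<in> poly_forms r k \<Longrightarrow> (\<lambda>y. p y ws) differentiable (at x)"
  by (rule pol_differentiable[OF poly_forms_pol])

lemma poly_forms_ext_d:
  assumes p: "p \<in> poly_forms r k" shows "ext_d k p \<in> poly_forms (r - 1) (Suc k)"
proof (rule poly_formsI)
  fix x
  note D = has_frechet_derivative[OF poly_forms_differentiable[OF p]]
  have "alternating k (\<lambda>ws. frechet_derivative (\<lambda>y. p y ws) (at x) v)" for v
    unfolding alternating_def
  proof (intro conjI allI impI)
    fix vs :: "(real^'a) list" assume "length vs \<noteq> k"
    then have "(\<lambda>y. p y vs) = (\<lambda>y. 0)" using alternating_length[OF poly_forms_alternating[OF p]] by auto
    then show "frechet_derivative (\<lambda>y. p y vs) (at x) v = 0" by (simp add: frechet_derivative_const)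
  next
    fix vs :: "(real^'a) list" assume "length vs = k \<and> \<not> distinct vs"
    then have "(\<lambda>y. p y vs) = (\<lambda>y. 0)" using alternating_repeat[OF poly_forms_alternating[OF p]] by auto
    then show "frechet_derivative (\<lambda>y. p y vs) (at x) v = 0" by (simp add: frechet_derivative_const)
  next
    fix vs :: "(real^'a) list" and i assume i: "length vs = k \<and> i < k"
    have lin: "linear (\<lambda>u. p y (vs[i := u]))" for y
      using alternating_linear[OF poly_forms_alternating[OF p]] i by blast
    show "linear (\<lambda>u. frechet_derivative (\<lambda>y. p y (vs[i := u])) (at x) v)"
    proof (rule linearI)
      fix u w
      have "(\<lambda>y. p y (vs[i := u + w])) = (\<lambda>y. p y (vs[i := u]) + p y (vs[i := w]))"
        by (simp add: linear_add[OF lin])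
      then show "frechet_derivative (\<lambda>y. p y (vs[i := u + w])) (at x) v =
          frechet_derivative (\<lambda>y. p y (vs[i := u])) (at x) v + frechet_derivative (\<lambda>y. p y (vs[i := w])) (at x) v"
        by (simp only: frechet_derivative_at[OF has_derivative_add[OF D D], symmetric])
    next
      fix b u
      have "(\<lambda>y. p y (vs[i := b *\<^sub>R u])) = (\<lambda>y. b *\<^sub>R p y (vs[i := u]))"
        by (simp add: linear_scale[OF lin])
      then show "frechet_derivative (\<lambda>y. p y (vs[i := b *\<^sub>R u])) (at x) v =
          b *\<^sub>R frechet_derivative (\<lambda>y. p y (vs[i := u])) (at x) v"
        by (simp only: frechet_derivative_at[OF has_derivative_scaleR_right[OF D], symmetric])
    qed
  qed
  then show "alternating (Suc k) (ext_d k p x)"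
    unfolding ext_d_def
    by (rule alternating_alt_sum) (rule linear_frechet_derivative[OF poly_forms_differentiable[OF p]])
next
  show "pol (r - 1) (\<lambda>x. ext_d k p x vs)" for vs
    unfolding ext_d_def alt_sum_def
    by (cases "length vs = Suc k")
       (auto intro!: pol_sum pol_scale pol_frechet_derivative poly_forms_pol[OF p] pol.zero)
qed

lemma ext_d_add:
  assumes "p \<in> poly_forms r k" "q \<in> poly_forms s k"
  shows "ext_d k (\<lambda>x vs. p x vs + q x vs) x vs = ext_d k p x vs + ext_d k q x vs"
proof -
  have "frechet_derivative (\<lambda>y. p y ws + q y ws) (at x) =
      (\<lambda>v. frechet_derivative (\<lambda>y. p y ws) (at x) v + frechet_derivative (\<lambda>y. q y ws) (at x) v)" for ws
    using assms by (intro frechet_derivative_at[symmetric] has_derivative_add has_frechet_derivative poly_forms_differentiable)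
  then show ?thesis by (simp add: ext_d_def alt_sum_add)
qed

lemma ext_d_scale:
  assumes "p \<in> poly_forms r k"
  shows "ext_d k (\<lambda>x vs. c * p x vs) x vs = c * ext_d k p x vs"
proof -
  have "frechet_derivative (\<lambda>y. c * p y ws) (at x) = (\<lambda>v. c * frechet_derivative (\<lambda>y. p y ws) (at x) v)" for ws
    using assms by (intro frechet_derivative_at[symmetric] has_derivative_mult_right has_frechet_derivative poly_forms_differentiable)
  then show ?thesis by (simp add: ext_d_def alt_sum_scale)
qed

lemma ext_d_mult:
  assumes p: "p \<in> poly_forms r k" and f: "(f has_derivative f') (at x)"
  shows "ext_d k (\<lambda>x vs. f x * p x vs) x vs = wedge k f' (p x) vs + f x * ext_d k p x vs"
proof -
  have "frechet_derivative (\<lambda>y. f y * p y ws) (at x) =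
      (\<lambda>v. f x * frechet_derivative (\<lambda>y. p y ws) (at x) v + f' v * p x ws)" for ws
    using assms by (intro frechet_derivative_at[symmetric] has_derivative_mult has_frechet_derivative poly_forms_differentiable)
  then show ?thesis by (simp add: ext_d_def alt_sum_add alt_sum_scale wedge_def)
qed


section \<open>Barycentric coordinates and Bernstein expansions\<close>

text \<open>
  A nondegenerate simplex with vertex set \<open>C\<close>, given by its barycentric coordinates: \<open>lam v\<close> is the one
  belonging to the vertex \<open>v\<close>, and \<open>D v\<close> is its gradient.  Cells, faces and their tangent
  spaces all are cut out by equations and inequalities between these affine functions, so no
  geometry of the vertices enters the later arguments.
\<close>

locale bary =
  fixes C :: "(real ^ 'n::finite) set" and D :: "real ^ 'n \<Rightarrow> real ^ 'n" and c0 :: "real ^ 'n \<Rightarrow> real"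
    and lam :: "real ^ 'n \<Rightarrow> real ^ 'n \<Rightarrow> real"
  assumes finite_C: "finite C" and card_C: "card C = CARD('n) + 1" and dim2: "2 \<le> CARD('n)"
    and lam_def: "\<And>v x. lam v x = D v \<bullet> x + c0 v"
    and lam_vertex: "\<And>u v. u \<in> C \<Longrightarrow> v \<in> C \<Longrightarrow> lam v u = (if u = v then 1 else 0)"
    and sum_lam: "\<And>x. (\<Sum>v\<in>C. lam v x) = 1"
    and lam_repr: "\<And>x. (\<Sum>v\<in>C. lam v x *\<^sub>R v) = x"
begin

lemma lam_diff: "D v \<bullet> (x - y) = lam v x - lam v y"
  by (simp add: lam_def inner_diff_right)

lemma lam_combination:
  assumes "sum t C = 1" "v \<in> C" shows "lam v (\<Sum>u\<in>C. t u *\<^sub>R u) = t v"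
proof -
  have "lam v (\<Sum>u\<in>C. t u *\<^sub>R u) = (\<Sum>u\<in>C. t u * (D v \<bullet> u)) + (\<Sum>u\<in>C. t u) * c0 v"
    using assms(1) by (simp add: lam_def inner_sum_right)
  also have "\<dots> = (\<Sum>u\<in>C. t u * lam v u)"
    by (simp add: lam_def algebra_simps sum.distrib sum_distrib_left)
  also have "\<dots> = (\<Sum>u\<in>C. if v = u then t u else 0)"
    using assms(2) by (intro sum.cong) (auto simp: lam_vertex)
  also have "\<dots> = t v" using assms(2) finite_C by (simp add: sum.delta)
  finally show ?thesis .
qed

lemma another_vertex:
  assumes "finite U" "card U \<le> 2" obtains w where "w \<in> C" "w \<notin> U"
proof -
  have "\<not> C \<subseteq> U" using card_mono[OF assms(1), of C] assms(2) card_C dim2 by auto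
  then show ?thesis using that by blast
qed

lemma pol_lam: "pol 1 (lam v)"
  using pol_affine[of "D v" "c0 v"] by (simp add: lam_def[abs_def])

lemma lam_has_derivative: "(lam v has_derivative (\<lambda>y. D v \<bullet> y)) (at x)"
  unfolding lam_def[abs_def] by (auto intro!: derivative_eq_intros)

lemma lam_continuous: "continuous_on S (lam v)"
  by (rule pol_continuous[OF pol_lam])

definition expo :: "nat \<Rightarrow> (real ^ 'n \<Rightarrow> nat) set" where
  "expo s = {\<alpha>. (\<forall>v. v \<notin> C \<longrightarrow> \<alpha> v = 0) \<and> sum \<alpha> C = s}"

definition bmono :: "(real ^ 'n \<Rightarrow> nat) \<Rightarrow> real ^ 'n \<Rightarrow> real" where
  "bmono \<alpha> x = (\<Prod>v\<in>C. lam v x ^ \<alpha> v)"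

lemma finite_expo: "finite (expo s)"
proof (rule finite_subset)
  show "expo s \<subseteq> {\<alpha>. \<forall>v. (v \<in> C \<longrightarrow> \<alpha> v \<in> {..s}) \<and> (v \<notin> C \<longrightarrow> \<alpha> v = 0)}"
    using finite_C by (auto simp: expo_def intro: member_le_sum)
  show "finite {\<alpha> :: real^'n \<Rightarrow> nat. \<forall>v. (v \<in> C \<longrightarrow> \<alpha> v \<in> {..s}) \<and> (v \<notin> C \<longrightarrow> \<alpha> v = 0)}"
    using finite_C by (rule finite_set_of_finite_funs) auto
qed

text \<open>
  As the barycentric coordinates add up to one, a polynomial of degree at most \<open>s\<close> is a combination
  of barycentric monomials of degree exactly \<open>s\<close>.
\<close>

definition homog :: "nat \<Rightarrow> (real ^ 'n \<Rightarrow> real) \<Rightarrow> bool" where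
  "homog s f \<longleftrightarrow> (\<exists>c. \<forall>x. f x = (\<Sum>\<alpha>\<in>expo s. c \<alpha> * bmono \<alpha> x))"

lemma homog_zero: "homog s (\<lambda>x. 0)"
  unfolding homog_def by (intro exI[of _ "\<lambda>\<alpha>. 0"]) simp

lemma homog_add: "homog s f \<Longrightarrow> homog s g \<Longrightarrow> homog s (\<lambda>x. f x + g x)"
proof -
  assume "homog s f" "homog s g"
  then obtain c d where "\<And>x. f x = (\<Sum>\<alpha>\<in>expo s. c \<alpha> * bmono \<alpha> x)"
    "\<And>x. g x = (\<Sum>\<alpha>\<in>expo s. d \<alpha> * bmono \<alpha> x)" unfolding homog_def by blast
  then show ?thesis unfolding homog_def
    by (intro exI[of _ "\<lambda>\<alpha>. c \<alpha> + d \<alpha>"]) (simp add: algebra_simps sum.distrib)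
qed

lemma homog_scale: "homog s f \<Longrightarrow> homog s (\<lambda>x. b * f x)"
proof -
  assume "homog s f"
  then obtain c where "\<And>x. f x = (\<Sum>\<alpha>\<in>expo s. c \<alpha> * bmono \<alpha> x)" unfolding homog_def by blast
  then show ?thesis unfolding homog_def
    by (intro exI[of _ "\<lambda>\<alpha>. b * c \<alpha>"]) (simp add: sum_distrib_left mult_ac)
qed

lemma homog_sum: "(\<And>i. i \<in> I \<Longrightarrow> homog s (f i)) \<Longrightarrow> homog s (\<lambda>x. \<Sum>i\<in>I. f i x)"
  by (induction I rule: infinite_finite_induct) (auto intro: homog_zero homog_add)

lemma homog_bmono: assumes "\<beta> \<in> expo s" shows "homog s (bmono \<beta>)"
  unfolding homog_def
proof (intro exI allI)
  fix x
  have "(\<Sum>\<alpha>\<in>expo s. (if \<alpha> = \<beta> then 1 else 0) * bmono \<alpha> x) = (\<Sum>\<alpha>\<in>expo s. if \<alpha> = \<beta> then bmono \<alpha> x else 0)"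
    by (intro sum.cong) auto
  then show "bmono \<beta> x = (\<Sum>\<alpha>\<in>expo s. (if \<alpha> = \<beta> then 1 else 0) * bmono \<alpha> x)"
    using assms finite_expo[of s] by (simp add: sum.delta)
qed

lemma homog_lam_mult:
  assumes f: "homog s f" and v: "v \<in> C" shows "homog (Suc s) (\<lambda>x. lam v x * f x)"
proof -
  obtain c where c: "\<And>x. f x = (\<Sum>\<alpha>\<in>expo s. c \<alpha> * bmono \<alpha> x)" using f unfolding homog_def by blast
  have e: "lam v x * bmono \<alpha> x = bmono (\<alpha>(v := Suc (\<alpha> v))) x" for \<alpha> x
    using v finite_C by (simp add: bmono_def prod.remove[of C v] mult_ac)
  have "homog (Suc s) (\<lambda>x. \<Sum>\<alpha>\<in>expo s. c \<alpha> * (lam v x * bmono \<alpha> x))"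
    unfolding e
  proof (intro homog_sum homog_scale homog_bmono)
    fix \<alpha> assume "\<alpha> \<in> expo s"
    moreover have "sum (\<alpha>(v := Suc (\<alpha> v))) C = sum \<alpha> C + 1"
      using v finite_C by (simp add: sum.remove[of C v])
    ultimately show "\<alpha>(v := Suc (\<alpha> v)) \<in> expo (Suc s)" using v by (auto simp: expo_def)
  qed
  then show ?thesis by (simp add: c sum_distrib_left mult_ac)
qed

lemma homog_affine_mult:
  assumes "homog s f" shows "homog (Suc s) (\<lambda>x. (a \<bullet> x + b) * f x)"
proof -
  have e: "a \<bullet> x + b = (\<Sum>v\<in>C. (a \<bullet> v + b) * lam v x)" for x
  proof -
    have "a \<bullet> x + b = a \<bullet> (\<Sum>v\<in>C. lam v x *\<^sub>R v) + b * (\<Sum>v\<in>C. lam v x)" by (simp add: lam_repr sum_lam)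
    also have "\<dots> = (\<Sum>v\<in>C. (a \<bullet> v + b) * lam v x)"
      by (simp add: inner_sum_right sum_distrib_left distrib_right sum.distrib mult.commute[of "lam _ x"])
    finally show ?thesis .
  qed
  have "(a \<bullet> x + b) * f x = (\<Sum>v\<in>C. (a \<bullet> v + b) * (lam v x * f x))" for x
    by (subst e) (simp only: sum_distrib_right mult.assoc)
  moreover have "homog (Suc s) (\<lambda>x. \<Sum>v\<in>C. (a \<bullet> v + b) * (lam v x * f x))"
    by (intro homog_sum homog_scale homog_lam_mult assms)
  ultimately show ?thesis by presburger
qed

lemma homog_const: "homog s (\<lambda>x. b)"
proof (induction s)
  case 0
  have "homog 0 (\<lambda>x. b * bmono (\<lambda>v. 0) x)" by (intro homog_scale homog_bmono) (simp add: expo_def)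
  then show ?case by (simp add: bmono_def)
next
  case (Suc s)
  show ?case using homog_affine_mult[OF Suc, of 0 1] by simp
qed

lemma pol_imp_homog: "pol r f \<Longrightarrow> r = int s \<Longrightarrow> homog s f"
proof (induction arbitrary: s rule: pol.induct)
  case (affine r f a c)
  show ?case
  proof (cases s)
    case 0
    then have "f x = 0" for x using pol_negative[OF affine.hyps] affine.prems by simp
    then show ?thesis by (simp add: homog_zero)
  next
    case (Suc s')
    then show ?thesis using homog_affine_mult[OF affine.IH[of s']] affine.prems by simp
  qed
qed (auto intro: homog_zero homog_const homog_add)

text \<open>
  A polynomial in several variables that vanishes for all positive arguments has no nonzero
  coefficient: view it as a polynomial in one variable, whose coefficients are polynomials in the
  others.
\<close>

lemma coefficients_eq_0:
  fixes c :: "('i \<Rightarrow> nat) \<Rightarrow> real"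
  assumes "finite V" "finite B" "\<And>\<alpha> v. \<alpha> \<in> B \<Longrightarrow> v \<notin> V \<Longrightarrow> \<alpha> v = 0"
    and "\<And>t. (\<And>v. v \<in> V \<Longrightarrow> t v > 0) \<Longrightarrow> (\<Sum>\<alpha>\<in>B. c \<alpha> * (\<Prod>v\<in>V. t v ^ \<alpha> v)) = 0"
    and "\<alpha> \<in> B"
  shows "c \<alpha> = 0"
  using assms
proof (induction V arbitrary: B c \<alpha> rule: finite_induct)
  case empty
  have z: "\<beta> = (\<lambda>v. 0)" if "\<beta> \<in> B" for \<beta> by (rule ext) (rule empty.prems(2)[OF that], simp)
  have B: "B = {\<alpha>}"
  proof (intro equalityI subsetI)
    fix \<beta> assume "\<beta> \<in> B"
    then show "\<beta> \<in> {\<alpha>}" using z[of \<beta>] z[OF empty.prems(4)] by blast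
  qed (use empty.prems(4) in blast)
  have "(\<Sum>\<alpha>\<in>B. c \<alpha> * (\<Prod>v\<in>{}. 1 ^ \<alpha> v)) = 0" by (rule empty.prems(3)) simp
  then show ?case unfolding B by simp
next
  case (insert v V)
  define m where "m = Max ((\<lambda>\<beta>. \<beta> v) ` B)"
  have m: "\<beta> v \<le> m" if "\<beta> \<in> B" for \<beta> using that insert.prems(1) by (simp add: m_def)
  let ?B = "\<lambda>j. {\<beta> \<in> B. \<beta> v = j}"
  have z: "(\<Sum>\<beta>\<in>?B j. c \<beta> * (\<Prod>u\<in>V. t u ^ \<beta> u)) = 0" if t: "\<And>u. u \<in> V \<Longrightarrow> t u > 0" for t j
  proof -
    define q where "q = (\<Sum>j\<le>m. monom (\<Sum>\<beta>\<in>?B j. c \<beta> * (\<Prod>u\<in>V. t u ^ \<beta> u)) j)"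
    have "poly q y = 0" if "y > 0" for y
    proof -
      have "0 = (\<Sum>\<beta>\<in>B. c \<beta> * (\<Prod>u\<in>insert v V. (t(v := y)) u ^ \<beta> u))"
        by (rule insert.prems(3)[symmetric]) (use t that in auto)
      also have "\<dots> = (\<Sum>\<beta>\<in>B. y ^ \<beta> v * (c \<beta> * (\<Prod>u\<in>V. t u ^ \<beta> u)))"
      proof (intro sum.cong refl)
        fix \<beta>
        have "(\<Prod>u\<in>V. (t(v := y)) u ^ \<beta> u) = (\<Prod>u\<in>V. t u ^ \<beta> u)" using insert.hyps by (intro prod.cong) auto
        then show "c \<beta> * (\<Prod>u\<in>insert v V. (t(v := y)) u ^ \<beta> u) = y ^ \<beta> v * (c \<beta> * (\<Prod>u\<in>V. t u ^ \<beta> u))"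
          using insert.hyps by (simp add: mult_ac)
      qed
      also have "\<dots> = (\<Sum>j\<le>m. \<Sum>\<beta>\<in>?B j. y ^ \<beta> v * (c \<beta> * (\<Prod>u\<in>V. t u ^ \<beta> u)))"
        using m insert.prems(1) by (intro sum.group[symmetric]) auto
      also have "\<dots> = (\<Sum>j\<le>m. y ^ j * (\<Sum>\<beta>\<in>?B j. c \<beta> * (\<Prod>u\<in>V. t u ^ \<beta> u)))"
        by (intro sum.cong refl) (simp add: sum_distrib_left)
      also have "\<dots> = poly q y" by (simp add: q_def poly_sum poly_monom mult.commute)
      finally show ?thesis by simp
    qed
    then have "{0<..} \<subseteq> {y. poly q y = 0}" by auto
    then have "infinite {y. poly q y = 0}" using infinite_Ioi[of "0::real"] finite_subset by blast
    then have "q = 0" using poly_roots_finite by blast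
    have "coeff q j = (if j \<le> m then (\<Sum>\<beta>\<in>?B j. c \<beta> * (\<Prod>u\<in>V. t u ^ \<beta> u)) else 0)"
      by (simp add: q_def coeff_sum)
    then show ?thesis using \<open>q = 0\<close> m by (cases "j \<le> m") (auto intro!: sum.neutral)
  qed
  have inj: "inj_on (\<lambda>\<beta>. \<beta>(v := 0)) (?B (\<alpha> v))"
    by (rule inj_onI) (auto simp: fun_eq_iff split: if_splits, metis)
  have "c ((\<alpha>(v := 0))(v := \<alpha> v)) = 0"
  proof (rule insert.IH[where B = "(\<lambda>\<beta>. \<beta>(v := 0)) ` ?B (\<alpha> v)" and c = "\<lambda>\<beta>. c (\<beta>(v := \<alpha> v))"])
    fix t :: "'i \<Rightarrow> real" assume t: "\<And>u. u \<in> V \<Longrightarrow> t u > 0"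
    have "(\<Sum>\<beta>\<in>(\<lambda>\<beta>. \<beta>(v := 0)) ` ?B (\<alpha> v). c (\<beta>(v := \<alpha> v)) * (\<Prod>u\<in>V. t u ^ \<beta> u))
        = (\<Sum>\<beta>\<in>?B (\<alpha> v). c (\<beta>(v := \<alpha> v)) * (\<Prod>u\<in>V. t u ^ (\<beta>(v := 0)) u))"
      by (simp add: sum.reindex[OF inj])
    also have "\<dots> = (\<Sum>\<beta>\<in>?B (\<alpha> v). c \<beta> * (\<Prod>u\<in>V. t u ^ \<beta> u))"
      using insert.hyps by (intro sum.cong arg_cong2[where f = "(*)"] prod.cong refl) (auto simp: fun_upd_idem)
    finally show "(\<Sum>\<beta>\<in>(\<lambda>\<beta>. \<beta>(v := 0)) ` ?B (\<alpha> v). c (\<beta>(v := \<alpha> v)) * (\<Prod>u\<in>V. t u ^ \<beta> u)) = 0"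
      using z[OF t] by simp
  next
    show "\<alpha>(v := 0) \<in> (\<lambda>\<beta>. \<beta>(v := 0)) ` ?B (\<alpha> v)" using insert.prems(4) by blast
  qed (use insert.prems in auto)
  then show ?case by simp
qed

text \<open>
  On the face where the coordinates in \<open>U\<close> vanish, the other coordinates take all positive values of sum one.
  By homogeneity the sum of the values does not matter, and they can be treated as independent variables.
\<close>

lemma bernstein_coefficients_eq_0:
  assumes U: "U \<subseteq> C" "U \<noteq> C"
    and 0: "\<And>x. (\<And>u. u \<in> U \<Longrightarrow> lam u x = 0) \<Longrightarrow> (\<Sum>\<alpha>\<in>expo s. c \<alpha> * bmono \<alpha> x) = 0"
    and \<alpha>: "\<alpha> \<in> expo s" "\<And>u. u \<in> U \<Longrightarrow> \<alpha> u = 0"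
  shows "c \<alpha> = 0"
proof (rule coefficients_eq_0[where V = "C - U" and B = "{\<alpha> \<in> expo s. \<forall>u\<in>U. \<alpha> u = 0}"])
  fix t :: "real^'n \<Rightarrow> real" assume t: "\<And>v. v \<in> C - U \<Longrightarrow> 0 < t v"
  define t' where "t' v = (if v \<in> U then 0 else t v)" for v
  define S where "S = sum t' C"
  have "S = sum t (C - U)" unfolding S_def using U finite_C
    by (intro sum.mono_neutral_cong_right) (auto simp: t'_def)
  moreover have "C - U \<noteq> {}" using U by blast
  ultimately have S: "S > 0" using t finite_C sum_pos[of "C - U" t] by auto
  define x where "x = (\<Sum>u\<in>C. (t' u / S) *\<^sub>R u)"
  have lx: "lam v x = t' v / S" if "v \<in> C" for v
    unfolding x_def using that S by (intro lam_combination) (auto simp: S_def sum_divide_distrib[symmetric])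
  have b: "bmono \<beta> x = (\<Prod>v\<in>C. t' v ^ \<beta> v) / S ^ s" if "\<beta> \<in> expo s" for \<beta>
  proof -
    have "bmono \<beta> x = (\<Prod>v\<in>C. (t' v / S) ^ \<beta> v)" by (simp add: bmono_def lx)
    also have "\<dots> = (\<Prod>v\<in>C. t' v ^ \<beta> v) / (\<Prod>v\<in>C. S ^ \<beta> v)" by (simp add: power_divide prod_dividef)
    also have "(\<Prod>v\<in>C. S ^ \<beta> v) = S ^ s" using that by (simp add: expo_def flip: power_sum)
    finally show ?thesis .
  qed
  have "lam u x = 0" if "u \<in> U" for u using lx that U by (auto simp: t'_def)
  then have "0 = (\<Sum>\<beta>\<in>expo s. c \<beta> * bmono \<beta> x) * S ^ s" using 0 by simp
  also have "\<dots> = (\<Sum>\<beta>\<in>expo s. c \<beta> * (\<Prod>v\<in>C. t' v ^ \<beta> v))"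
    using S by (auto simp: sum_distrib_right b intro!: sum.cong)
  also have "\<dots> = (\<Sum>\<beta>\<in>{\<alpha> \<in> expo s. \<forall>u\<in>U. \<alpha> u = 0}. c \<beta> * (\<Prod>v\<in>C - U. t v ^ \<beta> v))"
  proof (rule sum.mono_neutral_cong_right)
    show "\<forall>\<beta>\<in>expo s - {\<alpha> \<in> expo s. \<forall>u\<in>U. \<alpha> u = 0}. c \<beta> * (\<Prod>v\<in>C. t' v ^ \<beta> v) = 0"
    proof
      fix \<beta> assume "\<beta> \<in> expo s - {\<alpha> \<in> expo s. \<forall>u\<in>U. \<alpha> u = 0}"
      then obtain u where "u \<in> U" "\<beta> u \<noteq> 0" by auto
      then have "(\<Prod>v\<in>C. t' v ^ \<beta> v) = 0" using U finite_C
        by (intro prod_zero) (auto simp: t'_def intro!: bexI[of _ u])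
      then show "c \<beta> * (\<Prod>v\<in>C. t' v ^ \<beta> v) = 0" by simp
    qed
    fix \<beta> assume \<beta>: "\<beta> \<in> {\<alpha> \<in> expo s. \<forall>u\<in>U. \<alpha> u = 0}"
    have "(\<Prod>v\<in>C. t' v ^ \<beta> v) = (\<Prod>v\<in>C - U. t v ^ \<beta> v)"
      using \<beta> finite_C by (intro prod.mono_neutral_cong_right) (auto simp: t'_def)
    then show "c \<beta> * (\<Prod>v\<in>C. t' v ^ \<beta> v) = c \<beta> * (\<Prod>v\<in>C - U. t v ^ \<beta> v)" by simp
  qed (auto simp: finite_expo)
  finally show "(\<Sum>\<beta>\<in>{\<alpha> \<in> expo s. \<forall>u\<in>U. \<alpha> u = 0}. c \<beta> * (\<Prod>v\<in>C - U. t v ^ \<beta> v)) = 0" by simp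
next
  show "finite {\<alpha> \<in> expo s. \<forall>u\<in>U. \<alpha> u = 0}" using finite_expo[of s] by simp
qed (use \<alpha> finite_C in \<open>auto simp: expo_def\<close>)

definition coef :: "nat \<Rightarrow> (real ^ 'n \<Rightarrow> real) \<Rightarrow> (real ^ 'n \<Rightarrow> nat) \<Rightarrow> real" where
  "coef s f = (SOME c. \<forall>x. f x = (\<Sum>\<alpha>\<in>expo s. c \<alpha> * bmono \<alpha> x))"

lemma coef_expansion: "pol (int s) f \<Longrightarrow> f x = (\<Sum>\<alpha>\<in>expo s. coef s f \<alpha> * bmono \<alpha> x)"
proof -
  assume "pol (int s) f"
  from pol_imp_homog[OF this refl] have "\<exists>c. \<forall>x. f x = (\<Sum>\<alpha>\<in>expo s. c \<alpha> * bmono \<alpha> x)"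
    by (simp add: homog_def)
  then have "\<forall>x. f x = (\<Sum>\<alpha>\<in>expo s. coef s f \<alpha> * bmono \<alpha> x)" unfolding coef_def by (rule someI_ex)
  then show ?thesis by blast
qed

lemma coef_eq_0_on_face:
  assumes f: "pol (int s) f" and U: "U \<subseteq> C" "U \<noteq> C"
    and "\<And>x. (\<And>u. u \<in> U \<Longrightarrow> lam u x = 0) \<Longrightarrow> f x = 0"
    and "\<alpha> \<in> expo s" "\<And>u. u \<in> U \<Longrightarrow> \<alpha> u = 0"
  shows "coef s f \<alpha> = 0"
proof (rule bernstein_coefficients_eq_0[OF U])
  fix x assume "\<And>u. u \<in> U \<Longrightarrow> lam u x = 0"
  then show "(\<Sum>\<alpha>\<in>expo s. coef s f \<alpha> * bmono \<alpha> x) = 0"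
    using coef_expansion[OF f, of x] assms(4) by metis
qed (use assms in auto)

lemma coef_linear:
  assumes f: "pol (int s) f" and g: "pol (int s) g" and \<alpha>: "\<alpha> \<in> expo s"
  shows "coef s (\<lambda>x. a * f x + b * g x) \<alpha> = a * coef s f \<alpha> + b * coef s g \<alpha>"
proof -
  have fg: "pol (int s) (\<lambda>x. a * f x + b * g x)" by (rule pol.add[OF pol_scale[OF f] pol_scale[OF g]])
  have "(\<lambda>\<alpha>. coef s (\<lambda>x. a * f x + b * g x) \<alpha> - (a * coef s f \<alpha> + b * coef s g \<alpha>)) \<alpha> = 0"
  proof (rule bernstein_coefficients_eq_0[of "{}"])
    show "{} \<noteq> C" using card_C by auto
    fix x
    have "(\<Sum>\<alpha>\<in>expo s. (coef s (\<lambda>x. a * f x + b * g x) \<alpha> - (a * coef s f \<alpha> + b * coef s g \<alpha>)) * bmono \<alpha> x)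
       = (\<Sum>\<alpha>\<in>expo s. coef s (\<lambda>x. a * f x + b * g x) \<alpha> * bmono \<alpha> x)
         - (a * (\<Sum>\<alpha>\<in>expo s. coef s f \<alpha> * bmono \<alpha> x) + b * (\<Sum>\<alpha>\<in>expo s. coef s g \<alpha> * bmono \<alpha> x))"
      by (simp add: sum_distrib_left sum.distrib sum_subtractf algebra_simps)
    then show "(\<Sum>\<alpha>\<in>expo s. (coef s (\<lambda>x. a * f x + b * g x) \<alpha> - (a * coef s f \<alpha> + b * coef s g \<alpha>)) * bmono \<alpha> x) = 0"
      using coef_expansion[OF fg, of x] coef_expansion[OF f, of x] coef_expansion[OF g, of x] by simp
  qed (use \<alpha> in auto)
  then show ?thesis by simp
qed

lemma pol_bmono: "\<alpha> \<in> expo s \<Longrightarrow> pol (int s) (bmono \<alpha>)"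
proof -
  assume "\<alpha> \<in> expo s"
  then have "int s = (\<Sum>v\<in>C. int (\<alpha> v) * 1)" by (auto simp: expo_def)
  moreover have "pol (\<Sum>v\<in>C. int (\<alpha> v) * 1) (\<lambda>x. \<Prod>v\<in>C. lam v x ^ \<alpha> v)"
    by (rule pol_prod) (rule pol_power[OF pol_lam])
  ultimately show ?thesis by (simp only: bmono_def[abs_def])
qed

text \<open>
  For fixed \<open>\<alpha>\<close> the coefficient is a linear functional of the polynomial, and it preserves the
  identities that define alternating multilinear maps.
\<close>

lemma alternating_coef:
  assumes p: "p \<in> poly_forms (int s) k" and \<alpha>: "\<alpha> \<in> expo s"
  shows "alternating k (\<lambda>vs. coef s (\<lambda>x. p x vs) \<alpha>)"
  unfolding alternating_def
proof (intro conjI allI impI)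
  note P = poly_forms_pol[OF p]
  have z: "coef s (\<lambda>x. p x vs) \<alpha> = 0" if "\<And>x. p x vs = 0" for vs
    using coef_linear[OF P[of vs] P[of vs] \<alpha>, of 0 0] that by simp
  show "coef s (\<lambda>x. p x vs) \<alpha> = 0" if "length vs \<noteq> k" for vs
    using that alternating_length[OF poly_forms_alternating[OF p]] by (intro z)
  show "coef s (\<lambda>x. p x vs) \<alpha> = 0" if "length vs = k \<and> \<not> distinct vs" for vs
    using that alternating_repeat[OF poly_forms_alternating[OF p]] by (intro z) auto
  fix vs :: "(real^'n) list" and i assume i: "length vs = k \<and> i < k"
  have lin: "linear (\<lambda>v. p x (vs[i := v]))" for x
    using alternating_linear[OF poly_forms_alternating[OF p]] i by blast
  show "linear (\<lambda>v. coef s (\<lambda>x. p x (vs[i := v])) \<alpha>)"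
  proof (rule linearI)
    fix v w
    show "coef s (\<lambda>x. p x (vs[i := v + w])) \<alpha> = coef s (\<lambda>x. p x (vs[i := v])) \<alpha> + coef s (\<lambda>x. p x (vs[i := w])) \<alpha>"
      using coef_linear[OF P P \<alpha>, of 1 "vs[i := v]" 1 "vs[i := w]"] by (simp add: linear_add[OF lin])
  next
    fix b v
    show "coef s (\<lambda>x. p x (vs[i := b *\<^sub>R v])) \<alpha> = b *\<^sub>R coef s (\<lambda>x. p x (vs[i := v])) \<alpha>"
      using coef_linear[OF P P \<alpha>, of b "vs[i := v]" 0 "vs[i := v]"] by (simp add: linear_scale[OF lin])
  qed
qed

text \<open>
  Homogeneous expansions decouple the traces: the monomials with exponent \<open>\<alpha>\<close> are seen exactly by the
  facets opposite to the vertices outside the support of \<open>\<alpha>\<close>.  Positive degree makes the support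
  nonempty, so these facets have independent normals and the coefficients, which are constant
  forms, can be extended from their hyperplanes.
\<close>

lemma extend_traces:
  assumes s: "1 \<le> s" and p: "\<And>v. v \<in> C \<Longrightarrow> p v \<in> poly_forms (int s) k"
    and compat: "\<And>u v x vs. u \<in> C \<Longrightarrow> v \<in> C \<Longrightarrow> lam u x = 0 \<Longrightarrow> lam v x = 0
      \<Longrightarrow> (\<And>y. y \<in> set vs \<Longrightarrow> D u \<bullet> y = 0 \<and> D v \<bullet> y = 0) \<Longrightarrow> p u x vs = p v x vs"
  obtains \<Phi> where "\<Phi> \<in> poly_forms (int s) k"
    "\<And>v x vs. v \<in> C \<Longrightarrow> lam v x = 0 \<Longrightarrow> (\<And>y. y \<in> set vs \<Longrightarrow> D v \<bullet> y = 0) \<Longrightarrow> \<Phi> x vs = p v x vs"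
proof -
  let ?w = "\<lambda>\<alpha> v vs. coef s (\<lambda>x. p v x vs) \<alpha>"
  have "\<exists>W. alternating k W \<and> (\<forall>v\<in>C. \<alpha> v = 0 \<longrightarrow> (\<forall>vs. (\<forall>y\<in>set vs. D v \<bullet> y = 0) \<longrightarrow> W vs = ?w \<alpha> v vs))"
    if \<alpha>: "\<alpha> \<in> expo s" for \<alpha>
  proof -
    have "sum \<alpha> C \<noteq> 0" using \<alpha> s by (simp add: expo_def)
    then obtain v0 where v0: "v0 \<in> C" "\<alpha> v0 \<noteq> 0" by (meson sum.neutral)
    have "\<exists>W. alternating k W \<and> (\<forall>u\<in>{v\<in>C. \<alpha> v = 0}. \<forall>vs. (\<forall>y\<in>set vs. D u \<bullet> y = 0) \<longrightarrow> W vs = ?w \<alpha> u vs)"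
    proof (rule extend_from_hyperplanes[where N = "\<lambda>v. v - v0"])
      show "linear (\<lambda>y. D u \<bullet> y)" for u by (simp add: bounded_linear.linear bounded_linear_inner_right)
      show "D u \<bullet> (v - v0) = (if u = v then 1 else 0)" if "u \<in> {v\<in>C. \<alpha> v = 0}" "v \<in> {v\<in>C. \<alpha> v = 0}" for u v
        using that v0 by (auto simp: lam_diff lam_vertex)
      show "alternating k (?w \<alpha> u)" if "u \<in> {v\<in>C. \<alpha> v = 0}" for u
        using that by (intro alternating_coef p \<alpha>) auto
      fix u v vs assume uv: "u \<in> {v\<in>C. \<alpha> v = 0}" "v \<in> {v\<in>C. \<alpha> v = 0}"
        and vs: "\<And>y. y \<in> set vs \<Longrightarrow> D u \<bullet> y = 0 \<and> D v \<bullet> y = 0"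
      have P: "pol (int s) (\<lambda>x. p u x vs)" "pol (int s) (\<lambda>x. p v x vs)"
        using uv p by (auto intro: poly_forms_pol)
      have card2: "finite {u, v}" "card {u, v} \<le> 2" by (auto simp: card_insert_if)
      obtain w where "w \<in> C" "w \<notin> {u, v}" using another_vertex[OF card2] by blast
      then have "coef s (\<lambda>x. 1 * p u x vs + (-1) * p v x vs) \<alpha> = 0"
        using uv vs compat
        by (intro coef_eq_0_on_face[of _ _ "{u, v}"] \<alpha> pol.add[OF pol_scale[OF P(1)] pol_scale[OF P(2)]]) auto
      then show "?w \<alpha> u vs = ?w \<alpha> v vs" by (simp only: coef_linear[OF P \<alpha>])
    qed (use finite_C in auto)
    then show ?thesis by auto
  qed
  then obtain W where W: "\<And>\<alpha>. \<alpha> \<in> expo s \<Longrightarrow> alternating k (W \<alpha>)"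
    "\<And>\<alpha> v vs. \<alpha> \<in> expo s \<Longrightarrow> v \<in> C \<Longrightarrow> \<alpha> v = 0 \<Longrightarrow> (\<And>y. y \<in> set vs \<Longrightarrow> D v \<bullet> y = 0) \<Longrightarrow> W \<alpha> vs = ?w \<alpha> v vs"
    by metis
  define \<Phi> where "\<Phi> x vs = (\<Sum>\<alpha>\<in>expo s. bmono \<alpha> x * W \<alpha> vs)" for x vs
  have "\<Phi> \<in> poly_forms (int s) k"
  proof (rule poly_formsI)
    show "alternating k (\<Phi> x)" for x unfolding \<Phi>_def by (intro alternating_sum alternating_scale W)
    have "pol (int s) (\<lambda>x. \<Sum>\<alpha>\<in>expo s. W \<alpha> vs * bmono \<alpha> x)" for vs
      by (intro pol_sum pol_scale pol_bmono)
    then show "pol (int s) (\<lambda>x. \<Phi> x vs)" for vs by (simp add: \<Phi>_def mult.commute)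
  qed
  moreover have "\<Phi> x vs = p v x vs" if v: "v \<in> C" "lam v x = 0" "\<And>y. y \<in> set vs \<Longrightarrow> D v \<bullet> y = 0" for v x vs
  proof -
    have "bmono \<alpha> x * W \<alpha> vs = coef s (\<lambda>x. p v x vs) \<alpha> * bmono \<alpha> x" if "\<alpha> \<in> expo s" for \<alpha>
    proof (cases "\<alpha> v = 0")
      case True then show ?thesis using W(2)[OF that v(1) True v(3)] by simp
    next
      case False
      then have "bmono \<alpha> x = 0" unfolding bmono_def using v finite_C by (intro prod_zero) auto
      then show ?thesis by simp
    qed
    then show ?thesis unfolding \<Phi>_def coef_expansion[OF poly_forms_pol[OF p[OF v(1)], of vs], of x]
      by (intro sum.cong) auto
  qed
  ultimately show ?thesis using that by blast
qed

end


section \<open>Decomposition of piecewise polynomial forms\<close>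

context bary
begin

text \<open>
  A piecewise polynomial form is a family of polynomial forms indexed by the vertices, \<open>p v\<close> living on
  the cell where \<open>lam v\<close> is the smallest barycentric coordinate.  Since polynomials are determined
  by their restriction to a cell, matching conditions on the interfaces can be imposed on whole
  hyperplanes.  A tangential condition concerns only vectors in the direction of the hyperplane, a full one
  all coefficients of the form.
\<close>

definition fam :: "int \<Rightarrow> nat \<Rightarrow> (real ^ 'n \<Rightarrow> 'n rform) \<Rightarrow> bool" where
  "fam r k p \<longleftrightarrow> (\<forall>v\<in>C. p v \<in> poly_forms r k)"

definition tan_cont :: "(real ^ 'n \<Rightarrow> 'n rform) \<Rightarrow> bool" where
  "tan_cont p \<longleftrightarrow> (\<forall>u\<in>C. \<forall>v\<in>C. \<forall>x vs. lam u x = lam v x \<longrightarrow>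
     (\<forall>y\<in>set vs. D u \<bullet> y = D v \<bullet> y) \<longrightarrow> p u x vs = p v x vs)"

definition full_cont :: "(real ^ 'n \<Rightarrow> 'n rform) \<Rightarrow> bool" where
  "full_cont p \<longleftrightarrow> (\<forall>u\<in>C. \<forall>v\<in>C. \<forall>x. lam u x = lam v x \<longrightarrow> p u x = p v x)"

definition tan_zero :: "(real ^ 'n \<Rightarrow> 'n rform) \<Rightarrow> bool" where
  "tan_zero p \<longleftrightarrow> (\<forall>v\<in>C. \<forall>x vs. lam v x = 0 \<longrightarrow> (\<forall>y\<in>set vs. D v \<bullet> y = 0) \<longrightarrow> p v x vs = 0)"

definition full_zero :: "(real ^ 'n \<Rightarrow> 'n rform) \<Rightarrow> bool" where
  "full_zero p \<longleftrightarrow> (\<forall>v\<in>C. \<forall>x. lam v x = 0 \<longrightarrow> p v x = (\<lambda>vs. 0))"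

lemma tan_contD: "tan_cont p \<Longrightarrow> u \<in> C \<Longrightarrow> v \<in> C \<Longrightarrow> lam u x = lam v x \<Longrightarrow>
    (\<And>y. y \<in> set vs \<Longrightarrow> D u \<bullet> y = D v \<bullet> y) \<Longrightarrow> p u x vs = p v x vs"
  unfolding tan_cont_def by blast

lemma tan_zeroD: "tan_zero p \<Longrightarrow> v \<in> C \<Longrightarrow> lam v x = 0 \<Longrightarrow>
    (\<And>y. y \<in> set vs \<Longrightarrow> D v \<bullet> y = 0) \<Longrightarrow> p v x vs = 0"
  unfolding tan_zero_def by blast

lemma famD: "fam r k p \<Longrightarrow> v \<in> C \<Longrightarrow> p v \<in> poly_forms r k"
  by (simp add: fam_def)

lemma full_cont_imp_tan_cont: "full_cont p \<Longrightarrow> tan_cont p"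
  unfolding full_cont_def tan_cont_def by metis

lemma full_zero_imp_tan_zero: "full_zero p \<Longrightarrow> tan_zero p"
  by (auto simp: full_zero_def tan_zero_def)

lemma full_cont_add: "full_cont p \<Longrightarrow> full_cont q \<Longrightarrow> full_cont (\<lambda>v x vs. p v x vs + q v x vs)"
  unfolding full_cont_def by metis

lemma full_zero_add: "full_zero p \<Longrightarrow> full_zero q \<Longrightarrow> full_zero (\<lambda>v x vs. p v x vs + q v x vs)"
  by (simp add: full_zero_def fun_eq_iff)

lemma linear_D: "linear (\<lambda>y. D v \<bullet> y)"
  by (simp add: bounded_linear.linear bounded_linear_inner_right)

lemma linear_D_diff: "linear (\<lambda>y. D u \<bullet> y - D v \<bullet> y)"
  by (intro linear_compose_sub linear_D)

lemma exists_unit_normal: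
  assumes "v \<in> C" obtains w where "w \<in> C" "w \<noteq> v" "D v \<bullet> (v - w) = 1"
proof -
  obtain w where "w \<in> C" "w \<notin> {v}" using another_vertex[of "{v}"] by auto
  then show ?thesis using that assms by (auto simp: lam_diff lam_vertex)
qed

lemma alternating_first_diff:
  assumes "alternating (Suc k) w" "length vs = k"
  shows "w ((a - b) # vs) = w (a # vs) - w (b # vs)"
  using linear_diff[OF alternating_linear[OF assms(1), of "a # vs" 0]] assms(2) by simp

text \<open>
  For two contraction vectors \<open>N, N'\<close> on which \<open>a\<close> takes the same value, \<open>\<iota>\<^sub>N w\<close> and \<open>\<iota>\<^sub>N' w\<close> agree on the
  kernel of \<open>a\<close> if \<open>w\<close> vanishes there, since \<open>N - N'\<close> lies in the kernel.
\<close>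

lemma contract_indep:
  assumes w: "alternating (Suc k) w" and a: "linear a" "a N = a N'"
    and 0: "\<And>vs. (\<And>y. y \<in> set vs \<Longrightarrow> a y = 0) \<Longrightarrow> w vs = 0"
    and vs: "\<And>y. y \<in> set vs \<Longrightarrow> a y = 0"
  shows "w (N # vs) = w (N' # vs)"
proof (cases "length vs = k")
  case True
  have "w ((N - N') # vs) = 0" using a vs by (intro 0) (auto simp: linear_diff)
  then show ?thesis using alternating_first_diff[OF w True] by simp
qed (use w in \<open>auto simp: alternating_length\<close>)

definition centre :: "real ^ 'n" where "centre = (\<Sum>v\<in>C. (1 / card C) *\<^sub>R v)"

lemma lam_centre: "v \<in> C \<Longrightarrow> lam v centre = 1 / card C"
  unfolding centre_def using card_C by (intro lam_combination) auto

text \<open>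
  Piecewise constants: subtracting the value on one cell \<open>v\<^sub>0\<close>, the form on each other cell \<open>v\<close>
  vanishes tangentially to their interface, so it is a multiple of \<open>D v - D v\<^sub>0\<close>.  These \<open>n\<close> covectors are
  independent, and the cofactors, given on the interfaces, have a common extension \<open>\<beta>\<close>.
\<close>

lemma piecewise_constant_decomposition:
  assumes w: "\<And>v. v \<in> C \<Longrightarrow> alternating (Suc k) (w v)"
    and tc: "\<And>u v vs. u \<in> C \<Longrightarrow> v \<in> C \<Longrightarrow> (\<And>y. y \<in> set vs \<Longrightarrow> D u \<bullet> y = D v \<bullet> y) \<Longrightarrow> w u vs = w v vs"
  obtains c \<beta> where "alternating (Suc k) c" "alternating k \<beta>"
    "\<And>v vs. v \<in> C \<Longrightarrow> w v vs = c vs + wedge k (\<lambda>y. D v \<bullet> y) \<beta> vs"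
proof -
  obtain v0 where v0: "v0 \<in> C" using another_vertex[of "{}"] by auto
  let ?l = "\<lambda>v y. D v \<bullet> y - D v0 \<bullet> y" and ?N = "\<lambda>v. v - centre" and ?e = "\<lambda>v vs. w v vs - w v0 vs"
  have dual: "?l u (?N v) = (if u = v then 1 else 0)" if "u \<in> C - {v0}" "v \<in> C - {v0}" for u v
    using that v0 by (auto simp: lam_diff lam_vertex lam_centre)
  have alt: "alternating (Suc k) (?e v)" if "v \<in> C" for v using that v0 by (intro alternating_diff w)
  have van: "?e v vs = 0" if "v \<in> C" "\<And>y. y \<in> set vs \<Longrightarrow> ?l v y = 0" for v vs
    using tc[OF that(1) v0, of vs] that(2) by simp
  have "\<exists>\<beta>. alternating k \<beta> \<and> (\<forall>u\<in>C - {v0}. \<forall>vs. (\<forall>y\<in>set vs. ?l u y = 0) \<longrightarrow> \<beta> vs = ?e u (?N u # vs))"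
  proof (rule extend_from_hyperplanes[where N = ?N])
    show "finite (C - {v0})" using finite_C by simp
    show "linear (?l u)" for u by (rule linear_D_diff)
    show "?l u (?N v) = (if u = v then 1 else 0)" if "u \<in> C - {v0}" "v \<in> C - {v0}" for u v
      by (rule dual[OF that])
    show "alternating k (\<lambda>vs. ?e u (?N u # vs))" if "u \<in> C - {v0}" for u
      using alt that by (intro alternating_contract[of k "?e u"]) auto
    fix u v vs assume uv: "u \<in> C - {v0}" "v \<in> C - {v0}"
      and vs: "\<And>y. y \<in> set vs \<Longrightarrow> ?l u y = 0 \<and> ?l v y = 0"
    show "?e u (?N u # vs) = ?e v (?N v # vs)"
    proof (cases "u = v")
      case False
      \<comment> \<open>a common contraction vector, transversal to both interfaces with \<open>v\<^sub>0\<close> and tangential to the one of \<open>u\<close> and \<open>v\<close>\<close>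
      let ?M = "?N u + ?N v"
      have l: "?l u (?N u) = 1" "?l u (?N v) = 0" "?l v (?N u) = 0" "?l v (?N v) = 1"
        using dual uv False by auto
      have lu: "?l u ?M = ?l u (?N u) + ?l u (?N v)" "?l v ?M = ?l v (?N u) + ?l v (?N v)"
        by (simp_all only: inner_add_right add_diff_add)
      have "?e u (?N u # vs) = ?e u (?M # vs)"
        using uv vs l lu by (intro contract_indep[OF alt linear_D_diff[of u v0]] van) auto
      moreover have "?e v (?N v # vs) = ?e v (?M # vs)"
        using uv vs l lu by (intro contract_indep[OF alt linear_D_diff[of v v0]] van) auto
      moreover have "w u (?M # vs) = w v (?M # vs)"
      proof (rule tc)
        fix y assume "y \<in> set (?M # vs)"
        then have "?l u y = ?l v y" using vs l lu by auto
        then show "D u \<bullet> y = D v \<bullet> y" by simp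
      qed (use uv in auto)
      ultimately show ?thesis by simp
    qed simp
  qed
  then obtain \<beta> where \<beta>: "alternating k \<beta>"
    "\<And>u vs. u \<in> C - {v0} \<Longrightarrow> (\<And>y. y \<in> set vs \<Longrightarrow> ?l u y = 0) \<Longrightarrow> \<beta> vs = ?e u (?N u # vs)" by blast
  show ?thesis
  proof (rule that[of "\<lambda>vs. w v0 vs - wedge k (\<lambda>y. D v0 \<bullet> y) \<beta> vs" \<beta>])
    show "alternating (Suc k) (\<lambda>vs. w v0 vs - wedge k (\<lambda>y. D v0 \<bullet> y) \<beta> vs)"
      by (intro alternating_diff alternating_wedge linear_D \<beta> w v0)
    fix v vs assume v: "v \<in> C"
    show "w v vs = w v0 vs - wedge k (\<lambda>y. D v0 \<bullet> y) \<beta> vs + wedge k (\<lambda>y. D v \<bullet> y) \<beta> vs"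
    proof (cases "v = v0")
      case False
      then have v': "v \<in> C - {v0}" using v by simp
      have N1: "?l v (?N v) = 1" using dual[OF v' v'] by simp
      have 1: "?e v vs = wedge k (?l v) (\<lambda>ws. ?e v (?N v # ws)) vs"
        by (rule eq_wedge_contract_if_vanishes_on_kernel[OF linear_D_diff N1 alt[OF v] van[OF v]])
      have "wedge k (?l v) (\<lambda>ws. ?e v (?N v # ws)) vs - wedge k (?l v) \<beta> vs
          = wedge k (?l v) (\<lambda>ws. ?e v (?N v # ws) - \<beta> ws) vs"
        by (rule wedge_diff[symmetric])
      also have "\<dots> = 0"
      proof (rule wedge_eq_0_if_vanishes_on_kernel[OF linear_D_diff N1])
        show "alternating k (\<lambda>ws. ?e v (?N v # ws) - \<beta> ws)"
          using alternating_diff[OF alternating_contract[OF alt[OF v]] \<beta>(1)] .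
        show "?e v (?N v # ws) - \<beta> ws = 0" if "\<And>y. y \<in> set ws \<Longrightarrow> ?l v y = 0" for ws
          using \<beta>(2)[OF v' that] by simp
      qed
      finally have "?e v vs = wedge k (?l v) \<beta> vs" using 1 by simp
      then show ?thesis by (simp add: wedge_diff_left)
    qed simp
  qed (rule \<beta>)
qed

lemma ext_d_lam_power:
  assumes "\<gamma> \<in> poly_forms r k"
  shows "ext_d k (\<lambda>x vs. lam v x ^ Suc m * \<gamma> x vs) x vs =
    real (Suc m) * lam v x ^ m * wedge k (\<lambda>y. D v \<bullet> y) (\<gamma> x) vs + lam v x ^ Suc m * ext_d k \<gamma> x vs"
proof -
  have "((\<lambda>x. lam v x ^ Suc m) has_derivative (\<lambda>y. (real (Suc m) * lam v x ^ m) * (D v \<bullet> y))) (at x)"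
    by (rule has_derivative_eq_rhs[OF has_derivative_power[OF lam_has_derivative]]) (simp add: fun_eq_iff mult_ac)
  from ext_d_mult[OF assms this] show ?thesis by (simp only: wedge_scale_left)
qed

lemma poly_forms_lam_power: "\<gamma> \<in> poly_forms r k \<Longrightarrow> (\<lambda>x vs. lam v x ^ m * \<gamma> x vs) \<in> poly_forms (int m + r) k"
  using poly_forms_mult[OF pol_power[OF pol_lam, of m v], of \<gamma> r k] by simp

text \<open>
  If \<open>lam u - lam v\<close> vanishes at \<open>x\<close>, then \<open>x\<close> can be moved within that hyperplane to make \<open>lam u\<close> nonzero;
  hence factors \<open>lam v\<close> can be cancelled in matching conditions.
\<close>

lemma cancel_on_interface:
  assumes f: "pol r f" and uv: "u \<in> C" "v \<in> C" "u \<noteq> v"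
    and 0: "\<And>x. lam u x = lam v x \<Longrightarrow> lam v x * f x = 0" and x: "lam u x = lam v x"
  shows "f x = 0"
proof (rule pol_eq_0_on_affine[OF f, of "{x. lam u x = lam v x}" "{x. lam v x \<noteq> 0}"])
  have "{x. lam u x = lam v x} = {x. (D u - D v) \<bullet> x = c0 v - c0 u}"
    by (auto simp: lam_def inner_diff_left)
  then show "affine {x. lam u x = lam v x}" using affine_hyperplane by metis
  have "{x. lam v x \<noteq> 0} = lam v -` (-{0})" by auto
  then show "open {x. lam v x \<noteq> 0}" using lam_continuous[of UNIV v]
    by (simp add: continuous_on_open_vimage open_Compl)
  show "centre \<in> {x. lam u x = lam v x}" "centre \<in> {x. lam v x \<noteq> 0}"
    using uv card_C by (auto simp: lam_centre)
qed (use 0 x in auto)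

text \<open>
  One step of the descent: \<open>p\<close> is, up to \<open>lam\<^sup>m\<close>, the differential of \<open>lam\<^sup>m\<^sup>+\<^sup>1 \<gamma> / (m + 1)\<close> plus a form
  with one more factor \<open>lam\<close> and one degree less.  On the facet \<open>lam v = 0\<close> the form equals
  \<open>D v \<and> \<gamma>\<^sub>v\<close>, and tangential continuity makes the \<open>\<gamma>\<^sub>v\<close> compatible along the codimension-two faces.
\<close>

lemma descent_step:
  assumes s: "1 \<le> s" and p: "fam (int s) (Suc k) p" and tc: "tan_cont p" and tz: "tan_zero p"
  obtains \<gamma> q where "\<gamma> \<in> poly_forms (int s) k" "fam (int s - 1) (Suc k) q" "tan_cont q"
    "\<And>v x vs. v \<in> C \<Longrightarrow> lam v x ^ m * p v x vs =
       ext_d k (\<lambda>x vs. lam v x ^ Suc m * (1 / real (Suc m) * \<gamma> x vs)) x vs + lam v x ^ Suc m * q v x vs"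
proof -
  obtain w where w: "\<And>v. v \<in> C \<Longrightarrow> w v \<in> C \<and> w v \<noteq> v \<and> D v \<bullet> (v - w v) = 1"
  proof -
    have "\<forall>v. \<exists>w. v \<in> C \<longrightarrow> w \<in> C \<and> w \<noteq> v \<and> D v \<bullet> (v - w) = 1" by (meson exists_unit_normal)
    then show ?thesis using that by metis
  qed
  define N where "N v = v - w v" for v
  have N: "D v \<bullet> N v = 1" if "v \<in> C" for v using w[OF that] by (simp add: N_def)
  have altp: "alternating (Suc k) (p v x)" if "v \<in> C" for v x
    using famD[OF p that] by (rule poly_forms_alternating)
  obtain \<gamma> where \<gamma>: "\<gamma> \<in> poly_forms (int s) k"
    "\<And>v x vs. v \<in> C \<Longrightarrow> lam v x = 0 \<Longrightarrow> (\<And>y. y \<in> set vs \<Longrightarrow> D v \<bullet> y = 0) \<Longrightarrow> \<gamma> x vs = p v x (N v # vs)"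
  proof (rule extend_traces[OF s, of "\<lambda>v x vs. p v x (N v # vs)" k])
    show "(\<lambda>x vs. p v x (N v # vs)) \<in> poly_forms (int s) k" if "v \<in> C" for v
      by (rule poly_forms_contract[OF famD[OF p that]])
    fix u v x vs assume uv: "u \<in> C" "v \<in> C" "lam u x = 0" "lam v x = 0"
      and vs: "\<And>y. y \<in> set vs \<Longrightarrow> D u \<bullet> y = 0 \<and> D v \<bullet> y = 0"
    show "p u x (N u # vs) = p v x (N v # vs)"
    proof (cases "u = v")
      case False
      have card2: "finite {u, v}" "card {u, v} \<le> 2" by (auto simp: card_insert_if)
      obtain t where t: "t \<in> C" "t \<notin> {u, v}" using another_vertex[OF card2] by blast
      define M where "M = (u - t) + (v - t)"
      have M: "D u \<bullet> M = 1" "D v \<bullet> M = 1"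
        unfolding M_def inner_add_right lam_diff using t uv False by (auto simp: lam_vertex)
      have "p u x (N u # vs) = p u x (M # vs)"
        using uv vs N M by (intro contract_indep[OF altp linear_D[of u]] tan_zeroD[OF tz]) auto
      moreover have "p v x (N v # vs) = p v x (M # vs)"
        using uv vs N M by (intro contract_indep[OF altp linear_D[of v]] tan_zeroD[OF tz]) auto
      moreover have "p u x (M # vs) = p v x (M # vs)"
        using uv vs M by (intro tan_contD[OF tc]) auto
      ultimately show ?thesis by simp
    qed simp
  qed blast
  let ?W = "\<lambda>v. wedge k (\<lambda>y. D v \<bullet> y)"
  define e where "e v x vs = p v x vs - ?W v (\<gamma> x) vs" for v x vs
  have e: "e v \<in> poly_forms (int s) (Suc k)" if "v \<in> C" for v
    unfolding e_def[abs_def] by (intro poly_forms_diff poly_forms_wedge famD[OF p] that linear_D \<gamma>)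
  have "\<exists>q. q \<in> poly_forms (int s - 1) (Suc k) \<and> (\<forall>x vs. e v x vs = lam v x * q x vs)" if v: "v \<in> C" for v
  proof -
    have "e v x vs = 0" if "D v \<bullet> x + c0 v = 0" for x vs
    proof -
      have l: "lam v x = 0" using that by (simp add: lam_def)
      have 1: "p v x vs = ?W v (\<lambda>ws. p v x (N v # ws)) vs"
        by (rule eq_wedge_contract_if_vanishes_on_kernel[OF linear_D N[OF v] altp[OF v] tan_zeroD[OF tz v l]])
      have "?W v (\<lambda>ws. p v x (N v # ws)) vs - ?W v (\<gamma> x) vs = ?W v (\<lambda>ws. p v x (N v # ws) - \<gamma> x ws) vs"
        by (rule wedge_diff[symmetric])
      also have "\<dots> = 0"
      proof (rule wedge_eq_0_if_vanishes_on_kernel[OF linear_D N[OF v]])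
        show "alternating k (\<lambda>ws. p v x (N v # ws) - \<gamma> x ws)"
          using alternating_diff[OF alternating_contract[OF altp[OF v]] poly_forms_alternating[OF \<gamma>(1)]] .
        show "p v x (N v # ws) - \<gamma> x ws = 0" if "\<And>y. y \<in> set ws \<Longrightarrow> D v \<bullet> y = 0" for ws
          using \<gamma>(2)[OF v l that] by simp
      qed
      finally show ?thesis using 1 by (simp add: e_def)
    qed
    note z = this
    obtain q where "q \<in> poly_forms (int s - 1) (Suc k)" "\<And>x vs. e v x vs = (D v \<bullet> x + c0 v) * q x vs"
      using poly_forms_divide[OF e[OF v] N[OF v], of "c0 v"] z by blast
    then show ?thesis by (auto simp: lam_def)
  qed
  then obtain q' where q': "\<And>v. v \<in> C \<Longrightarrow> q' v \<in> poly_forms (int s - 1) (Suc k)"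
    "\<And>v x vs. v \<in> C \<Longrightarrow> e v x vs = lam v x * q' v x vs" by metis
  define q where "q v x vs = q' v x vs - 1 / real (Suc m) * ext_d k \<gamma> x vs" for v x vs
  have q: "fam (int s - 1) (Suc k) q"
    unfolding fam_def q_def[abs_def]
    by (intro ballI poly_forms_diff poly_forms_scale poly_forms_ext_d \<gamma> q')
  have "tan_cont q"
    unfolding tan_cont_def
  proof (intro ballI allI impI)
    fix u v x vs assume uv: "u \<in> C" "v \<in> C" "lam u x = lam v x" and vs: "\<forall>y\<in>set vs. D u \<bullet> y = D v \<bullet> y"
    show "q u x vs = q v x vs"
    proof (cases "u = v")
      case False
      have "q' u x vs - q' v x vs = 0"
      proof (rule cancel_on_interface[OF pol_diff[OF poly_forms_pol[OF q'(1)[OF uv(1)]] poly_forms_pol[OF q'(1)[OF uv(2)]]] uv(1,2) False _ uv(3)])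
        fix x assume x: "lam u x = lam v x"
        have "p u x vs = p v x vs" using tan_contD[OF tc uv(1,2) x] vs by blast
        moreover have "?W u (\<gamma> x) vs = ?W v (\<gamma> x) vs"
          unfolding wedge_def using vs by (intro alt_sum_cong) auto
        ultimately have "e u x vs = e v x vs" by (simp add: e_def)
        then show "lam v x * (q' u x vs - q' v x vs) = 0" using q'(2) uv x by (simp add: algebra_simps)
      qed
      then show ?thesis by (simp add: q_def)
    qed simp
  qed
  moreover have "lam v x ^ m * p v x vs =
       ext_d k (\<lambda>x vs. lam v x ^ Suc m * (1 / real (Suc m) * \<gamma> x vs)) x vs + lam v x ^ Suc m * q v x vs"
    if v: "v \<in> C" for v x vs
  proof -
    have "ext_d k (\<lambda>x vs. lam v x ^ Suc m * (1 / real (Suc m) * \<gamma> x vs)) x vs =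
      real (Suc m) * lam v x ^ m * ?W v (\<lambda>vs. 1 / real (Suc m) * \<gamma> x vs) vs
      + lam v x ^ Suc m * ext_d k (\<lambda>x vs. 1 / real (Suc m) * \<gamma> x vs) x vs"
      by (rule ext_d_lam_power[OF poly_forms_scale[OF \<gamma>(1)]])
    also have "\<dots> = lam v x ^ m * ?W v (\<gamma> x) vs + lam v x ^ Suc m * (1 / real (Suc m) * ext_d k \<gamma> x vs)"
      by (simp only: wedge_scale ext_d_scale[OF \<gamma>(1)]) simp
    finally have "ext_d k (\<lambda>x vs. lam v x ^ Suc m * (1 / real (Suc m) * \<gamma> x vs)) x vs + lam v x ^ Suc m * q v x vs
      = lam v x ^ m * (?W v (\<gamma> x) vs + lam v x * q' v x vs)"
      by (simp add: q_def algebra_simps)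
    also have "?W v (\<gamma> x) vs + lam v x * q' v x vs = p v x vs" using q'(2)[OF v, of x vs] by (simp add: e_def)
    finally show ?thesis by simp
  qed
  ultimately show ?thesis using that \<gamma>(1) q by blast
qed

text \<open>
  Iterating the step lowers the degree to zero.  Before each step the traces on the boundary are
  removed by a global polynomial form; its product with \<open>lam\<^sup>m\<close> is continuous, and it vanishes on the
  boundary if \<open>m > 0\<close>, so that only the first step needs vanishing traces from the outset.
\<close>

lemma descent:
  assumes "fam (int s) (Suc k) p" "tan_cont p" "1 \<le> m \<or> s = 0 \<or> tan_zero p"
  shows "\<exists>\<rho> \<eta>. fam (int (m + s) + 1) k \<rho> \<and> full_cont \<rho> \<and> full_zero \<rho> \<and>
    fam (int (m + s)) (Suc k) \<eta> \<and> full_cont \<eta> \<and> (1 \<le> m + s \<longrightarrow> full_zero \<eta>) \<and>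
    (m + s = 0 \<longrightarrow> (\<exists>c. alternating (Suc k) c \<and> (\<forall>v\<in>C. \<forall>x. \<eta> v x = c))) \<and>
    (\<forall>v\<in>C. \<forall>x vs. lam v x ^ m * p v x vs = ext_d k (\<rho> v) x vs + \<eta> v x vs)"
  using assms
proof (induction s arbitrary: p m)
  case 0
  have const: "p v x = p v 0" if "v \<in> C" for v x
  proof
    fix vs
    have "p v x vs = coef 0 (\<lambda>x. p v x vs) (\<lambda>v. 0)" for x
    proof -
      have "expo 0 = {\<lambda>v. 0}" using finite_C by (auto simp: expo_def)
      then show ?thesis
        using coef_expansion[of 0 "\<lambda>x. p v x vs" x] poly_forms_pol[OF famD[OF 0(1) that], of vs]
        by (simp add: bmono_def)
    qed
    then show "p v x vs = p v 0 vs" by metis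
  qed
  obtain c \<beta> where c: "alternating (Suc k) c" and \<beta>: "alternating k \<beta>"
    and e: "\<And>v vs. v \<in> C \<Longrightarrow> p v 0 vs = c vs + wedge k (\<lambda>y. D v \<bullet> y) \<beta> vs"
  proof (rule piecewise_constant_decomposition[of k "\<lambda>v. p v 0"])
    show "alternating (Suc k) (p v 0)" if "v \<in> C" for v
      using famD[OF 0(1) that] by (rule poly_forms_alternating)
    fix u v vs assume uv: "u \<in> C" "v \<in> C" and vs: "\<And>y. y \<in> set vs \<Longrightarrow> D u \<bullet> y = D v \<bullet> y"
    have "p u centre vs = p v centre vs"
      using uv vs by (intro tan_contD[OF 0(2)]) (auto simp: lam_centre)
    then show "p u 0 vs = p v 0 vs" using const uv by metis
  qed blast
  have \<beta>P: "(\<lambda>x vs. 1 / real (Suc m) * \<beta> vs) \<in> poly_forms 0 k"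
    by (rule poly_forms_const[OF alternating_scale[OF \<beta>]]) simp
  define \<rho> where "\<rho> v x vs = lam v x ^ Suc m * (1 / real (Suc m) * \<beta> vs)" for v x vs
  define \<eta> where "\<eta> v x vs = lam v x ^ m * c vs" for v x vs
  have "\<rho> v \<in> poly_forms (int m + 1) k" for v
    unfolding \<rho>_def[abs_def] using poly_forms_lam_power[OF \<beta>P, of v "Suc m"] by (simp add: add.commute)
  moreover have "\<eta> v \<in> poly_forms (int m) (Suc k)" for v
    unfolding \<eta>_def[abs_def] using poly_forms_lam_power[OF poly_forms_const[OF c], of 0 v m] by simp
  moreover have "full_cont \<rho>" "full_zero \<rho>" "full_cont \<eta>" "1 \<le> m \<longrightarrow> full_zero \<eta>" "m = 0 \<longrightarrow> (\<forall>v\<in>C. \<forall>x. \<eta> v x = c)"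
    by (auto simp: \<rho>_def \<eta>_def full_cont_def full_zero_def fun_eq_iff)
  moreover have "lam v x ^ m * p v x vs = ext_d k (\<rho> v) x vs + \<eta> v x vs" if v: "v \<in> C" for v x vs
  proof -
    have d0: "ext_d k (\<lambda>x vs. 1 / real (Suc m) * \<beta> vs) x vs = 0"
      by (rule poly_forms_negative[OF poly_forms_ext_d[OF \<beta>P]]) simp
    have "ext_d k (\<rho> v) x vs = lam v x ^ m * wedge k (\<lambda>y. D v \<bullet> y) \<beta> vs"
      unfolding \<rho>_def[abs_def] ext_d_lam_power[OF \<beta>P] d0 wedge_scale by simp
    then show ?thesis using const[OF v, of x] e[OF v, of vs] by (simp add: \<eta>_def algebra_simps)
  qed
  ultimately show ?case using c by (intro exI[of _ \<rho>] exI[of _ \<eta>]) (auto simp: fam_def)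
next
  case (Suc s)
  obtain \<Phi> where \<Phi>: "\<Phi> \<in> poly_forms (int (Suc s)) (Suc k)" "m = 0 \<Longrightarrow> \<Phi> = (\<lambda>x vs. 0)"
    "tan_zero (\<lambda>v x vs. p v x vs - \<Phi> x vs)"
  proof (cases "tan_zero p")
    case True then show ?thesis using that[of "\<lambda>x vs. 0"] poly_forms_zero by auto
  next
    case False
    obtain \<Phi> where "\<Phi> \<in> poly_forms (int (Suc s)) (Suc k)"
      "\<And>v x vs. v \<in> C \<Longrightarrow> lam v x = 0 \<Longrightarrow> (\<And>y. y \<in> set vs \<Longrightarrow> D v \<bullet> y = 0) \<Longrightarrow> \<Phi> x vs = p v x vs"
    proof (rule extend_traces[of "Suc s" p "Suc k"])
      fix u v x vs assume "u \<in> C" "v \<in> C" "lam u x = 0" "lam v x = 0"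
        "\<And>y. y \<in> set vs \<Longrightarrow> D u \<bullet> y = 0 \<and> D v \<bullet> y = 0"
      then show "p u x vs = p v x vs" by (intro tan_contD[OF Suc.prems(2)]) auto
    qed (use famD[OF Suc.prems(1)] in auto)
    then show ?thesis using that[of \<Phi>] False Suc.prems(3) by (auto simp: tan_zero_def)
  qed
  let ?p = "\<lambda>v x vs. p v x vs - \<Phi> x vs"
  have p': "fam (int (Suc s)) (Suc k) ?p"
    unfolding fam_def by (intro ballI poly_forms_diff famD[OF Suc.prems(1)] \<Phi>)
  have tc': "tan_cont ?p" using Suc.prems(2) unfolding tan_cont_def by metis
  obtain \<gamma> q where \<gamma>: "\<gamma> \<in> poly_forms (int (Suc s)) k" and q: "fam (int (Suc s) - 1) (Suc k) q" "tan_cont q"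
    and step: "\<And>v x vs. v \<in> C \<Longrightarrow> lam v x ^ m * ?p v x vs =
       ext_d k (\<lambda>x vs. lam v x ^ Suc m * (1 / real (Suc m) * \<gamma> x vs)) x vs + lam v x ^ Suc m * q v x vs"
    using descent_step[OF _ p' tc' \<Phi>(3), where m = m] by auto
  from q(1) have q1: "fam (int s) (Suc k) q" by simp
  obtain \<rho> \<eta> where \<rho>: "fam (int (Suc m + s) + 1) k \<rho>" "full_cont \<rho>" "full_zero \<rho>"
    and \<eta>: "fam (int (Suc m + s)) (Suc k) \<eta>" "full_cont \<eta>" "full_zero \<eta>"
    and eq: "\<And>v x vs. v \<in> C \<Longrightarrow> lam v x ^ Suc m * q v x vs = ext_d k (\<rho> v) x vs + \<eta> v x vs"
    using Suc.IH[OF q1 q(2), of "Suc m"] by auto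
  define \<rho>' where "\<rho>' v x vs = lam v x ^ Suc m * (1 / real (Suc m) * \<gamma> x vs)" for v x vs
  define \<eta>' where "\<eta>' v x vs = lam v x ^ m * \<Phi> x vs" for v x vs
  have \<rho>'P: "\<rho>' v \<in> poly_forms (int (m + Suc s) + 1) k" for v
    unfolding \<rho>'_def[abs_def] using poly_forms_lam_power[OF poly_forms_scale[OF \<gamma>], of v "Suc m" "1 / real (Suc m)"]
    by (simp add: algebra_simps)
  have \<eta>'P: "\<eta>' v \<in> poly_forms (int (m + Suc s)) (Suc k)" for v
    unfolding \<eta>'_def[abs_def] using poly_forms_lam_power[OF \<Phi>(1), of v m] by (simp add: algebra_simps)
  have z: "full_cont \<rho>'" "full_zero \<rho>'" "full_cont \<eta>'" "full_zero \<eta>'"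
    using \<Phi>(2) by (auto simp: \<rho>'_def \<eta>'_def full_cont_def full_zero_def fun_eq_iff)
  have \<rho>P: "fam (int (m + Suc s) + 1) k \<rho>" and \<eta>P: "fam (int (m + Suc s)) (Suc k) \<eta>"
    using \<rho>(1) \<eta>(1) by simp_all
  let ?\<rho> = "\<lambda>v x vs. \<rho>' v x vs + \<rho> v x vs" and ?\<eta> = "\<lambda>v x vs. \<eta>' v x vs + \<eta> v x vs"
  have "lam v x ^ m * p v x vs = ext_d k (?\<rho> v) x vs + ?\<eta> v x vs" if v: "v \<in> C" for v x vs
  proof -
    have "lam v x ^ m * p v x vs = lam v x ^ m * ?p v x vs + \<eta>' v x vs" by (simp add: \<eta>'_def algebra_simps)
    also have "\<dots> = ext_d k (\<rho>' v) x vs + (ext_d k (\<rho> v) x vs + \<eta> v x vs) + \<eta>' v x vs"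
      using step[OF v] eq[OF v] by (simp add: \<rho>'_def[abs_def])
    finally show ?thesis using ext_d_add[OF \<rho>'P famD[OF \<rho>P v], of v x vs] by simp
  qed
  moreover have "fam (int (m + Suc s) + 1) k ?\<rho>" "fam (int (m + Suc s)) (Suc k) ?\<eta>"
    unfolding fam_def
    by (rule ballI, rule poly_forms_add[OF \<rho>'P famD[OF \<rho>P]], assumption)
       (rule ballI, rule poly_forms_add[OF \<eta>'P famD[OF \<eta>P]], assumption)
  moreover have "full_cont ?\<rho>" "full_zero ?\<rho>" "full_cont ?\<eta>" "full_zero ?\<eta>"
    using z \<rho> \<eta> by (simp_all add: full_cont_add full_zero_add)
  ultimately show ?case by (intro exI[of _ ?\<rho>] exI[of _ ?\<eta>] conjI impI ballI allI) (assumption | simp)+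
qed

end


section \<open>Integration by parts and test functions\<close>

lemma integrable_compact_support:
  fixes f :: "'a::euclidean_space \<Rightarrow> real"
  assumes "continuous_on UNIV f" "compact K" "\<And>x. x \<notin> K \<Longrightarrow> f x = 0"
  shows "integrable lborel f"
proof -
  have "integrable lborel (\<lambda>x. indicator K x *\<^sub>R f x)"
    using assms by (intro borel_integrable_compact) (auto intro: continuous_on_subset)
  moreover have "(\<lambda>x. indicator K x *\<^sub>R f x) = f" using assms(3) by (auto simp: fun_eq_iff indicator_def)
  ultimately show ?thesis by simp
qed

lemma bounded_compact_support:
  fixes f :: "'a::euclidean_space \<Rightarrow> real"
  assumes "continuous_on UNIV f" "compact K" "\<And>x. x \<notin> K \<Longrightarrow> f x = 0"
  obtains M where "0 < M" "\<And>x. \<bar>f x\<bar> \<le> M"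
proof -
  have "bounded (f ` K)"
    using assms by (intro compact_imp_bounded compact_continuous_image) (auto intro: continuous_on_subset)
  then obtain M where "0 < M" "\<And>x. x \<in> K \<Longrightarrow> \<bar>f x\<bar> \<le> M" by (auto simp: bounded_pos)
  then have "\<bar>f x\<bar> \<le> M" for x using assms(3) by (cases "x \<in> K") auto
  then show ?thesis using that \<open>0 < M\<close> by blast
qed

lemma derivative_0_off_support:
  fixes f :: "'a::euclidean_space \<Rightarrow> real"
  assumes "(f has_derivative f') (at x)" "closed K" "\<And>x. x \<notin> K \<Longrightarrow> f x = 0" "x \<notin> K"
  shows "f' = (\<lambda>v. 0)"
proof -
  have "((\<lambda>x. 0) has_derivative f') (at x)"
    using assms by (intro has_derivative_transform_within_open[OF assms(1), of "-K"]) auto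
  then show ?thesis using has_derivative_unique has_derivative_const by blast
qed

text \<open>
  Difference quotients of a compactly supported function integrate to zero by translation
  invariance of Lebesgue measure.
\<close>

lemma integral_derivative_eq_0:
  fixes f :: "'a::euclidean_space \<Rightarrow> real"
  assumes der: "\<And>x. (f has_derivative f' x) (at x)"
    and cont: "continuous_on UNIV (\<lambda>x. f' x e)"
    and K: "compact K" "\<And>x. x \<notin> K \<Longrightarrow> f x = 0"
  shows "(LINT x|lborel. f' x e) = 0"
proof -
  have contf: "continuous_on UNIV f"
    using der by (intro continuous_at_imp_continuous_on ballI) (blast intro: has_derivative_continuous)
  have intf: "integrable lborel f" by (rule integrable_compact_support[OF contf K])
  have f'0: "f' x e = 0" if "x \<notin> K" for x
    using derivative_0_off_support[OF der compact_imp_closed[OF K(1)] K(2) that] by simp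
  obtain M where M: "0 < M" "\<And>x. \<bar>f' x e\<bar> \<le> M" using bounded_compact_support[OF cont K(1) f'0] by blast
  obtain R where R: "\<And>x. x \<in> K \<Longrightarrow> norm x \<le> R" using compact_imp_bounded[OF K(1)] by (auto simp: bounded_iff)
  define t where "t n = inverse (real (Suc n))" for n
  have t: "0 < t n" "t n \<le> 1" for n by (auto simp: t_def inverse_le_1_iff)
  define g where "g n x = (f (t n *\<^sub>R e + x) - f x) / t n" for n x
  have line: "((\<lambda>s. f (s *\<^sub>R e + x)) has_real_derivative f' (s *\<^sub>R e + x) e) (at s)" for s x
  proof -
    have "((\<lambda>s. f (s *\<^sub>R e + x)) has_derivative (\<lambda>h. f' (s *\<^sub>R e + x) (h *\<^sub>R e))) (at s)"
      by (rule has_derivative_compose[OF _ der]) (auto intro!: derivative_eq_intros)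
    moreover have "(\<lambda>h. f' (s *\<^sub>R e + x) (h *\<^sub>R e)) = (*) (f' (s *\<^sub>R e + x) e)"
      using has_derivative_linear[OF der, of "s *\<^sub>R e + x"] by (auto simp: linear_scale)
    ultimately show ?thesis by (simp add: has_field_derivative_def)
  qed
  have lim: "(\<lambda>n. g n x) \<longlonglongrightarrow> f' x e" for x
  proof -
    have "((\<lambda>h. (f ((0 + h) *\<^sub>R e + x) - f (0 *\<^sub>R e + x)) / h) \<longlongrightarrow> f' (0 *\<^sub>R e + x) e) (at 0)"
      using line[of x 0] by (simp only: DERIV_def)
    moreover have "filterlim t (at 0) sequentially"
      using LIMSEQ_inverse_real_of_nat t(1) unfolding t_def
      by (auto simp: filterlim_at eventually_sequentially intro!: always_eventually)
    ultimately have "(\<lambda>n. (f ((0 + t n) *\<^sub>R e + x) - f (0 *\<^sub>R e + x)) / t n) \<longlonglongrightarrow> f' (0 *\<^sub>R e + x) e"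
      by (rule filterlim_compose)
    then show ?thesis by (simp add: g_def)
  qed
  have bound: "\<bar>g n x\<bar> \<le> M * indicator (cball 0 (R + norm e)) x" for n x
  proof (cases "x \<in> cball 0 (R + norm e)")
    case True
    obtain z where "f (t n *\<^sub>R e + x) - f (0 *\<^sub>R e + x) = (t n - 0) * f' (z *\<^sub>R e + x) e"
      using MVT2[OF t(1)[of n], of "\<lambda>s. f (s *\<^sub>R e + x)" "\<lambda>s. f' (s *\<^sub>R e + x) e"] line by blast
    then have "g n x = f' (z *\<^sub>R e + x) e" using t[of n] by (simp add: g_def)
    then show ?thesis using M True by simp
  next
    case False
    then have n: "norm x > R + norm e" by (simp add: not_le)
    have "norm (t n *\<^sub>R e) \<le> norm e" using t[of n] by (simp add: mult_left_le_one_le)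
    then have "norm (t n *\<^sub>R e + x) > R" using n norm_triangle_ineq4[of "t n *\<^sub>R e + x" "t n *\<^sub>R e"] by simp
    moreover have "norm x > R" using n norm_ge_zero[of e] by linarith
    ultimately have "f (t n *\<^sub>R e + x) = 0" "f x = 0" using R K(2) by force+
    then show ?thesis using M(1) by (simp add: g_def)
  qed
  have trans: "integrable lborel (\<lambda>x. f (c + x))" "(LINT x|lborel. f (c + x)) = (LINT x|lborel. f x)" for c
  proof -
    have "integrable (distr lborel borel ((+) c)) f" using intf by (simp add: lborel_distr_plus)
    then show "integrable lborel (\<lambda>x. f (c + x))"
      by (subst (asm) integrable_distr_eq) (use intf in auto)
    have "(LINT x|lborel. f x) = (LINT x|distr lborel borel ((+) c). f x)" by (simp add: lborel_distr_plus)
    also have "\<dots> = (LINT x|lborel. f (c + x))" by (subst integral_distr) (use intf in auto)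
    finally show "(LINT x|lborel. f (c + x)) = (LINT x|lborel. f x)" by simp
  qed
  have "(LINT x|lborel. g n x) = 0" for n
    unfolding g_def using trans intf by simp
  moreover have "(\<lambda>n. LINT x|lborel. g n x) \<longlonglongrightarrow> (LINT x|lborel. f' x e)"
  proof (rule integral_dominated_convergence[where w = "\<lambda>x. M * indicator (cball 0 (R + norm e)) x"])
    show "(\<lambda>x. f' x e) \<in> borel_measurable lborel" using borel_measurable_continuous_onI[OF cont] by simp
    have "f \<in> borel_measurable borel" by (rule borel_measurable_continuous_onI[OF contf])
    then show "g n \<in> borel_measurable lborel" for n unfolding g_def by measurable
    show "integrable lborel (\<lambda>x. M * indicator (cball 0 (R + norm e)) x :: real)"
      using emeasure_lborel_cball_finite[of 0 "R + norm e"]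
      by (intro integrable_mult_right integrable_real_indicator) auto
  qed (use lim bound in auto)
  ultimately show ?thesis by (simp add: LIMSEQ_const_iff)
qed

subsection \<open>The function \<open>exp (-1/t)\<close>\<close>

definition flat :: "real \<Rightarrow> real" where "flat t = (if t > 0 then exp (- 1 / t) else 0)"

definition flat' :: "real \<Rightarrow> real" where "flat' t = (if t > 0 then exp (- 1 / t) / t\<^sup>2 else 0)"

lemma poly_over_exp_tendsto_0: "((\<lambda>x::real. poly q x / exp x) \<longlongrightarrow> 0) at_top"
proof -
  have "((\<lambda>x::real. \<Sum>i\<le>degree q. coeff q i * (x ^ i / exp x)) \<longlongrightarrow> (\<Sum>i\<le>degree q. coeff q i * 0)) at_top"
    by (intro tendsto_intros tendsto_power_div_exp_0)
  then show ?thesis by (simp add: poly_altdef sum_divide_distrib)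
qed

text \<open>
  The functions \<open>q (1/t) exp (-1/t)\<close> with a polynomial \<open>q\<close>, continued by zero, are closed under
  differentiation; all derivatives of \<open>flat\<close> are of this kind.
\<close>

lemma flat_poly_DERIV:
  "((\<lambda>t. if t > 0 then poly q (1 / t) * exp (- 1 / t) else 0) has_real_derivative
    (if t > 0 then poly ([:0, 0, 1:] * (q - pderiv q)) (1 / t) * exp (- 1 / t) else 0)) (at t)"
    (is "(?F has_real_derivative _) _")
proof (cases t "0::real" rule: linorder_cases)
  case greater
  have "((\<lambda>t. poly q (1 / t) * exp (- 1 / t)) has_real_derivative
      poly ([:0, 0, 1:] * (q - pderiv q)) (1 / t) * exp (- 1 / t)) (at t)"
    using greater
    by (auto intro!: derivative_eq_intros DERIV_chain2[OF poly_DERIV] simp: field_simps power2_eq_square)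
  then have "(?F has_real_derivative poly ([:0, 0, 1:] * (q - pderiv q)) (1 / t) * exp (- 1 / t)) (at t)"
    by (rule DERIV_cong_ev[THEN iffD1, rotated -1])
       (use greater eventually_nhds_in_open[of "{0<..}" t] in \<open>auto elim!: eventually_mono\<close>)
  then show ?thesis using greater by simp
next
  case less
  have "(?F has_real_derivative 0) (at t)"
    by (rule DERIV_cong_ev[THEN iffD1, OF refl _ refl DERIV_const[of 0]])
       (use less eventually_nhds_in_open[of "{..<0}" t] in \<open>auto elim!: eventually_mono\<close>)
  then show ?thesis using less by simp
next
  case equal
  have "((\<lambda>x. poly ([:0, 1:] * q) x / exp x) \<longlongrightarrow> 0) at_top" by (rule poly_over_exp_tendsto_0)
  then have "((\<lambda>h. poly ([:0, 1:] * q) (inverse h) / exp (inverse h)) \<longlongrightarrow> 0) (at_right (0::real))"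
    by (rule filterlim_compose[OF _ filterlim_inverse_at_top_right])
  then have "((\<lambda>h. (?F (0 + h) - ?F 0) / h) \<longlongrightarrow> 0) (at_right 0)"
    by (rule Lim_transform_eventually)
       (auto simp: eventually_at_right_field exp_minus field_simps intro!: exI[of _ 1])
  moreover have "((\<lambda>h. (?F (0 + h) - ?F 0) / h) \<longlongrightarrow> 0) (at_left 0)"
    by (rule Lim_transform_eventually[OF tendsto_const])
       (auto simp: eventually_at_left_field intro!: exI[of _ "-1"])
  ultimately have "((\<lambda>h. (?F (0 + h) - ?F 0) / h) \<longlongrightarrow> 0) (at 0)" by (rule filterlim_split_at[rotated])
  then show ?thesis using equal by (simp add: DERIV_def)
qed

lemma flat_DERIV: "(flat has_real_derivative flat' t) (at t)"
proof -
  have *: "flat = (\<lambda>t. if t > 0 then poly 1 (1 / t) * exp (- 1 / t) else 0)" by (auto simp: flat_def)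
  have "flat' t = (if t > 0 then poly ([:0, 0, 1:] * (1 - pderiv 1)) (1 / t) * exp (- 1 / t) else 0)"
    by (simp add: flat'_def field_simps power2_eq_square)
  then show ?thesis using flat_poly_DERIV[of 1 t] by (simp only: *)
qed

lemma flat_bounds: "0 \<le> flat t" "flat t \<le> 1" "0 \<le> flat' t" "t > 0 \<Longrightarrow> flat t > 0" "t \<le> 0 \<Longrightarrow> flat t = 0"
  "t \<le> 0 \<Longrightarrow> flat' t = 0"
  by (auto simp: flat_def flat'_def)

definition smooth1 :: "(real \<Rightarrow> real) \<Rightarrow> bool" where
  "smooth1 g \<longleftrightarrow> (\<exists>G. G 0 = g \<and> (\<forall>m t. (G m has_real_derivative G (Suc m) t) (at t)))"

lemma smooth1_flat: "smooth1 flat"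
  unfolding smooth1_def
proof (intro exI conjI allI)
  let ?q = "\<lambda>m. ((\<lambda>q. [:0, 0, 1:] * (q - pderiv q)) ^^ m) 1"
  let ?G = "\<lambda>m t. if t > 0 then poly (?q m) (1 / t) * exp (- 1 / t) else 0"
  show "?G 0 = flat" by (auto simp: flat_def)
  show "(?G m has_real_derivative ?G (Suc m) t) (at t)" for m t
    using flat_poly_DERIV[of "?q m" t] by (simp only: funpow.simps(2) o_apply)
qed

lemma smooth1_DERIV: "smooth1 g \<Longrightarrow> \<exists>g'. smooth1 g' \<and> (\<forall>t. (g has_real_derivative g' t) (at t))"
proof -
  assume "smooth1 g"
  then obtain G where G: "G 0 = g" "\<And>m t. (G m has_real_derivative G (Suc m) t) (at t)"
    unfolding smooth1_def by blast
  then have "smooth1 (G 1)" unfolding smooth1_def by (intro exI[of _ "\<lambda>m. G (Suc m)"]) auto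
  then show ?thesis using G(1) G(2)[of 0] by auto
qed

text \<open>
  Polynomials in smooth functions of affine functions.  The class contains the bumps in arbitrary affine
  coordinates and is closed under partial derivatives, so that its members are smooth by
  induction on the number of derivatives.
\<close>

inductive ridge :: "(real ^ 'n::finite \<Rightarrow> real) \<Rightarrow> bool" where
  const: "ridge (\<lambda>x. c)"
| comp: "smooth1 g \<Longrightarrow> ridge (\<lambda>x. g (a \<bullet> x + c))"
| add: "ridge f \<Longrightarrow> ridge g \<Longrightarrow> ridge (\<lambda>x. f x + g x)"
| mult: "ridge f \<Longrightarrow> ridge g \<Longrightarrow> ridge (\<lambda>x. f x * g x)"

lemma ridge_prod: "(\<And>i. i \<in> I \<Longrightarrow> ridge (f i)) \<Longrightarrow> ridge (\<lambda>x. \<Prod>i\<in>I. f i x)"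
  by (induction I rule: infinite_finite_induct) (auto intro: ridge.intros)

lemma ridge_derivative: "ridge f \<Longrightarrow> \<exists>f'. (\<forall>x. (f has_derivative f' x) (at x)) \<and> (\<forall>v. ridge (\<lambda>x. f' x v))"
proof (induction rule: ridge.induct)
  case (const c)
  show ?case by (intro exI[of _ "\<lambda>x v. 0"]) (auto intro: ridge.const)
next
  case (comp g a c)
  then obtain g' where g': "smooth1 g'" "\<And>t. (g has_real_derivative g' t) (at t)" using smooth1_DERIV by blast
  have "((\<lambda>x. g (a \<bullet> x + c)) has_derivative (\<lambda>v. g' (a \<bullet> x + c) * (a \<bullet> v))) (at x)" for x
    by (rule has_derivative_compose[OF _ g'(2)[unfolded has_field_derivative_def]])
       (auto intro!: derivative_eq_intros)
  moreover have "ridge (\<lambda>x. g' (a \<bullet> x + c) * (a \<bullet> v))" for v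
    by (rule ridge.mult[OF ridge.comp[OF g'(1)] ridge.const])
  ultimately show ?case by (intro exI[of _ "\<lambda>x v. g' (a \<bullet> x + c) * (a \<bullet> v)"]) auto
next
  case (add f g)
  then obtain f' g' where "\<forall>x. (f has_derivative f' x) (at x)" "\<forall>v. ridge (\<lambda>x. f' x v)"
    "\<forall>x. (g has_derivative g' x) (at x)" "\<forall>v. ridge (\<lambda>x. g' x v)" by blast
  then show ?case
    by (intro exI[of _ "\<lambda>x v. f' x v + g' x v"]) (auto intro!: derivative_eq_intros ridge.add)
next
  case (mult f g)
  then obtain f' g' where "\<forall>x. (f has_derivative f' x) (at x)" "\<forall>v. ridge (\<lambda>x. f' x v)"
    "\<forall>x. (g has_derivative g' x) (at x)" "\<forall>v. ridge (\<lambda>x. g' x v)" by blast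
  then show ?case using mult.hyps
    by (intro exI[of _ "\<lambda>x v. f x * g' x v + f' x v * g x"]) (auto intro!: derivative_eq_intros ridge.add ridge.mult)
qed

lemma ridge_smooth: "ridge f \<Longrightarrow> smooth f"
proof -
  assume f: "ridge f"
  have d: "ridge f \<Longrightarrow> f differentiable (at x)" for f :: "real^'a \<Rightarrow> real" and x
    using ridge_derivative unfolding differentiable_def by blast
  have "ridge (partial i f)" if f: "ridge f" for f :: "real^'a \<Rightarrow> real" and i
  proof -
    obtain f' where f': "\<And>x. (f has_derivative f' x) (at x)" "\<And>v. ridge (\<lambda>x. f' x v)"
      using ridge_derivative[OF f] by blast
    then have "partial i f = (\<lambda>x. f' x (axis i 1))"
      using frechet_derivative_at[OF f'(1)] by (auto simp: partial_def)
    then show ?thesis using f'(2) by simp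
  qed
  then have "ridge (foldr partial is f)" for "is" by (induction "is") (auto simp: f)
  then show ?thesis unfolding smooth_def using d by blast
qed

lemma smooth_has_derivative: "smooth f \<Longrightarrow> (f has_derivative frechet_derivative f (at x)) (at x)"
  using has_frechet_derivative[of f x] by (auto simp: smooth_def dest!: spec[of _ "[]"])

lemma smooth_continuous: "smooth f \<Longrightarrow> continuous_on S f"
  using smooth_has_derivative has_derivative_continuous
  by (intro continuous_at_imp_continuous_on ballI) blast

lemma smooth_continuous_derivative: "smooth f \<Longrightarrow> continuous_on S (\<lambda>x. frechet_derivative f (at x) v)"
proof -
  assume f: "smooth f"
  have "frechet_derivative f (at x) v = (\<Sum>i\<in>UNIV. v $ i * partial i f x)" for x
  proof -
    have lin: "linear (frechet_derivative f (at x))" by (rule has_derivative_linear[OF smooth_has_derivative[OF f]])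
    have "v = (\<Sum>i\<in>UNIV. v $ i *\<^sub>R axis i 1)"
      using basis_expansion[of v] by (simp add: scalar_mult_eq_scaleR)
    then have "frechet_derivative f (at x) v = frechet_derivative f (at x) (\<Sum>i\<in>UNIV. v $ i *\<^sub>R axis i 1)" by simp
    then show ?thesis by (simp only: linear_sum[OF lin] linear_scale[OF lin] partial_def real_scaleR_def)
  qed
  moreover have "continuous_on S (partial i f)" for i
  proof (intro continuous_at_imp_continuous_on ballI differentiable_imp_continuous_within)
    fix x show "partial i f differentiable (at x)"
      using f by (auto simp: smooth_def dest!: spec[of _ "[i]"])
  qed
  ultimately show ?thesis by (simp add: continuous_on_sum continuous_on_mult continuous_on_const)
qed

definition bump :: "real \<Rightarrow> real" where "bump t = flat (1 + t) * flat (1 - t)"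

definition bump' :: "real \<Rightarrow> real" where "bump' t = flat' (1 + t) * flat (1 - t) - flat (1 + t) * flat' (1 - t)"

lemma bump_DERIV: "(bump has_real_derivative bump' t) (at t)"
  unfolding bump_def[abs_def] bump'_def
  by (auto intro!: derivative_eq_intros DERIV_chain2[OF flat_DERIV])

lemma bump_bounds: "0 \<le> bump t" "bump t \<le> 1" "1 \<le> \<bar>t\<bar> \<Longrightarrow> bump t = 0" "\<bar>t\<bar> < 1 \<Longrightarrow> 0 < bump t"
proof -
  show "0 \<le> bump t" "bump t \<le> 1" unfolding bump_def by (simp_all add: flat_bounds mult_le_one)
  show "bump t = 0" if "1 \<le> \<bar>t\<bar>"
  proof -
    have "1 + t \<le> 0 \<or> 1 - t \<le> 0" using that by arith
    then show ?thesis using flat_bounds(5) by (auto simp: bump_def)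
  qed
  show "0 < bump t" if "\<bar>t\<bar> < 1"
    unfolding bump_def using that by (intro mult_pos_pos flat_bounds(4)) auto
qed

lemma bump'_sign: "t \<le> 0 \<Longrightarrow> 0 \<le> bump' t" "0 \<le> t \<Longrightarrow> bump' t \<le> 0" "0 < t \<Longrightarrow> t < 1 \<Longrightarrow> bump' t < 0" "bump' 0 = 0"
  "1 \<le> \<bar>t\<bar> \<Longrightarrow> bump' t = 0"
proof -
  have eq: "bump' t = bump t * (1 / (1 + t)\<^sup>2 - 1 / (1 - t)\<^sup>2)" if "\<bar>t\<bar> < 1"
    using that by (auto simp: bump'_def bump_def flat_def flat'_def field_simps)
  show out: "bump' t = 0" if "1 \<le> \<bar>t\<bar>"
  proof -
    have "1 + t \<le> 0 \<or> 1 - t \<le> 0" using that by arith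
    then show ?thesis using flat_bounds(5,6) by (auto simp: bump'_def)
  qed
  show "t \<le> 0 \<Longrightarrow> 0 \<le> bump' t"
  proof (cases "\<bar>t\<bar> < 1")
    case True
    assume "t \<le> 0"
    then have "(1 + t)\<^sup>2 \<le> (1 - t)\<^sup>2" "0 < (1 + t)\<^sup>2" using True by (auto intro!: power_mono)
    then show ?thesis using eq[OF True] bump_bounds(1)[of t] by (simp add: frac_le)
  qed (use out in auto)
  show "0 \<le> t \<Longrightarrow> bump' t \<le> 0"
  proof (cases "\<bar>t\<bar> < 1")
    case True
    assume "0 \<le> t"
    then have "(1 - t)\<^sup>2 \<le> (1 + t)\<^sup>2" "0 < (1 - t)\<^sup>2" using True by (auto intro!: power_mono)
    then show ?thesis using eq[OF True] bump_bounds(1)[of t] by (simp add: frac_le mult_nonneg_nonpos)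
  qed (use out in auto)
  show "bump' t < 0" if "0 < t" "t < 1"
  proof -
    have "(1 - t)\<^sup>2 < (1 + t)\<^sup>2" "0 < (1 - t)\<^sup>2" using that by (auto intro!: power_strict_mono)
    then have "1 / (1 + t)\<^sup>2 < 1 / (1 - t)\<^sup>2" using that by (intro divide_strict_left_mono mult_pos_pos) auto
    then show ?thesis using eq that bump_bounds(4)[of t] by (simp add: mult_pos_neg)
  qed
  show "bump' 0 = 0" by (simp add: bump'_def)
qed

lemma bump'_continuous: "continuous_on S bump'"
proof -
  have cont: "continuous_on T f" if "\<And>t. (f has_real_derivative f' t) (at t)" for f f' T
    using that by (intro continuous_at_imp_continuous_on ballI) (rule DERIV_isCont)
  obtain g where g: "smooth1 g" "\<And>t. (flat has_real_derivative g t) (at t)" using smooth1_DERIV[OF smooth1_flat] by blast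
  have "g = flat'" by (rule ext) (rule DERIV_unique[OF g(2) flat_DERIV])
  obtain g' where "\<And>t. (g has_real_derivative g' t) (at t)" using smooth1_DERIV[OF g(1)] by blast
  then have f': "continuous_on T flat'" for T unfolding \<open>g = flat'\<close> by (rule cont)
  have f: "continuous_on T flat" for T by (rule cont[OF flat_DERIV])
  have "continuous_on S (\<lambda>t. f (1 + t))" "continuous_on S (\<lambda>t. f (1 - t))" if "\<And>T. continuous_on T f" for f :: "real \<Rightarrow> real"
    by (rule continuous_on_compose2[OF that[of UNIV]]; auto intro!: continuous_intros)+
  note this[of flat, OF f] this[of flat', OF f']
  then show ?thesis unfolding bump'_def[abs_def] by (intro continuous_on_diff continuous_on_mult)
qed

lemma bump_continuous: "continuous_on S bump"
  by (intro continuous_at_imp_continuous_on ballI DERIV_isCont[OF bump_DERIV])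

lemma ridge_bump: "ridge (\<lambda>x. bump (a \<bullet> x + c))"
proof -
  have "ridge (\<lambda>x. flat (a \<bullet> x + (1 + c)) * flat ((- a) \<bullet> x + (1 - c)))"
    by (intro ridge.mult ridge.comp smooth1_flat)
  moreover have "a \<bullet> x + (1 + c) = 1 + (a \<bullet> x + c)" "(- a) \<bullet> x + (1 - c) = 1 - (a \<bullet> x + c)" for x by simp_all
  ultimately show ?thesis by (simp only: bump_def)
qed

text \<open>
  Test functions near a point of a hyperplane are products of a function of \<open>a \<bullet> x + c\<close> and one that is
  invariant in the transversal direction \<open>N\<close>: the derivative along \<open>N\<close> then falls on the first factor only.
  The invariant factor is a bump in all coordinates of the projection to the hyperplane along \<open>N\<close>.
\<close>

lemma exists_cylindrical_bump:
  fixes a N x0 :: "real ^ 'n::finite"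
  assumes N: "a \<bullet> N = 1" and x0: "a \<bullet> x0 + c = 0" and U: "open U" "x0 \<in> U"
  obtains \<kappa> \<delta> K where "0 < \<delta>" "ridge \<kappa>" "\<And>x. 0 \<le> \<kappa> x" "0 < \<kappa> x0" "\<And>x t. \<kappa> (x + t *\<^sub>R N) = \<kappa> x"
    "compact K" "K \<subseteq> U" "\<And>x. \<bar>a \<bullet> x + c\<bar> \<le> \<delta> \<Longrightarrow> \<kappa> x \<noteq> 0 \<Longrightarrow> x \<in> K"
proof -
  obtain e where e: "0 < e" "cball x0 e \<subseteq> U" using U open_contains_cball by blast
  define \<delta> where "\<delta> = e / (real CARD('n) + norm N)"
  have pos: "0 < real CARD('n) + norm N" by (simp add: add_pos_nonneg)
  have \<delta>: "0 < \<delta>" using e pos by (simp add: \<delta>_def)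
  define Q where "Q x = x - (a \<bullet> x + c) *\<^sub>R N" for x
  define \<kappa> where "\<kappa> x = (\<Prod>i\<in>UNIV. bump (1 / \<delta> * ((Q x - x0) $ i)))" for x
  have "ridge (\<lambda>x. bump (1 / \<delta> * ((Q x - x0) $ i)))" for i
  proof -
    have "1 / \<delta> * ((Q x - x0) $ i) = (1 / \<delta>) *\<^sub>R (axis i 1 - (N $ i) *\<^sub>R a) \<bullet> x + 1 / \<delta> * (- c * N $ i - x0 $ i)" for x
      by (simp add: Q_def inner_diff_left inner_axis' algebra_simps)
    then show ?thesis using ridge_bump[of "(1 / \<delta>) *\<^sub>R (axis i 1 - (N $ i) *\<^sub>R a)" "1 / \<delta> * (- c * N $ i - x0 $ i)"]
      by (simp only:)
  qed
  then have "ridge \<kappa>" unfolding \<kappa>_def[abs_def] by (intro ridge_prod)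
  moreover have "0 \<le> \<kappa> x" for x unfolding \<kappa>_def by (intro prod_nonneg bump_bounds)
  moreover have "0 < \<kappa> x0" unfolding \<kappa>_def using x0 by (intro prod_pos) (simp add: Q_def bump_bounds)
  moreover have "\<kappa> (x + t *\<^sub>R N) = \<kappa> x" for x t
  proof -
    have "Q (x + t *\<^sub>R N) = Q x" using N by (simp add: Q_def inner_add_right algebra_simps)
    then show ?thesis by (simp add: \<kappa>_def)
  qed
  moreover have "x \<in> cball x0 e" if h: "\<bar>a \<bullet> x + c\<bar> \<le> \<delta>" and k: "\<kappa> x \<noteq> 0" for x
  proof -
    have "\<bar>(Q x - x0) $ i\<bar> \<le> \<delta>" for i
    proof -
      have "bump (1 / \<delta> * ((Q x - x0) $ i)) \<noteq> 0" using k by (simp add: \<kappa>_def)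
      then have "\<bar>1 / \<delta> * ((Q x - x0) $ i)\<bar> < 1" using bump_bounds(3) by (meson not_le)
      then show ?thesis using \<delta> by (simp add: abs_mult field_simps)
    qed
    then have "norm (Q x - x0) \<le> real CARD('n) * \<delta>"
      using norm_le_l1_cart[of "Q x - x0"] sum_bounded_above[of UNIV "\<lambda>i. \<bar>(Q x - x0) $ i\<bar>" \<delta>] by simp
    moreover have "norm ((a \<bullet> x + c) *\<^sub>R N) \<le> \<delta> * norm N" using h by (simp add: mult_right_mono)
    moreover have "norm (x - x0) = norm ((Q x - x0) + (a \<bullet> x + c) *\<^sub>R N)" by (simp add: Q_def)
    ultimately have "norm (x - x0) \<le> real CARD('n) * \<delta> + \<delta> * norm N"
      using norm_triangle_ineq[of "Q x - x0" "(a \<bullet> x + c) *\<^sub>R N"] by linarith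
    also have "\<dots> = \<delta> * (real CARD('n) + norm N)" by (simp add: algebra_simps)
    also have "\<dots> = e" using pos by (simp add: \<delta>_def)
    finally show ?thesis by (simp add: dist_norm norm_minus_commute)
  qed
  ultimately show ?thesis using that[of \<delta> \<kappa> "cball x0 e"] \<delta> e by auto
qed

lemma exists_bump:
  fixes x0 :: "real ^ 'n::finite"
  assumes U: "open U" "x0 \<in> U"
  obtains \<psi> K where "ridge \<psi>" "\<And>x. 0 \<le> \<psi> x" "0 < \<psi> x0" "compact K" "K \<subseteq> U" "\<And>x. x \<notin> K \<Longrightarrow> \<psi> x = 0"
proof -
  obtain i :: 'n where True by simp
  let ?a = "axis i 1 :: real^'n"
  have N: "?a \<bullet> ?a = 1" by (simp add: inner_axis)
  have x: "?a \<bullet> x0 + (- (x0 $ i)) = 0" by (simp add: inner_axis')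
  obtain \<kappa> \<delta> K where k: "0 < \<delta>" "ridge \<kappa>" "\<And>x. 0 \<le> \<kappa> x" "0 < \<kappa> x0"
    "compact K" "K \<subseteq> U" "\<And>x. \<bar>?a \<bullet> x + (- (x0 $ i))\<bar> \<le> \<delta> \<Longrightarrow> \<kappa> x \<noteq> 0 \<Longrightarrow> x \<in> K"
    using exists_cylindrical_bump[OF N x U] by metis
  let ?b = "\<lambda>x. bump ((1 / \<delta>) *\<^sub>R ?a \<bullet> x + 1 / \<delta> * (- (x0 $ i)))"
  have e: "(1 / \<delta>) *\<^sub>R ?a \<bullet> x + 1 / \<delta> * (- (x0 $ i)) = (?a \<bullet> x + (- (x0 $ i))) / \<delta>" for x
    by (simp add: algebra_simps diff_divide_distrib)
  show ?thesis
  proof (rule that[of "\<lambda>x. ?b x * \<kappa> x" K])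
    show "ridge (\<lambda>x. ?b x * \<kappa> x)" by (rule ridge.mult[OF ridge_bump k(2)])
    show "0 \<le> ?b x * \<kappa> x" for x using k bump_bounds(1) by simp
    show "0 < ?b x0 * \<kappa> x0" unfolding e x using k bump_bounds(4)[of 0] by simp
    show "?b x * \<kappa> x = 0" if "x \<notin> K" for x
    proof (cases "\<kappa> x = 0")
      case False
      then have "\<delta> < \<bar>?a \<bullet> x + (- (x0 $ i))\<bar>" using k(7)[of x] that by linarith
      then have "1 \<le> \<bar>(?a \<bullet> x + (- (x0 $ i))) / \<delta>\<bar>" using k(1) by simp
      then show ?thesis unfolding e using bump_bounds(3) by simp
    qed simp
  qed (use k in auto)
qed

lemma test_functionI:
  assumes "ridge \<phi>" "compact K" "K \<subseteq> U" "\<And>x. x \<notin> K \<Longrightarrow> \<phi> x = 0" shows "test_function U \<phi>"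
  using assms ridge_smooth by (auto simp: test_function_def)


section \<open>The cells of the Alfeld split\<close>

context bary
begin

definition cell :: "real ^ 'n \<Rightarrow> (real ^ 'n) set" where
  "cell v = {x. 0 \<le> lam v x \<and> (\<forall>u\<in>C. lam v x \<le> lam u x)}"

definition ocell :: "real ^ 'n \<Rightarrow> (real ^ 'n) set" where
  "ocell v = {x. 0 < lam v x \<and> (\<forall>u\<in>C - {v}. lam v x < lam u x)}"

abbreviation "T \<equiv> convex hull C"

lemma lam_affine: "s + t = 1 \<Longrightarrow> lam v (s *\<^sub>R x + t *\<^sub>R y) = s * lam v x + t * lam v y"
proof -
  assume "s + t = 1"
  then have "c0 v = s * c0 v + t * c0 v" by (simp flip: distrib_right)
  then show ?thesis by (simp add: lam_def inner_add_right algebra_simps)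
qed

lemma card_pos: "0 < card C" using card_C by simp

lemma barycenter_eq: "barycenter C = centre"
  by (simp add: barycenter_def centre_def scaleR_sum_right)

lemma hull_eq: "T = {x. \<forall>v\<in>C. 0 \<le> lam v x}"
proof (intro equalityI subsetI)
  fix x assume "x \<in> T"
  then obtain t where t: "\<forall>x\<in>C. 0 \<le> t x" "sum t C = 1" "(\<Sum>x\<in>C. t x *\<^sub>R x) = x"
    using convex_hull_finite[OF finite_C] by auto
  then have "lam v x = t v" if "v \<in> C" for v using lam_combination[OF t(2) that] by simp
  then show "x \<in> {x. \<forall>v\<in>C. 0 \<le> lam v x}" using t by simp
next
  fix x assume x: "x \<in> {x. \<forall>v\<in>C. 0 \<le> lam v x}"
  show "x \<in> T" unfolding convex_hull_finite[OF finite_C]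
    using x sum_lam lam_repr by (intro CollectI exI[of _ "\<lambda>v. lam v x"]) auto
qed

lemma cell_subset: "v \<in> C \<Longrightarrow> cell v \<subseteq> T"
  unfolding hull_eq cell_def by (auto intro: order_trans)

lemma ocell_subset_cell: "ocell v \<subseteq> cell v"
proof
  fix x assume x: "x \<in> ocell v"
  have "lam v x \<le> lam u x" if "u \<in> C" for u
    using x that by (cases "u = v") (auto simp: ocell_def intro: less_imp_le)
  then show "x \<in> cell v" using x by (auto simp: ocell_def cell_def)
qed

text \<open>
  In the cell, \<open>x\<close> is the combination of the vertices \<open>u \<noteq> v\<close> with weights \<open>lam u x - lam v x\<close> and of the
  barycenter with weight \<open>(n + 1) lam v x\<close>.
\<close>

lemma alfeld_cell: assumes v: "v \<in> C" shows "convex hull (insert (barycenter C) (C - {v})) = cell v"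
proof (intro equalityI)
  show "convex hull (insert (barycenter C) (C - {v})) \<subseteq> cell v"
  proof (rule hull_minimal)
    show "insert (barycenter C) (C - {v}) \<subseteq> cell v"
      using v by (auto simp: cell_def barycenter_eq lam_centre lam_vertex)
    show "convex (cell v)"
      by (rule convexI) (auto simp: cell_def lam_affine intro!: add_mono mult_left_mono)
  qed
next
  show "cell v \<subseteq> convex hull (insert (barycenter C) (C - {v}))"
  proof
    fix x assume x: "x \<in> cell v"
    let ?q = "\<lambda>u. if u = v then centre else u"
    let ?w = "\<lambda>u. (lam u x - lam v x) + (if u = v then real (card C) * lam v x else 0)"
    have "sum ?w C = (\<Sum>u\<in>C. lam u x) - (\<Sum>u\<in>C. lam v x) + (\<Sum>u\<in>C. if u = v then real (card C) * lam v x else 0)"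
      by (simp add: sum.distrib sum_subtractf)
    also have "\<dots> = 1" using v finite_C by (simp add: sum_lam sum.delta)
    finally have "sum ?w C = 1" .
    moreover have "0 \<le> ?w u" if "u \<in> C" for u using x that v by (auto simp: cell_def)
    moreover have "?q u \<in> convex hull (insert (barycenter C) (C - {v}))" if "u \<in> C" for u
      using that by (auto simp: barycenter_eq intro: hull_inc)
    ultimately have "(\<Sum>u\<in>C. ?w u *\<^sub>R ?q u) \<in> convex hull (insert (barycenter C) (C - {v}))"
      using finite_C by (intro convex_sum convex_convex_hull) auto
    also have "(\<Sum>u\<in>C. ?w u *\<^sub>R ?q u) = (\<Sum>u\<in>C. (lam u x - lam v x) *\<^sub>R u + (if u = v then (real (card C) * lam v x) *\<^sub>R centre else 0))"
      by (intro sum.cong) auto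
    also have "\<dots> = (\<Sum>u\<in>C. lam u x *\<^sub>R u) - lam v x *\<^sub>R (\<Sum>u\<in>C. u) + (real (card C) * lam v x) *\<^sub>R centre"
      using v finite_C by (simp add: sum.distrib sum.delta scaleR_diff_left sum_subtractf scaleR_sum_right)
    also have "lam v x *\<^sub>R (\<Sum>u\<in>C. u) = (real (card C) * lam v x) *\<^sub>R centre"
      using card_pos by (simp add: centre_def scaleR_sum_right[symmetric])
    finally show "x \<in> convex hull (insert (barycenter C) (C - {v}))" by (simp add: lam_repr)
  qed
qed

lemma alfeld_split_eq: "alfeld_split C = cell ` C"
  unfolding alfeld_split_def using alfeld_cell by (intro image_cong) auto

lemma open_ocell: "open (ocell v)"
proof -
  have "ocell v = {x. 0 < lam v x} \<inter> (\<Inter>u\<in>C - {v}. {x. lam v x < lam u x})" by (auto simp: ocell_def)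
  moreover have "open {x. 0 < lam v x}" "open {x. lam v x < lam u x}" for u
    by (intro open_Collect_less continuous_on_const lam_continuous)+
  ultimately show ?thesis using finite_C by (simp only:) (intro open_Int open_INT; auto)
qed

lemma closed_cell: "closed (cell v)"
proof -
  have "cell v = {x. 0 \<le> lam v x} \<inter> (\<Inter>u\<in>C. {x. lam v x \<le> lam u x})" by (auto simp: cell_def)
  moreover have "closed {x. 0 \<le> lam v x}" "closed {x. lam v x \<le> lam u x}" for u
    by (intro closed_Collect_le continuous_on_const lam_continuous)+
  ultimately show ?thesis by (simp only:) (intro closed_Int closed_INT; auto)
qed

lemma open_positive: "open {x. \<forall>v\<in>C. 0 < lam v x}"
proof -
  have "{x. \<forall>v\<in>C. 0 < lam v x} = (\<Inter>v\<in>C. {x. 0 < lam v x})" by auto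
  moreover have "open {x. 0 < lam v x}" for v by (intro open_Collect_less continuous_on_const lam_continuous)
  ultimately show ?thesis using finite_C by (simp only:) (intro open_INT; auto)
qed

lemma interior_eq: "interior T = {x. \<forall>v\<in>C. 0 < lam v x}"
proof (intro equalityI)
  show "{x. \<forall>v\<in>C. 0 < lam v x} \<subseteq> interior T"
    using open_positive by (intro interior_maximal) (auto simp: hull_eq intro: less_imp_le)
  show "interior T \<subseteq> {x. \<forall>v\<in>C. 0 < lam v x}"
  proof clarify
    fix x v assume x: "x \<in> interior T" and v: "v \<in> C"
    obtain w where w: "w \<in> C" "w \<noteq> v" using exists_unit_normal[OF v] by metis
    obtain e where e: "0 < e" "cball x e \<subseteq> T" using x by (auto simp: mem_interior_cball)
    let ?y = "x + (e / norm (w - v)) *\<^sub>R (w - v)"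
    have "?y \<in> cball x e" using w e by (simp add: dist_norm)
    then have "0 \<le> lam v ?y" using e v hull_eq by auto
    also have "lam v ?y = lam v x + (e / norm (w - v)) * (lam v w - lam v v)"
      by (simp add: lam_def inner_add_right inner_diff_right algebra_simps)
    finally show "0 < lam v x" using w v e
      by (simp add: lam_vertex) (smt (verit) divide_pos_pos zero_less_norm_iff right_minus_eq)
  qed
qed

lemma compact_T: "compact T" using finite_C by (simp add: finite_imp_compact_convex_hull)

lemma closed_T: "closed T" using compact_T by (rule compact_imp_closed)

lemma frontier_eq: "frontier T = {x \<in> T. \<exists>v\<in>C. lam v x = 0}"
proof -
  have "frontier T = T - interior T" using closed_T by (simp add: frontier_def)
  also have "\<dots> = {x \<in> T. \<exists>v\<in>C. lam v x = 0}" unfolding interior_eq by (force simp: hull_eq not_less)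
  finally show ?thesis .
qed

lemma ocell_subset_interior: "v \<in> C \<Longrightarrow> ocell v \<subseteq> interior T"
proof
  fix x assume v: "v \<in> C" and x: "x \<in> ocell v"
  have "0 < lam u x" if "u \<in> C" for u
  proof (cases "u = v")
    case False
    then have "0 < lam v x" "lam v x < lam u x" using x that by (auto simp: ocell_def)
    then show ?thesis by linarith
  qed (use x in \<open>auto simp: ocell_def\<close>)
  then show "x \<in> interior T" by (simp add: interior_eq)
qed

lemma exists_minimal: obtains v where "v \<in> C" "\<And>u. u \<in> C \<Longrightarrow> lam v x \<le> lam u x"
proof -
  have "C \<noteq> {}" using card_C by auto
  then have "arg_min_on (\<lambda>v. lam v x) C \<in> C" "\<And>u. u \<in> C \<Longrightarrow> lam (arg_min_on (\<lambda>v. lam v x) C) x \<le> lam u x"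
    using arg_min_if_finite(1)[OF finite_C, of "\<lambda>v. lam v x"] arg_min_least[OF finite_C, of _ "\<lambda>v. lam v x"] by auto
  then show ?thesis using that by blast
qed

lemma negligible_ties:
  assumes "u \<in> C" "v \<in> C" "u \<noteq> v" shows "negligible {x. lam u x = lam v x}"
proof -
  have "{x. lam u x = lam v x} = {x. (D u - D v) \<bullet> x = c0 v - c0 u}"
    by (auto simp: lam_def inner_diff_left)
  moreover have "(D u - D v) \<bullet> (u - v) = 2" using assms by (simp add: inner_diff_left lam_diff lam_vertex)
  then have "D u - D v \<noteq> 0" by fastforce
  ultimately show ?thesis using negligible_hyperplane[of "D u - D v" "c0 v - c0 u"] by simp
qed

lemma negligible_facet:
  assumes "v \<in> C" shows "negligible {x. lam v x = 0}"
proof -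
  have "{x. lam v x = 0} = {x. D v \<bullet> x = - c0 v}" by (auto simp: lam_def)
  moreover have "D v \<noteq> 0" using exists_unit_normal[OF assms] by (metis inner_zero_left zero_neq_one)
  ultimately show ?thesis using negligible_hyperplane[of "D v" "- c0 v"] by simp
qed

lemma AE_generic:
  "AE x in lebesgue. (\<forall>u\<in>C. \<forall>v\<in>C. u \<noteq> v \<longrightarrow> lam u x \<noteq> lam v x) \<and> (\<forall>v\<in>C. lam v x \<noteq> 0)"
proof -
  have neg: "AE x in lebesgue. x \<notin> N" if "negligible N" for N :: "(real^'n) set"
    using that AE_not_in negligible_iff_null_sets by blast
  have "AE x in lebesgue. u \<noteq> v \<longrightarrow> lam u x \<noteq> lam v x" if "u \<in> C" "v \<in> C" for u v
    using neg[OF negligible_ties[OF that]] by (cases "u = v") auto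
  moreover have "AE x in lebesgue. lam v x \<noteq> 0" if "v \<in> C" for v
    using neg[OF negligible_facet[OF that]] by auto
  ultimately show ?thesis using finite_C by (simp add: AE_conj_iff AE_finite_all)
qed

lemma AE_ocell: "AE x in lebesgue. x \<in> T \<longrightarrow> (\<exists>v\<in>C. x \<in> ocell v)"
  using AE_generic
proof eventually_elim
  case (elim x)
  show ?case
  proof
    assume T: "x \<in> T"
    obtain v where v: "v \<in> C" "\<And>u. u \<in> C \<Longrightarrow> lam v x \<le> lam u x" using exists_minimal by blast
    have "lam v x < lam u x" if "u \<in> C - {v}" for u
    proof -
      have "lam v x \<noteq> lam u x" "lam v x \<le> lam u x" using v(1) v(2)[of u] elim that by auto
      then show ?thesis by simp
    qed
    moreover have "0 < lam v x"
    proof -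
      have "0 \<le> lam v x" "lam v x \<noteq> 0" using T v(1) elim by (auto simp: hull_eq)
      then show ?thesis by simp
    qed
    ultimately show "\<exists>v\<in>C. x \<in> ocell v" using v(1) by (auto simp: ocell_def)
  qed
qed

lemma ocell_disjoint: "x \<in> ocell u \<Longrightarrow> x \<in> ocell v \<Longrightarrow> u \<in> C \<Longrightarrow> v \<in> C \<Longrightarrow> u = v"
proof (rule ccontr)
  assume "x \<in> ocell u" "x \<in> ocell v" "u \<in> C" "v \<in> C" "u \<noteq> v"
  then have "lam u x < lam v x" "lam v x < lam u x" by (auto simp: ocell_def)
  then show False by simp
qed

definition pull :: "(real ^ 'n) set \<Rightarrow> real ^ 'n" where
  "pull U = centre + (1 / card C) *\<^sub>R (\<Sum>u\<in>U. centre - u)"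

lemma lam_pull:
  assumes "U \<subseteq> C" "v \<in> C"
  shows "lam v (pull U) = 1 / card C + (card U / card C - (if v \<in> U then 1 else 0)) / card C"
proof -
  have fU: "finite U" using assms finite_C finite_subset by blast
  have "lam v (pull U) = lam v centre + (1 / card C) * (\<Sum>u\<in>U. D v \<bullet> (centre - u))"
    by (simp add: pull_def lam_def inner_add_right inner_sum_right)
  also have "(\<Sum>u\<in>U. D v \<bullet> (centre - u)) = (\<Sum>u\<in>U. 1 / card C - (if v = u then 1 else 0))"
    using assms by (intro sum.cong refl) (auto simp: lam_diff lam_centre lam_vertex)
  also have "\<dots> = card U / card C - (if v \<in> U then 1 else 0)"
    using fU by (simp add: sum_subtractf sum.delta)
  finally show ?thesis using assms by (simp add: lam_centre)
qed

text \<open>Moving from the centre away from the vertices in \<open>U\<close> makes their coordinates the smallest.\<close>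

lemma lam_pull_less:
  assumes "U \<subseteq> C" "U \<noteq> {}" "u \<in> U" "v \<in> C - U"
  shows "0 < lam u (pull U)" "lam u (pull U) < lam v (pull U)"
proof -
  have "0 < card U" using assms finite_C by (metis card_gt_0_iff finite_subset)
  then show "0 < lam u (pull U)" "lam u (pull U) < lam v (pull U)"
    using assms card_pos lam_pull[OF assms(1), of u] lam_pull[OF assms(1), of v]
    by (auto simp: subset_iff diff_divide_distrib divide_strict_right_mono)
qed

lemma pull_in_ocell: "v \<in> C \<Longrightarrow> pull {v} \<in> ocell v"
proof -
  assume v: "v \<in> C"
  obtain w where w: "w \<in> C" "w \<noteq> v" using exists_unit_normal[OF v] by metis
  have "0 < lam v (pull {v})" using lam_pull_less(1)[of "{v}" v w] v w by auto
  moreover have "lam v (pull {v}) < lam u (pull {v})" if "u \<in> C - {v}" for u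
    using lam_pull_less(2)[of "{v}" v u] v that by auto
  ultimately show ?thesis by (simp add: ocell_def)
qed

lemma closure_ocell:
  assumes v: "v \<in> C" shows "closure (ocell v) = cell v"
proof (intro equalityI)
  show "closure (ocell v) \<subseteq> cell v" using ocell_subset_cell closed_cell by (rule closure_minimal)
  show "cell v \<subseteq> closure (ocell v)"
  proof
    fix x assume x: "x \<in> cell v"
    let ?y = "\<lambda>t. (1 - t) *\<^sub>R x + t *\<^sub>R pull {v}"
    have p: "0 < lam v (pull {v})" "\<And>u. u \<in> C - {v} \<Longrightarrow> lam v (pull {v}) < lam u (pull {v})"
      using pull_in_ocell[OF v] by (auto simp: ocell_def)
    have "?y t \<in> ocell v" if t: "0 < t" "t < 1" for t
    proof -
      have "0 < lam v (?y t)" using x p t by (simp add: lam_affine cell_def add_nonneg_pos)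
      moreover have "lam v (?y t) < lam u (?y t)" if "u \<in> C - {v}" for u
        using x p(2)[OF that] t that by (auto simp: lam_affine cell_def intro!: add_le_less_mono mult_left_mono)
      ultimately show ?thesis by (simp add: ocell_def)
    qed
    then have "\<forall>\<^sub>F t in at_right 0. ?y t \<in> ocell v"
      by (auto simp: eventually_at_right_field intro!: exI[of _ 1])
    moreover have "(?y \<longlongrightarrow> (1 - 0) *\<^sub>R x + 0 *\<^sub>R pull {v}) (at_right 0)" by (intro tendsto_intros)
    ultimately show "x \<in> closure (ocell v)"
      using closure_subset[of "ocell v"]
      by (intro Lim_in_closed_set[of "closure (ocell v)" ?y "at_right 0" x]) (auto elim!: eventually_mono)
  qed
qed

lemma eq_on_cell_if_eq_on_ocell:
  fixes f g :: "real^'n \<Rightarrow> real"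
  assumes v: "v \<in> C" and f: "continuous_on (cell v) f" "continuous_on (cell v) g"
    and eq: "\<And>x. x \<in> ocell v \<Longrightarrow> f x = g x" and x: "x \<in> cell v"
  shows "f x = g x"
proof -
  have "continuous_on (closure (ocell v)) (\<lambda>x. f x - g x)"
    unfolding closure_ocell[OF v] by (intro continuous_on_diff f)
  from continuous_constant_on_closure[OF this, of 0 x] show ?thesis
    using eq x closure_ocell[OF v] by auto
qed

lemma pol_eq_0_if_AE:
  assumes f: "pol r f" and v: "v \<in> C" and ae: "AE x in lebesgue. x \<in> ocell v \<longrightarrow> f x = 0"
  shows "f x = 0"
proof -
  have "f x = 0" if x: "x \<in> ocell v" for x
  proof (rule ccontr)
    assume "f x \<noteq> 0"
    let ?S = "ocell v \<inter> f -` (- {0})"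
    have "open ?S" using continuous_open_preimage[OF pol_continuous[OF f] open_ocell, of "- {0}"] by (simp add: open_Compl)
    moreover have "x \<in> ?S" using x \<open>f x \<noteq> 0\<close> by simp
    ultimately have "\<not> negligible ?S" using open_not_negligible by blast
    moreover have "AE x in lebesgue. x \<notin> ?S" using ae by eventually_elim auto
    moreover have "?S \<in> sets lebesgue" using \<open>open ?S\<close> by (intro sets_completionI_sets) simp
    ultimately show False using AE_iff_null_sets[of ?S lebesgue] negligible_iff_null_sets[of ?S] by blast
  qed
  then show ?thesis
    using pol_eq_0_on_affine[OF f affine_UNIV open_ocell _ pull_in_ocell[OF v]] by simp
qed

lemma poly_forms_eq_if_AE:
  assumes p: "p \<in> poly_forms r k" "q \<in> poly_forms r k" and v: "v \<in> C"
    and ae: "AE x in lebesgue. x \<in> ocell v \<longrightarrow> p x = q x"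
  shows "p = q"
proof (intro ext)
  fix x vs
  have "AE x in lebesgue. x \<in> ocell v \<longrightarrow> p x vs - q x vs = 0" using ae by eventually_elim simp
  from pol_eq_0_if_AE[OF pol_diff[OF poly_forms_pol[OF p(1)] poly_forms_pol[OF p(2)]] v this]
  show "p x vs = q x vs" by simp
qed

subsection \<open>The function of a family of forms\<close>

definition piece :: "real ^ 'n \<Rightarrow> real ^ 'n" where
  "piece x = (SOME v. v \<in> C \<and> (\<forall>u\<in>C. lam v x \<le> lam u x))"

text \<open>
  The choice between cells with a common point concerns a null set in general, and it has no effect
  if the family is continuous across the interfaces.
\<close>

definition pw :: "(real ^ 'n \<Rightarrow> 'n rform) \<Rightarrow> 'n rform" where
  "pw p x = (if x \<in> T then p (piece x) x else (\<lambda>vs. 0))"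

lemma piece: "piece x \<in> C" "u \<in> C \<Longrightarrow> lam (piece x) x \<le> lam u x"
proof -
  have "\<exists>v. v \<in> C \<and> (\<forall>u\<in>C. lam v x \<le> lam u x)" using exists_minimal[of x] by metis
  from someI_ex[OF this] show "piece x \<in> C" "u \<in> C \<Longrightarrow> lam (piece x) x \<le> lam u x" by (auto simp: piece_def)
qed

lemma pw_ocell:
  assumes v: "v \<in> C" and x: "x \<in> ocell v" shows "pw p x = p v x"
proof -
  have "piece x = v"
  proof (rule ccontr)
    assume "piece x \<noteq> v"
    then have "lam v x < lam (piece x) x" using x piece(1) by (auto simp: ocell_def)
    then show False using piece(2)[OF v, of x] by simp
  qed
  then show ?thesis using x v ocell_subset_cell cell_subset by (auto simp: pw_def)
qed

lemma pw_cell: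
  assumes p: "full_cont p" and v: "v \<in> C" and x: "x \<in> cell v" shows "pw p x = p v x"
proof -
  have "lam (piece x) x = lam v x" using piece(1)[of x] piece(2)[of v x] v x by (intro antisym) (auto simp: cell_def)
  then have "p (piece x) x = p v x" using p[unfolded full_cont_def] v piece(1) by blast
  then show ?thesis using x v cell_subset by (auto simp: pw_def)
qed

lemma pw_forms_on: "fam r k p \<Longrightarrow> pw p \<in> forms_on T k"
  using piece(1) by (auto simp: forms_on_def pw_def fam_def alternating_0 intro: poly_forms_alternating)

lemma sum_ocell:
  fixes f :: "real^'n \<Rightarrow> real"
  assumes "v \<in> C" "x \<in> ocell v" shows "(\<Sum>u\<in>C. indicator (ocell u) x * f u) = f v"
proof -
  have "(\<Sum>u\<in>C. indicator (ocell u) x * f u) = (\<Sum>u\<in>C. if u = v then f u else 0)"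
    using assms ocell_disjoint by (intro sum.cong) (auto simp: indicator_def)
  then show ?thesis using assms finite_C by (simp add: sum.delta)
qed

lemma sum_ocell_outside: "x \<notin> T \<Longrightarrow> (\<Sum>u\<in>C. indicator (ocell u) x * f u) = (0::real)"
  using ocell_subset_cell cell_subset by (intro sum.neutral) (auto simp: indicator_def)

text \<open>
  Up to a null set \<open>T\<close> is the disjoint union of the open cells, and a function that is only measurable
  for the completed measure can be replaced by one assembled from Borel functions on the cells.
\<close>

lemma integral_T:
  fixes f :: "real^'n \<Rightarrow> real" and g :: "real^'n \<Rightarrow> real^'n \<Rightarrow> real"
  assumes f: "AE x in lebesgue. \<forall>v\<in>C. x \<in> ocell v \<longrightarrow> f x = g v x" and g: "\<And>v. v \<in> C \<Longrightarrow> g v \<in> borel_measurable borel"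
  shows "(LINT x|lebesgue_on T. f x) = (LINT x|lborel. (\<Sum>v\<in>C. indicator (ocell v) x * g v x))"
    and "f \<in> borel_measurable (lebesgue_on T)"
    and "integrable (lebesgue_on T) f \<longleftrightarrow> integrable lborel (\<lambda>x. \<Sum>v\<in>C. indicator (ocell v) x * g v x)"
proof -
  let ?g = "\<lambda>x. \<Sum>v\<in>C. indicator (ocell v) x * g v x :: real" and ?f = "\<lambda>x. indicator T x *\<^sub>R f x"
  have T: "T \<inter> space lebesgue \<in> sets lebesgue" using closed_T by simp
  have gm: "?g \<in> borel_measurable lborel"
    using g open_ocell by (auto intro!: borel_measurable_sum borel_measurable_times borel_measurable_indicator)
  then have gl: "?g \<in> borel_measurable lebesgue" by (rule measurable_completion)
  have ae: "AE x in lebesgue. ?g x = ?f x"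
    using AE_ocell f
  proof eventually_elim
    case (elim x)
    show ?case
    proof (cases "x \<in> T")
      case True
      then obtain v where v: "v \<in> C" "x \<in> ocell v" using elim by blast
      then have "f x = g v x" using elim by blast
      then show ?thesis using True by (simp add: sum_ocell[OF v])
    qed (simp add: sum_ocell_outside)
  qed
  then have fl: "?f \<in> borel_measurable lebesgue" by (rule borel_measurable_AE[OF gl])
  then show "f \<in> borel_measurable (lebesgue_on T)"
    using borel_measurable_restrict_space_iff[OF T, of f] by (simp add: mult.commute)
  have "(LINT x|lebesgue_on T. f x) = (LINT x|lebesgue. ?f x)" by (rule integral_restrict_space[OF T])
  also have "\<dots> = (LINT x|lebesgue. ?g x)" using ae by (intro integral_cong_AE fl gl) auto
  also have "\<dots> = (LINT x|lborel. ?g x)" by (rule integral_completion[OF gm])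
  finally show "(LINT x|lebesgue_on T. f x) = (LINT x|lborel. ?g x)" .
  have "integrable (lebesgue_on T) f \<longleftrightarrow> integrable lebesgue ?f" by (rule integrable_restrict_space[OF T])
  also have "\<dots> \<longleftrightarrow> integrable lebesgue ?g" using ae by (intro integrable_cong_AE fl gl) auto
  also have "\<dots> \<longleftrightarrow> integrable lborel ?g" by (rule integrable_completion[OF gm])
  finally show "integrable (lebesgue_on T) f \<longleftrightarrow> integrable lborel ?g" .
qed

lemma integrable_indicator_continuous:
  fixes f :: "real^'n \<Rightarrow> real"
  assumes f: "continuous_on UNIV f" and A: "A \<in> sets borel" "A \<subseteq> K" "compact K"
  shows "integrable lborel (\<lambda>x. indicator A x * f x)"
proof (rule Bochner_Integration.integrable_bound)
  show "integrable lborel (\<lambda>x. indicator K x *\<^sub>R f x)"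
    using f A by (intro borel_integrable_compact) (auto intro: continuous_on_subset)
  show "(\<lambda>x. indicator A x * f x) \<in> borel_measurable lborel"
    using A(1) borel_measurable_continuous_onI[OF f] by simp
  show "AE x in lborel. norm (indicator A x * f x) \<le> norm (indicator K x *\<^sub>R f x)"
    using A(2) by (auto simp: indicator_def)
qed

lemma pw_L2: assumes p: "fam r k p" shows "pw p \<in> L2_forms T k"
proof -
  have pol: "pol r (form_coeff (p v) is)" if "v \<in> C" for v "is"
    using poly_forms_pol[OF famD[OF p that]] by (simp add: form_coeff_def[abs_def])
  have eq: "form_coeff (pw p) is x = form_coeff (p v) is x" if "v \<in> C" "x \<in> ocell v" for v x "is"
    using pw_ocell[OF that] by (simp add: form_coeff_def)
  have "form_coeff (pw p) is \<in> borel_measurable (lebesgue_on T)" for "is"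
    using eq borel_measurable_continuous_onI[OF pol_continuous[OF pol]]
    by (intro integral_T(2)[of _ "\<lambda>v. form_coeff (p v) is"] AE_I2) auto
  moreover have "integrable (lebesgue_on T) (\<lambda>x. (form_coeff (pw p) is x)\<^sup>2)" for "is"
  proof (subst integral_T(3)[where g = "\<lambda>v x. (form_coeff (p v) is x)\<^sup>2"])
    have cont: "continuous_on UNIV (\<lambda>x. (form_coeff (p v) is x)\<^sup>2)" if "v \<in> C" for v
      by (intro continuous_on_power pol_continuous[OF pol[OF that]])
    then show "(\<lambda>x. (form_coeff (p v) is x)\<^sup>2) \<in> borel_measurable borel" if "v \<in> C" for v
      using that by (intro borel_measurable_continuous_onI)
    show "integrable lborel (\<lambda>x. \<Sum>v\<in>C. indicator (ocell v) x * (form_coeff (p v) is x)\<^sup>2)"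
    proof (intro Bochner_Integration.integrable_sum integrable_indicator_continuous[where K = T])
      show "ocell v \<subseteq> T" if "v \<in> C" for v using ocell_subset_cell cell_subset[OF that] by blast
    qed (use cont open_ocell compact_T in auto)
  qed (use eq in simp)
  ultimately show ?thesis using pw_forms_on[OF p] by (simp add: L2_forms_def)
qed

lemma pw_C0: assumes p: "fam r k p" and c: "full_cont p" shows "pw p \<in> C0_forms T k"
proof -
  have T: "T = (\<Union>v\<in>C. cell v)"
  proof
    show "T \<subseteq> (\<Union>v\<in>C. cell v)"
    proof
      fix x assume "x \<in> T"
      then have "x \<in> cell (piece x)" using piece by (auto simp: cell_def hull_eq)
      then show "x \<in> (\<Union>v\<in>C. cell v)" using piece(1) by blast
    qed
  qed (use cell_subset in blast)
  have "continuous_on (\<Union>v\<in>C. cell v) (form_coeff (pw p) is)" for "is"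
  proof (rule continuous_on_closed_Union[OF finite_C closed_cell])
    fix v assume v: "v \<in> C"
    have "pol r (\<lambda>x. p v x (map (\<lambda>i. axis i 1) is))" by (rule poly_forms_pol[OF famD[OF p v]])
    from pol_continuous[OF this] show "continuous_on (cell v) (form_coeff (pw p) is)"
      by (rule continuous_on_eq) (use pw_cell[OF c v] in \<open>simp add: form_coeff_def\<close>)
  qed
  then show ?thesis using pw_forms_on[OF p] T by (simp add: C0_forms_def)
qed

end


section \<open>Weak derivatives of tangentially continuous forms\<close>

lemma wedge_scale_add_left:
  "wedge k (\<lambda>y. c * a y + d * b y) w vs = c * wedge k a w vs + d * wedge k b w vs"
  by (simp add: wedge_def alt_sum_def algebra_simps sum.distrib sum_distrib_left)

lemma wedge_sum_left: "wedge k (\<lambda>y. \<Sum>u\<in>U. c u * a u y) w vs = (\<Sum>u\<in>U. c u * wedge k (a u) w vs)"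
proof (induction U rule: infinite_finite_induct)
  case (insert u U)
  then show ?case using wedge_scale_add_left[of k "c u" "a u" 1 "\<lambda>y. \<Sum>u\<in>U. c u * a u y" w vs] by simp
qed (simp_all add: wedge_def alt_sum_def)

text \<open>
  The integrand \<open>d(g p) = dg \<and> p + g dp\<close> is a sum of partial derivatives of functions with compact support.
\<close>

lemma integral_d_form:
  assumes p: "p \<in> poly_forms r k" and g: "\<And>x. (g has_derivative g' x) (at x)"
    and cont: "\<And>v. continuous_on UNIV (\<lambda>x. g' x v)" and K: "compact K" "\<And>x. x \<notin> K \<Longrightarrow> g x = 0"
  shows "integrable lborel (\<lambda>x. wedge k (g' x) (p x) vs)"
    and "integrable lborel (\<lambda>x. g x * ext_d k p x vs)"
    and "(LINT x|lborel. wedge k (g' x) (p x) vs) + (LINT x|lborel. g x * ext_d k p x vs) = 0"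
proof -
  let ?ws = "\<lambda>l. take l vs @ drop (Suc l) vs"
  let ?dp = "\<lambda>l x. frechet_derivative (\<lambda>y. p y (?ws l)) (at x) (vs ! l)"
  let ?a = "\<lambda>l x. g' x (vs ! l) * p x (?ws l)" and ?b = "\<lambda>l x. g x * ?dp l x"
  have g'0: "g' x = (\<lambda>v. 0)" if "x \<notin> K" for x
    using derivative_0_off_support[OF g compact_imp_closed[OF K(1)] K(2) that] .
  have pc: "continuous_on UNIV (\<lambda>x. p x ws)" for ws by (rule pol_continuous[OF poly_forms_pol[OF p]])
  have dc: "continuous_on UNIV (\<lambda>x. ?dp l x)" for l
    by (rule pol_continuous[OF pol_frechet_derivative[OF poly_forms_pol[OF p]]])
  have gc: "continuous_on UNIV g"
    using g by (intro continuous_at_imp_continuous_on ballI) (blast intro: has_derivative_continuous)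
  have ca: "continuous_on UNIV (?a l)" and cb: "continuous_on UNIV (?b l)" for l
    by (intro continuous_on_mult cont pc gc dc)+
  have ia: "integrable lborel (?a l)" for l
    by (rule integrable_compact_support[OF ca K(1)]) (simp add: g'0)
  have ib: "integrable lborel (?b l)" for l
    by (rule integrable_compact_support[OF cb K(1)]) (simp add: K(2))
  have zero: "(LINT x|lborel. ?a l x) + (LINT x|lborel. ?b l x) = 0" for l
  proof -
    have "(LINT x|lborel. (\<lambda>x y. g x * frechet_derivative (\<lambda>y. p y (?ws l)) (at x) y + g' x y * p x (?ws l)) x (vs ! l)) = 0"
    proof (rule integral_derivative_eq_0[where f = "\<lambda>x. g x * p x (?ws l)"])
      show "((\<lambda>x. g x * p x (?ws l)) has_derivative
          (\<lambda>y. g x * frechet_derivative (\<lambda>y. p y (?ws l)) (at x) y + g' x y * p x (?ws l))) (at x)" for x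
        by (intro has_derivative_mult g has_frechet_derivative poly_forms_differentiable[OF p])
      show "continuous_on UNIV (\<lambda>x. g x * ?dp l x + g' x (vs ! l) * p x (?ws l))"
        by (intro continuous_on_add ca cb)
    qed (use K in auto)
    then show ?thesis using ia[of l] ib[of l] by simp
  qed
  have A: "wedge k (g' x) (p x) vs = (if length vs = Suc k then \<Sum>l\<le>k. (-1) ^ l * ?a l x else 0)" for x
    by (simp add: wedge_def alt_sum_def)
  have B: "g x * ext_d k p x vs = (if length vs = Suc k then \<Sum>l\<le>k. (-1) ^ l * ?b l x else 0)" for x
    by (simp add: ext_d_def alt_sum_def sum_distrib_left mult_ac)
  show "integrable lborel (\<lambda>x. wedge k (g' x) (p x) vs)" unfolding A
    by (cases "length vs = Suc k") (auto intro!: Bochner_Integration.integrable_sum integrable_mult_right ia)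
  show "integrable lborel (\<lambda>x. g x * ext_d k p x vs)" unfolding B
    by (cases "length vs = Suc k") (auto intro!: Bochner_Integration.integrable_sum integrable_mult_right ib)
  have "(LINT x|lborel. wedge k (g' x) (p x) vs) + (LINT x|lborel. g x * ext_d k p x vs)
     = (if length vs = Suc k then \<Sum>l\<le>k. (-1) ^ l * ((LINT x|lborel. ?a l x) + (LINT x|lborel. ?b l x)) else 0)"
  proof (cases "length vs = Suc k")
    case True
    have "(LINT x|lborel. wedge k (g' x) (p x) vs) = (\<Sum>l\<le>k. (-1) ^ l * (LINT x|lborel. ?a l x))"
      unfolding A using True ia by (simp add: Bochner_Integration.integral_sum)
    moreover have "(LINT x|lborel. g x * ext_d k p x vs) = (\<Sum>l\<le>k. (-1) ^ l * (LINT x|lborel. ?b l x))"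
      unfolding B using True ib by (simp add: Bochner_Integration.integral_sum)
    ultimately show ?thesis using True by (simp add: distrib_left sum.distrib)
  qed (simp add: A B)
  then show "(LINT x|lborel. wedge k (g' x) (p x) vs) + (LINT x|lborel. g x * ext_d k p x vs) = 0"
    using zero by simp
qed

lemma mult_exp_bounds:
  assumes "0 \<le> (t::real)" shows "t * exp (- t) \<le> 1"
proof -
  have "t \<le> exp t" using exp_ge_add_one_self[of t] by linarith
  then show ?thesis by (simp add: exp_minus field_simps)
qed

lemma mult_exp_tendsto_0:
  assumes "0 < (d::real)" shows "(\<lambda>m. (real m * d) * exp (- (real m * d))) \<longlonglongrightarrow> 0"
proof -
  have "filterlim (\<lambda>m. real m * d) at_top sequentially"
    using assms by (intro filterlim_at_top_mult_tendsto_pos[OF tendsto_const _ filterlim_real_sequentially])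
  from filterlim_compose[OF tendsto_power_div_exp_0[of 1] this]
  show ?thesis by (simp add: exp_minus divide_inverse)
qed

lemma exp_tendsto_0:
  assumes "0 < (d::real)" shows "(\<lambda>m. exp (- (real m * d))) \<longlonglongrightarrow> 0"
proof -
  have "filterlim (\<lambda>m. real m * d) at_top sequentially"
    using assms by (intro filterlim_at_top_mult_tendsto_pos[OF tendsto_const _ filterlim_real_sequentially])
  from filterlim_compose[OF tendsto_power_div_exp_0[of 0] this]
  show ?thesis by (simp add: exp_minus divide_inverse)
qed

context bary
begin

definition vecs :: "'n list \<Rightarrow> (real ^ 'n) list" where "vecs js = map (\<lambda>i. axis i 1) js"

text \<open>
  Square integrable forms matter up to null sets only, so a family is compared with them on the open cells,
  where it is unambiguous.
\<close>

definition represents :: "'n rform \<Rightarrow> (real ^ 'n \<Rightarrow> 'n rform) \<Rightarrow> bool" where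
  "represents \<omega> p \<longleftrightarrow> (AE x in lebesgue. \<forall>v\<in>C. x \<in> ocell v \<longrightarrow> \<omega> x = p v x)"

lemma represents_pw: "represents (pw p) p"
  unfolding represents_def by (intro AE_I2) (use pw_ocell in blast)

lemma weak_integrand:
  assumes "length js = Suc k"
  shows "(\<Sum>l\<le>k. (-1) ^ l * form_coeff \<omega> (take l js @ drop (Suc l) js) x * partial (js ! l) \<phi> x)
    = wedge k (frechet_derivative \<phi> (at x)) (\<omega> x) (vecs js)"
  using assms by (simp add: wedge_def alt_sum_def vecs_def form_coeff_def partial_def take_map drop_map mult_ac)

lemma wedge_continuous:
  assumes "\<And>v. continuous_on S (\<lambda>x. a x v)" "p \<in> poly_forms r k"
  shows "continuous_on S (\<lambda>x. wedge k (a x) (p x) vs)"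
  unfolding wedge_def alt_sum_def
  by (cases "length vs = Suc k")
     (auto intro!: continuous_on_sum continuous_on_mult continuous_on_const assms(1)
        pol_continuous[OF poly_forms_pol[OF assms(2)]])

lemma weak_lhs:
  assumes p: "fam r k p" and \<omega>: "represents \<omega> p" and \<phi>: "smooth \<phi>" and js: "length js = Suc k"
  shows "(LINT x|lebesgue_on T. (\<Sum>l\<le>k. (-1) ^ l * form_coeff \<omega> (take l js @ drop (Suc l) js) x * partial (js ! l) \<phi> x))
    = (LINT x|lborel. (\<Sum>v\<in>C. indicator (ocell v) x * wedge k (frechet_derivative \<phi> (at x)) (p v x) (vecs js)))"
proof (rule integral_T(1))
  show "AE x in lebesgue. \<forall>v\<in>C. x \<in> ocell v \<longrightarrow>
      (\<Sum>l\<le>k. (-1) ^ l * form_coeff \<omega> (take l js @ drop (Suc l) js) x * partial (js ! l) \<phi> x)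
      = wedge k (frechet_derivative \<phi> (at x)) (p v x) (vecs js)"
    using \<omega> unfolding represents_def by eventually_elim (simp add: weak_integrand[OF js])
  show "(\<lambda>x. wedge k (frechet_derivative \<phi> (at x)) (p v x) (vecs js)) \<in> borel_measurable borel" if "v \<in> C" for v
    by (intro borel_measurable_continuous_onI wedge_continuous[OF _ famD[OF p that]] smooth_continuous_derivative \<phi>)
qed

text \<open>
  The softmin of the barycentric coordinates is a smooth partition of unity that becomes the partition
  into cells in the limit.  Its derivatives are explicit, and products of two different members decay
  exponentially in \<open>m\<close> away from the interface.
\<close>

definition soft :: "nat \<Rightarrow> real ^ 'n \<Rightarrow> real ^ 'n \<Rightarrow> real" where
  "soft m v x = exp (- real m * lam v x) / (\<Sum>u\<in>C. exp (- real m * lam u x))"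

lemma soft_denominator_pos: "0 < (\<Sum>u\<in>C. exp (- real m * lam u x))"
  using finite_C card_C by (intro sum_pos) auto

lemma soft_bounds: "0 \<le> soft m v x" "v \<in> C \<Longrightarrow> soft m v x \<le> 1" "(\<Sum>v\<in>C. soft m v x) = 1"
proof -
  show "0 \<le> soft m v x" using soft_denominator_pos[of m x] by (simp add: soft_def)
  show s: "(\<Sum>v\<in>C. soft m v x) = 1" using soft_denominator_pos[of m x]
    by (simp add: soft_def flip: sum_divide_distrib)
  show "soft m v x \<le> 1" if "v \<in> C"
    using member_le_sum[OF that, of "\<lambda>v. soft m v x"] finite_C s soft_denominator_pos[of m x]
    by (simp add: soft_def)
qed

lemma soft_le: "u \<in> C \<Longrightarrow> soft m v x \<le> exp (- (real m * (lam v x - lam u x)))"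
proof -
  assume u: "u \<in> C"
  have "exp (- real m * lam u x) \<le> (\<Sum>u\<in>C. exp (- real m * lam u x))"
    using u finite_C by (intro member_le_sum) auto
  then have "soft m v x \<le> exp (- real m * lam v x) / exp (- real m * lam u x)"
    unfolding soft_def by (intro divide_left_mono mult_pos_pos soft_denominator_pos) auto
  also have "\<dots> = exp (- (real m * (lam v x - lam u x)))" by (simp add: algebra_simps flip: exp_diff)
  finally show ?thesis .
qed

lemma soft_pair_le: "u \<in> C \<Longrightarrow> v \<in> C \<Longrightarrow> soft m u x * soft m v x \<le> exp (- (real m * \<bar>lam u x - lam v x\<bar>))"
proof -
  assume uv: "u \<in> C" "v \<in> C"
  have "soft m u x * soft m v x \<le> min (soft m u x) (soft m v x)"
    using soft_bounds(1,2) uv by (simp add: mult_left_le mult_left_le_one_le)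
  also have "\<dots> \<le> exp (- (real m * \<bar>lam u x - lam v x\<bar>))"
    using soft_le[OF uv(2), of m u x] soft_le[OF uv(1), of m v x] by (auto simp: abs_if min_def)
  finally show ?thesis .
qed

lemma soft_has_derivative:
  assumes "v \<in> C"
  shows "(soft m v has_derivative (\<lambda>y. \<Sum>u\<in>C. (real m * soft m v x * soft m u x) * (D u \<bullet> y - D v \<bullet> y))) (at x)"
proof -
  let ?e = "\<lambda>u x. exp (- real m * lam u x)" and ?S = "\<lambda>x. \<Sum>u\<in>C. exp (- real m * lam u x)"
  have e: "(?e u has_derivative (\<lambda>y. ?e u x * (- real m * (D u \<bullet> y)))) (at x)" for u
    by (auto intro!: derivative_eq_intros lam_has_derivative)
  have S: "(?S has_derivative (\<lambda>y. \<Sum>u\<in>C. ?e u x * (- real m * (D u \<bullet> y)))) (at x)"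
    by (intro has_derivative_sum e)
  have nz: "?S x \<noteq> 0" using soft_denominator_pos[of m x] by simp
  have "((\<lambda>x. ?e v x / ?S x) has_derivative
      (\<lambda>y. (?e v x * (- real m * (D v \<bullet> y)) * ?S x - ?e v x * (\<Sum>u\<in>C. ?e u x * (- real m * (D u \<bullet> y)))) / (?S x * ?S x))) (at x)"
    by (rule has_derivative_divide'[OF e S nz])
  moreover have "(?e v x * (- real m * (D v \<bullet> y)) * ?S x - ?e v x * (\<Sum>u\<in>C. ?e u x * (- real m * (D u \<bullet> y)))) / (?S x * ?S x)
      = (\<Sum>u\<in>C. (real m * soft m v x * soft m u x) * (D u \<bullet> y - D v \<bullet> y))" for y
  proof -
    have "(\<Sum>u\<in>C. (real m * soft m v x * soft m u x) * (D u \<bullet> y - D v \<bullet> y))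
        = (\<Sum>u\<in>C. real m * ?e v x * (?e u x * (D u \<bullet> y - D v \<bullet> y)) / (?S x * ?S x))"
      by (simp add: soft_def mult_ac)
    also have "\<dots> = (\<Sum>u\<in>C. real m * ?e v x * (?e u x * (D u \<bullet> y - D v \<bullet> y))) / (?S x * ?S x)"
      by (simp only: sum_divide_distrib)
    also have "(\<Sum>u\<in>C. real m * ?e v x * (?e u x * (D u \<bullet> y - D v \<bullet> y)))
        = ?e v x * (- real m * (D v \<bullet> y)) * ?S x - ?e v x * (\<Sum>u\<in>C. ?e u x * (- real m * (D u \<bullet> y)))"
      by (simp add: sum_distrib_left sum_subtractf sum_negf algebra_simps)
    finally show ?thesis by simp
  qed
  ultimately show ?thesis by (simp add: soft_def[abs_def])
qed

lemma soft_continuous: "continuous_on S (soft m v)"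
  unfolding soft_def[abs_def] using soft_denominator_pos
  by (intro continuous_intros lam_continuous) (metis less_irrefl)

lemma soft_tendsto:
  assumes v: "v \<in> C" and x: "x \<in> interior T"
    and gen: "\<And>u u'. u \<in> C \<Longrightarrow> u' \<in> C \<Longrightarrow> u \<noteq> u' \<Longrightarrow> lam u x \<noteq> lam u' x"
  shows "(\<lambda>m. soft m v x) \<longlonglongrightarrow> indicator (ocell v) x"
proof -
  have lim0: "(\<lambda>m. soft m u x) \<longlonglongrightarrow> 0" if "w \<in> C" "lam w x < lam u x" for u w
  proof (rule tendsto_sandwich[OF _ _ tendsto_const exp_tendsto_0])
    show "0 < lam u x - lam w x" using that by simp
    show "\<forall>\<^sub>F m in sequentially. soft m u x \<le> exp (- (real m * (lam u x - lam w x)))"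
      using soft_le[OF that(1)] by simp
  qed (simp add: soft_bounds)
  show ?thesis
  proof (cases "x \<in> ocell v")
    case True
    have "(\<lambda>m. 1 - (\<Sum>u\<in>C - {v}. soft m u x)) \<longlonglongrightarrow> 1 - (\<Sum>u\<in>C - {v}. 0)"
      by (intro tendsto_intros lim0[OF v]) (use True in \<open>auto simp: ocell_def\<close>)
    moreover have "1 - (\<Sum>u\<in>C - {v}. soft m u x) = soft m v x" for m
      using soft_bounds(3)[of m x] v finite_C by (simp add: sum.remove[of C v])
    ultimately show ?thesis using True by simp
  next
    case False
    then obtain u where "u \<in> C" "u \<noteq> v" "lam u x \<le> lam v x"
      using x v by (force simp: ocell_def interior_eq not_less)
    then show ?thesis using False gen[of u v] v lim0[of u v] by simp
  qed
qed

text \<open>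
  Replace the piecewise form by the smooth sum of the \<open>soft m v * p v\<close>.  Its derivative contains
  the terms \<open>m soft\<^sub>u soft\<^sub>v (D u - D v) \<and> (p v - p u)\<close>; by tangential
  continuity the product is divisible by \<open>lam u - lam v\<close>, so that on the support of the test function these
  terms are bounded and tend to zero almost everywhere.
\<close>

lemma piecewise_stokes:
  assumes p: "fam r k p" and tc: "tan_cont p" and \<phi>: "smooth \<phi>"
    and K: "compact K" "K \<subseteq> interior T" "\<And>x. x \<notin> K \<Longrightarrow> \<phi> x = 0"
  shows "(LINT x|lborel. (\<Sum>v\<in>C. indicator (ocell v) x *
    (wedge k (frechet_derivative \<phi> (at x)) (p v x) vs + \<phi> x * ext_d k (p v) x vs))) = 0"
proof -
  let ?d\<phi> = "\<lambda>x. frechet_derivative \<phi> (at x)"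
  define A where "A v x = wedge k (?d\<phi> x) (p v x) vs + \<phi> x * ext_d k (p v) x vs" for v x
  define G where "G u v x = wedge k (\<lambda>y. D u \<bullet> y - D v \<bullet> y) (p v x) vs" for u v x
  define c where "c m u v x = real m * soft m v x * soft m u x" for m u v x
  have d\<phi>0: "?d\<phi> x = (\<lambda>v. 0)" if "x \<notin> K" for x
    using derivative_0_off_support[OF smooth_has_derivative[OF \<phi>] compact_imp_closed[OF K(1)] K(3) that] .
  have \<phi>c: "continuous_on S \<phi>" "continuous_on S (\<lambda>x. ?d\<phi> x v)" for S v
    by (rule smooth_continuous[OF \<phi>], rule smooth_continuous_derivative[OF \<phi>])
  have extc: "continuous_on S (\<lambda>x. ext_d k (p v) x vs)" if "v \<in> C" for S v
    by (rule pol_continuous[OF poly_forms_pol[OF poly_forms_ext_d[OF famD[OF p that]]]])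
  have Ac: "continuous_on UNIV (A v)" if "v \<in> C" for v
    unfolding A_def[abs_def]
    by (intro continuous_on_add continuous_on_mult wedge_continuous[OF _ famD[OF p that]] \<phi>c extc that)
  have A0: "A v x = 0" if "x \<notin> K" for v x using d\<phi>0[OF that] K(3)[OF that] by (simp add: A_def wedge_def alt_sum_def)
  have "\<exists>g. continuous_on UNIV g \<and> (\<forall>x. G u v x + G v u x = (lam u x - lam v x) * g x)" if "u \<in> C" "v \<in> C" for u v
  proof (cases "u = v")
    case True then show ?thesis by (intro exI[of _ "\<lambda>x. 0"]) (simp add: G_def wedge_def alt_sum_def)
  next
    case False
    define H where "H x = wedge k (\<lambda>y. D u \<bullet> y - D v \<bullet> y) (\<lambda>ws. p v x ws - p u x ws) vs" for x
    have sumG: "G u v x + G v u x = H x" for x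
      by (simp add: G_def H_def wedge_diff) (simp add: wedge_diff_left)
    let ?a = "D u - D v" and ?c = "c0 u - c0 v" and ?N = "(1 / 2) *\<^sub>R (u - v)"
    have N: "?a \<bullet> ?N = 1" using that False by (simp add: inner_diff_left lam_diff lam_vertex)
    have h: "?a \<bullet> x + ?c = lam u x - lam v x" for x by (simp add: lam_def inner_diff_left)
    have Hpol: "pol r H"
      unfolding H_def[abs_def]
      by (rule poly_forms_pol[OF poly_forms_wedge[OF linear_D_diff poly_forms_diff[OF famD[OF p that(2)] famD[OF p that(1)]]]])
    have H0: "H x = 0" if x: "lam u x = lam v x" for x
      unfolding H_def
    proof (rule wedge_eq_0_if_vanishes_on_kernel[OF linear_D_diff])
      show "D u \<bullet> ?N - D v \<bullet> ?N = 1" using N by (simp add: inner_diff_left)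
      show "alternating k (\<lambda>ws. p v x ws - p u x ws)"
        using poly_forms_alternating[OF famD[OF p \<open>u \<in> C\<close>]] poly_forms_alternating[OF famD[OF p \<open>v \<in> C\<close>]]
        by (intro alternating_diff)
      show "p v x ws - p u x ws = 0" if "\<And>y. y \<in> set ws \<Longrightarrow> D u \<bullet> y - D v \<bullet> y = 0" for ws
        using tan_contD[OF tc \<open>u \<in> C\<close> \<open>v \<in> C\<close> x, of ws] that by simp
    qed
    obtain g where g: "pol (r - 1) g" "\<And>x. H x - H (x - (?a \<bullet> x + ?c) *\<^sub>R ?N) = (?a \<bullet> x + ?c) * g x"
      using pol_divided_difference[OF Hpol] by blast
    have "H (x - (?a \<bullet> x + ?c) *\<^sub>R ?N) = 0" for x
    proof (rule H0)
      have "?a \<bullet> (x - (?a \<bullet> x + ?c) *\<^sub>R ?N) + ?c = 0"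
        using N by (simp only: inner_diff_right inner_scaleR_right) simp
      then show "lam u (x - (?a \<bullet> x + ?c) *\<^sub>R ?N) = lam v (x - (?a \<bullet> x + ?c) *\<^sub>R ?N)" unfolding h by simp
    qed
    then have "H x = (lam u x - lam v x) * g x" for x using g(2)[of x] unfolding h by simp
    then show ?thesis using pol_continuous[OF g(1)] sumG by auto
  qed
  then obtain g where g: "\<And>u v. u \<in> C \<Longrightarrow> v \<in> C \<Longrightarrow> continuous_on UNIV (g u v)"
    "\<And>u v x. u \<in> C \<Longrightarrow> v \<in> C \<Longrightarrow> G u v x + G v u x = (lam u x - lam v x) * g u v x" by metis
  define f where "f m x = (\<Sum>v\<in>C. soft m v x * A v x) +
      (\<Sum>v\<in>C. \<Sum>u\<in>C. (c m u v x * (lam u x - lam v x)) * (\<phi> x * g u v x / 2))" for m x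
  have int_f: "integrable lborel (f m) \<and> (LINT x|lborel. f m x) = 0" for m
  proof -
    define s' where "s' v x y = (\<Sum>u\<in>C. c m u v x * (D u \<bullet> y - D v \<bullet> y))" for v x y
    define q where "q v x y = soft m v x * ?d\<phi> x y + \<phi> x * s' v x y" for v x y
    have der: "((\<lambda>x. soft m v x * \<phi> x) has_derivative q v x) (at x)" if "v \<in> C" for v x
      unfolding q_def[abs_def]
      by (rule has_derivative_eq_rhs[OF has_derivative_mult[OF soft_has_derivative[OF that] smooth_has_derivative[OF \<phi>]]])
         (auto simp: s'_def c_def)
    have qc: "continuous_on UNIV (\<lambda>x. q v x y)" for v y
      unfolding q_def s'_def c_def
      by (intro continuous_on_add continuous_on_mult continuous_on_sum continuous_on_const soft_continuous \<phi>c)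
    have z: "soft m v x * \<phi> x = 0" if "x \<notin> K" for v x using K(3)[OF that] by simp
    note Z = integral_d_form[where vs = vs, OF famD[OF p] der qc K(1) z]
    have wq: "wedge k (q v x) (p v x) vs + soft m v x * \<phi> x * ext_d k (p v) x vs
        = soft m v x * A v x + \<phi> x * (\<Sum>u\<in>C. c m u v x * G u v x)" for v x
      unfolding q_def[abs_def] wedge_scale_add_left s'_def[abs_def] wedge_sum_left A_def G_def
      by (simp add: algebra_simps)
    have "f m x = (\<Sum>v\<in>C. wedge k (q v x) (p v x) vs + soft m v x * \<phi> x * ext_d k (p v) x vs)" for x
    proof -
      let ?X = "\<Sum>v\<in>C. \<Sum>u\<in>C. c m u v x * G u v x"
      have "?X = (\<Sum>v\<in>C. \<Sum>u\<in>C. c m v u x * G v u x)" by (rule sum.swap)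
      also have "\<dots> = (\<Sum>v\<in>C. \<Sum>u\<in>C. c m u v x * G v u x)" by (simp add: c_def mult_ac)
      finally have "2 * ?X = (\<Sum>v\<in>C. \<Sum>u\<in>C. c m u v x * (G u v x + G v u x))"
        by (simp add: distrib_left sum.distrib)
      also have "\<dots> = (\<Sum>v\<in>C. \<Sum>u\<in>C. c m u v x * (lam u x - lam v x) * g u v x)"
        using g(2) by (intro sum.cong refl) (simp add: mult.assoc)
      finally have X: "?X = (\<Sum>v\<in>C. \<Sum>u\<in>C. c m u v x * (lam u x - lam v x) * g u v x) / 2" by simp
      have "(\<Sum>v\<in>C. wedge k (q v x) (p v x) vs + soft m v x * \<phi> x * ext_d k (p v) x vs)
          = (\<Sum>v\<in>C. soft m v x * A v x) + \<phi> x * ?X"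
        unfolding wq by (simp add: sum.distrib sum_distrib_left)
      also have "\<phi> x * ?X = (\<Sum>v\<in>C. \<Sum>u\<in>C. (c m u v x * (lam u x - lam v x)) * (\<phi> x * g u v x / 2))"
        unfolding X by (simp add: sum_distrib_left sum_divide_distrib mult_ac)
      finally show ?thesis by (simp add: f_def)
    qed
    then have f: "f m = (\<lambda>x. \<Sum>v\<in>C. wedge k (q v x) (p v x) vs + soft m v x * \<phi> x * ext_d k (p v) x vs)" by blast
    have "(LINT x|lborel. f m x) = (\<Sum>v\<in>C. (LINT x|lborel. wedge k (q v x) (p v x) vs)
        + (LINT x|lborel. soft m v x * \<phi> x * ext_d k (p v) x vs))"
      unfolding f using Z by (simp add: Bochner_Integration.integral_sum)
    also have "\<dots> = 0" using Z(3) by (intro sum.neutral ballI)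
    finally show ?thesis unfolding f using Z(1,2) by auto
  qed
  define w where "w x = (\<Sum>v\<in>C. \<bar>A v x\<bar>) + (\<Sum>v\<in>C. \<Sum>u\<in>C. \<bar>\<phi> x * g u v x / 2\<bar>)" for x
  have cb: "\<bar>c m u v x * (lam u x - lam v x)\<bar> \<le> (real m * \<bar>lam u x - lam v x\<bar>) * exp (- (real m * \<bar>lam u x - lam v x\<bar>))"
    if "u \<in> C" "v \<in> C" for m u v x
  proof -
    have "\<bar>c m u v x * (lam u x - lam v x)\<bar> = (real m * \<bar>lam u x - lam v x\<bar>) * (soft m u x * soft m v x)"
      using soft_bounds(1) by (simp add: c_def abs_mult mult_ac)
    also have "\<dots> \<le> (real m * \<bar>lam u x - lam v x\<bar>) * exp (- (real m * \<bar>lam u x - lam v x\<bar>))"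
      by (intro mult_left_mono soft_pair_le that) auto
    finally show ?thesis .
  qed
  have "(\<lambda>m. LINT x|lborel. f m x) \<longlonglongrightarrow> (LINT x|lborel. (\<Sum>v\<in>C. indicator (ocell v) x * A v x))"
  proof (rule integral_dominated_convergence[where w = w])
    show "(\<lambda>x. \<Sum>v\<in>C. indicator (ocell v) x * A v x) \<in> borel_measurable lborel"
      using borel_measurable_continuous_onI[OF Ac] open_ocell by simp
    show "f m \<in> borel_measurable lborel" for m using int_f by blast
    show "integrable lborel w"
      unfolding w_def
    proof (intro Bochner_Integration.integrable_add Bochner_Integration.integrable_sum integrable_abs)
      show "integrable lborel (A v)" if "v \<in> C" for v
        by (rule integrable_compact_support[OF Ac[OF that] K(1) A0])
      show "integrable lborel (\<lambda>x. \<phi> x * g u v x / 2)" if "u \<in> C" "v \<in> C" for u v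
        by (rule integrable_compact_support[OF _ K(1)])
           (use g(1)[OF that] K(3) \<phi>c in \<open>auto intro!: continuous_intros\<close>)
    qed
    show "AE x in lborel. (\<lambda>m. f m x) \<longlonglongrightarrow> (\<Sum>v\<in>C. indicator (ocell v) x * A v x)"
      using AE_generic[unfolded AE_completion_iff]
    proof eventually_elim
      case (elim x)
      have 1: "(\<lambda>m. soft m v x * A v x) \<longlonglongrightarrow> indicator (ocell v) x * A v x" if v: "v \<in> C" for v
      proof (cases "x \<in> K")
        case True
        then have "(\<lambda>m. soft m v x) \<longlonglongrightarrow> indicator (ocell v) x" using elim v K(2) by (intro soft_tendsto) auto
        then show ?thesis by (rule tendsto_mult_right)
      qed (simp add: A0)
      have 2: "(\<lambda>m. (c m u v x * (lam u x - lam v x)) * (\<phi> x * g u v x / 2)) \<longlonglongrightarrow> 0" if uv: "u \<in> C" "v \<in> C" for u v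
      proof (cases "u = v")
        case False
        then have "0 < \<bar>lam u x - lam v x\<bar>" using elim uv by simp
        then have "(\<lambda>m. c m u v x * (lam u x - lam v x)) \<longlonglongrightarrow> 0"
          by (intro Lim_null_comparison[OF _ mult_exp_tendsto_0]) (auto intro!: always_eventually cb uv)
        then show ?thesis by (rule tendsto_mult_left_zero)
      qed simp
      have "(\<lambda>m. f m x) \<longlonglongrightarrow> (\<Sum>v\<in>C. indicator (ocell v) x * A v x) + (\<Sum>v\<in>C. \<Sum>u\<in>C. 0)"
        unfolding f_def by (intro tendsto_add tendsto_sum 1 2)
      then show ?case by simp
    qed
    fix m show "AE x in lborel. norm (f m x) \<le> w x"
    proof (rule AE_I2)
      fix x
      have "\<bar>soft m v x * A v x\<bar> \<le> \<bar>A v x\<bar>" if "v \<in> C" for v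
        using soft_bounds(1)[of m v x] soft_bounds(2)[of v m x] that by (simp add: abs_mult mult_left_le_one_le)
      moreover have "\<bar>(c m u v x * (lam u x - lam v x)) * (\<phi> x * g u v x / 2)\<bar> \<le> \<bar>\<phi> x * g u v x / 2\<bar>"
        if "u \<in> C" "v \<in> C" for u v
      proof -
        have "\<bar>c m u v x * (lam u x - lam v x)\<bar> \<le> 1"
          using cb[OF that, of m x] mult_exp_bounds[of "real m * \<bar>lam u x - lam v x\<bar>"] by simp
        then show ?thesis unfolding abs_mult[of "c m u v x * (lam u x - lam v x)"] by (intro mult_left_le_one_le) auto
      qed
      ultimately show "norm (f m x) \<le> w x"
        unfolding f_def w_def real_norm_def
        by (intro order_trans[OF abs_triangle_ineq] add_mono order_trans[OF sum_abs] sum_mono) auto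
    qed
  qed
  moreover have "(\<lambda>m. LINT x|lborel. f m x) \<longlonglongrightarrow> 0" using int_f by simp
  ultimately show ?thesis unfolding A_def using LIMSEQ_unique by blast
qed

lemma weak_d_if_tan_cont:
  assumes p: "fam r k p" and tc: "tan_cont p" and \<omega>: "represents \<omega> p"
    and \<xi>: "represents \<xi> (\<lambda>v. ext_d k (p v))"
  shows "weak_d T k \<omega> \<xi>"
  unfolding weak_d_def
proof (intro allI impI, elim conjE)
  fix \<phi> and js :: "'n list" assume "test_function (interior T) \<phi>" and js: "length js = Suc k"
  then obtain K where \<phi>: "smooth \<phi>" and K: "compact K" "K \<subseteq> interior T" "\<And>x. x \<notin> K \<Longrightarrow> \<phi> x = 0"
    unfolding test_function_def by blast
  let ?W = "\<lambda>v x. wedge k (frechet_derivative \<phi> (at x)) (p v x) (vecs js)"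
  let ?E = "\<lambda>v x. \<phi> x * ext_d k (p v) x (vecs js)"
  have Wc: "continuous_on UNIV (?W v)" and Ec: "continuous_on UNIV (?E v)" if "v \<in> C" for v
    by (intro wedge_continuous[OF _ famD[OF p that]] smooth_continuous_derivative \<phi> continuous_on_mult
        smooth_continuous pol_continuous[OF poly_forms_pol[OF poly_forms_ext_d[OF famD[OF p that]]]])+
  have sub: "ocell v \<subseteq> T" if "v \<in> C" for v using that ocell_subset_cell cell_subset by blast
  have int: "integrable lborel (\<lambda>x. \<Sum>v\<in>C. indicator (ocell v) x * f v x)"
    if "\<And>v. v \<in> C \<Longrightarrow> continuous_on UNIV (f v)" for f :: "real^'n \<Rightarrow> real^'n \<Rightarrow> real"
    by (intro Bochner_Integration.integrable_sum integrable_indicator_continuous[where K = T])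
       (use that sub open_ocell compact_T in auto)
  have "(LINT x|lebesgue_on T. form_coeff \<xi> js x * \<phi> x) = (LINT x|lborel. (\<Sum>v\<in>C. indicator (ocell v) x * ?E v x))"
  proof (rule integral_T(1))
    show "AE x in lebesgue. \<forall>v\<in>C. x \<in> ocell v \<longrightarrow> form_coeff \<xi> js x * \<phi> x = ?E v x"
      using \<xi> unfolding represents_def by eventually_elim (simp add: form_coeff_def vecs_def)
  qed (rule borel_measurable_continuous_onI[OF Ec])
  moreover have "(LINT x|lborel. (\<Sum>v\<in>C. indicator (ocell v) x * ?W v x)) +
      (LINT x|lborel. (\<Sum>v\<in>C. indicator (ocell v) x * ?E v x)) = 0"
    using piecewise_stokes[OF p tc \<phi> K, of "vecs js"] int[of ?W, OF Wc] int[of ?E, OF Ec]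
    by (simp add: distrib_left sum.distrib)
  ultimately show "(LINT x|lebesgue_on T. (\<Sum>l\<le>k. (-1) ^ l * form_coeff \<omega> (take l js @ drop (Suc l) js) x * partial (js ! l) \<phi> x))
      = - (LINT x|lebesgue_on T. form_coeff \<xi> js x * \<phi> x)"
    unfolding weak_lhs[OF p \<omega> \<phi> js] by simp
qed

end


section \<open>Consequences of the existence of a weak derivative\<close>

lemma bump_measurable: "bump \<in> borel_measurable borel"
  by (rule borel_measurable_continuous_onI[OF bump_continuous])

lemma integral_bump_tendsto_0:
  fixes F h :: "'a \<Rightarrow> real"
  assumes F: "integrable M F" and h: "h \<in> borel_measurable M" "AE x in M. h x \<noteq> 0"
  shows "(\<lambda>m. LINT x|M. bump (real m * h x) * F x) \<longlonglongrightarrow> 0"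
proof -
  have "(\<lambda>m. LINT x|M. bump (real m * h x) * F x) \<longlonglongrightarrow> (LINT x|M. 0)"
  proof (rule integral_dominated_convergence[where w = "\<lambda>x. \<bar>F x\<bar>"])
    show "(\<lambda>x. bump (real m * h x) * F x) \<in> borel_measurable M" for m
      using F h(1) by (intro borel_measurable_times measurable_compose[OF _ bump_measurable]) auto
    show "AE x in M. (\<lambda>m. bump (real m * h x) * F x) \<longlonglongrightarrow> 0"
      using h(2)
    proof eventually_elim
      case (elim x)
      have "\<forall>\<^sub>F m in sequentially. 1 / \<bar>h x\<bar> \<le> real m"
        using filterlim_real_sequentially by (simp add: filterlim_at_top)
      then have "\<forall>\<^sub>F m in sequentially. bump (real m * h x) * F x = 0"
      proof eventually_elim
        case (elim m)
        then have "1 \<le> \<bar>real m * h x\<bar>" using \<open>h x \<noteq> 0\<close> by (simp add: abs_mult field_simps)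
        then show ?case by (simp add: bump_bounds(3))
      qed
      then show ?case by (rule tendsto_eventually)
    qed
    show "AE x in M. norm (bump (real m * h x) * F x) \<le> \<bar>F x\<bar>" for m
      using bump_bounds(1,2) by (intro AE_I2) (simp add: abs_mult mult_left_le_one_le)
  qed (use F in auto)
  then show ?thesis by simp
qed

lemma integral_pos_if_pos_on_open:
  fixes F :: "real^'n::finite \<Rightarrow> real"
  assumes F: "integrable lborel F" "\<And>x. 0 \<le> F x" and U: "open U" "x0 \<in> U" "\<And>x. x \<in> U \<Longrightarrow> 0 < F x"
  shows "0 < (LINT x|lborel. F x)"
proof -
  have "(LINT x|lborel. F x) \<noteq> 0"
  proof
    assume "(LINT x|lborel. F x) = 0"
    then have "AE x in lborel. F x = 0" using integral_nonneg_eq_0_iff_AE[OF F(1)] F(2) by simp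
    then have "AE x in lborel. x \<notin> U" by eventually_elim (use U(3) in force)
    then have "AE x in lebesgue. x \<notin> U" by (simp add: AE_completion_iff)
    moreover have "U \<in> sets lebesgue" using U(1) by (intro sets_completionI_sets) simp
    ultimately have "negligible U" using AE_iff_null_sets negligible_iff_null_sets by blast
    then show False using open_not_negligible U by blast
  qed
  moreover have "0 \<le> (LINT x|lborel. F x)" using F(2) by simp
  ultimately show ?thesis by simp
qed

lemma wedge_Cons_kernel:
  assumes "length vs = k" "\<And>y. y \<in> set vs \<Longrightarrow> a y = 0"
  shows "wedge k a w (N # vs) = a N * w vs"
proof -
  let ?t = "\<lambda>l. (-1) ^ l * (a ((N # vs) ! l) * w (take l (N # vs) @ drop (Suc l) (N # vs)))"
  have "?t l = 0" if "l \<in> {..k} - {0}" for l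
    using that assms by (cases l) auto
  then have "sum ?t {..k} = sum ?t {0}" by (intro sum.mono_neutral_right) auto
  then show ?thesis using assms by (simp add: wedge_def alt_sum_def)
qed

context bary
begin

lemma L2_integrable:
  assumes \<xi>: "\<xi> \<in> L2_forms T k" and g: "continuous_on UNIV g" "\<And>x. x \<notin> K \<Longrightarrow> g x = (0::real)" "compact K"
  shows "integrable (lebesgue_on T) (\<lambda>x. form_coeff \<xi> js x * g x)"
proof -
  obtain B where B: "0 < B" "\<And>x. \<bar>g x\<bar> \<le> B" using bounded_compact_support[OF g(1) g(3) g(2)] by blast
  have m: "form_coeff \<xi> js \<in> borel_measurable (lebesgue_on T)"
    and sq: "integrable (lebesgue_on T) (\<lambda>x. (form_coeff \<xi> js x)\<^sup>2)"
    using \<xi> by (auto simp: L2_forms_def)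
  have gm: "g \<in> borel_measurable (lebesgue_on T)"
    using borel_measurable_continuous_onI[OF g(1)]
    by (intro measurable_restrict_space1 measurable_completion) simp
  show ?thesis
  proof (rule Bochner_Integration.integrable_bound)
    have "finite_measure (lebesgue_on T)"
      by (rule finite_measure_lebesgue_on) (use compact_T in \<open>simp add: lmeasurable_compact\<close>)
    then show "integrable (lebesgue_on T) (\<lambda>x. B * (1 + (form_coeff \<xi> js x)\<^sup>2))"
      by (intro integrable_mult_right Bochner_Integration.integrable_add sq finite_measure.integrable_const)
    show "AE x in lebesgue_on T. norm (form_coeff \<xi> js x * g x) \<le> norm (B * (1 + (form_coeff \<xi> js x)\<^sup>2))"
    proof (rule AE_I2)
      fix x
      let ?f = "form_coeff \<xi> js x"
      have "0 \<le> (1 - \<bar>?f\<bar>)\<^sup>2" by simp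
      then have "\<bar>?f\<bar> \<le> 1 + ?f\<^sup>2" by (simp add: power2_eq_square algebra_simps)
      then have "\<bar>?f\<bar> * \<bar>g x\<bar> \<le> (1 + ?f\<^sup>2) * B" using B by (intro mult_mono) auto
      then show "norm (?f * g x) \<le> norm (B * (1 + ?f\<^sup>2))" using B by (simp add: abs_mult mult_ac)
    qed
  qed (use m gm in auto)
qed

lemma lam_diff_measurable: "(\<lambda>x. lam u x - lam v x) \<in> borel_measurable borel"
  by (intro borel_measurable_continuous_onI continuous_on_diff lam_continuous)

text \<open>
  Test functions \<open>bump (m h) \<psi>\<close>, where \<open>h\<close> is affine and vanishes on the interface, concentrate there
  as \<open>m\<close> tends to infinity.  All integrals in the weak formulation tend to zero, with the exception of the
  one that contains \<open>m bump' (m h)\<close>; its limit is the integral of the jump over the interface.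
  So that limit is zero, although the jump has a sign on the support of \<open>\<psi>\<close>: a contradiction, since
  the limit for the constant jump \<open>1\<close> is positive.  The latter is computed without surface integrals by
  integrating by parts in the transversal direction, which puts the derivative on \<open>\<psi>\<close>.
\<close>

lemma no_tangential_jump:
  assumes p: "fam r k p" and \<omega>: "represents \<omega> p" and \<xi>: "\<xi> \<in> L2_forms T (Suc k)" and wd: "weak_d T k \<omega> \<xi>"
    and uv: "u \<in> C" "v \<in> C" "u \<noteq> v" and js: "length js = Suc k" and x: "lam u x = lam v x"
  shows "wedge k (\<lambda>y. D u \<bullet> y - D v \<bullet> y) (\<lambda>ws. p u x ws - p v x ws) (vecs js) = 0"
proof -
  define a where "a = D u - D v"
  define c where "c = c0 u - c0 v"
  define h where "h x = a \<bullet> x + c" for x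
  define N where "N = (1 / 2) *\<^sub>R (u - v)"
  define q where "q x ws = p u x ws - p v x ws" for x ws
  define G where "G x = wedge k (\<lambda>y. a \<bullet> y) (q x) (vecs js)" for x
  have h: "h x = lam u x - lam v x" for x by (simp add: h_def a_def c_def lam_def inner_diff_left)
  have N: "a \<bullet> N = 1" using uv by (simp add: a_def N_def inner_diff_left lam_diff lam_vertex)
  have a_eq: "(\<lambda>y. D u \<bullet> y - D v \<bullet> y) = (\<lambda>y. a \<bullet> y)" by (simp add: a_def inner_diff_left fun_eq_iff)
  have q: "q \<in> poly_forms r k"
    unfolding q_def[abs_def] by (rule poly_forms_diff[OF famD[OF p uv(1)] famD[OF p uv(2)]])
  have linA: "linear (\<lambda>y. a \<bullet> y)" using linear_D_diff[of u v] by (simp add: a_eq)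
  have Gpol: "pol r G" unfolding G_def[abs_def] by (rule poly_forms_pol[OF poly_forms_wedge[OF linA q]])
  define U where "U = {x. 0 < lam u x \<and> 0 < lam v x \<and> (\<forall>w\<in>C - {u, v}. lam u x < lam w x \<and> lam v x < lam w x)}"
  have U_eq: "U = {x. 0 < lam u x} \<inter> {x. 0 < lam v x} \<inter>
      (\<Inter>w\<in>C - {u, v}. {x. lam u x < lam w x} \<inter> {x. lam v x < lam w x})"
    by (auto simp: U_def)
  have openU: "open U"
    unfolding U_eq using finite_C
    by (intro open_Int open_INT ballI open_Collect_less continuous_on_const lam_continuous) auto
  have Uu: "x \<in> ocell u" if "x \<in> U" "h x < 0" for x using that by (auto simp: U_def ocell_def h)
  have Uv: "x \<in> ocell v" if "x \<in> U" "0 < h x" for x using that by (auto simp: U_def ocell_def h)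
  have UT: "U \<subseteq> interior T" unfolding interior_eq
  proof clarify
    fix x w assume "x \<in> U" "w \<in> C"
    then show "0 < lam w x"
      by (cases "w \<in> {u, v}") (auto simp: U_def intro: less_trans)
  qed
  have AEh: "AE x in lborel. h x \<noteq> 0" "AE x in lebesgue. h x \<noteq> 0"
  proof -
    show "AE x in lebesgue. h x \<noteq> 0" using AE_generic by eventually_elim (use uv in \<open>auto simp: h\<close>)
    then show "AE x in lborel. h x \<noteq> 0" by (simp add: AE_completion_iff)
  qed
  have hm: "h \<in> borel_measurable borel" unfolding h[abs_def] by (rule lam_diff_measurable)
  have "G x0 = 0" if x0: "x0 \<in> U" "h x0 = 0" for x0
  proof (rule ccontr)
    assume G0: "G x0 \<noteq> 0"
    define s where "s = sgn (G x0)"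
    have s: "s * s = 1" "s * G x0 = \<bar>G x0\<bar>" using G0 by (auto simp: s_def sgn_if)
    define b where "b = \<bar>G x0\<bar> / 2"
    have b: "0 < b" using G0 by (simp add: b_def)
    let ?U = "U \<inter> {x. b < s * G x}"
    have U1: "open ?U" by (intro open_Int openU open_Collect_less continuous_on_const continuous_on_mult pol_continuous[OF Gpol])
    have U2: "x0 \<in> ?U" using x0 G0 s by (simp add: b_def)
    obtain \<kappa> \<delta> K where \<kappa>: "0 < \<delta>" "ridge \<kappa>" "\<And>x. 0 \<le> \<kappa> x" "0 < \<kappa> x0" "\<And>x t. \<kappa> (x + t *\<^sub>R N) = \<kappa> x"
      and K: "compact K" "K \<subseteq> ?U" "\<And>x. \<bar>a \<bullet> x + c\<bar> \<le> \<delta> \<Longrightarrow> \<kappa> x \<noteq> 0 \<Longrightarrow> x \<in> K"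
      by (rule exists_cylindrical_bump[OF N x0(2)[unfolded h_def] U1 U2]) blast
    obtain \<kappa>' where \<kappa>': "\<And>x. (\<kappa> has_derivative \<kappa>' x) (at x)" "\<And>y. ridge (\<lambda>x. \<kappa>' x y)"
      using ridge_derivative[OF \<kappa>(2)] by blast
    have ridge_cont: "continuous_on S f" if "ridge f" for f :: "real^'n \<Rightarrow> real" and S
      by (rule smooth_continuous[OF ridge_smooth[OF that]])
    have \<kappa>'N: "\<kappa>' x N = 0" for x
    proof -
      have "((\<lambda>t. \<kappa> (x + t *\<^sub>R N)) has_derivative (\<lambda>t. \<kappa>' (x + 0 *\<^sub>R N) (t *\<^sub>R N))) (at 0)"
        by (rule has_derivative_compose[OF _ \<kappa>'(1)]) (auto intro!: derivative_eq_intros)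
      then have "((\<lambda>t. \<kappa> x) has_derivative (\<lambda>t. \<kappa>' x (t *\<^sub>R N))) (at 0)" using \<kappa>(5) by simp
      then have "(\<lambda>t. \<kappa>' x (t *\<^sub>R N)) = (\<lambda>t. 0)" using has_derivative_unique has_derivative_const by blast
      then show ?thesis by (metis scaleR_one)
    qed
    define \<psi> where "\<psi> x = bump (h x / \<delta>) * \<kappa> x" for x
    define \<psi>' where "\<psi>' x y = bump (h x / \<delta>) * \<kappa>' x y + bump' (h x / \<delta>) / \<delta> * (a \<bullet> y) * \<kappa> x" for x y
    have bh: "ridge (\<lambda>x. bump (t * h x))" for t
    proof -
      have "t * h x = (t *\<^sub>R a) \<bullet> x + t * c" for x by (simp add: h_def distrib_left)
      then show ?thesis using ridge_bump[of "t *\<^sub>R a" "t * c"] by simp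
    qed
    have h_der: "(h has_derivative (\<lambda>y. a \<bullet> y)) (at x)" for x
      unfolding h_def[abs_def] by (auto intro!: derivative_eq_intros)
    have bump_der: "((\<lambda>x. bump (t * h x)) has_derivative (\<lambda>y. bump' (t * h x) * (t * (a \<bullet> y)))) (at x)" for t x
      by (rule has_derivative_compose[OF _ bump_DERIV[unfolded has_field_derivative_def]])
         (intro has_derivative_mult_right h_der)
    have \<psi>_ridge: "ridge \<psi>"
      unfolding \<psi>_def[abs_def] using ridge.mult[OF bh[of "1 / \<delta>"] \<kappa>(2)] by simp
    have \<psi>_der: "(\<psi> has_derivative \<psi>' x) (at x)" for x
    proof -
      have "((\<lambda>x. bump (1 / \<delta> * h x) * \<kappa> x) has_derivative \<psi>' x) (at x)"
        by (rule has_derivative_eq_rhs[OF has_derivative_mult[OF bump_der \<kappa>'(1)]]) (simp add: \<psi>'_def fun_eq_iff)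
      then show ?thesis by (simp add: \<psi>_def[abs_def])
    qed
    have hc: "continuous_on S h" for S unfolding h_def[abs_def] by (intro continuous_intros)
    have bc: "continuous_on S (\<lambda>x. bump (t * h x))" "continuous_on S (\<lambda>x. bump' (t * h x))" for S t
      by (rule continuous_on_compose2[OF bump_continuous[of UNIV]] continuous_on_compose2[OF bump'_continuous[of UNIV]];
          auto intro!: continuous_intros hc)+
    have \<psi>'c: "continuous_on S (\<lambda>x. \<psi>' x y)" for S y
    proof -
      have "continuous_on S (\<lambda>x. bump (1 / \<delta> * h x) * \<kappa>' x y + bump' (1 / \<delta> * h x) / \<delta> * (a \<bullet> y) * \<kappa> x)"
        using \<kappa>(1) by (intro continuous_intros bc ridge_cont \<kappa>' \<kappa>) auto
      then show ?thesis by (simp add: \<psi>'_def)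
    qed
    have \<psi>c: "continuous_on S \<psi>" for S by (rule ridge_cont[OF \<psi>_ridge])
    have \<psi>0: "\<psi> x = 0" if "x \<notin> K" for x
    proof (cases "\<kappa> x = 0")
      case False
      then have "\<delta> < \<bar>h x\<bar>" using K(3)[of x] that unfolding h_def by linarith
      then have "1 \<le> \<bar>h x / \<delta>\<bar>" using \<kappa>(1) by simp
      then show ?thesis by (simp add: \<psi>_def bump_bounds(3))
    qed (simp add: \<psi>_def)
    have \<psi>'0: "\<psi>' x = (\<lambda>y. 0)" if "x \<notin> K" for x
      using derivative_0_off_support[OF \<psi>_der compact_imp_closed[OF K(1)] \<psi>0 that] .
    have \<psi>nn: "0 \<le> \<psi> x" for x using \<kappa>(3) bump_bounds(1) by (simp add: \<psi>_def)
    define \<phi> where "\<phi> m x = bump (real m * h x) * \<psi> x" for m x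
    define \<phi>' where "\<phi>' m x y = bump (real m * h x) * \<psi>' x y + (real m * bump' (real m * h x) * \<psi> x) * (a \<bullet> y)" for m x y
    have \<phi>_ridge: "ridge (\<phi> m)" for m unfolding \<phi>_def[abs_def] by (rule ridge.mult[OF bh \<psi>_ridge])
    have \<phi>_der: "(\<phi> m has_derivative \<phi>' m x) (at x)" for m x
      unfolding \<phi>_def[abs_def]
      by (rule has_derivative_eq_rhs[OF has_derivative_mult[OF bump_der \<psi>_der]]) (simp add: \<phi>'_def fun_eq_iff algebra_simps)
    have \<phi>'c: "continuous_on S (\<lambda>x. \<phi>' m x y)" for S m y
      unfolding \<phi>'_def by (intro continuous_intros bc \<psi>c \<psi>'c)
    have \<phi>0: "\<phi> m x = 0" if "x \<notin> K" for m x using \<psi>0[OF that] by (simp add: \<phi>_def)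
    have fd: "frechet_derivative (\<phi> m) (at x) = \<phi>' m x" for m x using frechet_derivative_at[OF \<phi>_der] by simp
    have test: "test_function (interior T) (\<phi> m)" for m
      using K UT by (intro test_functionI[OF \<phi>_ridge K(1) _ \<phi>0]) auto
    let ?V = "vecs js" and ?neg = "{x. h x < 0}"
    have negm: "?neg \<in> sets borel" using hm by measurable
    define J where "J m = (LINT x|lborel. indicator ?neg x * (real m * bump' (real m * h x) * \<psi> x * G x))" for m
    define L where "L m = (LINT x|lborel. indicator ?neg x * (real m * bump' (real m * h x) * \<psi> x))" for m
    define E where "E x = indicator ?neg x * wedge k (\<psi>' x) (q x) ?V" for x
    have compactK: "integrable lborel (\<lambda>x. indicator ?neg x * f x)" if f: "continuous_on UNIV f" "\<And>x. x \<notin> K \<Longrightarrow> f x = 0" for f :: "real^'n \<Rightarrow> real"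
    proof -
      have "(\<lambda>x. indicator ?neg x * f x) = (\<lambda>x. indicator (?neg \<inter> K) x * f x)"
        using f(2) by (auto simp: fun_eq_iff indicator_def)
      moreover have "integrable lborel (\<lambda>x. indicator (?neg \<inter> K) x * f x)"
        using negm K(1) by (intro integrable_indicator_continuous[OF f(1) _ _ K(1)]) (auto intro: borel_compact)
      ultimately show ?thesis by simp
    qed
    have intE: "integrable lborel E"
      unfolding E_def
    proof (rule compactK)
      show "continuous_on UNIV (\<lambda>x. wedge k (\<psi>' x) (q x) ?V)" by (rule wedge_continuous[OF \<psi>'c q])
    qed (simp add: \<psi>'0 wedge_def alt_sum_def)
    have intJ: "integrable lborel (\<lambda>x. indicator ?neg x * (real m * bump' (real m * h x) * \<psi> x * G x))" for m
      by (rule compactK) (auto intro!: continuous_intros bc \<psi>c pol_continuous[OF Gpol] simp: \<psi>0)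
    have intL: "integrable lborel (\<lambda>x. indicator ?neg x * (real m * bump' (real m * h x) * \<psi> x))" for m
      by (rule compactK) (auto intro!: continuous_intros bc \<psi>c simp: \<psi>0)
    have weak: "J m = - (LINT x|lborel. bump (real m * h x) * E x)
        + (LINT x|lborel. bump (real m * h x) * (\<psi> x * ext_d k (p v) x ?V))
        - (LINT x|lebesgue_on T. bump (real m * h x) * (form_coeff \<xi> js x * \<psi> x))" for m
    proof -
      note S = integral_d_form[OF famD[OF p uv(2)] \<phi>_der[of m] \<phi>'c K(1) \<phi>0, of ?V]
      have "(LINT x|lebesgue_on T. (\<Sum>l\<le>k. (-1) ^ l * form_coeff \<omega> (take l js @ drop (Suc l) js) x * partial (js ! l) (\<phi> m) x))
          = - (LINT x|lebesgue_on T. form_coeff \<xi> js x * \<phi> m x)"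
        using wd test js unfolding weak_d_def by blast
      then have "- (LINT x|lebesgue_on T. form_coeff \<xi> js x * \<phi> m x)
          = (LINT x|lborel. (\<Sum>w\<in>C. indicator (ocell w) x * wedge k (\<phi>' m x) (p w x) ?V))"
        unfolding weak_lhs[OF p \<omega> ridge_smooth[OF \<phi>_ridge] js] fd by simp
      also have "\<dots> = (LINT x|lborel. wedge k (\<phi>' m x) (p v x) ?V + indicator ?neg x * wedge k (\<phi>' m x) (q x) ?V)"
      proof (rule integral_cong_AE)
        have wc: "continuous_on UNIV (\<lambda>x. wedge k (\<phi>' m x) (f x) ?V)" if "f \<in> poly_forms r k" for f
          by (rule wedge_continuous[OF \<phi>'c that])
        show "(\<lambda>x. \<Sum>w\<in>C. indicator (ocell w) x * wedge k (\<phi>' m x) (p w x) ?V) \<in> borel_measurable lborel"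
          using borel_measurable_continuous_onI[OF wc[OF famD[OF p]]] open_ocell by simp
        show "(\<lambda>x. wedge k (\<phi>' m x) (p v x) ?V + indicator ?neg x * wedge k (\<phi>' m x) (q x) ?V) \<in> borel_measurable lborel"
          using borel_measurable_continuous_onI[OF wc[OF famD[OF p uv(2)]]] borel_measurable_continuous_onI[OF wc[OF q]] negm
          by simp
        show "AE x in lborel. (\<Sum>w\<in>C. indicator (ocell w) x * wedge k (\<phi>' m x) (p w x) ?V)
            = wedge k (\<phi>' m x) (p v x) ?V + indicator ?neg x * wedge k (\<phi>' m x) (q x) ?V"
          using AEh(1)
        proof eventually_elim
          case (elim x)
          show ?case
          proof (cases "x \<in> K")
            case False
            then have "\<phi>' m x = (\<lambda>y. 0)"
              using derivative_0_off_support[OF \<phi>_der compact_imp_closed[OF K(1)] \<phi>0] by blast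
            then show ?thesis by (simp add: wedge_def alt_sum_def)
          next
            case True
            then have xU: "x \<in> U" using K(2) by blast
            have qe: "wedge k (\<phi>' m x) (q x) ?V = wedge k (\<phi>' m x) (p u x) ?V - wedge k (\<phi>' m x) (p v x) ?V"
              unfolding q_def by (rule wedge_diff)
            show ?thesis
            proof (cases "h x < 0")
              case True then show ?thesis unfolding sum_ocell[OF uv(1) Uu[OF xU True]] qe by simp
            next
              case False
              then have "0 < h x" using elim by simp
              then show ?thesis unfolding sum_ocell[OF uv(2) Uv[OF xU \<open>0 < h x\<close>]] by simp
            qed
          qed
        qed
      qed
      also have "(\<lambda>x. wedge k (\<phi>' m x) (p v x) ?V + indicator ?neg x * wedge k (\<phi>' m x) (q x) ?V)
          = (\<lambda>x. wedge k (\<phi>' m x) (p v x) ?V + (bump (real m * h x) * E x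
              + indicator ?neg x * (real m * bump' (real m * h x) * \<psi> x * G x)))"
        unfolding \<phi>'_def[abs_def] wedge_scale_add_left E_def G_def
        by (rule ext) (simp add: algebra_simps)
      also have "(LINT x|lborel. wedge k (\<phi>' m x) (p v x) ?V + (bump (real m * h x) * E x
              + indicator ?neg x * (real m * bump' (real m * h x) * \<psi> x * G x)))
          = (LINT x|lborel. wedge k (\<phi>' m x) (p v x) ?V) + ((LINT x|lborel. bump (real m * h x) * E x) + J m)"
      proof -
        have "integrable lborel (\<lambda>x. bump (real m * h x) * E x)"
        proof (rule Bochner_Integration.integrable_bound[OF intE])
          show "(\<lambda>x. bump (real m * h x) * E x) \<in> borel_measurable lborel"
            using borel_measurable_continuous_onI[OF bc(1)] intE by (intro borel_measurable_times) auto
          show "AE x in lborel. norm (bump (real m * h x) * E x) \<le> norm (E x)"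
            using bump_bounds(1,2) by (intro AE_I2) (simp add: abs_mult mult_left_le_one_le)
        qed
        then show ?thesis using S(1) intJ[of m] by (simp add: J_def)
      qed
      also have "(LINT x|lborel. wedge k (\<phi>' m x) (p v x) ?V) = - (LINT x|lborel. \<phi> m x * ext_d k (p v) x ?V)"
        using S(3) by linarith
      finally show ?thesis by (simp add: \<phi>_def mult_ac)
    qed
    have "J \<longlonglongrightarrow> - 0 + 0 - 0"
      unfolding weak[abs_def]
    proof (intro tendsto_intros integral_bump_tendsto_0)
      show "integrable lborel E" by (rule intE)
      have "continuous_on UNIV (\<lambda>x. \<psi> x * ext_d k (p v) x ?V)"
        by (intro continuous_on_mult \<psi>c pol_continuous[OF poly_forms_pol[OF poly_forms_ext_d[OF famD[OF p uv(2)]]]])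
      then show "integrable lborel (\<lambda>x. \<psi> x * ext_d k (p v) x ?V)"
        by (rule integrable_compact_support[OF _ K(1)]) (simp add: \<psi>0)
      show "integrable (lebesgue_on T) (\<lambda>x. form_coeff \<xi> js x * \<psi> x)"
        by (rule L2_integrable[OF \<xi> \<psi>c \<psi>0 K(1)])
      show "h \<in> borel_measurable (lebesgue_on T)"
        using hm by (intro measurable_restrict_space1 measurable_completion) simp
      show "AE x in lebesgue_on T. h x \<noteq> 0" using AEh(2) closed_T by (simp add: AE_restrict_space_iff eventually_mono)
    qed (use hm AEh in auto)
    then have "(\<lambda>m. s * J m) \<longlonglongrightarrow> s * 0" by (intro tendsto_mult_left) simp
    moreover have "b * L m \<le> s * J m" for m
    proof -
      have "b * L m = (LINT x|lborel. b * (indicator ?neg x * (real m * bump' (real m * h x) * \<psi> x)))"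
        unfolding L_def using intL by simp
      also have "\<dots> \<le> (LINT x|lborel. s * (indicator ?neg x * (real m * bump' (real m * h x) * \<psi> x * G x)))"
      proof (intro integral_mono integrable_mult_right intL intJ)
        fix x
        show "b * (indicator ?neg x * (real m * bump' (real m * h x) * \<psi> x))
            \<le> s * (indicator ?neg x * (real m * bump' (real m * h x) * \<psi> x * G x))"
        proof (cases "x \<in> K \<and> h x < 0")
          case True
          then have "b \<le> s * G x" using K(2) by auto
          moreover have "0 \<le> real m * bump' (real m * h x) * \<psi> x"
            using True \<psi>nn by (intro mult_nonneg_nonneg bump'_sign) (auto simp: mult_nonneg_nonpos)
          ultimately have "b * (real m * bump' (real m * h x) * \<psi> x) \<le> (s * G x) * (real m * bump' (real m * h x) * \<psi> x)"
            by (rule mult_right_mono)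
          then show ?thesis using True by (simp add: mult_ac)
        next
          case False
          then show ?thesis using \<psi>0[of x] by (auto simp: indicator_def)
        qed
      qed
      also have "\<dots> = s * J m" unfolding J_def using intJ by simp
      finally show ?thesis .
    qed
    moreover define \<Lambda> where "\<Lambda> = (LINT x|lborel. indicator {x. 0 < h x} x * (bump 0 * (- bump' (h x / \<delta>) / \<delta> * \<kappa> x)))"
    moreover have "0 < \<Lambda>"
    proof -
      have z: "- bump' (h x / \<delta>) / \<delta> * \<kappa> x = 0" if "x \<notin> K" for x
      proof (cases "\<kappa> x = 0")
        case False
        then have "\<delta> < \<bar>h x\<bar>" using K(3)[of x] that unfolding h_def by linarith
        then have "1 \<le> \<bar>h x / \<delta>\<bar>" using \<kappa>(1) by simp
        then show ?thesis by (simp add: bump'_sign(5))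
      qed simp
      have cont: "continuous_on UNIV (\<lambda>x. bump 0 * (- bump' (1 / \<delta> * h x) / \<delta> * \<kappa> x))"
        using \<kappa>(1) by (intro continuous_intros bc ridge_cont \<kappa>) auto
      have "integrable lborel (\<lambda>x. indicator ({x. 0 < h x} \<inter> K) x * (bump 0 * (- bump' (1 / \<delta> * h x) / \<delta> * \<kappa> x)))"
        using hm K(1) by (intro integrable_indicator_continuous[OF cont _ _ K(1)] sets.Int) (auto intro: borel_compact)
      moreover have "(\<lambda>x. indicator ({x. 0 < h x} \<inter> K) x * (bump 0 * (- bump' (1 / \<delta> * h x) / \<delta> * \<kappa> x)))
          = (\<lambda>x. indicator {x. 0 < h x} x * (bump 0 * (- bump' (h x / \<delta>) / \<delta> * \<kappa> x)))"
      proof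
        fix x
        show "indicator ({x. 0 < h x} \<inter> K) x * (bump 0 * (- bump' (1 / \<delta> * h x) / \<delta> * \<kappa> x))
          = indicator {x. 0 < h x} x * (bump 0 * (- bump' (h x / \<delta>) / \<delta> * \<kappa> x))"
          using z[of x] by (cases "x \<in> K") (auto simp: indicator_def)
      qed
      ultimately have int: "integrable lborel (\<lambda>x. indicator {x. 0 < h x} x * (bump 0 * (- bump' (h x / \<delta>) / \<delta> * \<kappa> x)))"
        by (simp only:)
      let ?O = "{x. 0 < h x} \<inter> {x. h x < \<delta>} \<inter> {x. 0 < \<kappa> x}"
      have "x0 + (\<delta> / 2) *\<^sub>R N \<in> ?O"
        using \<kappa> x0 N by (simp add: h_def inner_add_right)
      moreover have "open ?O"
        by (intro open_Int open_Collect_less continuous_on_const hc ridge_cont \<kappa>)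
      ultimately show ?thesis
        unfolding \<Lambda>_def
      proof (intro integral_pos_if_pos_on_open[OF int])
        fix x
        show "0 \<le> indicator {x. 0 < h x} x * (bump 0 * (- bump' (h x / \<delta>) / \<delta> * \<kappa> x))"
        proof (cases "0 < h x")
          case True
          then have "bump' (h x / \<delta>) \<le> 0" using \<kappa>(1) by (intro bump'_sign(2)) simp
          then show ?thesis using True \<kappa>(1,3) bump_bounds(1)[of 0] by (simp add: divide_nonpos_pos mult_nonneg_nonpos mult_nonpos_nonneg)
        qed simp
        show "0 < indicator {x. 0 < h x} x * (bump 0 * (- bump' (h x / \<delta>) / \<delta> * \<kappa> x))" if "x \<in> ?O"
        proof -
          have "bump' (h x / \<delta>) < 0" using that \<kappa>(1) by (intro bump'_sign(3)) auto
          then have "0 < - bump' (h x / \<delta>) / \<delta> * \<kappa> x" using that \<kappa>(1) by (intro mult_pos_pos divide_pos_pos) auto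
          then have "0 < bump 0 * (- bump' (h x / \<delta>) / \<delta> * \<kappa> x)" by (rule mult_pos_pos[OF bump_bounds(4), rotated]) simp
          moreover have "indicator {x. 0 < h x} x = (1::real)" using that by simp
          ultimately show ?thesis by (simp only: mult_1_left)
        qed
      qed auto
    qed
    moreover have "L \<longlonglongrightarrow> \<Lambda>"
    proof -
      \<comment> \<open>a continuously differentiable function because \<open>bump'\<close> vanishes at \<open>0\<close>\<close>
      define B where "B t = (if t \<le> 0 then bump t else bump 0)" for t
      define B' where "B' t = (if t \<le> 0 then bump' t else 0)" for t
      have B_der: "(B has_real_derivative B' t) (at t)" for t
      proof -
        have "((\<lambda>t. if t \<in> {..0} then bump t else bump 0) has_derivative (if t \<in> {..0} then (\<lambda>y. bump' t * y) else (\<lambda>y. 0)))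
            (at t within {..0} \<union> {0..})"
          using bump_DERIV[of t] bump'_sign(4)
          by (intro has_derivative_If_within_closures)
             (auto simp: has_field_derivative_def intro: has_derivative_at_withinI)
        moreover have "{..0} \<union> {0..} = (UNIV :: real set)" by auto
        moreover have "(if t \<in> {..0} then (\<lambda>y. bump' t * y) else (\<lambda>y. 0)) = (*) (B' t)"
          by (auto simp: B'_def fun_eq_iff)
        moreover have "(\<lambda>t. if t \<in> {..0} then bump t else bump 0) = B" by (simp add: B_def[abs_def])
        ultimately show ?thesis by (simp only: has_field_derivative_def)
      qed
      have B'c: "continuous_on UNIV B'"
      proof -
        have "continuous_on ({..0} \<union> {0..}) (\<lambda>t. if t \<le> 0 then bump' t else 0)"
          by (rule continuous_on_If) (auto intro: bump'_continuous simp: bump'_sign(4))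
        moreover have "{..0} \<union> {0..} = (UNIV :: real set)" by auto
        ultimately show ?thesis by (simp add: B'_def[abs_def])
      qed
      have Bc: "continuous_on UNIV B" by (intro continuous_at_imp_continuous_on ballI DERIV_isCont[OF B_der])
      have Bhc: "continuous_on UNIV (\<lambda>x. B (real m * h x))" "continuous_on UNIV (\<lambda>x. B' (real m * h x))" for m
        by (rule continuous_on_compose2[OF Bc] continuous_on_compose2[OF B'c]; auto intro!: continuous_intros hc)+
      have der: "((\<lambda>x. B (real m * h x) * \<psi> x) has_derivative
          (\<lambda>y. B (real m * h x) * \<psi>' x y + (B' (real m * h x) * (real m * (a \<bullet> y))) * \<psi> x)) (at x)" for m x
        by (intro has_derivative_mult \<psi>_der has_derivative_compose[OF _ B_der[unfolded has_field_derivative_def]]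
            has_derivative_mult_right h_der)
      have \<psi>'N: "\<psi>' x N = bump' (h x / \<delta>) / \<delta> * \<kappa> x" for x using N \<kappa>'N by (simp add: \<psi>'_def)
      have i1: "integrable lborel (\<lambda>x. B (real m * h x) * \<psi>' x N)" for m
        by (rule integrable_compact_support[OF _ K(1)]) (auto intro!: continuous_on_mult Bhc \<psi>'c simp: \<psi>'0)
      have i2: "integrable lborel (\<lambda>x. B' (real m * h x) * real m * \<psi> x)" for m
        by (rule integrable_compact_support[OF _ K(1)]) (auto intro!: continuous_intros Bhc \<psi>c simp: \<psi>0)
      have L: "L m = - (LINT x|lborel. B (real m * h x) * \<psi>' x N)" for m
      proof -
        have "(LINT x|lborel. (\<lambda>x y. B (real m * h x) * \<psi>' x y + (B' (real m * h x) * (real m * (a \<bullet> y))) * \<psi> x) x N) = 0"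
        proof (rule integral_derivative_eq_0[OF der _ K(1)])
          show "continuous_on UNIV (\<lambda>x. B (real m * h x) * \<psi>' x N + (B' (real m * h x) * (real m * (a \<bullet> N))) * \<psi> x)"
            by (intro continuous_intros Bhc \<psi>c \<psi>'c)
        qed (simp add: \<psi>0)
        then have "(LINT x|lborel. B (real m * h x) * \<psi>' x N) + (LINT x|lborel. B' (real m * h x) * real m * \<psi> x) = 0"
          using i1[of m] i2[of m] by (simp add: N)
        moreover have "B' (real m * h x) * real m * \<psi> x = indicator ?neg x * (real m * bump' (real m * h x) * \<psi> x)" for x
        proof (cases "h x < 0")
          case True then show ?thesis by (simp add: B'_def mult_nonneg_nonpos)
        next
          case False
          then show ?thesis using bump'_sign(4) by (cases "real m * h x = 0") (auto simp: B'_def mult_le_0_iff)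
        qed
        ultimately show ?thesis by (simp add: L_def)
      qed
      have "(\<lambda>m. LINT x|lborel. B (real m * h x) * \<psi>' x N) \<longlonglongrightarrow> (LINT x|lborel. indicator {x. 0 < h x} x * (bump 0 * \<psi>' x N))"
      proof (rule integral_dominated_convergence[where w = "\<lambda>x. \<bar>\<psi>' x N\<bar>"])
        show "integrable lborel (\<lambda>x. \<bar>\<psi>' x N\<bar>)"
          by (intro integrable_abs integrable_compact_support[OF \<psi>'c K(1)]) (simp add: \<psi>'0)
        show "(\<lambda>x. indicator {x. 0 < h x} x * (bump 0 * \<psi>' x N)) \<in> borel_measurable lborel"
          using hm borel_measurable_continuous_onI[OF \<psi>'c] by measurable
        show "AE x in lborel. (\<lambda>m. B (real m * h x) * \<psi>' x N) \<longlonglongrightarrow> indicator {x. 0 < h x} x * (bump 0 * \<psi>' x N)"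
          using AEh(1)
        proof eventually_elim
          case (elim x)
          show ?case
          proof (cases "0 < h x")
            case True
            then have "\<forall>m. B (real m * h x) = bump 0" by (auto simp: B_def mult_le_0_iff)
            then show ?thesis using True by simp
          next
            case False
            then have neg: "h x < 0" using elim by simp
            have "\<forall>\<^sub>F m in sequentially. 1 / \<bar>h x\<bar> \<le> real m"
              using filterlim_real_sequentially by (simp add: filterlim_at_top)
            then have "\<forall>\<^sub>F m in sequentially. B (real m * h x) * \<psi>' x N = 0"
            proof eventually_elim
              case (elim m)
              then have "1 \<le> \<bar>real m * h x\<bar>" using neg by (simp add: abs_mult field_simps)
              then have "bump (real m * h x) = 0" by (rule bump_bounds(3))
              then show ?case using neg by (simp add: B_def mult_nonneg_nonpos)
            qed
            then show ?thesis using neg by (simp add: tendsto_eventually)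
          qed
        qed
        show "AE x in lborel. norm (B (real m * h x) * \<psi>' x N) \<le> \<bar>\<psi>' x N\<bar>" for m
          using bump_bounds(1,2) by (intro AE_I2) (simp add: abs_mult mult_left_le_one_le B_def)
      qed (use i1 in auto)
      then have "L \<longlonglongrightarrow> - (LINT x|lborel. indicator {x. 0 < h x} x * (bump 0 * \<psi>' x N))"
        unfolding L[abs_def] by (rule tendsto_minus)
      also have "- (LINT x|lborel. indicator {x. 0 < h x} x * (bump 0 * \<psi>' x N)) = \<Lambda>"
        unfolding \<Lambda>_def \<psi>'N
        by (subst Bochner_Integration.integral_minus[symmetric], rule Bochner_Integration.integral_cong) auto
      finally show ?thesis .
    qed
    ultimately have "b * \<Lambda> \<le> s * 0"
      by (intro LIMSEQ_le[OF tendsto_mult_left[of L \<Lambda> _ b]]) auto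
    then show False using b \<open>0 < \<Lambda>\<close> by (simp add: mult_le_0_iff)
  qed
  then have "G y = 0" if "y \<in> {x. h x = 0}" for y
  proof (intro pol_eq_0_on_affine[OF Gpol _ openU _ _ _ that])
    have "{x. h x = 0} = {x. a \<bullet> x = - c}" by (auto simp: h_def)
    then show "affine {x. h x = 0}" using affine_hyperplane by metis
    have sub: "{u, v} \<subseteq> C" "{u, v} \<noteq> {}" using uv by auto
    show "pull {u, v} \<in> {x. h x = 0}" using lam_pull[OF sub(1)] uv by (simp add: h)
    have card2: "finite {u, v}" "card {u, v} \<le> 2" by (auto simp: card_insert_if)
    obtain w where w: "w \<in> C - {u, v}" using another_vertex[OF card2] by blast
    show "pull {u, v} \<in> U" unfolding U_def using lam_pull_less[OF sub] w by auto
  qed auto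
  then show ?thesis using x h unfolding a_eq G_def q_def by simp
qed

text \<open>
  The product of the jump with \<open>D u - D v\<close> vanishes on the interface; contraction with a transversal vector recovers the
  tangential part of the jump.
\<close>

lemma tan_cont_if_weak_d:
  assumes p: "fam r k p" and \<omega>: "represents \<omega> p" and \<xi>: "\<xi> \<in> L2_forms T (Suc k)" and wd: "weak_d T k \<omega> \<xi>"
  shows "tan_cont p"
  unfolding tan_cont_def
proof (intro ballI allI impI)
  fix u v x vs assume uv: "u \<in> C" "v \<in> C" and x: "lam u x = lam v x" and vs: "\<forall>y\<in>set vs. D u \<bullet> y = D v \<bullet> y"
  show "p u x vs = p v x vs"
  proof (cases "u \<noteq> v \<and> length vs = k")
    case True
    let ?a = "\<lambda>y. D u \<bullet> y - D v \<bullet> y" and ?w = "\<lambda>ws. p u x ws - p v x ws"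
    have alt: "alternating k ?w"
      using poly_forms_alternating[OF famD[OF p uv(1)]] poly_forms_alternating[OF famD[OF p uv(2)]]
      by (intro alternating_diff)
    have "wedge k ?a ?w V = 0" for V
    proof (rule alternating_eqI_spanning[OF alternating_wedge[OF linear_D_diff alt] span_axes])
      fix vs :: "(real^'n) list" assume V: "length vs = Suc k" "set vs \<subseteq> range (\<lambda>i. axis i 1)"
      then obtain js where js: "vs = vecs js" unfolding vecs_def by (blast elim: set_subset_axes_imp_map)
      then show "wedge k ?a ?w vs = 0"
        using no_tangential_jump[OF p \<omega> \<xi> wd uv _ _ x, of js] True V by (simp add: vecs_def)
    qed
    moreover have "wedge k ?a ?w ((u - v) # vs) = ?a (u - v) * ?w vs"
      using True vs by (intro wedge_Cons_kernel) auto
    moreover have "?a (u - v) = 2" using uv True by (auto simp: lam_diff lam_vertex)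
    ultimately show ?thesis by simp
  next
    case False
    then show ?thesis
      using alternating_length[OF poly_forms_alternating[OF famD[OF p uv(1)]]]
        alternating_length[OF poly_forms_alternating[OF famD[OF p uv(2)]]] by auto
  qed
qed


text \<open>
  Testing inside a single cell, where Stokes' formula applies to the polynomial form, determines a
  continuous weak derivative there, and by continuity on the closed cell.
\<close>

lemma continuous_weak_d_eq:
  assumes p: "fam r k p" and \<omega>: "represents \<omega> p" and \<xi>: "\<xi> \<in> C0_forms T (Suc k)" and wd: "weak_d T k \<omega> \<xi>"
    and v: "v \<in> C" and x: "x \<in> cell v"
  shows "\<xi> x = ext_d k (p v) x"
proof
  fix vs
  have alt\<xi>: "alternating (Suc k) (\<xi> x)" using \<xi> by (simp add: C0_forms_def forms_on_def)
  note dp = poly_forms_ext_d[OF famD[OF p v]]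
  have js_eq: "\<xi> x (vecs js) = ext_d k (p v) x (vecs js)" if js: "length js = Suc k" for js
  proof -
    have form: "form_coeff \<xi> js x = \<xi> x (vecs js)" for x by (simp add: form_coeff_def vecs_def)
    have \<xi>c: "continuous_on (cell v) (form_coeff \<xi> js)"
      using \<xi> cell_subset[OF v] by (auto simp: C0_forms_def intro: continuous_on_subset)
    have dc: "continuous_on S (\<lambda>x. ext_d k (p v) x (vecs js))" for S by (rule pol_continuous[OF poly_forms_pol[OF dp]])
    have "form_coeff \<xi> js x0 = ext_d k (p v) x0 (vecs js)" if x0: "x0 \<in> ocell v" for x0
    proof (rule ccontr)
      define e where "e x = form_coeff \<xi> js x - ext_d k (p v) x (vecs js)" for x
      assume "form_coeff \<xi> js x0 \<noteq> ext_d k (p v) x0 (vecs js)"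
      then have e0: "e x0 \<noteq> 0" by (simp add: e_def)
      define s where "s = sgn (e x0)"
      have s0: "0 < s * e x0" using e0 by (auto simp: s_def sgn_if)
      have ec: "continuous_on (ocell v) e"
        unfolding e_def[abs_def] using continuous_on_subset[OF \<xi>c ocell_subset_cell] by (intro continuous_on_diff dc)
      let ?U = "ocell v \<inter> (\<lambda>x. s * e x) -` {0<..}"
      have "open ?U" using open_ocell ec by (intro continuous_open_preimage continuous_on_mult continuous_on_const) auto
      moreover have "x0 \<in> ?U" using x0 s0 by simp
      ultimately obtain \<psi> K where \<psi>: "ridge \<psi>" "\<And>x. 0 \<le> \<psi> x" "0 < \<psi> x0" and K: "compact K" "K \<subseteq> ?U" "\<And>x. x \<notin> K \<Longrightarrow> \<psi> x = 0"
        by (rule exists_bump) blast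
      have Ko: "K \<subseteq> ocell v" using K(2) by blast
      have sm: "smooth \<psi>" by (rule ridge_smooth[OF \<psi>(1)])
      let ?d\<psi> = "\<lambda>x. frechet_derivative \<psi> (at x)"
      have test: "test_function (interior T) \<psi>"
        using Ko ocell_subset_interior[OF v] by (intro test_functionI[OF \<psi>(1) K(1) _ K(3)]) auto
      have d0: "?d\<psi> x = (\<lambda>y. 0)" if "x \<notin> K" for x
        using derivative_0_off_support[OF smooth_has_derivative[OF sm] compact_imp_closed[OF K(1)] K(3) that] .
      have "(LINT x|lebesgue_on T. (\<Sum>l\<le>k. (-1) ^ l * form_coeff \<omega> (take l js @ drop (Suc l) js) x * partial (js ! l) \<psi> x))
          = - (LINT x|lebesgue_on T. form_coeff \<xi> js x * \<psi> x)"
        using wd test js unfolding weak_d_def by blast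
      then have 1: "(LINT x|lborel. (\<Sum>w\<in>C. indicator (ocell w) x * wedge k (?d\<psi> x) (p w x) (vecs js)))
          = - (LINT x|lebesgue_on T. form_coeff \<xi> js x * \<psi> x)"
        unfolding weak_lhs[OF p \<omega> sm js] .
      have "(\<Sum>w\<in>C. indicator (ocell w) x * wedge k (?d\<psi> x) (p w x) (vecs js)) = wedge k (?d\<psi> x) (p v x) (vecs js)" for x
      proof (cases "x \<in> K")
        case True then show ?thesis using Ko by (intro sum_ocell[OF v]) auto
      qed (simp add: d0 wedge_def alt_sum_def)
      then have 2: "(LINT x|lborel. (\<Sum>w\<in>C. indicator (ocell w) x * wedge k (?d\<psi> x) (p w x) (vecs js)))
          = - (LINT x|lborel. \<psi> x * ext_d k (p v) x (vecs js))"
        using integral_d_form(3)[OF famD[OF p v] smooth_has_derivative[OF sm] smooth_continuous_derivative[OF sm] K(1) K(3), of "vecs js"]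
        by simp
      have \<psi>m: "continuous_on S \<psi>" for S by (rule smooth_continuous[OF sm])
      have i\<xi>: "integrable lborel (\<lambda>x. indicator K x *\<^sub>R (form_coeff \<xi> js x * \<psi> x))"
        using Ko ocell_subset_cell[of v]
        by (intro borel_integrable_compact K(1) continuous_on_mult \<psi>m continuous_on_subset[OF \<xi>c]) auto
      have id: "integrable lborel (\<lambda>x. \<psi> x * ext_d k (p v) x (vecs js))"
        by (rule integrable_compact_support[OF continuous_on_mult[OF \<psi>m dc] K(1)]) (simp add: K(3))
      have 3: "(LINT x|lebesgue_on T. form_coeff \<xi> js x * \<psi> x) = (LINT x|lborel. indicator K x *\<^sub>R (form_coeff \<xi> js x * \<psi> x))"
      proof -
        let ?g = "\<lambda>w x. indicator K x *\<^sub>R (form_coeff \<xi> js x * \<psi> x)"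
        have "(LINT x|lebesgue_on T. form_coeff \<xi> js x * \<psi> x) = (LINT x|lborel. (\<Sum>w\<in>C. indicator (ocell w) x * ?g w x))"
        proof (rule integral_T(1))
          show "AE x in lebesgue. \<forall>w\<in>C. x \<in> ocell w \<longrightarrow> form_coeff \<xi> js x * \<psi> x = ?g w x"
            using K(3) by (intro AE_I2) (auto simp: indicator_def)
          show "?g w \<in> borel_measurable borel" for w using i\<xi> by simp
        qed
        also have "(\<lambda>x. \<Sum>w\<in>C. indicator (ocell w) x * ?g w x) = ?g v"
        proof
          fix x show "(\<Sum>w\<in>C. indicator (ocell w) x * ?g w x) = ?g v x"
          proof (cases "x \<in> K")
            case True then show ?thesis using Ko by (subst sum_ocell[OF v]) auto
          qed simp
        qed
        finally show ?thesis .
      qed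
      have "(LINT x|lborel. indicator K x *\<^sub>R (form_coeff \<xi> js x * \<psi> x)) = (LINT x|lborel. \<psi> x * ext_d k (p v) x (vecs js))"
        using 1 2 3 by simp
      then have "0 = s * ((LINT x|lborel. indicator K x *\<^sub>R (form_coeff \<xi> js x * \<psi> x)) - (LINT x|lborel. \<psi> x * ext_d k (p v) x (vecs js)))"
        by simp
      also have "\<dots> = (LINT x|lborel. s * (indicator K x *\<^sub>R (form_coeff \<xi> js x * \<psi> x) - \<psi> x * ext_d k (p v) x (vecs js)))"
        using i\<xi> id by simp
      also have "(\<lambda>x. s * (indicator K x *\<^sub>R (form_coeff \<xi> js x * \<psi> x) - \<psi> x * ext_d k (p v) x (vecs js)))
          = (\<lambda>x. \<psi> x * (s * e x))"
        using K(3) by (auto simp: fun_eq_iff indicator_def e_def algebra_simps)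
      finally have zero: "0 = (LINT x|lborel. \<psi> x * (s * e x))" .
      have "integrable lborel (\<lambda>x. s * (indicator K x *\<^sub>R (form_coeff \<xi> js x * \<psi> x) - \<psi> x * ext_d k (p v) x (vecs js)))"
        using i\<xi> id by (intro integrable_mult_right Bochner_Integration.integrable_diff)
      moreover have "(\<lambda>x. s * (indicator K x *\<^sub>R (form_coeff \<xi> js x * \<psi> x) - \<psi> x * ext_d k (p v) x (vecs js)))
          = (\<lambda>x. \<psi> x * (s * e x))"
        using K(3) by (auto simp: fun_eq_iff indicator_def e_def algebra_simps)
      ultimately have int: "integrable lborel (\<lambda>x. \<psi> x * (s * e x))" by (simp only:)
      have pos: "0 < s * e x" if "\<psi> x \<noteq> 0" for x using K(2,3) that by blast
      have "0 < (LINT x|lborel. \<psi> x * (s * e x))"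
      proof (rule integral_pos_if_pos_on_open[OF int, of "{x. 0 < \<psi> x}" x0])
        show "0 \<le> \<psi> x * (s * e x)" for x
          using \<psi>(2)[of x] pos[of x] by (cases "\<psi> x = 0") (auto intro: mult_nonneg_nonneg less_imp_le)
        show "open {x. 0 < \<psi> x}" by (intro open_Collect_less continuous_on_const \<psi>m)
        show "0 < \<psi> x * (s * e x)" if "x \<in> {x. 0 < \<psi> x}" for x
          using that by (intro mult_pos_pos[OF _ pos]) auto
      qed (use \<psi>(3) in simp)
      then show False using zero by simp
    qed
    from eq_on_cell_if_eq_on_ocell[OF v \<xi>c dc this x] show ?thesis by (simp add: form)
  qed
  have "alternating (Suc k) (\<lambda>vs. \<xi> x vs - ext_d k (p v) x vs)"
    by (rule alternating_diff[OF alt\<xi> poly_forms_alternating[OF dp]])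
  then have "\<xi> x vs - ext_d k (p v) x vs = 0"
  proof (rule alternating_eqI_spanning[OF _ span_axes])
    fix vs :: "(real^'n) list" assume V: "length vs = Suc k" "set vs \<subseteq> range (\<lambda>i. axis i 1)"
    then obtain js where "vs = vecs js" unfolding vecs_def by (blast elim: set_subset_axes_imp_map)
    then show "\<xi> x vs - ext_d k (p v) x vs = 0" using js_eq[of js] V by (simp add: vecs_def)
  qed
  then show "\<xi> x vs = ext_d k (p v) x vs" by simp
qed

lemma flat'_weighted_bound: "\<bar>flat' s * (s + 1)\<bar> \<le> 3"
proof (cases "0 < s")
  case True
  define y where "y = 1 / s"
  have y: "0 < y" using True by (simp add: y_def)
  have "flat' s * (s + 1) = y * exp (- y) + y\<^sup>2 * exp (- y)"
    using True by (simp add: flat'_def y_def field_simps power2_eq_square)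
  moreover have "y * exp (- y) \<le> 1" using mult_exp_bounds[of y] y by simp
  moreover have "y\<^sup>2 * exp (- y) \<le> 2"
  proof -
    have "y\<^sup>2 / 2 \<le> exp y" using exp_lower_Taylor_quadratic[of y] y by simp
    then show ?thesis by (simp add: exp_minus field_simps)
  qed
  moreover have "0 \<le> y * exp (- y)" "0 \<le> y\<^sup>2 * exp (- y)" using y by simp_all
  ultimately show ?thesis by linarith
next
  case False then show ?thesis by (simp add: flat'_def)
qed

lemma flat'_weighted_tendsto:
  assumes "0 < (t::real)"
  shows "(\<lambda>m. flat' (real m * t - 1) * (real m * t)) \<longlonglongrightarrow> 0" "(\<lambda>m. flat (real m * t - 1)) \<longlonglongrightarrow> 1"
proof -
  have lim: "filterlim (\<lambda>m. real m * t - 1) at_top sequentially"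
    using assms unfolding diff_conv_add_uminus
    by (intro filterlim_tendsto_add_at_top_iff[THEN iffD2, OF tendsto_const] filterlim_at_top_mult_tendsto_pos[OF tendsto_const _ filterlim_real_sequentially] |
        subst add.commute)+
  have inv: "((\<lambda>s::real. 1 / s) \<longlongrightarrow> 0) at_top"
    using tendsto_inverse_0_at_top[OF filterlim_ident] by (simp add: inverse_eq_divide)
  have exp: "((\<lambda>s::real. exp (- (1 / s))) \<longlongrightarrow> exp (- 0)) at_top" by (intro tendsto_intros inv)
  have ev: "\<forall>\<^sub>F s in at_top. (0::real) < s" by (rule eventually_gt_at_top)
  have "((\<lambda>s::real. exp (- (1 / s)) * (1 / s + 1 / s * (1 / s))) \<longlongrightarrow> exp (- 0) * (0 + 0 * 0)) at_top"
    by (intro tendsto_mult tendsto_add inv exp)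
  moreover have "\<forall>\<^sub>F s in at_top. exp (- (1 / s)) * (1 / s + 1 / s * (1 / s)) = flat' s * (s + 1)"
    using ev by eventually_elim (simp add: flat'_def field_simps power2_eq_square)
  ultimately have "((\<lambda>s. flat' s * (s + 1)) \<longlongrightarrow> exp (- 0) * (0 + 0 * 0)) at_top"
    by (rule Lim_transform_eventually)
  then have "((\<lambda>s. flat' s * (s + 1)) \<longlongrightarrow> 0) at_top" by simp
  from filterlim_compose[OF this lim] show "(\<lambda>m. flat' (real m * t - 1) * (real m * t)) \<longlonglongrightarrow> 0" by simp
  have "\<forall>\<^sub>F s in at_top. exp (- (1 / s)) = flat s"
    using ev by eventually_elim (simp add: flat_def)
  with exp have "(flat \<longlongrightarrow> exp (- 0)) at_top" by (rule Lim_transform_eventually)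
  then have "(flat \<longlongrightarrow> 1) at_top" by simp
  from filterlim_compose[OF this lim] show "(\<lambda>m. flat (real m * t - 1)) \<longlonglongrightarrow> 1" .
qed

text \<open>
  The form is cut off near the boundary by products of \<open>flat (m lam w - 1)\<close>.  In the derivative of the cutoff, \<open>m flat' (m lam w - 1)\<close> is compensated by the
  factor \<open>lam v\<close> that is contained in the form on the cell of \<open>v\<close>, where \<open>lam v \<le> lam w\<close>.
\<close>

lemma integral_d_zero:
  assumes p: "fam r k p" and fc: "full_cont p" and fz: "full_zero p"
  shows "(LINT x|lborel. (\<Sum>v\<in>C. indicator (ocell v) x * ext_d k (p v) x vs)) = 0"
proof -
  let ?f = "\<lambda>m w x. flat (real m * lam w x - 1)" and ?f' = "\<lambda>m w x. flat' (real m * lam w x - 1)"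
  define \<phi> where "\<phi> m x = (\<Prod>w\<in>C. ?f m w x)" for m x
  define \<phi>' where "\<phi>' m x y = (\<Sum>w\<in>C. (?f' m w x * real m * (\<Prod>u\<in>C - {w}. ?f m u x)) * (D w \<bullet> y))" for m x y
  have f_arg: "real m * lam w x - 1 = (real m *\<^sub>R D w) \<bullet> x + (real m * c0 w - 1)" for m w x
    by (simp add: lam_def algebra_simps)
  have "ridge (?f m w)" for m w unfolding f_arg by (rule ridge.comp[OF smooth1_flat])
  then have \<phi>_ridge: "ridge (\<phi> m)" for m unfolding \<phi>_def[abs_def] by (rule ridge_prod)
  note sm = ridge_smooth[OF \<phi>_ridge]
  have f_der: "(?f m w has_derivative (\<lambda>y. ?f' m w x * (real m * (D w \<bullet> y)))) (at x)" for m w x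
    by (rule has_derivative_compose[OF _ flat_DERIV[unfolded has_field_derivative_def]])
       (auto intro!: derivative_eq_intros lam_has_derivative)
  have \<phi>_der: "(\<phi> m has_derivative \<phi>' m x) (at x)" for m x
    unfolding \<phi>_def[abs_def]
    by (rule has_derivative_eq_rhs[OF has_derivative_prod[OF f_der]]) (simp add: \<phi>'_def fun_eq_iff mult_ac)
  have fd: "frechet_derivative (\<phi> m) (at x) = \<phi>' m x" for m x using frechet_derivative_at[OF \<phi>_der] by simp
  define K where "K m = T \<inter> (\<Inter>w\<in>C. {x. 1 \<le> real m * lam w x})" for m
  have K: "compact (K m)" "K m \<subseteq> interior T" for m
  proof -
    have "closed (\<Inter>w\<in>C. {x. 1 \<le> real m * lam w x})"
      by (intro closed_INT ballI closed_Collect_le continuous_intros lam_continuous)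
    then show "compact (K m)" unfolding K_def by (intro compact_Int_closed compact_T)
    show "K m \<subseteq> interior T"
      unfolding K_def interior_eq
    proof clarify
      fix x w assume "x \<in> (\<Inter>w\<in>C. {x. 1 \<le> real m * lam w x})" and w: "w \<in> C"
      then have "0 < real m * lam w x" by force
      then show "0 < lam w x" by (simp add: zero_less_mult_iff)
    qed
  qed
  have \<phi>0: "\<phi> m x = 0" if "x \<notin> K m" for m x
  proof -
    have "\<exists>w\<in>C. real m * lam w x < 1"
    proof (cases "x \<in> T")
      case True then show ?thesis using that by (auto simp: K_def not_le)
    next
      case False
      then obtain w where "w \<in> C" "lam w x < 0" by (auto simp: hull_eq not_le)
      then show ?thesis by (intro bexI[of _ w]) (auto intro: le_less_trans[OF mult_nonneg_nonpos])
    qed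
    then obtain w where "w \<in> C" "flat (real m * lam w x - 1) = 0" using flat_bounds(5) by (metis diff_le_0_iff_le less_imp_le)
    then show ?thesis unfolding \<phi>_def using finite_C by (intro prod_zero) auto
  qed
  have g: "\<exists>g. g \<in> poly_forms (r - 1) k \<and> (\<forall>x vs. p v x vs = lam v x * g x vs)" if v: "v \<in> C" for v
  proof -
    obtain w where w: "w \<in> C" "w \<noteq> v" "D v \<bullet> (v - w) = 1" using exists_unit_normal[OF v] .
    have "p v x vs = 0" if "D v \<bullet> x + c0 v = 0" for x vs
      using fz v that by (simp add: full_zero_def lam_def)
    from poly_forms_divide[OF famD[OF p v] w(3) this] show ?thesis by (metis lam_def)
  qed
  then obtain g where g: "\<And>v. v \<in> C \<Longrightarrow> g v \<in> poly_forms (r - 1) k"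
    "\<And>v x vs. v \<in> C \<Longrightarrow> p v x vs = lam v x * g v x vs" by metis
  have gc: "continuous_on UNIV (\<lambda>x. wedge k (\<lambda>y. D w \<bullet> y) (g v x) vs)" if "v \<in> C" for v w
    by (rule wedge_continuous[OF continuous_on_const g(1)[OF that]])
  have ec: "continuous_on UNIV (\<lambda>x. ext_d k (p v) x vs)" if "v \<in> C" for v
    by (rule pol_continuous[OF poly_forms_pol[OF poly_forms_ext_d[OF famD[OF p that]]]])
  have sub: "ocell v \<subseteq> T" if "v \<in> C" for v using that ocell_subset_cell cell_subset by blast
  have int: "integrable lborel (\<lambda>x. indicator (ocell v) x * f x)" if "v \<in> C" "continuous_on UNIV f" for v and f :: "real^'n \<Rightarrow> real"
    using sub[OF that(1)] open_ocell compact_T by (intro integrable_indicator_continuous[OF that(2)]) auto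
  let ?A = "\<lambda>m v x. wedge k (\<phi>' m x) (p v x) vs + \<phi> m x * ext_d k (p v) x vs"
  let ?w = "\<lambda>v x. (\<Sum>w\<in>C. 3 * \<bar>wedge k (\<lambda>y. D w \<bullet> y) (g v x) vs\<bar>) + \<bar>ext_d k (p v) x vs\<bar>"
  have "(\<lambda>m. LINT x|lborel. (\<Sum>v\<in>C. indicator (ocell v) x * ?A m v x)) \<longlonglongrightarrow>
      (LINT x|lborel. (\<Sum>v\<in>C. indicator (ocell v) x * ext_d k (p v) x vs))"
  proof (rule integral_dominated_convergence[where w = "\<lambda>x. \<Sum>v\<in>C. indicator (ocell v) x * ?w v x"])
    have wpos: "0 \<le> ?w v x" for v x by (intro add_nonneg_nonneg sum_nonneg) auto
    show "(\<lambda>x. \<Sum>v\<in>C. indicator (ocell v) x * ext_d k (p v) x vs) \<in> borel_measurable lborel"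
      using borel_measurable_continuous_onI[OF ec] open_ocell by simp
    have "continuous_on UNIV (?A m v)" if "v \<in> C" for m v
      using smooth_continuous_derivative[OF sm[of m]] unfolding fd
      by (intro continuous_on_add continuous_on_mult ec that smooth_continuous[OF sm] wedge_continuous[OF _ famD[OF p that]])
    from borel_measurable_continuous_onI[OF this]
    show "(\<lambda>x. \<Sum>v\<in>C. indicator (ocell v) x * ?A m v x) \<in> borel_measurable lborel" for m
      using open_ocell by simp
    show "integrable lborel (\<lambda>x. \<Sum>v\<in>C. indicator (ocell v) x * ?w v x)"
      by (intro Bochner_Integration.integrable_sum int continuous_intros gc ec) auto
    have split: "wedge k (\<phi>' m x) (p v x) vs = (\<Sum>w\<in>C. (?f' m w x * real m * lam v x) * (\<Prod>u\<in>C - {w}. ?f m u x)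
        * wedge k (\<lambda>y. D w \<bullet> y) (g v x) vs)" if v: "v \<in> C" for m v x
    proof -
      have "p v x = (\<lambda>vs. lam v x * g v x vs)" using g(2)[OF v] by blast
      then show ?thesis unfolding \<phi>'_def[abs_def] wedge_sum_left by (simp add: wedge_scale mult_ac)
    qed
    have prod1: "0 \<le> (\<Prod>u\<in>U. ?f m u x)" "(\<Prod>u\<in>U. ?f m u x) \<le> 1" for U m x
      by (intro prod_nonneg flat_bounds ballI) (intro prod_le_1 conjI flat_bounds)
    have coef: "\<bar>(?f' m w x * real m * lam v x) * (\<Prod>u\<in>C - {w}. ?f m u x)\<bar> \<le> \<bar>?f' m w x * (real m * lam w x)\<bar>"
      if v: "v \<in> C" "x \<in> ocell v" and w: "w \<in> C" for m v w x
    proof -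
      have l: "0 \<le> lam v x" "lam v x \<le> lam w x" using ocell_subset_cell v w by (auto simp: cell_def)
      have "\<bar>(?f' m w x * real m * lam v x) * (\<Prod>u\<in>C - {w}. ?f m u x)\<bar> \<le> \<bar>?f' m w x * real m * lam v x\<bar>"
        using prod1 by (simp add: abs_mult mult_left_le)
      also have "\<dots> \<le> \<bar>?f' m w x * (real m * lam w x)\<bar>"
        using l flat_bounds(3) by (simp add: abs_mult mult_left_mono mult.assoc)
      finally show ?thesis .
    qed
    show "AE x in lborel. (\<lambda>m. \<Sum>v\<in>C. indicator (ocell v) x * ?A m v x) \<longlonglongrightarrow> (\<Sum>v\<in>C. indicator (ocell v) x * ext_d k (p v) x vs)"
    proof (rule AE_I2)
      fix x
      have "(\<lambda>m. indicator (ocell v) x * ?A m v x) \<longlonglongrightarrow> indicator (ocell v) x * ext_d k (p v) x vs" if v: "v \<in> C" for v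
      proof (cases "x \<in> ocell v")
        case True
        have pos: "0 < lam w x" if "w \<in> C" for w
          using ocell_subset_interior[OF v] True that by (auto simp: interior_eq)
        have "(\<lambda>m. \<Sum>w\<in>C. (?f' m w x * real m * lam v x) * (\<Prod>u\<in>C - {w}. ?f m u x)
            * wedge k (\<lambda>y. D w \<bullet> y) (g v x) vs) \<longlonglongrightarrow> (\<Sum>w\<in>C. 0)"
        proof (intro tendsto_sum tendsto_mult_left_zero)
          fix w assume w: "w \<in> C"
          show "(\<lambda>m. (?f' m w x * real m * lam v x) * (\<Prod>u\<in>C - {w}. ?f m u x)) \<longlonglongrightarrow> 0"
          proof (rule Lim_null_comparison[OF always_eventually])
            show "\<forall>m. norm ((?f' m w x * real m * lam v x) * (\<Prod>u\<in>C - {w}. ?f m u x)) \<le> \<bar>?f' m w x * (real m * lam w x)\<bar>"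
              unfolding real_norm_def by (rule allI) (rule coef[OF v True w])
            show "(\<lambda>m. \<bar>?f' m w x * (real m * lam w x)\<bar>) \<longlonglongrightarrow> 0"
              by (rule tendsto_rabs_zero[OF flat'_weighted_tendsto(1)[OF pos[OF w]]])
          qed
        qed
        then have "(\<lambda>m. wedge k (\<phi>' m x) (p v x) vs) \<longlonglongrightarrow> 0" unfolding split[OF v] by simp
        moreover have "(\<lambda>m. \<phi> m x) \<longlonglongrightarrow> (\<Prod>w\<in>C. 1)"
          unfolding \<phi>_def using pos by (intro tendsto_prod flat'_weighted_tendsto(2)) auto
        ultimately have "(\<lambda>m. ?A m v x) \<longlonglongrightarrow> 0 + (\<Prod>w\<in>C. 1) * ext_d k (p v) x vs"
          by (intro tendsto_add tendsto_mult tendsto_const)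
        then show ?thesis using True by simp
      qed simp
      then show "(\<lambda>m. \<Sum>v\<in>C. indicator (ocell v) x * ?A m v x) \<longlonglongrightarrow> (\<Sum>v\<in>C. indicator (ocell v) x * ext_d k (p v) x vs)"
        by (rule tendsto_sum)
    qed
    show "AE x in lborel. norm (\<Sum>v\<in>C. indicator (ocell v) x * ?A m v x) \<le> (\<Sum>v\<in>C. indicator (ocell v) x * ?w v x)" for m
    proof (rule AE_I2)
      fix x
      have "\<bar>indicator (ocell v) x * ?A m v x\<bar> \<le> indicator (ocell v) x * ?w v x" if v: "v \<in> C" for v
      proof (cases "x \<in> ocell v")
        case True
        have "\<bar>wedge k (\<phi>' m x) (p v x) vs\<bar> \<le> (\<Sum>w\<in>C. 3 * \<bar>wedge k (\<lambda>y. D w \<bullet> y) (g v x) vs\<bar>)"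
          unfolding split[OF v]
        proof (rule order_trans[OF sum_abs sum_mono])
          fix w assume w: "w \<in> C"
          have "\<bar>?f' m w x * (real m * lam w x)\<bar> \<le> 3" using flat'_weighted_bound[of "real m * lam w x - 1"] by simp
          then have "\<bar>(?f' m w x * real m * lam v x) * (\<Prod>u\<in>C - {w}. ?f m u x)\<bar> \<le> 3" using coef[OF v True w, of m] by linarith
          then show "\<bar>(?f' m w x * real m * lam v x) * (\<Prod>u\<in>C - {w}. ?f m u x) * wedge k (\<lambda>y. D w \<bullet> y) (g v x) vs\<bar>
              \<le> 3 * \<bar>wedge k (\<lambda>y. D w \<bullet> y) (g v x) vs\<bar>"
            unfolding abs_mult[of "(?f' m w x * real m * lam v x) * (\<Prod>u\<in>C - {w}. ?f m u x)"] by (rule mult_right_mono) simp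
        qed
        moreover have "\<bar>\<phi> m x * ext_d k (p v) x vs\<bar> \<le> \<bar>ext_d k (p v) x vs\<bar>"
          using prod1[of m x C] by (simp add: \<phi>_def abs_mult mult_left_le_one_le)
        ultimately show ?thesis using True by simp
      qed simp
      then show "norm (\<Sum>v\<in>C. indicator (ocell v) x * ?A m v x) \<le> (\<Sum>v\<in>C. indicator (ocell v) x * ?w v x)"
        unfolding real_norm_def by (intro order_trans[OF sum_abs sum_mono]) blast
    qed
  qed
  moreover have "(LINT x|lborel. (\<Sum>v\<in>C. indicator (ocell v) x * ?A m v x)) = 0" for m
    using piecewise_stokes[OF p full_cont_imp_tan_cont[OF fc] sm K \<phi>0, of m m vs] by (simp add: fd)
  ultimately show ?thesis by (simp add: LIMSEQ_const_iff)
qed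

end


section \<open>Dimension counts\<close>

definition fin_dim :: "'a::real_vector set \<Rightarrow> bool" where
  "fin_dim S \<longleftrightarrow> (\<exists>B. finite B \<and> S \<subseteq> span B)"

lemma fin_dim_subset: "fin_dim S \<Longrightarrow> R \<subseteq> S \<Longrightarrow> fin_dim R"
  unfolding fin_dim_def by (meson order_trans)

lemma fin_dim_image: assumes "linear f" "fin_dim S" shows "fin_dim (f ` S)"
proof -
  obtain B where "finite B" "S \<subseteq> span B" using assms(2) by (auto simp: fin_dim_def)
  then have "f ` S \<subseteq> span (f ` B)" using linear_span_image[OF assms(1), of B] by blast
  then show ?thesis using \<open>finite B\<close> unfolding fin_dim_def by blast
qed

lemma finite_basis:
  assumes "fin_dim S"
  obtains B where "B \<subseteq> S" "independent B" "S \<subseteq> span B" "card B = dim S" "finite B"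
proof -
  obtain B where B: "B \<subseteq> S" "independent B" "S \<subseteq> span B" "card B = dim S" using basis_exists by blast
  obtain F where "finite F" "S \<subseteq> span F" using assms by (auto simp: fin_dim_def)
  then have "finite B" using independent_span_bound[of F B] B by blast
  then show ?thesis using that B by blast
qed

text \<open>
  The ambient space is infinite-dimensional, and finite dimension is known for kernel and image at first.  A basis of
  the kernel and preimages of a basis of the image form a basis together.
\<close>

lemma rank_nullity:
  fixes f :: "'a::real_vector \<Rightarrow> 'b::real_vector"
  assumes f: "linear f" and S: "subspace S" and fin: "fin_dim (f ` S)" "fin_dim {x \<in> S. f x = 0}"
  shows "dim S = dim (f ` S) + dim {x \<in> S. f x = 0}" and "fin_dim S"
proof -
  let ?K = "{x \<in> S. f x = 0}"
  obtain BK where K: "BK \<subseteq> ?K" "independent BK" "?K \<subseteq> span BK" "card BK = dim ?K" "finite BK"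
    using finite_basis[OF fin(2)] by blast
  obtain BI where I: "BI \<subseteq> f ` S" "independent BI" "f ` S \<subseteq> span BI" "card BI = dim (f ` S)" "finite BI"
    using finite_basis[OF fin(1)] by blast
  have "\<forall>b\<in>BI. \<exists>y. y \<in> S \<and> f y = b" using I(1) by blast
  then obtain g where g: "\<And>b. b \<in> BI \<Longrightarrow> g b \<in> S \<and> f (g b) = b" by (auto dest!: bchoice)
  let ?B = "BK \<union> g ` BI"
  have injg: "inj_on g BI" using g by (metis inj_onI)
  have "0 \<notin> BI" using I(2) dependent_zero by blast
  then have disj: "BK \<inter> g ` BI = {}" using K(1) g by force
  have finB: "finite ?B" using K I by simp
  have indep: "independent ?B"
  proof
    assume "dependent ?B"
    then obtain u where nz: "\<exists>v\<in>?B. u v \<noteq> 0" and z: "(\<Sum>v\<in>?B. u v *\<^sub>R v) = 0"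
      using dependent_finite[OF finB] by blast
    have split: "(\<Sum>v\<in>BK. u v *\<^sub>R v) + (\<Sum>b\<in>BI. u (g b) *\<^sub>R g b) = 0"
      using z K(5) I(5) disj by (simp add: sum.union_disjoint sum.reindex[OF injg])
    have "f ((\<Sum>v\<in>BK. u v *\<^sub>R v) + (\<Sum>b\<in>BI. u (g b) *\<^sub>R g b)) = f 0" by (simp only: split)
    then have "(\<Sum>v\<in>BK. u v *\<^sub>R f v) + (\<Sum>b\<in>BI. u (g b) *\<^sub>R f (g b)) = 0"
      by (simp add: linear_add[OF f] linear_sum[OF f] linear_scale[OF f] linear_0[OF f])
    moreover have "(\<Sum>v\<in>BK. u v *\<^sub>R f v) = 0" using K(1) by (intro sum.neutral) auto
    moreover have "(\<Sum>b\<in>BI. u (g b) *\<^sub>R f (g b)) = (\<Sum>b\<in>BI. u (g b) *\<^sub>R b)" using g by (intro sum.cong) auto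
    ultimately have sum0: "(\<Sum>b\<in>BI. u (g b) *\<^sub>R b) = 0" by simp
    have ub: "u (g b) = 0" if "b \<in> BI" for b
    proof (rule ccontr)
      assume "u (g b) \<noteq> 0"
      then have "\<exists>w. (\<exists>v\<in>BI. w v \<noteq> 0) \<and> (\<Sum>v\<in>BI. w v *\<^sub>R v) = 0"
        using that sum0 by (intro exI[of _ "\<lambda>b. u (g b)"]) auto
      then show False using I(2) dependent_finite[OF I(5)] by blast
    qed
    then have "(\<Sum>v\<in>BK. u v *\<^sub>R v) = 0" using split by simp
    then have "u v = 0" if "v \<in> BK" for v
      using K(2) dependent_finite[OF K(5)] that by blast
    then show False using nz ub by auto
  qed
  have sub: "?B \<subseteq> S" using K(1) g by auto
  have span: "S \<subseteq> span ?B"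
  proof
    fix x assume x: "x \<in> S"
    then obtain c where c: "f x = (\<Sum>b\<in>BI. c b *\<^sub>R b)" using I(3) span_finite[OF I(5)] by auto
    let ?y = "\<Sum>b\<in>BI. c b *\<^sub>R g b"
    have yS: "?y \<in> S" using g S by (intro subspace_sum subspace_scale) auto
    have "f ?y = f x" unfolding c using g by (simp add: linear_sum[OF f] linear_scale[OF f])
    then have "x - ?y \<in> ?K" using x yS S by (simp add: linear_diff[OF f] subspace_diff)
    then have "x - ?y \<in> span ?B" using K(3) span_mono[of BK ?B] by blast
    moreover have "?y \<in> span ?B" by (intro span_sum span_scale span_base) auto
    ultimately have "(x - ?y) + ?y \<in> span ?B" by (rule span_add)
    then show "x \<in> span ?B" by simp
  qed
  have "card ?B = card BK + card BI" using K(5) I(5) disj by (simp add: card_Un_disjoint card_image[OF injg])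
  then show "dim S = dim (f ` S) + dim ?K"
    using dim_unique[OF sub span indep] K(4) I(4) by simp
  show "fin_dim S" using finB span unfolding fin_dim_def by blast
qed

lemma dim_injective_image:
  assumes f: "linear f" and S: "subspace S" and fin: "fin_dim S" and inj: "\<And>x. x \<in> S \<Longrightarrow> f x = 0 \<Longrightarrow> x = 0"
  shows "dim (f ` S) = dim S"
proof -
  have "{x \<in> S. f x = 0} = {0}" using inj S linear_0[OF f] by (auto simp: subspace_0)
  moreover have "dim {0 :: 'a} = 0" by (rule dim_unique[of "{}"]) (auto simp: independent_empty)
  ultimately show ?thesis
    using rank_nullity(1)[OF f S fin_dim_image[OF f fin] fin_dim_subset[OF fin]] subspace_0[OF S] by simp
qed

text \<open>
  \<open>G\<close> is the graph of a linear operator \<open>d\<close> with domain \<open>M = fst ` G\<close>.  The map \<open>(a, c) \<mapsto> d a + c\<close> on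
  \<open>M \<times> M'\<close> has a kernel isomorphic to the set of all \<open>a\<close> with \<open>d a \<in> M'\<close>.
\<close>

lemma dim_graph:
  fixes G :: "('a::real_vector \<times> 'a) set"
  assumes G: "subspace G" and sv: "\<And>b. (0, b) \<in> G \<Longrightarrow> b = 0" and M': "subspace M'"
    and fin: "fin_dim (fst ` G)" "fin_dim M'" "fin_dim {b + c | b c. b \<in> snd ` G \<and> c \<in> M'}"
  shows "dim {a. \<exists>b. (a, b) \<in> G \<and> b \<in> M'} + dim {b + c | b c. b \<in> snd ` G \<and> c \<in> M'} = dim (fst ` G) + dim M'"
proof -
  let ?K = "G \<times> M'" and ?f = "\<lambda>x :: ('a \<times> 'a) \<times> 'a. fst (fst x)" and ?g = "\<lambda>x :: ('a \<times> 'a) \<times> 'a. snd (fst x) + snd x"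
  let ?i = "\<lambda>c :: 'a. ((0 :: 'a, 0 :: 'a), c)"
  have K: "subspace ?K" using G M' by (rule subspace_Times)
  have lin: "linear ?f" "linear ?g" "linear ?i" by (auto intro!: linearI simp: scaleR_add_right)
  have f_im: "?f ` ?K = fst ` G" using subspace_0[OF M'] by force
  have g_im: "?g ` ?K = {b + c | b c. b \<in> snd ` G \<and> c \<in> M'}" by force
  have f_ker: "{x \<in> ?K. ?f x = 0} = ?i ` M'" using sv subspace_0[OF G] by (force simp: zero_prod_def)
  have dim_i: "dim (?i ` M') = dim M'" by (rule dim_injective_image[OF lin(3) M' fin(2)]) (simp add: zero_prod_def)
  have finf: "fin_dim (?f ` ?K)" "fin_dim {x \<in> ?K. ?f x = 0}"
    unfolding f_im f_ker using fin fin_dim_image[OF lin(3)] by auto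
  note rf = rank_nullity[OF lin(1) K finf]
  let ?L = "{x \<in> ?K. ?g x = 0}"
  have L: "subspace ?L"
    using subspace_inter[OF K linear_subspace_kernel[OF lin(2)]] by (simp add: Int_def)
  have "dim (?f ` ?L) = dim ?L"
  proof (rule dim_injective_image[OF lin(1) L fin_dim_subset[OF rf(2)]])
    fix x assume x: "x \<in> ?L" "?f x = 0"
    then have "snd (fst x) = 0" using sv[of "snd (fst x)"] by (cases x) auto
    then show "x = 0" using x by (cases x) (auto simp: zero_prod_def)
  qed auto
  moreover have "?f ` ?L = {a. \<exists>b. (a, b) \<in> G \<and> b \<in> M'}"
  proof (intro equalityI subsetI)
    fix a assume "a \<in> ?f ` ?L"
    then obtain b c where *: "(a, b) \<in> G" "c \<in> M'" "b + c = 0" by force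
    then have "b = - c" by (simp add: eq_neg_iff_add_eq_0)
    then show "a \<in> {a. \<exists>b. (a, b) \<in> G \<and> b \<in> M'}" using * subspace_neg[OF M'] by auto
  next
    fix a assume "a \<in> {a. \<exists>b. (a, b) \<in> G \<and> b \<in> M'}"
    then obtain b where "(a, b) \<in> G" "b \<in> M'" by blast
    then have "((a, b), - b) \<in> ?L" using subspace_neg[OF M'] by auto
    then show "a \<in> ?f ` ?L" by force
  qed
  ultimately have "dim ?L = dim {a. \<exists>b. (a, b) \<in> G \<and> b \<in> M'}" by simp
  moreover have "dim ?K = dim (?g ` ?K) + dim ?L"
    by (rule rank_nullity(1)[OF lin(2) K _ fin_dim_subset[OF rf(2)]]) (auto simp: g_im fin(3)[simplified])
  ultimately show ?thesis using rf(1) unfolding f_im f_ker g_im dim_i by simp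
qed

subsection \<open>Classes of piecewise polynomial forms\<close>

lemma abs_ae_form_eq_iff: "abs_ae_form \<omega> = abs_ae_form \<eta> \<longleftrightarrow> (AE x in lebesgue. \<omega> x = \<eta> x)"
  by (rule ae_form.abs_eq_iff)

lemma abs_ae_form_sum:
  "(\<Sum>i\<in>I. c i *\<^sub>R abs_ae_form (e i)) = abs_ae_form (\<lambda>x vs. \<Sum>i\<in>I. c i * e i x vs)"
  by (induction I rule: infinite_finite_induct)
     (simp_all add: zero_ae_form_def plus_ae_form.abs_eq scaleR_ae_form.abs_eq)

lemma alternating_expansion:
  fixes w :: "(real^'n::finite) list \<Rightarrow> real"
  assumes w: "alternating k w" and vs: "length vs = k"
  shows "w vs = (\<Sum>is | length is = k. (\<Prod>j<k. (vs ! j) $ (is ! j)) * w (map (\<lambda>i. axis i 1) is))"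
proof -
  let ?ax = "\<lambda>i::'n. axis i (1::real)"
  have "w vs = (\<Sum>is | length is = j. (\<Prod>l<j. (vs ! l) $ (is ! l)) * w (map ?ax is @ drop j vs))" if "j \<le> k" for j
    using that
  proof (induction j)
    case (Suc j)
    have step: "w (map ?ax is @ drop j vs) = (\<Sum>i\<in>UNIV. (vs ! j) $ i * w (map ?ax (is @ [i]) @ drop (Suc j) vs))"
      if "length is = j" for "is"
    proof -
      have d: "drop j vs = vs ! j # drop (Suc j) vs" using Suc.prems vs by (simp add: Cons_nth_drop_Suc)
      have "w (map ?ax is @ drop j vs) =
          (\<Sum>i\<in>UNIV. ((map ?ax is @ drop j vs) ! j) $ i * w ((map ?ax is @ drop j vs)[j := ?ax i]))"
        using Suc.prems vs that by (intro alternating_expand_slot[OF w]) auto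
      then show ?thesis using that by (simp add: d nth_append list_update_append)
    qed
    have inj: "inj_on (\<lambda>(is, i). is @ [i]) ({is :: 'n list. length is = j} \<times> UNIV)" by (auto simp: inj_on_def)
    have im: "{is :: 'n list. length is = Suc j} = (\<lambda>(is, i). is @ [i]) ` ({is. length is = j} \<times> UNIV)"
    proof (intro equalityI subsetI)
      fix xs :: "'n list" assume "xs \<in> {is. length is = Suc j}"
      then have "xs = butlast xs @ [last xs]" "length (butlast xs) = j" by (auto intro: append_butlast_last_id[symmetric])
      then show "xs \<in> (\<lambda>(is, i). is @ [i]) ` ({is. length is = j} \<times> UNIV)" by force
    qed auto
    have "w vs = (\<Sum>is | length is = j. \<Sum>i\<in>UNIV. (\<Prod>l<j. (vs ! l) $ (is ! l)) * ((vs ! j) $ i * w (map ?ax (is @ [i]) @ drop (Suc j) vs)))"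
      using Suc.IH Suc.prems by (simp add: step sum_distrib_left)
    also have "\<dots> = (\<Sum>(is, i)\<in>{is. length is = j} \<times> UNIV. (\<Prod>l<j. (vs ! l) $ (is ! l)) * ((vs ! j) $ i * w (map ?ax (is @ [i]) @ drop (Suc j) vs)))"
      using finite_lists_length_eq[of "UNIV :: 'n set" j] by (simp add: sum.cartesian_product)
    also have "\<dots> = (\<Sum>(is, i)\<in>{is. length is = j} \<times> UNIV. (\<Prod>l<Suc j. (vs ! l) $ ((is @ [i]) ! l)) * w (map ?ax (is @ [i]) @ drop (Suc j) vs))"
      by (intro sum.cong refl) (auto simp: nth_append intro!: prod.cong)
    also have "\<dots> = (\<Sum>is | length is = Suc j. (\<Prod>l<Suc j. (vs ! l) $ (is ! l)) * w (map ?ax is @ drop (Suc j) vs))"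
      unfolding im sum.reindex[OF inj] by (simp add: case_prod_unfold o_def)
    finally show ?case .
  qed simp
  from this[of k] show ?thesis using vs by simp
qed

context bary
begin

definition cls :: "(real ^ 'n \<Rightarrow> 'n rform) \<Rightarrow> 'n ae_form" where "cls p = abs_ae_form (pw p)"

lemma abs_eq_cls: "\<omega> \<in> forms_on T k \<Longrightarrow> represents \<omega> p \<Longrightarrow> abs_ae_form \<omega> = cls p"
proof -
  assume \<omega>: "\<omega> \<in> forms_on T k" "represents \<omega> p"
  have "AE x in lebesgue. \<omega> x = pw p x"
    using \<omega>(2)[unfolded represents_def] AE_ocell
  proof eventually_elim
    case (elim x)
    show ?case
    proof (cases "x \<in> T")
      case True
      then obtain v where "v \<in> C" "x \<in> ocell v" using elim by blast
      then show ?thesis using elim pw_ocell by simp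
    next
      case False then show ?thesis using \<omega>(1) by (simp add: forms_on_def pw_def)
    qed
  qed
  then show ?thesis by (simp add: cls_def abs_ae_form_eq_iff)
qed

lemma cls_eq_iff:
  assumes "fam r k p" "fam s k q" shows "cls p = cls q \<longleftrightarrow> (\<forall>v\<in>C. p v = q v)"
proof
  assume "cls p = cls q"
  then have ae: "AE x in lebesgue. pw p x = pw q x" by (simp add: cls_def abs_ae_form_eq_iff)
  show "\<forall>v\<in>C. p v = q v"
  proof
    fix v assume v: "v \<in> C"
    have "AE x in lebesgue. x \<in> ocell v \<longrightarrow> p v x = q v x"
      using ae by eventually_elim (metis pw_ocell[OF v])
    then show "p v = q v"
      using poly_forms_mono[OF famD[OF assms(1) v], of "max r s"] poly_forms_mono[OF famD[OF assms(2) v], of "max r s"]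
      by (intro poly_forms_eq_if_AE[OF _ _ v]) auto
  qed
next
  assume "\<forall>v\<in>C. p v = q v"
  then have "pw p = pw q" using piece(1) by (auto simp: pw_def fun_eq_iff)
  then show "cls p = cls q" by (simp add: cls_def)
qed

lemma cls_add: "cls p + cls q = cls (\<lambda>v x vs. p v x vs + q v x vs)"
proof -
  have "(\<lambda>x vs. pw p x vs + pw q x vs) = pw (\<lambda>v x vs. p v x vs + q v x vs)" by (auto simp: pw_def fun_eq_iff)
  then show ?thesis by (simp add: cls_def plus_ae_form.abs_eq)
qed

lemma cls_scale: "c *\<^sub>R cls p = cls (\<lambda>v x vs. c * p v x vs)"
proof -
  have "(\<lambda>x vs. c * pw p x vs) = pw (\<lambda>v x vs. c * p v x vs)" by (auto simp: pw_def fun_eq_iff)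
  then show ?thesis by (simp add: cls_def scaleR_ae_form.abs_eq)
qed

lemma cls_zero: "cls (\<lambda>v x vs. 0) = 0"
  using cls_scale[of 0 "\<lambda>v x vs. 0"] by simp

text \<open>
  A family is determined by finitely many numbers: expanding in the list entries and in the monomials,
  \<open>p\<close> is a combination of elementary forms, each concentrated on one cell.
\<close>

lemma fin_dim_fam: "fin_dim (cls ` {p. fam r k p})"
proof (cases "r < 0")
  case True
  have "cls p = 0" if p: "fam r k p" for p
  proof -
    have "cls p = cls (\<lambda>v x vs. 0)"
      using poly_forms_negative[OF famD[OF p] True] poly_forms_zero
      by (subst cls_eq_iff[OF p, of r]) (auto simp: fam_def fun_eq_iff)
    then show ?thesis by (simp add: cls_zero)
  qed
  then have "cls ` {p. fam r k p} \<subseteq> span {}" by auto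
  then show ?thesis unfolding fin_dim_def by blast
next
  case False
  then obtain s where s: "r = int s" by (metis nonneg_int_cases not_less)
  let ?I = "C \<times> expo s \<times> {is :: 'n list. length is = k}"
  define m where "m is vs = (if length vs = k then \<Prod>j<k. (vs ! j) $ (is ! j) else 0)" for "is" and vs :: "(real^'n) list"
  define e where "e i = (\<lambda>x vs. indicator (ocell (fst i)) x * (bmono (fst (snd i)) x * m (snd (snd i)) vs))" for i
  have finI: "finite ?I" using finite_C finite_expo finite_lists_length_eq[of "UNIV :: 'n set" k] by simp
  have "cls p \<in> span ((\<lambda>i. abs_ae_form (e i)) ` ?I)" if p: "fam r k p" for p
  proof -
    define c where "c i = coef s (\<lambda>x. p (fst i) x (vecs (snd (snd i)))) (fst (snd i))" for i
    have ex: "p v x vs = (\<Sum>\<alpha>\<in>expo s. \<Sum>is | length is = k. c (v, \<alpha>, is) * (bmono \<alpha> x * m is vs))" if v: "v \<in> C" for v x vs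
    proof -
      have P: "p v \<in> poly_forms (int s) k" using famD[OF p v] s by simp
      have co: "coef s (\<lambda>x. p v x vs) \<alpha> = (\<Sum>is | length is = k. m is vs * c (v, \<alpha>, is))" if "\<alpha> \<in> expo s" for \<alpha>
      proof (cases "length vs = k")
        case True
        then show ?thesis using alternating_expansion[OF alternating_coef[OF P that] True] by (simp add: m_def c_def vecs_def)
      next
        case False
        then show ?thesis using alternating_length[OF alternating_coef[OF P that] False] by (simp add: m_def)
      qed
      have "p v x vs = (\<Sum>\<alpha>\<in>expo s. coef s (\<lambda>x. p v x vs) \<alpha> * bmono \<alpha> x)"
        by (rule coef_expansion[OF poly_forms_pol[OF P]])
      also have "\<dots> = (\<Sum>\<alpha>\<in>expo s. \<Sum>is | length is = k. c (v, \<alpha>, is) * (bmono \<alpha> x * m is vs))"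
        by (intro sum.cong refl) (simp add: co sum_distrib_right sum_distrib_left mult_ac)
      finally show ?thesis .
    qed
    have "AE x in lebesgue. pw p x = (\<lambda>vs. \<Sum>i\<in>?I. c i * e i x vs)"
      using AE_ocell
    proof eventually_elim
      case (elim x)
      have ee: "(\<Sum>i\<in>?I. c i * e i x vs) = (\<Sum>v\<in>C. indicator (ocell v) x * p v x vs)" for vs
      proof -
        have "(\<Sum>v\<in>C. indicator (ocell v) x * p v x vs) =
            (\<Sum>v\<in>C. \<Sum>\<alpha>\<in>expo s. \<Sum>is | length is = k. c (v, \<alpha>, is) * e (v, \<alpha>, is) x vs)"
          by (intro sum.cong refl) (simp add: ex e_def sum_distrib_left mult_ac)
        also have "\<dots> = (\<Sum>(v, \<alpha>, is)\<in>?I. c (v, \<alpha>, is) * e (v, \<alpha>, is) x vs)"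
          by (simp add: sum.cartesian_product)
        finally show ?thesis by (simp add: case_prod_unfold)
      qed
      then show ?case
      proof (cases "x \<in> T")
        case True
        then obtain v where "v \<in> C" "x \<in> ocell v" using elim by blast
        then show ?thesis using ee pw_ocell sum_ocell by (simp add: fun_eq_iff)
      next
        case False
        then show ?thesis using ee sum_ocell_outside[OF False] by (simp add: fun_eq_iff pw_def)
      qed
    qed
    then have "cls p = (\<Sum>i\<in>?I. c i *\<^sub>R abs_ae_form (e i))"
      unfolding abs_ae_form_sum cls_def abs_ae_form_eq_iff .
    also have "\<dots> \<in> span ((\<lambda>i. abs_ae_form (e i)) ` ?I)" by (intro span_sum span_scale span_base imageI)
    finally show ?thesis .
  qed
  then show ?thesis using finI unfolding fin_dim_def by blast
qed

definition fd :: "nat \<Rightarrow> (real ^ 'n \<Rightarrow> 'n rform) \<Rightarrow> real ^ 'n \<Rightarrow> 'n rform" where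
  "fd k p v = ext_d k (p v)"

lemma fam_fd: "fam r k p \<Longrightarrow> fam (r - 1) (Suc k) (fd k p)"
  by (simp add: fam_def fd_def poly_forms_ext_d)

text \<open>
  Subspaces of families.  The values of a family outside \<open>C\<close> carry no meaning, and membership must not depend on them.
\<close>

definition fam_space :: "int \<Rightarrow> nat \<Rightarrow> (real ^ 'n \<Rightarrow> 'n rform) set \<Rightarrow> bool" where
  "fam_space r k R \<longleftrightarrow> (\<forall>p\<in>R. fam r k p) \<and> (\<lambda>v x vs. 0) \<in> R \<and>
     (\<forall>p\<in>R. \<forall>q\<in>R. (\<lambda>v x vs. p v x vs + q v x vs) \<in> R) \<and> (\<forall>c. \<forall>p\<in>R. (\<lambda>v x vs. c * p v x vs) \<in> R) \<and>
     (\<forall>p\<in>R. \<forall>q. (\<forall>v\<in>C. p v = q v) \<longrightarrow> q \<in> R)"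

lemma fam_space_cong: "fam_space r k R \<Longrightarrow> p \<in> R \<Longrightarrow> (\<And>v. v \<in> C \<Longrightarrow> p v = q v) \<Longrightarrow> q \<in> R"
  unfolding fam_space_def by blast

lemma subspace_cls: "fam_space r k R \<Longrightarrow> subspace (cls ` R)"
  unfolding subspace_def fam_space_def
  by (auto simp: cls_add cls_scale intro!: image_eqI[of _ cls "\<lambda>v x vs. 0", OF cls_zero[symmetric]])

lemma fd_add: "fam r k p \<Longrightarrow> fam s k q \<Longrightarrow> v \<in> C \<Longrightarrow> fd k (\<lambda>v x vs. p v x vs + q v x vs) v = (\<lambda>x vs. fd k p v x vs + fd k q v x vs)"
  unfolding fd_def by (intro ext ext_d_add[OF famD famD])

lemma fd_scale: "fam r k p \<Longrightarrow> v \<in> C \<Longrightarrow> fd k (\<lambda>v x vs. c * p v x vs) v = (\<lambda>x vs. c * fd k p v x vs)"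
  unfolding fd_def by (intro ext ext_d_scale[OF famD])

text \<open>
  The graph \<open>{(\<rho>, d\<rho>)}\<close> is taken between classes of forms; the operator is well defined on classes, since a
  family is determined by its class up to the values outside \<open>C\<close>.
\<close>

lemma dim_families:
  assumes R: "fam_space r k R" and E: "fam_space (r - 1) (Suc k) E"
  shows "dim (cls ` {\<rho> \<in> R. fd k \<rho> \<in> E}) + dim (cls ` {q. \<exists>\<rho>\<in>R. \<exists>\<eta>\<in>E. \<forall>v\<in>C. q v = (\<lambda>x vs. fd k \<rho> v x vs + \<eta> v x vs)})
    = dim (cls ` R) + dim (cls ` E)"
proof -
  let ?G = "(\<lambda>\<rho>. (cls \<rho>, cls (fd k \<rho>))) ` R"
  have fR: "fam r k p" if "p \<in> R" for p using R that by (simp add: fam_space_def)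
  have fE: "fam (r - 1) (Suc k) p" if "p \<in> E" for p using E that by (simp add: fam_space_def)
  have fdR: "fam (r - 1) (Suc k) (fd k p)" if "p \<in> R" for p using fam_fd[OF fR[OF that]] .
  have cls_eqI: "cls p = cls q" if "\<And>v. v \<in> C \<Longrightarrow> p v = q v" for p q
  proof -
    have "pw p = pw q" using piece(1) that by (auto simp: pw_def fun_eq_iff)
    then show ?thesis by (simp add: cls_def)
  qed
  have z: "(\<lambda>v x vs. 0) \<in> R" "\<And>p q. p \<in> R \<Longrightarrow> q \<in> R \<Longrightarrow> (\<lambda>v x vs. p v x vs + q v x vs) \<in> R"
    "\<And>c p. p \<in> R \<Longrightarrow> (\<lambda>v x vs. c * p v x vs) \<in> R" using R by (auto simp: fam_space_def)
  have fd0: "cls (fd k (\<lambda>v x vs. 0)) = 0"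
  proof -
    have "cls (fd k (\<lambda>v x vs. 0 * (\<lambda>v x vs. 0) v x vs)) = cls (\<lambda>v x vs. 0 * fd k (\<lambda>v x vs. 0) v x vs)"
      by (intro cls_eqI fd_scale[OF fR[OF z(1)]])
    then show ?thesis using cls_zero by simp
  qed
  have "subspace ?G"
    unfolding subspace_def
  proof (intro conjI ballI allI)
    show "0 \<in> ?G" using z(1) fd0 cls_zero by (auto simp: zero_prod_def intro!: image_eqI[of _ _ "\<lambda>v x vs. 0"])
    fix x y assume "x \<in> ?G" "y \<in> ?G"
    then obtain p q where pq: "p \<in> R" "q \<in> R" "x = (cls p, cls (fd k p))" "y = (cls q, cls (fd k q))" by blast
    have "cls (fd k (\<lambda>v x vs. p v x vs + q v x vs)) = cls (fd k p) + cls (fd k q)"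
      unfolding cls_add by (intro cls_eqI fd_add[OF fR fR] pq)
    then show "x + y \<in> ?G" using pq z(2)[OF pq(1,2)] cls_add by (intro image_eqI[of _ _ "\<lambda>v x vs. p v x vs + q v x vs"]) auto
  next
    fix c x assume "x \<in> ?G"
    then obtain p where p: "p \<in> R" "x = (cls p, cls (fd k p))" by blast
    have "cls (fd k (\<lambda>v x vs. c * p v x vs)) = c *\<^sub>R cls (fd k p)"
      unfolding cls_scale by (intro cls_eqI fd_scale[OF fR] p)
    then show "c *\<^sub>R x \<in> ?G" using p z(3)[OF p(1)] cls_scale by (intro image_eqI[of _ _ "\<lambda>v x vs. c * p v x vs"]) auto
  qed
  moreover have "b = 0" if "(0, b) \<in> ?G" for b
  proof -
    from that obtain p where p: "p \<in> R" "0 = cls p" "b = cls (fd k p)" by blast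
    then have "cls p = cls (\<lambda>v x vs. 0)" by (simp add: cls_zero)
    then have "p v = (\<lambda>x vs. 0)" if "v \<in> C" for v using cls_eq_iff[OF fR[OF p(1)] fR[OF z(1)]] that by auto
    then have "cls (fd k p) = cls (fd k (\<lambda>v x vs. 0))" by (intro cls_eqI) (simp add: fd_def)
    then show ?thesis using p fd0 by simp
  qed
  moreover have "subspace (cls ` E)" by (rule subspace_cls[OF E])
  moreover have sum: "{b + c | b c. b \<in> snd ` ?G \<and> c \<in> cls ` E}
      = cls ` {q. \<exists>\<rho>\<in>R. \<exists>\<eta>\<in>E. \<forall>v\<in>C. q v = (\<lambda>x vs. fd k \<rho> v x vs + \<eta> v x vs)}" (is "?S = cls ` ?Q")
  proof (intro equalityI subsetI)
    fix y assume "y \<in> ?S"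
    then obtain \<rho> \<eta> where *: "\<rho> \<in> R" "\<eta> \<in> E" "y = cls (fd k \<rho>) + cls \<eta>" by auto
    then have "y = cls (\<lambda>v x vs. fd k \<rho> v x vs + \<eta> v x vs)" by (simp add: cls_add)
    then show "y \<in> cls ` ?Q" using * by blast
  next
    fix y assume "y \<in> cls ` ?Q"
    then obtain q \<rho> \<eta> where *: "\<rho> \<in> R" "\<eta> \<in> E" "\<forall>v\<in>C. q v = (\<lambda>x vs. fd k \<rho> v x vs + \<eta> v x vs)" "y = cls q" by blast
    then have "y = cls (fd k \<rho>) + cls \<eta>" unfolding cls_add by (auto intro: cls_eqI)
    moreover have "cls (fd k \<rho>) \<in> snd ` ?G" using * by force
    ultimately show "y \<in> ?S" using * by blast
  qed
  moreover have "fst ` ?G = cls ` R" by (simp add: image_image)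
  moreover have "fin_dim (cls ` R)" using fR by (intro fin_dim_subset[OF fin_dim_fam[of r k]]) auto
  moreover have "fin_dim (cls ` E)" using fE by (intro fin_dim_subset[OF fin_dim_fam[of "r - 1" "Suc k"]]) auto
  moreover have "fin_dim (cls ` ?Q)"
  proof (rule fin_dim_subset[OF fin_dim_fam[of "r - 1" "Suc k"]])
    have "fam (r - 1) (Suc k) q" if "q \<in> ?Q" for q
      using that fdR fE by (auto simp: fam_def intro!: poly_forms_add)
    then show "cls ` ?Q \<subseteq> cls ` {p. fam (r - 1) (Suc k) p}" by blast
  qed
  moreover have "{a. \<exists>b. (a, b) \<in> ?G \<and> b \<in> cls ` E} = cls ` {\<rho> \<in> R. fd k \<rho> \<in> E}"
  proof (intro equalityI subsetI)
    fix a assume "a \<in> {a. \<exists>b. (a, b) \<in> ?G \<and> b \<in> cls ` E}"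
    then obtain \<rho> \<eta> where *: "\<rho> \<in> R" "\<eta> \<in> E" "a = cls \<rho>" "cls (fd k \<rho>) = cls \<eta>" by auto
    then have "fd k \<rho> v = \<eta> v" if "v \<in> C" for v using cls_eq_iff[OF fdR fE] that by blast
    then have "fd k \<rho> \<in> E" using fam_space_cong[OF E *(2)] by metis
    then show "a \<in> cls ` {\<rho> \<in> R. fd k \<rho> \<in> E}" using * by blast
  qed blast
  ultimately show ?thesis using dim_graph[of ?G "cls ` E"] by (simp only:)
qed

end


section \<open>The spaces in terms of families of polynomial forms\<close>

context bary
begin

text \<open>
  The common face of two cells contains a relatively open piece of the hyperplane \<open>lam u = lam v\<close>, around \<open>pull {u, v}\<close>.
  This and the next lemma carry conditions known on faces over to the hyperplanes.
\<close>

lemma interface_extension: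
  assumes f: "pol r f" and uv: "u \<in> C" "v \<in> C" "u \<noteq> v"
    and 0: "\<And>x. x \<in> cell u \<Longrightarrow> x \<in> cell v \<Longrightarrow> f x = 0" and x: "lam u x = lam v x"
  shows "f x = 0"
proof -
  let ?H = "{x. lam u x = lam v x}" and ?U = "{x. 0 < lam u x} \<inter> (\<Inter>w\<in>C - {u, v}. {x. lam u x < lam w x})"
  show ?thesis
  proof (rule pol_eq_0_on_affine[OF f, of ?H ?U "pull {u, v}"])
    have "?H = {x. (D u - D v) \<bullet> x = c0 v - c0 u}" by (auto simp: lam_def inner_diff_left)
    then show "affine ?H" using affine_hyperplane by metis
    show "open ?U" using finite_C
      by (intro open_Int open_INT ballI open_Collect_less continuous_on_const lam_continuous) auto
    have sub: "{u, v} \<subseteq> C" "{u, v} \<noteq> {}" using uv by auto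
    show "pull {u, v} \<in> ?H" using lam_pull[OF sub(1)] uv by simp
    have card2: "finite {u, v}" "card {u, v} \<le> 2" by (auto simp: card_insert_if)
    obtain w where w: "w \<in> C - {u, v}" using another_vertex[OF card2] by blast
    show "pull {u, v} \<in> ?U" using lam_pull_less[OF sub] w by auto
    fix y assume y: "y \<in> ?H" "y \<in> ?U"
    have "lam u y \<le> lam w y" if "w \<in> C" for w
      using y that by (cases "w \<in> {u, v}") (auto intro: less_imp_le)
    then show "f y = 0" using y by (intro 0) (auto simp: cell_def intro: less_imp_le)
  qed (use x in simp)
qed

lemma facet_extension:
  assumes f: "pol r f" and v: "v \<in> C" and 0: "\<And>x. x \<in> T \<Longrightarrow> lam v x = 0 \<Longrightarrow> f x = 0" and x: "lam v x = 0"
  shows "f x = 0"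
proof -
  let ?H = "{x. lam v x = 0}" and ?U = "\<Inter>w\<in>C - {v}. {x. 0 < lam w x}"
  define t where "t u = (if u = v then 0 else 1 / real CARD('n))" for u
  define y where "y = (\<Sum>u\<in>C. t u *\<^sub>R u)"
  have "sum t C = sum t (C - {v})" using finite_C v by (simp add: sum.remove[of C v] t_def)
  also have "\<dots> = (\<Sum>u\<in>C - {v}. 1 / real CARD('n))" by (intro sum.cong) (auto simp: t_def)
  also have "\<dots> = 1" using finite_C v card_C by simp
  finally have ly: "lam u y = t u" if "u \<in> C" for u unfolding y_def using that by (intro lam_combination)
  show ?thesis
  proof (rule pol_eq_0_on_affine[OF f, of ?H ?U y])
    have "?H = {x. D v \<bullet> x = - c0 v}" by (auto simp: lam_def)
    then show "affine ?H" using affine_hyperplane by metis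
    show "open ?U" using finite_C
      by (intro open_INT ballI open_Collect_less continuous_on_const lam_continuous) auto
    show "y \<in> ?H" using ly[OF v] by (simp add: t_def)
    show "y \<in> ?U" using ly by (auto simp: t_def)
    fix y assume y: "y \<in> ?H" "y \<in> ?U"
    have "0 \<le> lam w y" if "w \<in> C" for w using y that by (cases "w = v") (auto intro: less_imp_le)
    then show "f y = 0" using y by (intro 0) (auto simp: hull_eq)
  qed (use x in simp)
qed

lemma AE_on_cell:
  "v \<in> C \<Longrightarrow> (AE x in lebesgue_on (cell v). P x) \<longleftrightarrow> (AE x in lebesgue. x \<in> ocell v \<longrightarrow> P x)"
proof -
  assume v: "v \<in> C"
  have "(AE x in lebesgue_on (cell v). P x) \<longleftrightarrow> (AE x in lebesgue. x \<in> cell v \<longrightarrow> P x)"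
    using closed_cell by (intro AE_restrict_space_iff) simp
  also have "\<dots> \<longleftrightarrow> (AE x in lebesgue. x \<in> ocell v \<longrightarrow> P x)"
  proof
    assume "AE x in lebesgue. x \<in> ocell v \<longrightarrow> P x"
    then show "AE x in lebesgue. x \<in> cell v \<longrightarrow> P x"
      using AE_generic
    proof eventually_elim
      case (elim x)
      have "x \<in> ocell v" if "x \<in> cell v"
      proof -
        have "lam v x < lam u x" if "u \<in> C - {v}" for u
        proof -
          have "lam v x \<le> lam u x" "lam v x \<noteq> lam u x" using that \<open>x \<in> cell v\<close> elim v by (auto simp: cell_def)
          then show ?thesis by simp
        qed
        moreover have "0 < lam v x"
        proof -
          have "0 \<le> lam v x" "lam v x \<noteq> 0" using \<open>x \<in> cell v\<close> elim v by (auto simp: cell_def)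
          then show ?thesis by simp
        qed
        ultimately show ?thesis by (simp add: ocell_def)
      qed
      then show ?case using elim by blast
    qed
  qed (auto elim!: eventually_mono dest: subsetD[OF ocell_subset_cell])
  finally show ?thesis .
qed

lemma V_fun_represented:
  assumes "\<omega> \<in> V_fun C r k" obtains p where "fam r k p" "represents \<omega> p"
proof -
  have "\<forall>v\<in>C. \<exists>p. p \<in> poly_forms r k \<and> (AE x in lebesgue. x \<in> ocell v \<longrightarrow> \<omega> x = p x)"
    using assms AE_on_cell unfolding V_fun_def alfeld_split_eq by fastforce
  then obtain p where p: "\<And>v. v \<in> C \<Longrightarrow> p v \<in> poly_forms r k \<and> (AE x in lebesgue. x \<in> ocell v \<longrightarrow> \<omega> x = p v x)"
    by (auto dest!: bchoice)
  then have "represents \<omega> p" unfolding represents_def using finite_C by (simp add: AE_finite_all)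
  moreover have "fam r k p" using p by (simp add: fam_def)
  ultimately show ?thesis using that by blast
qed

lemma pw_V_fun: "fam r k p \<Longrightarrow> pw p \<in> V_fun C r k"
  unfolding V_fun_def alfeld_split_eq
  using pw_L2[of r k p] by (auto simp: AE_on_cell fam_def pw_ocell intro!: bexI[of _ "p _"])

lemma fd_eq: "fd k p = (\<lambda>v. ext_d k (p v))"
  by (rule ext) (simp add: fd_def)

lemma Vd_fun_pw: "fam r k p \<Longrightarrow> tan_cont p \<Longrightarrow> pw p \<in> Vd_fun C r k"
  unfolding Vd_fun_def
  using pw_V_fun[of r k p] pw_L2[OF fam_fd[of r k p]] weak_d_if_tan_cont[of r k p "pw p" "pw (fd k p)"]
    represents_pw[of p] represents_pw[of "fd k p"] by (auto simp: fd_eq)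

lemma Vd_fun_represented:
  assumes "\<omega> \<in> Vd_fun C r k" obtains p where "fam r k p" "tan_cont p" "represents \<omega> p" "abs_ae_form \<omega> = cls p"
proof -
  obtain \<xi> where \<omega>: "\<omega> \<in> V_fun C r k" and \<xi>: "\<xi> \<in> L2_forms T (Suc k)" "weak_d T k \<omega> \<xi>"
    using assms by (auto simp: Vd_fun_def)
  obtain p where p: "fam r k p" "represents \<omega> p" using V_fun_represented[OF \<omega>] .
  moreover have "\<omega> \<in> forms_on T k" using \<omega> by (simp add: V_fun_def L2_forms_def)
  ultimately show ?thesis using that tan_cont_if_weak_d[OF p \<xi>] abs_eq_cls by blast
qed

lemma Vd_space_eq: "Vd_space C r k = cls ` {p. fam r k p \<and> tan_cont p}"
  unfolding Vd_space_def
proof (intro equalityI subsetI)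
  fix y assume "y \<in> abs_ae_form ` Vd_fun C r k"
  then show "y \<in> cls ` {p. fam r k p \<and> tan_cont p}" by (auto elim!: Vd_fun_represented)
next
  fix y assume "y \<in> cls ` {p. fam r k p \<and> tan_cont p}"
  then show "y \<in> abs_ae_form ` Vd_fun C r k" by (auto simp: cls_def intro!: imageI Vd_fun_pw)
qed

lemma forms_eq_0_if_coeffs:
  assumes "\<omega> \<in> forms_on T k" "\<And>is. form_coeff \<omega> is x = 0" shows "\<omega> x = (\<lambda>vs. 0)"
proof
  fix vs
  have alt: "alternating k (\<omega> x)" using assms(1) by (simp add: forms_on_def)
  show "\<omega> x vs = 0"
  proof (rule alternating_eqI_spanning[OF alt span_axes])
    fix vs :: "(real^'n) list" assume "set vs \<subseteq> range (\<lambda>i. axis i 1)"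
    then obtain "is" where "vs = map (\<lambda>i. axis i 1) is" by (blast elim: set_subset_axes_imp_map)
    then show "\<omega> x vs = 0" using assms(2)[of "is"] by (simp add: form_coeff_def)
  qed
qed

lemma M_fun_represented:
  assumes "\<omega> \<in> M_fun C r k"
  obtains p where "fam r k p" "full_cont p" "\<And>v x. v \<in> C \<Longrightarrow> x \<in> cell v \<Longrightarrow> \<omega> x = p v x"
    "represents \<omega> p" "abs_ae_form \<omega> = cls p"
proof -
  have "\<forall>v\<in>C. \<exists>p. p \<in> poly_forms r k \<and> (\<forall>x\<in>cell v. \<omega> x = p x)"
    using assms unfolding M_fun_def alfeld_split_eq by fastforce
  then obtain p where p: "\<And>v. v \<in> C \<Longrightarrow> p v \<in> poly_forms r k \<and> (\<forall>x\<in>cell v. \<omega> x = p v x)"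
    by (auto dest!: bchoice)
  have fam: "fam r k p" using p by (simp add: fam_def)
  have eq: "\<omega> x = p v x" if "v \<in> C" "x \<in> cell v" for v x using p that by blast
  have "p u x = p v x" if uv: "u \<in> C" "v \<in> C" and x: "lam u x = lam v x" for u v x
  proof (cases "u = v")
    case False
    have "p u x vs - p v x vs = 0" for vs
    proof (rule interface_extension[OF pol_diff[OF poly_forms_pol[OF famD[OF fam uv(1)]] poly_forms_pol[OF famD[OF fam uv(2)]]] uv False _ x])
      show "p u x vs - p v x vs = 0" if "x \<in> cell u" "x \<in> cell v" for x
        using eq[OF uv(1) that(1)] eq[OF uv(2) that(2)] by simp
    qed
    then show ?thesis by (simp add: fun_eq_iff)
  qed simp
  then have fc: "full_cont p" unfolding full_cont_def by blast
  have rep: "represents \<omega> p"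
    unfolding represents_def by (intro AE_I2) (use eq ocell_subset_cell in blast)
  have fo: "\<omega> \<in> forms_on T k" using assms by (simp add: M_fun_def C0_forms_def)
  show ?thesis by (rule that[OF fam fc eq rep abs_eq_cls[OF fo rep]])
qed

lemma M_fun_pw: "fam r k p \<Longrightarrow> full_cont p \<Longrightarrow> pw p \<in> M_fun C r k"
  unfolding M_fun_def alfeld_split_eq
  using pw_C0[of r k p] pw_cell[of p] by (auto simp: fam_def intro!: bexI[of _ "p _"])

lemma M_space_eq: "M_space C r k = cls ` {p. fam r k p \<and> full_cont p}"
  unfolding M_space_def
proof (intro equalityI subsetI)
  fix y assume "y \<in> abs_ae_form ` M_fun C r k"
  then show "y \<in> cls ` {p. fam r k p \<and> full_cont p}" by (auto elim!: M_fun_represented)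
next
  fix y assume "y \<in> cls ` {p. fam r k p \<and> full_cont p}"
  then show "y \<in> abs_ae_form ` M_fun C r k" by (auto simp: cls_def intro!: imageI M_fun_pw)
qed

lemma zero_on_frontier:
  assumes fam: "fam r k p" and eq: "\<And>v x. v \<in> C \<Longrightarrow> x \<in> cell v \<Longrightarrow> \<omega> x = p v x" and \<omega>: "\<omega> \<in> forms_on T k"
  shows "zero_on (frontier T) \<omega> \<longleftrightarrow> full_zero p"
proof
  assume z: "zero_on (frontier T) \<omega>"
  show "full_zero p"
    unfolding full_zero_def
  proof (intro ballI allI impI ext)
    fix v x vs assume v: "v \<in> C" and x: "lam v x = 0"
    show "p v x vs = 0"
    proof (rule facet_extension[OF poly_forms_pol[OF famD[OF fam v]] v _ x])
      fix x assume x: "x \<in> T" "lam v x = 0"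
      then have "x \<in> cell v" by (simp add: cell_def hull_eq)
      moreover have "x \<in> frontier T" using x v by (auto simp: frontier_eq)
      then have "\<omega> x = (\<lambda>vs. 0)" using z by (intro forms_eq_0_if_coeffs[OF \<omega>]) (simp add: zero_on_def)
      ultimately show "p v x vs = 0" using eq[OF v] by simp
    qed
  qed
next
  assume z: "full_zero p"
  show "zero_on (frontier T) \<omega>"
    unfolding zero_on_def
  proof (intro allI ballI)
    fix "is" x assume "x \<in> frontier T"
    then obtain v where v: "v \<in> C" "x \<in> T" "lam v x = 0" by (auto simp: frontier_eq)
    then have "x \<in> cell v" by (simp add: cell_def hull_eq)
    then show "form_coeff \<omega> is x = 0" using eq[OF v(1)] z v by (simp add: form_coeff_def full_zero_def)
  qed
qed

lemma C0_weak_d: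
  assumes p: "fam r k p" "represents \<omega> p" and \<xi>: "\<xi> \<in> C0_forms T (Suc k)" "weak_d T k \<omega> \<xi>"
  shows "\<And>v x. v \<in> C \<Longrightarrow> x \<in> cell v \<Longrightarrow> \<xi> x = fd k p v x" and "full_cont (fd k p)"
proof -
  show eq: "\<xi> x = fd k p v x" if "v \<in> C" "x \<in> cell v" for v x
    using continuous_weak_d_eq[OF p \<xi> that] by (simp add: fd_def)
  have fam: "fam (r - 1) (Suc k) (fd k p)" by (rule fam_fd[OF p(1)])
  show "full_cont (fd k p)"
    unfolding full_cont_def
  proof (intro ballI allI impI)
    fix u v x assume uv: "u \<in> C" "v \<in> C" and x: "lam u x = lam v x"
    show "fd k p u x = fd k p v x"
    proof (cases "u = v")
      case False
      have "fd k p u x vs - fd k p v x vs = 0" for vs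
      proof (rule interface_extension[OF pol_diff[OF poly_forms_pol[OF famD[OF fam uv(1)]] poly_forms_pol[OF famD[OF fam uv(2)]]] uv False _ x])
        show "fd k p u x vs - fd k p v x vs = 0" if "x \<in> cell u" "x \<in> cell v" for x
          using eq[OF uv(1) that(1)] eq[OF uv(2) that(2)] by simp
      qed
      then show ?thesis by (simp add: fun_eq_iff)
    qed simp
  qed
qed

lemma weak_d_pw: "fam r k p \<Longrightarrow> full_cont p \<Longrightarrow> weak_d T k (pw p) (pw (fd k p))"
  using weak_d_if_tan_cont[of r k p "pw p" "pw (fd k p)"] full_cont_imp_tan_cont represents_pw[of p] represents_pw[of "fd k p"]
  by (simp add: fd_eq)

lemma Md_space_eq: "Md_space C r k = cls ` {p. fam r k p \<and> full_cont p \<and> full_cont (fd k p)}"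
  unfolding Md_space_def
proof (intro equalityI subsetI)
  fix y assume "y \<in> abs_ae_form ` Md_fun C r k"
  then obtain \<omega> \<xi> where \<omega>: "y = abs_ae_form \<omega>" "\<omega> \<in> M_fun C r k" and \<xi>: "\<xi> \<in> C0_forms T (Suc k)" "weak_d T k \<omega> \<xi>"
    by (auto simp: Md_fun_def)
  obtain p where p: "fam r k p" "full_cont p" "represents \<omega> p" "abs_ae_form \<omega> = cls p"
    using M_fun_represented[OF \<omega>(2)] by metis
  then show "y \<in> cls ` {p. fam r k p \<and> full_cont p \<and> full_cont (fd k p)}"
    using C0_weak_d(2)[OF p(1,3) \<xi>] \<omega>(1) by blast
next
  fix y assume "y \<in> cls ` {p. fam r k p \<and> full_cont p \<and> full_cont (fd k p)}"
  then obtain p where p: "y = cls p" "fam r k p" "full_cont p" "full_cont (fd k p)" by blast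
  then have "pw p \<in> Md_fun C r k"
    using M_fun_pw[OF p(2,3)] weak_d_pw[OF p(2,3)] pw_C0[OF fam_fd[OF p(2)] p(4)] by (auto simp: Md_fun_def)
  then show "y \<in> abs_ae_form ` Md_fun C r k" using p(1) by (simp add: cls_def)
qed

lemma Md0_space_eq:
  "Md0_space C r k = cls ` {p. fam r k p \<and> full_cont p \<and> full_zero p \<and> full_cont (fd k p) \<and> full_zero (fd k p)}"
  unfolding Md0_space_def
proof (intro equalityI subsetI)
  fix y assume "y \<in> abs_ae_form ` Md0_fun C r k"
  then obtain \<omega> \<xi> where \<omega>: "y = abs_ae_form \<omega>" "\<omega> \<in> M_fun C r k" "zero_on (frontier T) \<omega>"
    and \<xi>: "\<xi> \<in> C0_forms T (Suc k)" "weak_d T k \<omega> \<xi>" "zero_on (frontier T) \<xi>"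
    by (auto simp: Md0_fun_def)
  obtain p where p: "fam r k p" "full_cont p" "\<And>v x. v \<in> C \<Longrightarrow> x \<in> cell v \<Longrightarrow> \<omega> x = p v x"
    "represents \<omega> p" "abs_ae_form \<omega> = cls p"
    using M_fun_represented[OF \<omega>(2)] by metis
  have "\<omega> \<in> forms_on T k" "\<xi> \<in> forms_on T (Suc k)" using \<omega>(2) \<xi>(1) by (simp_all add: M_fun_def C0_forms_def)
  then have "full_zero p" "full_zero (fd k p)"
    using zero_on_frontier[OF p(1,3)] zero_on_frontier[OF fam_fd[OF p(1)] C0_weak_d(1)[OF p(1,4) \<xi>(1,2)]] \<omega>(3) \<xi>(3) by auto
  then show "y \<in> cls ` {p. fam r k p \<and> full_cont p \<and> full_zero p \<and> full_cont (fd k p) \<and> full_zero (fd k p)}"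
    using C0_weak_d(2)[OF p(1,4) \<xi>(1,2)] p \<omega>(1) by blast
next
  fix y assume "y \<in> cls ` {p. fam r k p \<and> full_cont p \<and> full_zero p \<and> full_cont (fd k p) \<and> full_zero (fd k p)}"
  then obtain p where p: "y = cls p" "fam r k p" "full_cont p" "full_cont (fd k p)" "full_zero p" "full_zero (fd k p)" by blast
  note fd = fam_fd[OF p(2)]
  have "zero_on (frontier T) (pw p)" "zero_on (frontier T) (pw (fd k p))"
    using zero_on_frontier[OF p(2) pw_cell[OF p(3)] pw_forms_on[OF p(2)]]
      zero_on_frontier[OF fd pw_cell[OF p(4)] pw_forms_on[OF fd]] p by auto
  then have "pw p \<in> Md0_fun C r k"
    using M_fun_pw[OF p(2,3)] weak_d_pw[OF p(2,3)] pw_C0[OF fd p(4)] by (auto simp: Md0_fun_def)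
  then show "y \<in> abs_ae_form ` Md0_fun C r k" using p(1) by (simp add: cls_def)
qed

definition fint :: "(real ^ 'n \<Rightarrow> 'n rform) \<Rightarrow> real" where
  "fint p = (LINT x|lborel. (\<Sum>v\<in>C. indicator (ocell v) x * p v x (vecs coords)))"

lemma form_integral_eq: "fam r k p \<Longrightarrow> represents \<omega> p \<Longrightarrow> form_integral T \<omega> = fint p"
  unfolding form_integral_def fint_def
proof (rule integral_T(1))
  assume p: "fam r k p" and "represents \<omega> p"
  then show "AE x in lebesgue. \<forall>v\<in>C. x \<in> ocell v \<longrightarrow> form_coeff \<omega> coords x = p v x (vecs coords)"
    unfolding represents_def by (auto elim!: eventually_mono simp: form_coeff_def vecs_def)
  show "(\<lambda>x. p v x (vecs coords)) \<in> borel_measurable borel" if "v \<in> C" for v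
    by (rule borel_measurable_continuous_onI[OF pol_continuous[OF poly_forms_pol[OF famD[OF p that]]]])
qed

lemma fint_integrable: "fam r k p \<Longrightarrow> integrable lborel (\<lambda>x. \<Sum>v\<in>C. indicator (ocell v) x * p v x (vecs coords))"
proof (intro Bochner_Integration.integrable_sum integrable_indicator_continuous[where K = T])
  assume p: "fam r k p"
  fix v assume v: "v \<in> C"
  show "continuous_on UNIV (\<lambda>x. p v x (vecs coords))" by (rule pol_continuous[OF poly_forms_pol[OF famD[OF p v]]])
  show "ocell v \<subseteq> T" using v ocell_subset_cell cell_subset by blast
qed (use open_ocell compact_T in auto)

lemma fint_add: "fam r k p \<Longrightarrow> fam s k q \<Longrightarrow> fint (\<lambda>v x vs. p v x vs + q v x vs) = fint p + fint q"
  unfolding fint_def using fint_integrable[of r k p] fint_integrable[of s k q] by (simp add: distrib_left sum.distrib)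

lemma fint_scale: "fint (\<lambda>v x vs. c * p v x vs) = c * fint p"
proof -
  have "(\<Sum>v\<in>C. indicator (ocell v) x * (c * p v x (vecs coords))) = c * (\<Sum>v\<in>C. indicator (ocell v) x * p v x (vecs coords))" for x
    by (simp add: sum_distrib_left mult_ac)
  then show ?thesis by (simp add: fint_def)
qed

lemma fint_cong: "(\<And>v. v \<in> C \<Longrightarrow> p v = q v) \<Longrightarrow> fint p = fint q"
  unfolding fint_def by (intro Bochner_Integration.integral_cong sum.cong) auto

lemma M0_space_eq:
  "M0_space C r k = cls ` {p. fam r k p \<and> full_cont p \<and> full_zero p \<and> (k = CARD('n) \<longrightarrow> fint p = 0)}"
  unfolding M0_space_def
proof (intro equalityI subsetI)
  fix y assume "y \<in> abs_ae_form ` M0_fun C r k"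
  then obtain \<omega> where \<omega>: "y = abs_ae_form \<omega>" "\<omega> \<in> M_fun C r k" "zero_on (frontier T) \<omega>"
    "k = CARD('n) \<longrightarrow> form_integral T \<omega> = 0"
    by (auto simp: M0_fun_def)
  obtain p where p: "fam r k p" "full_cont p" "\<And>v x. v \<in> C \<Longrightarrow> x \<in> cell v \<Longrightarrow> \<omega> x = p v x"
    "represents \<omega> p" "abs_ae_form \<omega> = cls p"
    using M_fun_represented[OF \<omega>(2)] by metis
  have "\<omega> \<in> forms_on T k" using \<omega>(2) by (simp add: M_fun_def C0_forms_def)
  then have "full_zero p" using zero_on_frontier[OF p(1,3)] \<omega>(3) by auto
  then show "y \<in> cls ` {p. fam r k p \<and> full_cont p \<and> full_zero p \<and> (k = CARD('n) \<longrightarrow> fint p = 0)}"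
    using p \<omega>(1,4) form_integral_eq[OF p(1,4)] by auto
next
  fix y assume "y \<in> cls ` {p. fam r k p \<and> full_cont p \<and> full_zero p \<and> (k = CARD('n) \<longrightarrow> fint p = 0)}"
  then obtain p where p: "y = cls p" "fam r k p" "full_cont p" "full_zero p" "k = CARD('n) \<longrightarrow> fint p = 0" by blast
  have "zero_on (frontier T) (pw p)"
    using zero_on_frontier[OF p(2) pw_cell[OF p(3)] pw_forms_on[OF p(2)]] p(4) by auto
  then have "pw p \<in> M0_fun C r k"
    using M_fun_pw[OF p(2,3)] form_integral_eq[OF p(2) represents_pw] p(5) by (auto simp: M0_fun_def)
  then show "y \<in> abs_ae_form ` M0_fun C r k" using p(1) by (simp add: cls_def)
qed

subsection \<open>Facets and traces\<close>

lemma sum_D: "(\<Sum>u\<in>C. D u \<bullet> y) = 0"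
  using sum_lam[of y] sum_lam[of 0] by (simp add: lam_def sum.distrib)

lemma repr_D: "(\<Sum>u\<in>C. (D u \<bullet> y) *\<^sub>R (u - w)) = y"
proof -
  have "(\<Sum>u\<in>C. (D u \<bullet> y) *\<^sub>R u) = (\<Sum>u\<in>C. lam u y *\<^sub>R u) - (\<Sum>u\<in>C. lam u 0 *\<^sub>R u)"
    by (simp add: lam_def scaleR_add_left sum.distrib)
  also have "\<dots> = y" by (simp only: lam_repr) simp
  finally have "(\<Sum>u\<in>C. (D u \<bullet> y) *\<^sub>R u) = y" .
  moreover have "(\<Sum>u\<in>C. (D u \<bullet> y) *\<^sub>R w) = 0" by (simp add: sum_D flip: scaleR_sum_left)
  ultimately show ?thesis by (simp add: scaleR_diff_right sum_subtractf)
qed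

lemma facet_eq:
  assumes v: "v \<in> C" shows "convex hull (C - {v}) = {x \<in> T. lam v x = 0}"
proof (intro equalityI subsetI)
  fix x assume x: "x \<in> convex hull (C - {v})"
  have "convex {x. lam v x = 0}" by (rule convexI) (simp add: lam_affine)
  then have "convex hull (C - {v}) \<subseteq> {x. lam v x = 0}" using v by (intro hull_minimal) (auto simp: lam_vertex)
  then show "x \<in> {x \<in> T. lam v x = 0}" using x hull_mono[of "C - {v}" C] by auto
next
  fix x assume x: "x \<in> {x \<in> T. lam v x = 0}"
  have fin: "finite (C - {v})" using finite_C by simp
  have l: "lam v x = 0" using x by simp
  have "sum (\<lambda>u. lam u x) (C - {v}) = (\<Sum>u\<in>C. lam u x)"
    using v finite_C by (simp add: sum.remove[of C v] l)
  then have "sum (\<lambda>u. lam u x) (C - {v}) = 1" by (simp only: sum_lam)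
  moreover have "(\<Sum>u\<in>C - {v}. lam u x *\<^sub>R u) = (\<Sum>u\<in>C. lam u x *\<^sub>R u)"
    using v finite_C by (simp add: sum.remove[of C v] l)
  then have "(\<Sum>u\<in>C - {v}. lam u x *\<^sub>R u) = x" by (simp only: lam_repr)
  moreover have "\<forall>u\<in>C - {v}. 0 \<le> lam u x" using x by (simp add: hull_eq)
  ultimately show "x \<in> convex hull (C - {v})" unfolding convex_hull_finite[OF fin]
    by (intro CollectI exI[of _ "\<lambda>u. lam u x"] conjI)
qed

lemma tangent_facet:
  assumes v: "v \<in> C" shows "tangent_space (convex hull (C - {v})) = {y. D v \<bullet> y = 0}"
proof (intro equalityI subsetI)
  fix y assume "y \<in> tangent_space (convex hull (C - {v}))"
  then have y: "y \<in> span {a - b | a b. a \<in> convex hull (C - {v}) \<and> b \<in> convex hull (C - {v})}" by (simp add: tangent_space_def)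
  have "span {a - b | a b. a \<in> convex hull (C - {v}) \<and> b \<in> convex hull (C - {v})} \<subseteq> {y. D v \<bullet> y = 0}"
  proof (rule span_minimal)
    show "subspace {y. D v \<bullet> y = 0}" by (rule subspace_hyperplane)
  qed (auto simp: facet_eq[OF v] lam_diff)
  then show "y \<in> {y. D v \<bullet> y = 0}" using y by blast
next
  fix y assume y: "y \<in> {y. D v \<bullet> y = 0}"
  obtain w where w: "w \<in> C" "w \<noteq> v" using exists_unit_normal[OF v] by metis
  have "(D u \<bullet> y) *\<^sub>R (u - w) \<in> tangent_space (convex hull (C - {v}))" if "u \<in> C" for u
  proof (cases "u = v")
    case True then show ?thesis using y by (simp add: tangent_space_def span_zero)
  next
    case False
    then show ?thesis unfolding tangent_space_def using that w
      by (intro span_scale span_base) (auto intro: hull_inc)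
  qed
  then have "(\<Sum>u\<in>C. (D u \<bullet> y) *\<^sub>R (u - w)) \<in> tangent_space (convex hull (C - {v}))"
    unfolding tangent_space_def by (rule span_sum)
  then show "y \<in> tangent_space (convex hull (C - {v}))" by (simp only: repr_D)
qed

lemma facets_eq: "subsimplices (CARD('n) - 1) C = (\<lambda>v. convex hull (C - {v})) ` C"
proof (intro equalityI subsetI)
  fix F assume "F \<in> subsimplices (CARD('n) - 1) C"
  then obtain E where E: "F = convex hull E" "E \<subseteq> C" "card E = CARD('n)"
    using zero_less_card_finite[where 'a = 'n] by (auto simp: subsimplices_def)
  have "card (C - E) = 1" using E card_C finite_C by (simp add: card_Diff_subset finite_subset)
  then obtain v where "C - E = {v}" by (auto simp: card_1_singleton_iff)
  then have "v \<in> C" "E = C - {v}" using E by auto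
  then show "F \<in> (\<lambda>v. convex hull (C - {v})) ` C" using E by blast
next
  fix F assume "F \<in> (\<lambda>v. convex hull (C - {v})) ` C"
  then obtain v where v: "v \<in> C" "F = convex hull (C - {v})" by blast
  then have "card (C - {v}) = CARD('n) - 1 + 1" using card_C finite_C dim2 by simp
  then show "F \<in> subsimplices (CARD('n) - 1) C" unfolding subsimplices_def using v by blast
qed

lemma facet_subset_cell:
  assumes "v \<in> C" "w \<in> C" shows "convex hull (C - {v}) \<subseteq> cell w \<longleftrightarrow> w = v"
proof
  assume sub: "convex hull (C - {v}) \<subseteq> cell w"
  show "w = v"
  proof (rule ccontr)
    assume "w \<noteq> v"
    then have "w \<in> cell w" using sub assms by (auto intro: hull_inc)
    moreover obtain u where "u \<in> C" "u \<noteq> w" using exists_unit_normal[OF assms(2)] by metis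
    ultimately show False using assms by (auto simp: cell_def lam_vertex)
  qed
next
  assume "w = v"
  then show "convex hull (C - {v}) \<subseteq> cell w" using assms by (auto simp: facet_eq cell_def hull_eq)
qed

text \<open>
  Each facet lies in one cell only, the piece \<open>q\<close> in the definition of the trace is unique, and the tangent space of
  the facet is the kernel of \<open>D v\<close>.
\<close>

lemma zero_traces_iff:
  assumes p: "fam r k p" and \<omega>: "represents \<omega> p"
  shows "zero_traces C r k \<omega> \<longleftrightarrow> tan_zero p"
proof -
  have rep: "AE x in lebesgue. x \<in> ocell v \<longrightarrow> \<omega> x = p v x" if "v \<in> C" for v
    using \<omega> unfolding represents_def by eventually_elim (use that in blast)
  have "zero_traces C r k \<omega> \<longleftrightarrow> (\<forall>v\<in>C. \<exists>q\<in>poly_forms r k. (AE x in lebesgue. x \<in> ocell v \<longrightarrow> \<omega> x = q x) \<and>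
      trace_form (convex hull (C - {v})) q = (\<lambda>x vs. 0))"
    unfolding zero_traces_def facets_eq alfeld_split_eq using facet_subset_cell AE_on_cell by auto
  also have "\<dots> \<longleftrightarrow> (\<forall>v\<in>C. trace_form (convex hull (C - {v})) (p v) = (\<lambda>x vs. 0))"
  proof (intro ball_cong refl iffI)
    fix v assume v: "v \<in> C"
    assume "\<exists>q\<in>poly_forms r k. (AE x in lebesgue. x \<in> ocell v \<longrightarrow> \<omega> x = q x) \<and>
      trace_form (convex hull (C - {v})) q = (\<lambda>x vs. 0)"
    then obtain q where q: "q \<in> poly_forms r k" "AE x in lebesgue. x \<in> ocell v \<longrightarrow> \<omega> x = q x"
      "trace_form (convex hull (C - {v})) q = (\<lambda>x vs. 0)" by blast
    have "AE x in lebesgue. x \<in> ocell v \<longrightarrow> p v x = q x" using rep[OF v] q(2) by eventually_elim simp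
    then have "p v = q" by (rule poly_forms_eq_if_AE[OF famD[OF p v] q(1) v])
    then show "trace_form (convex hull (C - {v})) (p v) = (\<lambda>x vs. 0)" using q(3) by simp
  qed (use rep famD[OF p] in blast)
  also have "\<dots> \<longleftrightarrow> tan_zero p"
  proof
    assume z: "\<forall>v\<in>C. trace_form (convex hull (C - {v})) (p v) = (\<lambda>x vs. 0)"
    show "tan_zero p"
      unfolding tan_zero_def
    proof (intro ballI allI impI)
      fix v x vs assume v: "v \<in> C" and x: "lam v x = 0" and vs: "\<forall>y\<in>set vs. D v \<bullet> y = 0"
      show "p v x vs = 0"
      proof (rule facet_extension[OF poly_forms_pol[OF famD[OF p v]] v _ x])
        fix x assume "x \<in> T" "lam v x = 0"
        then have "x \<in> convex hull (C - {v})" by (simp add: facet_eq[OF v])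
        moreover have "set vs \<subseteq> tangent_space (convex hull (C - {v}))" using vs tangent_facet[OF v] by auto
        moreover have "trace_form (convex hull (C - {v})) (p v) x vs = 0" using z v by simp
        ultimately show "p v x vs = 0" by (simp add: trace_form_def)
      qed
    qed
  next
    assume z: "tan_zero p"
    show "\<forall>v\<in>C. trace_form (convex hull (C - {v})) (p v) = (\<lambda>x vs. 0)"
    proof (intro ballI ext)
      fix v x vs assume v: "v \<in> C"
      show "trace_form (convex hull (C - {v})) (p v) x vs = 0"
        unfolding trace_form_def tangent_facet[OF v] unfolding facet_eq[OF v] using tan_zeroD[OF z v, of x vs] by auto
    qed
  qed
  finally show ?thesis .
qed

lemma Vd0_space_eq:
  "Vd0_space C r k = cls ` {p. fam r k p \<and> tan_cont p \<and> (if k < CARD('n) then tan_zero p else fint p = 0)}"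
  unfolding Vd0_space_def
proof (intro equalityI subsetI)
  fix y assume "y \<in> abs_ae_form ` Vd0_fun C r k"
  then obtain \<omega> where \<omega>: "y = abs_ae_form \<omega>" "\<omega> \<in> Vd_fun C r k"
    "if k < CARD('n) then zero_traces C r k \<omega> else form_integral T \<omega> = 0" by (auto simp: Vd0_fun_def)
  obtain p where p: "fam r k p" "tan_cont p" "represents \<omega> p" "abs_ae_form \<omega> = cls p"
    using Vd_fun_represented[OF \<omega>(2)] .
  then show "y \<in> cls ` {p. fam r k p \<and> tan_cont p \<and> (if k < CARD('n) then tan_zero p else fint p = 0)}"
    using \<omega>(1,3) zero_traces_iff[OF p(1,3)] form_integral_eq[OF p(1,3)] by auto
next
  fix y assume "y \<in> cls ` {p. fam r k p \<and> tan_cont p \<and> (if k < CARD('n) then tan_zero p else fint p = 0)}"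
  then obtain p where p: "y = cls p" "fam r k p" "tan_cont p" "if k < CARD('n) then tan_zero p else fint p = 0" by blast
  then have "pw p \<in> Vd0_fun C r k"
    using Vd_fun_pw[OF p(2,3)] zero_traces_iff[OF p(2) represents_pw] form_integral_eq[OF p(2) represents_pw]
    by (auto simp: Vd0_fun_def)
  then show "y \<in> abs_ae_form ` Vd0_fun C r k" using p(1) by (simp add: cls_def)
qed

end


section \<open>Exactness and the dimension formula\<close>

context bary
begin

text \<open>
  A form that vanishes on a hyperplane is \<open>h g\<close> with an affine function \<open>h\<close>, and on the hyperplane
  \<open>d (h g) = dh \<and> g\<close>, which is zero on tangential vectors.  Applied to \<open>p u - p v\<close> and to \<open>p v\<close>, this
  gives the matching conditions for the derivative of a continuous form.
\<close>

lemma ext_d_tangential_zero: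
  assumes p: "p \<in> poly_forms r k" and N: "a \<bullet> N = 1" and 0: "\<And>x vs. a \<bullet> x + c = 0 \<Longrightarrow> p x vs = 0"
    and x: "a \<bullet> x + c = 0" and vs: "\<And>y. y \<in> set vs \<Longrightarrow> a \<bullet> y = 0"
  shows "ext_d k p x vs = 0"
proof -
  obtain q where q: "q \<in> poly_forms (r - 1) k" "\<And>x vs. p x vs = (a \<bullet> x + c) * q x vs"
    using poly_forms_divide[OF p N, of c] 0 by blast
  have "p = (\<lambda>x vs. (a \<bullet> x + c) * q x vs)" using q(2) by (intro ext)
  moreover have "((\<lambda>x. a \<bullet> x + c) has_derivative (\<lambda>y. a \<bullet> y)) (at x)" by (auto intro!: derivative_eq_intros)
  ultimately show ?thesis using ext_d_mult[OF q(1)] x wedge_vanishes_on_kernel[of vs "\<lambda>y. a \<bullet> y", OF vs] by simp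
qed

lemma tan_cont_fd:
  assumes p: "fam r k p" and c: "full_cont p" shows "tan_cont (fd k p)"
  unfolding tan_cont_def
proof (intro ballI allI impI)
  fix u v x vs assume uv: "u \<in> C" "v \<in> C" and x: "lam u x = lam v x" and vs: "\<forall>y\<in>set vs. D u \<bullet> y = D v \<bullet> y"
  show "fd k p u x vs = fd k p v x vs"
  proof (cases "u = v")
    case False
    let ?q = "\<lambda>x vs. p u x vs - p v x vs" and ?a = "D u - D v" and ?c = "c0 u - c0 v"
    have h: "?a \<bullet> x + ?c = lam u x - lam v x" for x by (simp add: lam_def inner_diff_left)
    have q: "?q \<in> poly_forms r k" by (rule poly_forms_diff[OF famD[OF p uv(1)] famD[OF p uv(2)]])
    have N: "?a \<bullet> ((1 / 2) *\<^sub>R (u - v)) = 1" using uv False by (simp add: inner_diff_left lam_diff lam_vertex)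
    have "ext_d k ?q x vs = 0"
    proof (rule ext_d_tangential_zero[OF q N])
      show "?q x vs = 0" if "?a \<bullet> x + ?c = 0" for x vs
      proof -
        have "lam u x = lam v x" using that h[of x] by simp
        then have "p u x = p v x" using c[unfolded full_cont_def] uv by blast
        then show ?thesis by simp
      qed
      show "?a \<bullet> x + ?c = 0" using x h[of x] by simp
      show "?a \<bullet> y = 0" if "y \<in> set vs" for y using vs that by (simp add: inner_diff_left)
    qed
    moreover have "ext_d k (\<lambda>x vs. ?q x vs + p v x vs) x vs = ext_d k ?q x vs + ext_d k (p v) x vs"
      by (rule ext_d_add[OF q famD[OF p uv(2)]])
    ultimately show ?thesis by (simp add: fd_def)
  qed simp
qed

lemma tan_zero_fd:
  assumes p: "fam r k p" and z: "full_zero p" shows "tan_zero (fd k p)"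
  unfolding tan_zero_def
proof (intro ballI allI impI)
  fix v x vs assume v: "v \<in> C" and x: "lam v x = 0" and vs: "\<forall>y\<in>set vs. D v \<bullet> y = 0"
  obtain w where w: "D v \<bullet> (v - w) = 1" using exists_unit_normal[OF v] by metis
  show "fd k p v x vs = 0"
    unfolding fd_def
  proof (rule ext_d_tangential_zero[OF famD[OF p v] w])
    show "p v x vs = 0" if "D v \<bullet> x + c0 v = 0" for x vs
      using z v that by (simp add: full_zero_def lam_def)
  qed (use x vs in \<open>auto simp: lam_def\<close>)
qed

lemma fint_fd: "fam r k p \<Longrightarrow> full_cont p \<Longrightarrow> full_zero p \<Longrightarrow> fint (fd k p) = 0"
  unfolding fint_def fd_def by (rule integral_d_zero)

lemma tan_cont_add: "tan_cont p \<Longrightarrow> tan_cont q \<Longrightarrow> tan_cont (\<lambda>v x vs. p v x vs + q v x vs)"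
  unfolding tan_cont_def by metis

lemma tan_zero_add: "tan_zero p \<Longrightarrow> tan_zero q \<Longrightarrow> tan_zero (\<lambda>v x vs. p v x vs + q v x vs)"
  by (simp add: tan_zero_def)

lemma tan_zero_cong: "tan_zero p \<Longrightarrow> (\<And>v. v \<in> C \<Longrightarrow> p v = q v) \<Longrightarrow> tan_zero q"
  unfolding tan_zero_def by metis

lemma tan_cont_cong: "tan_cont p \<Longrightarrow> (\<And>v. v \<in> C \<Longrightarrow> p v = q v) \<Longrightarrow> tan_cont q"
  unfolding tan_cont_def by metis

lemma full_cont_cong: "full_cont p \<Longrightarrow> (\<And>v. v \<in> C \<Longrightarrow> p v = q v) \<Longrightarrow> full_cont q"
  unfolding full_cont_def by metis

lemma full_zero_cong: "full_zero p \<Longrightarrow> (\<And>v. v \<in> C \<Longrightarrow> p v = q v) \<Longrightarrow> full_zero q"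
  unfolding full_zero_def by metis

lemma fam_cong: "fam r k p \<Longrightarrow> (\<And>v. v \<in> C \<Longrightarrow> p v = q v) \<Longrightarrow> fam r k q"
  unfolding fam_def by metis

lemma full_cont_scale: "full_cont p \<Longrightarrow> full_cont (\<lambda>v x vs. c * p v x vs)"
  unfolding full_cont_def by metis

lemma fam_add: "fam r k p \<Longrightarrow> fam r k q \<Longrightarrow> fam r k (\<lambda>v x vs. p v x vs + q v x vs)"
  by (simp add: fam_def poly_forms_add)

lemma fam_scale: "fam r k p \<Longrightarrow> fam r k (\<lambda>v x vs. c * p v x vs)"
  by (simp add: fam_def poly_forms_scale)

lemma fam_zero: "fam r k (\<lambda>v x vs. 0)"
  by (simp add: fam_def poly_forms_zero)

lemma fam_space_M: "fam_space r k {p. fam r k p \<and> full_cont p}"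
  unfolding fam_space_def
proof (intro conjI ballI allI impI CollectI)
  show "full_cont (\<lambda>v x vs. 0)" by (simp add: full_cont_def)
qed (auto intro: fam_add fam_scale fam_zero full_cont_add full_cont_scale fam_cong full_cont_cong)

lemma fam_space_M0: "fam_space r k {p. fam r k p \<and> full_cont p \<and> full_zero p \<and> (k = CARD('n) \<longrightarrow> fint p = 0)}"
  unfolding fam_space_def
proof (intro conjI ballI allI impI CollectI)
  show "full_cont (\<lambda>v x vs. 0)" "full_zero (\<lambda>v x vs. 0)" by (simp_all add: full_cont_def full_zero_def)
  show "fint (\<lambda>v x vs. 0) = 0" by (simp add: fint_def)
  show "full_zero (\<lambda>v x vs. c * p v x vs)"
    if "p \<in> {p. fam r k p \<and> full_cont p \<and> full_zero p \<and> (k = CARD('n) \<longrightarrow> fint p = 0)}" for c p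
    using that by (simp add: full_zero_def)
  show "fint q = 0" if "k = CARD('n)" "p \<in> {p. fam r k p \<and> full_cont p \<and> full_zero p \<and> (k = CARD('n) \<longrightarrow> fint p = 0)}"
    "\<forall>v\<in>C. p v = q v" for p q
    using that fint_cong[of p q] by auto
qed (auto intro: fam_add fam_scale fam_zero full_cont_add full_cont_scale full_zero_add fam_cong full_cont_cong full_zero_cong
       simp: fint_add fint_scale)

text \<open>Without boundary conditions, the boundary traces are first removed by a global polynomial form.\<close>

lemma decomposition:
  assumes p: "fam (int r - 1) (Suc k) p" "tan_cont p"
  shows "\<exists>\<rho> \<eta>. fam (int r) k \<rho> \<and> full_cont \<rho> \<and> fam (int r - 1) (Suc k) \<eta> \<and> full_cont \<eta> \<and>
    (\<forall>v\<in>C. p v = (\<lambda>x vs. fd k \<rho> v x vs + \<eta> v x vs))"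
proof (cases r)
  case 0
  then have "p v x vs = 0" if "v \<in> C" for v x vs using poly_forms_negative[OF famD[OF p(1) that]] by simp
  moreover have "fd k (\<lambda>v x vs. 0) v x vs = 0" for v x vs
    using poly_forms_negative[OF poly_forms_ext_d[OF poly_forms_zero[of "-1" k]]] by (simp add: fd_def)
  moreover have "full_cont (\<lambda>v x vs. 0)" by (simp add: full_cont_def)
  ultimately show ?thesis
    by (intro exI[of _ "\<lambda>v x vs. 0"] conjI fam_zero ballI) (auto simp: fun_eq_iff)
next
  case (Suc s)
  have fp: "fam (int s) (Suc k) p" using p(1) Suc by simp
  obtain \<Phi> where \<Phi>: "\<Phi> \<in> poly_forms (int s) (Suc k)" "s = 0 \<or> tan_zero (\<lambda>v x vs. p v x vs - \<Phi> x vs)"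
  proof (cases "s = 0")
    case True then show ?thesis using that poly_forms_zero by blast
  next
    case False
    obtain \<Phi> where "\<Phi> \<in> poly_forms (int s) (Suc k)"
      "\<And>v x vs. v \<in> C \<Longrightarrow> lam v x = 0 \<Longrightarrow> (\<And>y. y \<in> set vs \<Longrightarrow> D v \<bullet> y = 0) \<Longrightarrow> \<Phi> x vs = p v x vs"
    proof (rule extend_traces[of s p "Suc k"])
      fix u v x vs assume "u \<in> C" "v \<in> C" "lam u x = 0" "lam v x = 0"
        "\<And>y. y \<in> set vs \<Longrightarrow> D u \<bullet> y = 0 \<and> D v \<bullet> y = 0"
      then show "p u x vs = p v x vs" by (intro tan_contD[OF p(2)]) auto
    qed (use False famD[OF fp] in auto)
    then show ?thesis using that[of \<Phi>] by (auto simp: tan_zero_def)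
  qed
  let ?p = "\<lambda>v x vs. p v x vs - \<Phi> x vs"
  have p': "fam (int s) (Suc k) ?p" "tan_cont ?p"
  proof -
    show "fam (int s) (Suc k) ?p" using poly_forms_diff[OF famD[OF fp] \<Phi>(1)] by (simp add: fam_def)
    show "tan_cont ?p" using p(2) unfolding tan_cont_def by metis
  qed
  obtain \<rho> \<eta> where \<rho>: "fam (int (0 + s) + 1) k \<rho>" "full_cont \<rho>" and \<eta>: "fam (int (0 + s)) (Suc k) \<eta>" "full_cont \<eta>"
    and eq: "\<forall>v\<in>C. \<forall>x vs. lam v x ^ 0 * ?p v x vs = ext_d k (\<rho> v) x vs + \<eta> v x vs"
    using descent[OF p', of 0] \<Phi>(2) by blast
  have "p v = (\<lambda>x vs. fd k \<rho> v x vs + (\<eta> v x vs + \<Phi> x vs))" if "v \<in> C" for v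
  proof (intro ext)
    fix x vs show "p v x vs = fd k \<rho> v x vs + (\<eta> v x vs + \<Phi> x vs)"
      using eq[rule_format, OF that, of x vs] by (simp add: fd_def)
  qed
  moreover have "fam (int s) (Suc k) (\<lambda>v x vs. \<eta> v x vs + \<Phi> x vs)"
    using poly_forms_add[OF famD[OF \<eta>(1)[simplified]] \<Phi>(1)] by (simp add: fam_def)
  moreover have "full_cont (\<lambda>v x vs. \<eta> v x vs + \<Phi> x vs)"
    by (rule full_cont_add[OF \<eta>(2)]) (simp add: full_cont_def)
  moreover have "fam (int r) k \<rho>" "int r - 1 = int s" using \<rho>(1) Suc by (simp_all add: add.commute)
  ultimately show ?thesis using \<rho>(2)
    by (intro exI[of _ \<rho>] exI[of _ "\<lambda>v x vs. \<eta> v x vs + \<Phi> x vs"] conjI ballI) simp_all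
qed

text \<open>
  The \<open>n\<close> edge vectors \<open>u - w\<close> span the space and are dual to the covectors \<open>D u\<close>.  A list of fewer than \<open>n\<close> of them
  omits some \<open>u - w\<close>, and all its entries are tangential to the facet opposite to \<open>u\<close>.
\<close>

lemma zero_if_zero_on_facets:
  assumes c: "alternating k c" and k: "k < CARD('n)"
    and 0: "\<And>v vs. v \<in> C \<Longrightarrow> (\<And>y. y \<in> set vs \<Longrightarrow> D v \<bullet> y = 0) \<Longrightarrow> c vs = 0"
  shows "c vs = 0"
proof -
  obtain w where w: "w \<in> C" using another_vertex[of "{}"] by auto
  let ?B = "(\<lambda>u. u - w) ` (C - {w})"
  have "y \<in> span ?B" for y
  proof -
    have "(D u \<bullet> y) *\<^sub>R (u - w) \<in> span ?B" if "u \<in> C" for u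
      using that by (cases "u = w") (auto intro: span_zero span_scale span_base)
    then have "(\<Sum>u\<in>C. (D u \<bullet> y) *\<^sub>R (u - w)) \<in> span ?B" by (rule span_sum)
    then show ?thesis by (simp only: repr_D)
  qed
  then have "span ?B = UNIV" by auto
  then show ?thesis
  proof (rule alternating_eqI_spanning[OF c])
    fix vs assume vs: "length vs = k" "set vs \<subseteq> ?B"
    have "card (set vs) < card ?B"
    proof -
      have "card ?B = CARD('n)" using w finite_C card_C by (simp add: card_image inj_on_def)
      then show ?thesis using card_length[of vs] vs k by simp
    qed
    then obtain y where "y \<in> ?B" "y \<notin> set vs" using card_mono[of "set vs" ?B] by fastforce
    then obtain u where u: "u \<in> C" "u \<noteq> w" "u - w \<notin> set vs" by blast
    show "c vs = 0"
    proof (rule 0[OF u(1)])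
      fix y assume y: "y \<in> set vs"
      then obtain u' where "u' \<in> C" "u' \<noteq> w" "y = u' - w" using vs by blast
      then show "D u \<bullet> y = 0" using u w y by (auto simp: lam_diff lam_vertex)
    qed
  qed
qed

lemma fint_const:
  assumes c: "alternating CARD('n) c" and "fint (\<lambda>v x. c) = 0" shows "c vs = 0"
proof (rule top_form_eq_0[OF c])
  have fam: "fam 0 CARD('n) (\<lambda>v x. c)" using poly_forms_const[OF c, of 0] by (simp add: fam_def)
  show "c (map (\<lambda>i. axis i 1) coords) = 0"
  proof (rule ccontr)
    assume nz: "c (map (\<lambda>i. axis i 1) coords) \<noteq> 0"
    let ?c = "c (vecs coords)" 
    let ?F = "\<lambda>x. \<Sum>v\<in>C. indicator (ocell v) x * (?c * ?c)"
    have pos: "0 < ?c * ?c" using nz by (auto simp: vecs_def zero_less_mult_iff linorder_neq_iff)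
    obtain v where v: "v \<in> C" using another_vertex[of "{}"] by auto
    have F: "?F = (\<lambda>x. ?c * (\<Sum>v\<in>C. indicator (ocell v) x * ?c))" by (simp add: sum_distrib_left mult_ac)
    have int: "integrable lborel ?F" unfolding F using fint_integrable[OF fam] by (rule integrable_mult_right)
    have "0 < (LINT x|lborel. ?F x)"
    proof (rule integral_pos_if_pos_on_open[OF int _ open_ocell pull_in_ocell[OF v]])
      show "0 \<le> ?F x" for x by (intro sum_nonneg mult_nonneg_nonneg[OF _ less_imp_le[OF pos]]) auto
      show "0 < ?F x" if "x \<in> ocell v" for x using sum_ocell[OF v that, of "\<lambda>v. ?c * ?c"] pos by simp
    qed
    moreover have "(LINT x|lborel. ?F x) = ?c * fint (\<lambda>v x. c)" unfolding F fint_def by (rule integral_mult_right_zero)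
    ultimately show False using assms(2) by simp
  qed
qed

text \<open>
  The tangential traces vanish by hypothesis if \<open>k + 1 < n\<close>, and in top degree because a facet has no \<open>n\<close>
  independent tangent vectors; so the descent starts at once, and in positive degree both terms vanish on the boundary.
  For constant \<open>p\<close> it leaves a global constant form.  This has vanishing traces if \<open>k + 1 < n\<close> and
  vanishing integral if \<open>k + 1 = n\<close>, and is zero in both cases.
\<close>

lemma decomposition_zero_boundary:
  assumes k: "Suc k \<le> CARD('n)" and p: "fam (int r - 1) (Suc k) p" "tan_cont p"
    and bd: "if Suc k < CARD('n) then tan_zero p else fint p = 0"
  shows "\<exists>\<rho> \<eta>. fam (int r) k \<rho> \<and> full_cont \<rho> \<and> full_zero \<rho> \<and> fam (int r - 1) (Suc k) \<eta> \<and> full_cont \<eta> \<and> full_zero \<eta> \<and>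
    (Suc k = CARD('n) \<longrightarrow> fint \<eta> = 0) \<and> (\<forall>v\<in>C. p v = (\<lambda>x vs. fd k \<rho> v x vs + \<eta> v x vs))"
proof (cases r)
  case 0
  then have "p v x vs = 0" if "v \<in> C" for v x vs using poly_forms_negative[OF famD[OF p(1) that]] by simp
  moreover have "fd k (\<lambda>v x vs. 0) v x vs = 0" for v x vs
    using poly_forms_negative[OF poly_forms_ext_d[OF poly_forms_zero[of "-1" k]]] by (simp add: fd_def)
  moreover have "full_cont (\<lambda>v x vs. 0)" "full_zero (\<lambda>v x vs. 0)" "fint (\<lambda>v x vs. 0) = 0"
    by (simp_all add: full_cont_def full_zero_def fint_def)
  ultimately show ?thesis
    by (intro exI[of _ "\<lambda>v x vs. 0"] conjI fam_zero ballI) (auto simp: fun_eq_iff)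
next
  case (Suc s)
  have fp: "fam (int s) (Suc k) p" using p(1) Suc by simp
  have tz: "tan_zero p"
  proof (cases "Suc k < CARD('n)")
    case False
    then have kn: "Suc k = CARD('n)" using k by simp
    show ?thesis
      unfolding tan_zero_def
    proof (intro ballI allI impI)
      fix v x vs assume v: "v \<in> C" and vs: "\<forall>y\<in>set vs. D v \<bullet> y = 0"
      obtain w where w: "D v \<bullet> (v - w) = 1" using exists_unit_normal[OF v] by metis
      show "p v x vs = 0"
        using vanishes_on_hyperplane_if_top_degree[OF linear_D w, of "p v x" vs]
          poly_forms_alternating[OF famD[OF fp v]] vs kn by simp
    qed
  qed (use bd in simp)
  obtain \<rho> \<eta> where \<rho>: "fam (int (0 + s) + 1) k \<rho>" "full_cont \<rho>" "full_zero \<rho>"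
    and \<eta>: "fam (int (0 + s)) (Suc k) \<eta>" "full_cont \<eta>" "1 \<le> 0 + s \<longrightarrow> full_zero \<eta>"
    "0 + s = 0 \<longrightarrow> (\<exists>c. alternating (Suc k) c \<and> (\<forall>v\<in>C. \<forall>x. \<eta> v x = c))"
    and eq: "\<forall>v\<in>C. \<forall>x vs. lam v x ^ 0 * p v x vs = ext_d k (\<rho> v) x vs + \<eta> v x vs"
    using descent[OF fp p(2), of 0] tz by blast
  have dec: "p v = (\<lambda>x vs. fd k \<rho> v x vs + \<eta> v x vs)" if "v \<in> C" for v
  proof (intro ext)
    fix x vs show "p v x vs = fd k \<rho> v x vs + \<eta> v x vs"
      using eq[rule_format, OF that, of x vs] by (simp add: fd_def)
  qed
  have \<rho>': "fam (int r) k \<rho>" and \<eta>': "fam (int r - 1) (Suc k) \<eta>" using \<rho>(1) \<eta>(1) Suc by (simp_all add: add.commute)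
  have fint: "fint \<eta> = 0" if "Suc k = CARD('n)"
  proof -
    have "fint p = fint (\<lambda>v x vs. fd k \<rho> v x vs + \<eta> v x vs)" by (rule fint_cong[OF dec])
    also have "\<dots> = fint (fd k \<rho>) + fint \<eta>" by (rule fint_add[OF fam_fd[OF \<rho>'] \<eta>'])
    finally show ?thesis using fint_fd[OF \<rho>' \<rho>(2,3)] bd that by simp
  qed
  have "full_zero \<eta>"
  proof (cases "s = 0")
    case True
    then obtain c where c: "alternating (Suc k) c" "\<And>v x. v \<in> C \<Longrightarrow> \<eta> v x = c" using \<eta>(4) by auto
    have "c vs = 0" for vs
    proof (cases "Suc k < CARD('n)")
      case k': True
      show ?thesis
      proof (rule zero_if_zero_on_facets[OF c(1) k'])
        fix v vs assume v: "v \<in> C" and vs: "\<And>y. y \<in> set vs \<Longrightarrow> D v \<bullet> y = 0"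
        obtain w where w: "w \<in> C" "w \<noteq> v" using exists_unit_normal[OF v] by metis
        then have l: "lam v w = 0" using v by (simp add: lam_vertex)
        have "c vs = p v w vs - fd k \<rho> v w vs" using dec[OF v] c(2)[OF v] by simp
        then show "c vs = 0"
          using tan_zeroD[OF tz v l vs] tan_zeroD[OF tan_zero_fd[OF \<rho>' \<rho>(3)] v l vs] by simp
      qed
    next
      case False
      then have kn: "Suc k = CARD('n)" using k by simp
      have "fint (\<lambda>v x. c) = fint \<eta>" by (rule fint_cong) (use c(2) in auto)
      then show ?thesis using fint_const[of c vs] fint[OF kn] c(1) kn by simp
    qed
    then show ?thesis using c(2) by (auto simp: full_zero_def)
  qed (use \<eta>(3) in auto)
  then show ?thesis using \<rho>' \<rho> \<eta>' \<eta>(2) fint dec by blast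
qed

lemma dimension_formula:
  "dim (Md_space C (int r) k) + dim (Vd_space C (int r - 1) (Suc k))
   = dim (M_space C (int r) k) + dim (M_space C (int r - 1) (Suc k))"
proof -
  let ?R = "{p. fam (int r) k p \<and> full_cont p}" and ?E = "{p. fam (int r - 1) (Suc k) p \<and> full_cont p}"
  have "{\<rho> \<in> ?R. fd k \<rho> \<in> ?E} = {p. fam (int r) k p \<and> full_cont p \<and> full_cont (fd k p)}"
    using fam_fd by auto
  moreover have "{q. \<exists>\<rho>\<in>?R. \<exists>\<eta>\<in>?E. \<forall>v\<in>C. q v = (\<lambda>x vs. fd k \<rho> v x vs + \<eta> v x vs)}
      = {p. fam (int r - 1) (Suc k) p \<and> tan_cont p}"
  proof (intro equalityI subsetI)
    fix q assume "q \<in> {q. \<exists>\<rho>\<in>?R. \<exists>\<eta>\<in>?E. \<forall>v\<in>C. q v = (\<lambda>x vs. fd k \<rho> v x vs + \<eta> v x vs)}"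
    then obtain \<rho> \<eta> where *: "\<rho> \<in> ?R" "\<eta> \<in> ?E" "\<And>v. v \<in> C \<Longrightarrow> (\<lambda>x vs. fd k \<rho> v x vs + \<eta> v x vs) = q v" by force
    have "fam (int r - 1) (Suc k) (\<lambda>v x vs. fd k \<rho> v x vs + \<eta> v x vs)"
      "tan_cont (\<lambda>v x vs. fd k \<rho> v x vs + \<eta> v x vs)"
      using * by (auto intro!: fam_add fam_fd tan_cont_add intro: tan_cont_fd full_cont_imp_tan_cont)
    then show "q \<in> {p. fam (int r - 1) (Suc k) p \<and> tan_cont p}"
      using fam_cong[of _ _ _ q] tan_cont_cong[of _ q] *(3) by blast
  next
    fix q assume "q \<in> {p. fam (int r - 1) (Suc k) p \<and> tan_cont p}"
    then show "q \<in> {q. \<exists>\<rho>\<in>?R. \<exists>\<eta>\<in>?E. \<forall>v\<in>C. q v = (\<lambda>x vs. fd k \<rho> v x vs + \<eta> v x vs)}"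
      using decomposition[of r k q] by blast
  qed
  ultimately show ?thesis
    using dim_families[OF fam_space_M fam_space_M, of "int r" k] by (simp only: Md_space_eq Vd_space_eq M_space_eq)
qed

lemma dimension_formula_zero_boundary:
  assumes k: "k < CARD('n)"
  shows "dim (Md0_space C (int r) k) + dim (Vd0_space C (int r - 1) (Suc k))
   = dim (M0_space C (int r) k) + dim (M0_space C (int r - 1) (Suc k))"
proof -
  let ?R = "{p. fam (int r) k p \<and> full_cont p \<and> full_zero p \<and> (k = CARD('n) \<longrightarrow> fint p = 0)}"
    and ?E = "{p. fam (int r - 1) (Suc k) p \<and> full_cont p \<and> full_zero p \<and> (Suc k = CARD('n) \<longrightarrow> fint p = 0)}"
  let ?V = "{p. fam (int r - 1) (Suc k) p \<and> tan_cont p \<and> (if Suc k < CARD('n) then tan_zero p else fint p = 0)}"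
  have "{\<rho> \<in> ?R. fd k \<rho> \<in> ?E}
      = {p. fam (int r) k p \<and> full_cont p \<and> full_zero p \<and> full_cont (fd k p) \<and> full_zero (fd k p)}"
    using fam_fd fint_fd k by auto
  moreover have "{q. \<exists>\<rho>\<in>?R. \<exists>\<eta>\<in>?E. \<forall>v\<in>C. q v = (\<lambda>x vs. fd k \<rho> v x vs + \<eta> v x vs)} = ?V"
  proof (intro equalityI subsetI)
    fix q assume "q \<in> {q. \<exists>\<rho>\<in>?R. \<exists>\<eta>\<in>?E. \<forall>v\<in>C. q v = (\<lambda>x vs. fd k \<rho> v x vs + \<eta> v x vs)}"
    then obtain \<rho> \<eta> where *: "\<rho> \<in> ?R" "\<eta> \<in> ?E" "\<And>v. v \<in> C \<Longrightarrow> (\<lambda>x vs. fd k \<rho> v x vs + \<eta> v x vs) = q v" by force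
    let ?s = "\<lambda>v x vs. fd k \<rho> v x vs + \<eta> v x vs"
    have s: "fam (int r - 1) (Suc k) ?s" "tan_cont ?s"
      using * by (auto intro!: fam_add fam_fd tan_cont_add intro: tan_cont_fd full_cont_imp_tan_cont)
    have "tan_zero ?s"
      using * tan_zero_fd[of "int r" k \<rho>] full_zero_imp_tan_zero[of \<eta>] by (intro tan_zero_add) auto
    then have "tan_zero q" using *(3) by (rule tan_zero_cong)
    moreover have "fint q = 0" if "\<not> Suc k < CARD('n)"
    proof -
      have "fint q = fint ?s" by (rule fint_cong) (simp add: *(3))
      also have "\<dots> = fint (fd k \<rho>) + fint \<eta>" using * by (intro fint_add[OF fam_fd]) auto
      also have "\<dots> = 0" using * fint_fd[of "int r" k \<rho>] that k by auto
      finally show ?thesis .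
    qed
    moreover have "fam (int r - 1) (Suc k) q" "tan_cont q"
      using fam_cong[OF s(1) *(3)] tan_cont_cong[OF s(2) *(3)] by auto
    ultimately show "q \<in> ?V" by simp
  next
    fix q assume "q \<in> ?V"
    then obtain \<rho> \<eta> where "\<rho> \<in> ?R" "\<eta> \<in> ?E" "\<forall>v\<in>C. q v = (\<lambda>x vs. fd k \<rho> v x vs + \<eta> v x vs)"
      using decomposition_zero_boundary[of k r q] k by fastforce
    then show "q \<in> {q. \<exists>\<rho>\<in>?R. \<exists>\<eta>\<in>?E. \<forall>v\<in>C. q v = (\<lambda>x vs. fd k \<rho> v x vs + \<eta> v x vs)}" by blast
  qed
  ultimately show ?thesis
    using dim_families[OF fam_space_M0 fam_space_M0, of "int r" k] by (simp only: Md0_space_eq Vd0_space_eq M0_space_eq)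
qed

end

text \<open>
  The gradients are the basis dual to the edge vectors at one vertex \<open>v\<^sub>0\<close>, and the coordinate of \<open>v\<^sub>0\<close> is the
  difference between one and the sum of the others.
\<close>

lemma exists_barycentric_coordinates:
  fixes C :: "(real ^ 'n::finite) set"
  assumes n: "CARD('n) \<ge> 2" and aff: "\<not> affine_dependent C" and card: "card C = CARD('n) + 1"
  shows "\<exists>D c0. bary C D c0 (\<lambda>v x. D v \<bullet> x + c0 v)"
proof -
  have fin: "finite C" using card card.infinite by fastforce
  obtain v0 where v0: "v0 \<in> C" using card by (metis card.empty add_is_0 one_neq_zero ex_in_conv)
  let ?S = "C - {v0}" and ?e = "\<lambda>u. u - v0"
  have inj: "inj_on ?e ?S" by (simp add: inj_on_def)
  have "\<not> dependent ((\<lambda>x. - v0 + x) ` (C - {v0}))" using affine_dependent_iff_dependent2[OF v0] aff by blast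
  then have indep: "independent (?e ` ?S)" by simp
  have "card (?e ` ?S) = CARD('n)" using card v0 fin by (simp add: card_image[OF inj])
  then have "UNIV \<subseteq> span (?e ` ?S)"
    using indep by (intro card_ge_dim_independent) auto
  then have span: "span (?e ` ?S) = UNIV" by blast
  have "\<exists>d. \<forall>w\<in>?S. d \<bullet> ?e w = (if w = u then 1 else 0)" for u
  proof -
    obtain f where f: "linear f" "\<forall>x\<in>?e ` ?S. f x = (if x = ?e u then 1 else (0::real))"
      using linear_independent_extend[OF indep, of "\<lambda>x. if x = ?e u then 1 else 0"] by blast
    define a :: "real^'n" where "a = (\<Sum>i\<in>UNIV. f (axis i 1) *\<^sub>R axis i 1)"
    have fa: "f y = a \<bullet> y" for y
    proof -
      have "f y = f (\<Sum>i\<in>UNIV. y $ i *\<^sub>R axis i 1)"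
        using basis_expansion[of y] by (simp add: scalar_mult_eq_scaleR)
      also have "\<dots> = (\<Sum>i\<in>UNIV. y $ i * f (axis i 1))" by (simp add: linear_sum[OF f(1)] linear_scale[OF f(1)])
      finally show ?thesis by (simp add: a_def inner_sum_left inner_axis' mult.commute)
    qed
    show ?thesis using f(2) by (intro exI[of _ a]) (auto simp flip: fa)
  qed
  then obtain d where d: "\<And>u w. w \<in> ?S \<Longrightarrow> d u \<bullet> ?e w = (if w = u then 1 else 0)" by metis
  define D where "D v = (if v = v0 then - (\<Sum>u\<in>?S. d u) else d v)" for v
  define c0 where "c0 v = (if v = v0 then 1 + (\<Sum>u\<in>?S. d u \<bullet> v0) else - (d v \<bullet> v0))" for v
  let ?lam = "\<lambda>v x. D v \<bullet> x + c0 v"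
  have l: "?lam v x = d v \<bullet> ?e x" if "v \<in> ?S" for v x using that by (simp add: D_def c0_def inner_diff_right)
  have l0: "?lam v0 x = 1 - (\<Sum>u\<in>?S. d u \<bullet> ?e x)" for x
    by (simp add: D_def c0_def inner_diff_right inner_sum_left sum_subtractf)
  have sum1: "(\<Sum>v\<in>C. ?lam v x) = 1" for x
  proof -
    have "(\<Sum>v\<in>C. ?lam v x) = ?lam v0 x + (\<Sum>v\<in>?S. ?lam v x)" by (rule sum.remove[OF fin v0])
    also have "(\<Sum>v\<in>?S. ?lam v x) = (\<Sum>v\<in>?S. d v \<bullet> ?e x)" using l by (intro sum.cong) auto
    finally show ?thesis using l0 by simp
  qed
  have expand: "(\<Sum>u\<in>?S. (d u \<bullet> y) *\<^sub>R ?e u) = y" for y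
  proof -
    have lin: "linear (\<lambda>y. \<Sum>u\<in>?S. (d u \<bullet> y) *\<^sub>R ?e u)"
      by (rule linearI) (simp_all add: inner_add_right scaleR_add_left sum.distrib scaleR_sum_right)
    have "(\<Sum>u\<in>?S. (d u \<bullet> x) *\<^sub>R ?e u) = x" if x: "x \<in> ?e ` ?S" for x
    proof -
      obtain w where w: "w \<in> ?S" "x = ?e w" using x by blast
      have "(\<Sum>u\<in>?S. (d u \<bullet> ?e w) *\<^sub>R ?e u) = (\<Sum>u\<in>?S. if w = u then ?e u else 0)"
        using d[OF w(1)] by (intro sum.cong) auto
      then show ?thesis using w fin by (simp add: sum.delta)
    qed
    from linear_eq_on_span[OF lin linear_id[unfolded id_def] this] show ?thesis using span by auto
  qed
  have "bary C D c0 ?lam"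
  proof (unfold_locales)
    fix u v assume uv: "u \<in> C" "v \<in> C"
    show "?lam v u = (if u = v then 1 else 0)"
    proof (cases "v = v0")
      case False
      then have v: "v \<in> ?S" using uv by simp
      show ?thesis
      proof (cases "u = v0")
        case True then show ?thesis unfolding l[OF v] using False by simp
      next
        case False then show ?thesis unfolding l[OF v] using d[of u v] uv by simp
      qed
    next
      case True
      show ?thesis
      proof (cases "u = v0")
        case u: True then show ?thesis unfolding True l0 by simp
      next
        case False
        then have "(\<Sum>w\<in>?S. d w \<bullet> ?e u) = (\<Sum>w\<in>?S. if u = w then 1 else 0)"
          using d uv by (intro sum.cong) auto
        then have "(\<Sum>w\<in>?S. d w \<bullet> ?e u) = 1" using fin False uv by simp
        then show ?thesis unfolding True l0 using False by simp
      qed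
    qed
  next
    fix x
    have "(\<Sum>v\<in>C. ?lam v x *\<^sub>R v) = (\<Sum>v\<in>C. ?lam v x *\<^sub>R ?e v) + (\<Sum>v\<in>C. ?lam v x *\<^sub>R v0)"
      by (simp add: scaleR_diff_right flip: sum.distrib)
    also have "(\<Sum>v\<in>C. ?lam v x *\<^sub>R ?e v) = (\<Sum>v\<in>?S. ?lam v x *\<^sub>R ?e v)"
      by (subst sum.remove[OF fin v0]) simp
    also have "\<dots> = (\<Sum>v\<in>?S. (d v \<bullet> ?e x) *\<^sub>R ?e v)" by (intro sum.cong) (simp_all only: l)
    also have "\<dots> = ?e x" by (rule expand)
    also have "(\<Sum>v\<in>C. ?lam v x *\<^sub>R v0) = v0" by (simp only: scaleR_sum_left[symmetric] sum1) simp
    finally show "(\<Sum>v\<in>C. ?lam v x *\<^sub>R v) = x" by simp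
  qed (use fin card n sum1 in auto)
  then show ?thesis by blast
qed

theorem corollary3p6:
  fixes C :: "(real ^ 'n::finite) set" and r k :: nat
  assumes "CARD('n) \<ge> 2"
    and "\<not> affine_dependent C" and "card C = CARD('n) + 1"
    and "k \<le> CARD('n) - 1"
  shows "int (dim (Md_space C (int r) k))
           = int (dim (M_space C (int r - 1) (k + 1))) + int (dim (M_space C (int r) k))
             - int (dim (Vd_space C (int r - 1) (k + 1)))
       \<and> int (dim (Md0_space C (int r) k))
           = int (dim (M0_space C (int r - 1) (k + 1))) + int (dim (M0_space C (int r) k))
             - int (dim (Vd0_space C (int r - 1) (k + 1)))"
proof -
  obtain D c0 where "bary C D c0 (\<lambda>v x. D v \<bullet> x + c0 v)"
    using exists_barycentric_coordinates[OF assms(1-3)] by blast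
  then interpret bary C D c0 "\<lambda>v x. D v \<bullet> x + c0 v" .
  have "k < CARD('n)" using assms(1,4) by linarith
  then show ?thesis
    using dimension_formula[of r k] dimension_formula_zero_boundary[of k r] by simp
qed

end
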